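(* Let $(X,T^*_{X,-})$ be a good model. Then ${\bf H}^1_\partial(X,\mathcal A_{T^*_{X,-}})=(0)$ if and only if $\partial:H^1(X,\mathcal A_{T^*_{X,-}})\to H^2(X,\mathcal A_{T^*_{X,-}}[1])$ is injective.
   Context: A model $(X,T^*_{X,-})$ is a complex manifold $X$ with a holomorphic vector bundle $T^*_{X,-}$ (identified with its locally free sheaf of sections). Let $J=\bigoplus_{j>0}\wedge^jT^*_{X,-}\subset\wedge^\bullet T^*_{X,-}$ and $J^k=\bigoplus_{j\ge k}\wedge^jT^*_{X,-}$. For $k\ge2$ let $\mathrm G_k=\mathrm G_{T^*_{X,-},k}$ be the sheaf of groups of automorphisms $\alpha$ of $\wedge^\bullet T^*_{X,-}$ (as a sheaf of $\mathbb C$-algebras, preserving the $\mathbb Z_2$-grading) with $\alpha(u)-u\in J^k$ for all $u$. Then $\mathrm G_2\supseteq\mathrm G_3\supseteq\cdots$ is a descending series of sheaves of normal subgroups of $\mathrm G_2$, trivial for $k>\operatorname{rank}T^*_{X,-}$, and the quotients $\mathrm G_j/\mathrm G_{j+1},\dots,\mathrm G_j/\mathrm G_{j+4}$ are abelian. The obstruction sheaf is the $\mathbb Z$-graded abelian sheaf $\mathcal A_{T^*_{X,-}}=\bigoplus_j\mathcal A_j$, with $\mathcal A_j=\mathrm G_j/\mathrm G_{j+1}$ for $j\ge2$ and $\mathcal A_j=0$ for $j<2$; $[1]$ denotes the shift $(\mathcal F[1])_j=\mathcal F_{j+1}$. Obstruction complex: $\partial:H^n(X,\mathcal A_j)\to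 H^{n+1}(X,\mathcal A_{j+1})$ is the connecting map of $0\to\mathcal A_{j+1}\to\mathrm G_j/\mathrm G_{j+2}\to\mathcal A_j\to0$ (zero for $j<2$); $\partial\circ\partial=0$. The first obstruction cohomology is ${\bf H}^1_\partial=\bigoplus_j\ker\{\partial:H^1(X,\mathcal A_j)\to H^2(X,\mathcal A_{j+1})\}/\operatorname{im}\{\partial:H^0(X,\mathcal A_{j-1})\to H^1(X,\mathcal A_j)\}$. A $j$-th order supermanifold atlas ($j\ge2$) modelled on $(X,T^*_{X,-})$ is a representative of an element of the non-abelian Čech cohomology set $\check H^1(X,\mathrm G_j)$. Its obstruction to splitting is its image under $\omega_{j*}:\check H^1(X,\mathrm G_j)\to H^1(X,\mathcal A_j)$ induced by $\mathrm G_j\to\mathcal A_j$. It is strongly split if its image under the map $\check H^1(X,\mathrm G_j)\to\check H^1(X,\mathrm G_2)$ induced by inclusion is the base-point. It is exotic if it is strongly split and its obstruction to splitting is non-zero. The model is good if there are no exotic supermanifold atlases (of any order $j$) modelled on it. *)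

theory Defs
  imports "HOL-Analysis.Analysis" "HOL-Algebra.FiniteProduct" "HOL-Algebra.Product_Groups"
begin

section \<open>Complex manifolds\<close>

text \<open>Points of \<open>\<complex>\<^sup>n\<close> are functions on \<open>{..<n}\<close> (undefined elsewhere), so that every natural
  number \<open>n\<close>, including 0, is a possible dimension.\<close>

definition Cn :: "nat \<Rightarrow> (nat \<Rightarrow> complex) topology" where
  "Cn n = product_topology (\<lambda>_. euclidean) {..<n}"

text \<open>Complex (Frechet) differentiability at every point of an open set \<open>D\<close>.\<close>

definition holo_Cn :: "nat \<Rightarrow> (nat \<Rightarrow> complex) set \<Rightarrow> ((nat \<Rightarrow> complex) \<Rightarrow> complex) \<Rightarrow> bool" where
  "holo_Cn n D f \<longleftrightarrow> openin (Cn n) D \<and>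
     (\<forall>p\<in>D. \<exists>c. \<forall>\<epsilon>>0. \<exists>\<delta>>0. \<forall>z\<in>D. (\<forall>i<n. norm (z i - p i) < \<delta>) \<longrightarrow>
        norm (f z - f p - (\<Sum>i<n. c i * (z i - p i))) \<le> \<epsilon> * (\<Sum>i<n. norm (z i - p i)))"

text \<open>A chart is a pair of its domain and its coordinate map; the values of the coordinate map off
  the domain are irrelevant.\<close>

type_synonym 'a chart = "'a set \<times> ('a \<Rightarrow> nat \<Rightarrow> complex)"

definition complex_manifold :: "'a topology \<Rightarrow> nat \<Rightarrow> 'a chart set \<Rightarrow> bool" where
  "complex_manifold X n \<A> \<longleftrightarrow>
     Hausdorff_space X \<and> second_countable X \<and> topspace X = (\<Union>(W, \<phi>)\<in>\<A>. W) \<and>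
     (\<forall>(W, \<phi>)\<in>\<A>. openin X W \<and> openin (Cn n) (\<phi> ` W) \<and>
        homeomorphic_map (subtopology X W) (subtopology (Cn n) (\<phi> ` W)) \<phi>) \<and>
     (\<forall>(W, \<phi>)\<in>\<A>. \<forall>(W', \<psi>)\<in>\<A>. \<forall>i<n. holo_Cn n (\<phi> ` (W \<inter> W')) (\<lambda>z. \<psi> (inv_into W \<phi> z) i))"

definition holo_fun :: "nat \<Rightarrow> 'a chart set \<Rightarrow> 'a set \<Rightarrow> ('a \<Rightarrow> complex) \<Rightarrow> bool" where
  "holo_fun n \<A> U f \<longleftrightarrow> (\<forall>(W, \<phi>)\<in>\<A>. holo_Cn n (\<phi> ` (U \<inter> W)) (\<lambda>z. f (inv_into W \<phi> z)))"


section \<open>Models\<close>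

text \<open>The fibres of the bundle are subspaces \<open>fib M x\<close> of one complex vector space (the type \<open>'v\<close>
  with scalar multiplication \<open>scl M\<close>). This is no restriction, and does not make the bundle
  trivial: any family of vector spaces embeds into its direct sum, and the holomorphic structure is
  carried only by the local frames. A frame is a pair of an open set \<open>W\<close> and sections
  \<open>e 0, \<dots>, e (rk M - 1)\<close> over \<open>W\<close>. The bundle of a model is the bundle written \<open>T\<^sup>*\<^sub>X\<^sub>,\<^sub>-\<close>
  (and not its dual).\<close>

record ('a, 'v) model =
  base :: "'a topology"
  dm :: nat
  charts :: "'a chart set"
  scl :: "complex \<Rightarrow> 'v \<Rightarrow> 'v"
  fib :: "'a \<Rightarrow> 'v set"
  rk :: nat
  frames :: "('a set \<times> (nat \<Rightarrow> 'a \<Rightarrow> 'v)) set"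

definition holomorphic_bundle :: "('a, 'v::ab_group_add) model \<Rightarrow> bool" where
  "holomorphic_bundle M \<longleftrightarrow>
     vector_space (scl M) \<and>
     (\<forall>x\<in>topspace (base M). Modules.module.subspace (scl M) (fib M x)) \<and>
     topspace (base M) = (\<Union>(W, e)\<in>frames M. W) \<and>
     (\<forall>(W, e)\<in>frames M. openin (base M) W \<and>
        (\<forall>x\<in>W. inj_on (\<lambda>i. e i x) {..<rk M} \<and>
           \<not> Modules.module.dependent (scl M) ((\<lambda>i. e i x) ` {..<rk M}) \<and>
           Modules.module.span (scl M) ((\<lambda>i. e i x) ` {..<rk M}) = fib M x)) \<and>
     (\<forall>(W, e)\<in>frames M. \<forall>(W', e')\<in>frames M.
        \<exists>g. (\<forall>i<rk M. \<forall>j<rk M. holo_fun (dm M) (charts M) (W \<inter> W') (g i j)) \<and>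
            (\<forall>x\<in>W \<inter> W'. \<forall>j<rk M. e' j x = (\<Sum>i<rk M. scl M (g i j x) (e i x))))"

definition is_model :: "('a, 'v::ab_group_add) model \<Rightarrow> bool" where
  "is_model M \<longleftrightarrow> complex_manifold (base M) (dm M) (charts M) \<and> holomorphic_bundle M"


section \<open>The exterior algebra bundle\<close>

text \<open>Linear functionals on a fibre, extended by 0 to all of \<open>'v\<close>.\<close>

definition dual_fib :: "('a, 'v::ab_group_add) model \<Rightarrow> 'a \<Rightarrow> ('v \<Rightarrow> complex) set" where
  "dual_fib M x = {\<theta>. (\<forall>v\<in>fib M x. \<forall>w\<in>fib M x. \<theta> (v + w) = \<theta> v + \<theta> w) \<and>
     (\<forall>a. \<forall>v\<in>fib M x. \<theta> (scl M a v) = a * \<theta> v) \<and> (\<forall>v. v \<notin> fib M x \<longrightarrow> \<theta> v = 0)}"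

definition dual_frame ::
    "('a, 'v::ab_group_add) model \<Rightarrow> (nat \<Rightarrow> 'a \<Rightarrow> 'v) \<Rightarrow> nat \<Rightarrow> 'a \<Rightarrow> 'v \<Rightarrow> complex" where
  "dual_frame M e i x =
     (\<lambda>v. Modules.module.representation (scl M) ((\<lambda>k. e k x) ` {..<rk M}) v (e i x))"

text \<open>For a finite-dimensional vector space \<open>V\<close>, the space \<open>\<And>\<^sup>k V\<close> is realised as the alternating
  \<open>k\<close>-linear forms on the dual of \<open>V\<close>. A multivector \<open>\<omega>\<close>, i.e. an element of the direct sum over
  all \<open>k\<close>, is encoded as a function on lists of covectors, its component of degree \<open>k\<close> being the
  restriction of \<open>\<omega>\<close> to lists of length \<open>k\<close>.\<close>

type_synonym 'v mvec = "('v \<Rightarrow> complex) list \<Rightarrow> complex"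

definition multivectors :: "('a, 'v::ab_group_add) model \<Rightarrow> 'a \<Rightarrow> 'v mvec set" where
  "multivectors M x = {\<omega>.
     (\<forall>as\<in>lists (dual_fib M x). \<forall>bs\<in>lists (dual_fib M x).
        \<forall>\<theta>\<in>dual_fib M x. \<forall>\<eta>\<in>dual_fib M x. \<forall>c.
          \<omega> (as @ (\<lambda>v. c * \<theta> v + \<eta> v) # bs) = c * \<omega> (as @ \<theta> # bs) + \<omega> (as @ \<eta> # bs)) \<and>
     (\<forall>xs\<in>lists (dual_fib M x). \<not> distinct xs \<longrightarrow> \<omega> xs = 0) \<and>
     (\<forall>xs. xs \<notin> lists (dual_fib M x) \<longrightarrow> \<omega> xs = 0)}"

text \<open>The recursion says that contraction with a covector is an antiderivation. Unfolded, it is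
  the signed sum over all shuffles (without factorials).\<close>

fun wedge :: "('c list \<Rightarrow> complex) \<Rightarrow> ('c list \<Rightarrow> complex) \<Rightarrow> 'c list \<Rightarrow> complex" where
  "wedge \<omega> \<eta> [] = \<omega> [] * \<eta> []"
| "wedge \<omega> \<eta> (x # xs) =
     wedge (\<lambda>ys. \<omega> (x # ys)) \<eta> xs + wedge (\<lambda>ys. (-1) ^ length ys * \<omega> ys) (\<lambda>ys. \<eta> (x # ys)) xs"

text \<open>Sections are extended by 0 off their domain of definition. A section is holomorphic if its
  coefficients with respect to all local frames are.\<close>

type_synonym ('a, 'v) msection = "'a \<Rightarrow> 'v mvec"

definition ext_sections :: "('a, 'v::ab_group_add) model \<Rightarrow> 'a set \<Rightarrow> ('a, 'v) msection set" where
  "ext_sections M U = {s. (\<forall>x\<in>U. s x \<in> multivectors M x) \<and> (\<forall>x. x \<notin> U \<longrightarrow> s x = (\<lambda>_. 0)) \<and>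
     (\<forall>(W, e)\<in>frames M. \<forall>is\<in>lists {..<rk M}.
        holo_fun (dm M) (charts M) (U \<inter> W) (\<lambda>x. s x (map (\<lambda>i. dual_frame M e i x) is)))}"

definition sec_restrict :: "'a set \<Rightarrow> ('a, 'v) msection \<Rightarrow> ('a, 'v) msection" where
  "sec_restrict V s = (\<lambda>x. if x \<in> V then s x else (\<lambda>_. 0))"

definition sec_add :: "('a, 'v) msection \<Rightarrow> ('a, 'v) msection \<Rightarrow> ('a, 'v) msection" where
  "sec_add s t = (\<lambda>x xs. s x xs + t x xs)"

definition sec_diff :: "('a, 'v) msection \<Rightarrow> ('a, 'v) msection \<Rightarrow> ('a, 'v) msection" where
  "sec_diff s t = (\<lambda>x xs. s x xs - t x xs)"

definition sec_scale :: "complex \<Rightarrow> ('a, 'v) msection \<Rightarrow> ('a, 'v) msection" where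
  "sec_scale c s = (\<lambda>x xs. c * s x xs)"

definition sec_wedge :: "('a, 'v) msection \<Rightarrow> ('a, 'v) msection \<Rightarrow> ('a, 'v) msection" where
  "sec_wedge s t = (\<lambda>x. wedge (s x) (t x))"

definition sec_one :: "'a set \<Rightarrow> ('a, 'v) msection" where
  "sec_one U = (\<lambda>x xs. if x \<in> U \<and> xs = [] then 1 else 0)"

definition sec_even :: "('a, 'v) msection \<Rightarrow> bool" where
  "sec_even s \<longleftrightarrow> (\<forall>x xs. odd (length xs) \<longrightarrow> s x xs = 0)"

definition sec_odd :: "('a, 'v) msection \<Rightarrow> bool" where
  "sec_odd s \<longleftrightarrow> (\<forall>x xs. even (length xs) \<longrightarrow> s x xs = 0)"

text \<open>The sections over \<open>U\<close> of the ideal \<open>J\<^sup>k\<close>.\<close>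

definition J_ideal :: "('a, 'v::ab_group_add) model \<Rightarrow> nat \<Rightarrow> 'a set \<Rightarrow> ('a, 'v) msection set" where
  "J_ideal M k U = {s \<in> ext_sections M U. \<forall>x xs. length xs < k \<longrightarrow> s x xs = 0}"


section \<open>Sheaves of groups and their quotients\<close>

text \<open>\<open>res F U V\<close> is the restriction from \<open>U\<close> to a smaller open set \<open>V\<close>.\<close>

record ('a, 'g) gsheaf =
  sec :: "'a set \<Rightarrow> 'g monoid"
  res :: "'a set \<Rightarrow> 'a set \<Rightarrow> 'g \<Rightarrow> 'g"

text \<open>For a sheaf of normal subgroups \<open>H\<close> of \<open>G\<close>, the quotient sheaf is the sheafification of
  \<open>U \<mapsto> G(U)/H(U)\<close>: its sections over \<open>U\<close> are the functions sending \<open>x \<in> U\<close> to an element of the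
  stalk \<open>G\<^sub>x/H\<^sub>x\<close> that are locally given by sections of \<open>G\<close>. An element of the stalk is the set of
  all pairs (neighbourhood, section of \<open>G\<close>) representing it.\<close>

definition qgerm :: "'a topology \<Rightarrow> ('a, 'g) gsheaf \<Rightarrow> ('a, 'g) gsheaf \<Rightarrow> 'a \<Rightarrow> 'a set \<times> 'g
    \<Rightarrow> ('a set \<times> 'g) set" where
  "qgerm X G H x = (\<lambda>(V, \<alpha>). {(W, \<beta>). openin X W \<and> x \<in> W \<and> \<beta> \<in> carrier (sec G W) \<and>
     (\<exists>N. openin X N \<and> x \<in> N \<and> N \<subseteq> V \<inter> W \<and>
        inv\<^bsub>sec G N\<^esub> (res G V N \<alpha>) \<otimes>\<^bsub>sec G N\<^esub> res G W N \<beta> \<in> carrier (sec H N))})"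

type_synonym ('a, 'g) qsec = "'a \<Rightarrow> ('a set \<times> 'g) set"

definition qproj :: "'a topology \<Rightarrow> ('a, 'g) gsheaf \<Rightarrow> ('a, 'g) gsheaf \<Rightarrow> 'a set \<Rightarrow> 'g
    \<Rightarrow> ('a, 'g) qsec" where
  "qproj X G H U \<alpha> = (\<lambda>x\<in>U. qgerm X G H x (U, \<alpha>))"

definition quot_sheaf :: "'a topology \<Rightarrow> ('a, 'g) gsheaf \<Rightarrow> ('a, 'g) gsheaf
    \<Rightarrow> ('a, ('a, 'g) qsec) gsheaf" where
  "quot_sheaf X G H =
     \<lparr> sec = (\<lambda>U.
         \<lparr> carrier = {\<sigma> \<in> extensional U. \<forall>x\<in>U. \<exists>V \<alpha>. openin X V \<and> x \<in> V \<and> V \<subseteq> U \<and>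
             \<alpha> \<in> carrier (sec G V) \<and> (\<forall>y\<in>V. \<sigma> y = qgerm X G H y (V, \<alpha>))},
           monoid.mult = (\<lambda>\<sigma> \<tau>. \<lambda>x\<in>U. \<Union>(V, \<alpha>)\<in>\<sigma> x. \<Union>(W, \<beta>)\<in>\<tau> x.
             qgerm X G H x (V \<inter> W, res G V (V \<inter> W) \<alpha> \<otimes>\<^bsub>sec G (V \<inter> W)\<^esub> res G W (V \<inter> W) \<beta>)),
           one = qproj X G H U \<one>\<^bsub>sec G U\<^esub> \<rparr>),
       res = (\<lambda>U V \<sigma>. restrict \<sigma> V) \<rparr>"

text \<open>The natural map \<open>G/H \<rightarrow> G'/H'\<close> for \<open>G \<subseteq> G'\<close> and \<open>H \<subseteq> H'\<close>; it does not depend on \<open>G, H\<close>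
  except through its argument.\<close>

definition qmap :: "'a topology \<Rightarrow> ('a, 'g) gsheaf \<Rightarrow> ('a, 'g) gsheaf \<Rightarrow> 'a set
    \<Rightarrow> ('a, 'g) qsec \<Rightarrow> ('a, 'g) qsec" where
  "qmap X G' H' U \<sigma> = (\<lambda>x\<in>U. \<Union>p\<in>\<sigma> x. qgerm X G' H' x p)"

definition zero_sheaf :: "('a, 'a \<Rightarrow> 'c) gsheaf" where
  "zero_sheaf = \<lparr> sec = (\<lambda>_. singleton_group (\<lambda>_. undefined)), res = (\<lambda>_ _ _. \<lambda>_. undefined) \<rparr>"


section \<open>Cech cohomology\<close>

text \<open>An open cover is a set of open sets, indexed by itself; simplices are lists of members, with
  repetitions allowed. Cohomology is the direct limit over all open covers: its elements are sets of
  pairs (cover, cocycle), two such pairs being identified if they become cohomologous on a common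
  refinement.\<close>

definition open_cover :: "'a topology \<Rightarrow> 'a set set \<Rightarrow> bool" where
  "open_cover X \<U> \<longleftrightarrow> (\<forall>U\<in>\<U>. openin X U) \<and> \<Union>\<U> = topspace X"

definition simplices :: "'a set set \<Rightarrow> nat \<Rightarrow> 'a set list set" where
  "simplices \<U> n = {l. length l = Suc n \<and> set l \<subseteq> \<U>}"

type_synonym ('a, 'g) cochain = "'a set list \<Rightarrow> 'g"

definition cochains :: "('a, 'g) gsheaf \<Rightarrow> 'a set set \<Rightarrow> nat \<Rightarrow> ('a, 'g) cochain set" where
  "cochains F \<U> n = (\<Pi>\<^sub>E l\<in>simplices \<U> n. carrier (sec F (\<Inter>(set l))))"

text \<open>\<open>face_res F c l k\<close> is the value of \<open>c\<close> on the \<open>k\<close>-th face of \<open>l\<close>, restricted to the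
  intersection of all of \<open>l\<close>.\<close>

definition face_res :: "('a, 'g) gsheaf \<Rightarrow> ('a, 'g) cochain \<Rightarrow> 'a set list \<Rightarrow> nat \<Rightarrow> 'g" where
  "face_res F c l k = (let f = take k l @ drop (Suc k) l in res F (\<Inter>(set f)) (\<Inter>(set l)) (c f))"

definition cmult :: "('a, 'g) gsheaf \<Rightarrow> 'a set set \<Rightarrow> nat \<Rightarrow> ('a, 'g) cochain \<Rightarrow> ('a, 'g) cochain
    \<Rightarrow> ('a, 'g) cochain" where
  "cmult F \<U> n c d = (\<lambda>l\<in>simplices \<U> n. c l \<otimes>\<^bsub>sec F (\<Inter>(set l))\<^esub> d l)"

definition cone :: "('a, 'g) gsheaf \<Rightarrow> 'a set set \<Rightarrow> nat \<Rightarrow> ('a, 'g) cochain" where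
  "cone F \<U> n = (\<lambda>l\<in>simplices \<U> n. \<one>\<^bsub>sec F (\<Inter>(set l))\<^esub>)"

definition cmap :: "('a set \<Rightarrow> 'g \<Rightarrow> 'h) \<Rightarrow> 'a set set \<Rightarrow> nat \<Rightarrow> ('a, 'g) cochain
    \<Rightarrow> ('a, 'h) cochain" where
  "cmap f \<U> n c = (\<lambda>l\<in>simplices \<U> n. f (\<Inter>(set l)) (c l))"

definition refinement :: "('a set \<Rightarrow> 'a set) \<Rightarrow> 'a set set \<Rightarrow> 'a set set \<Rightarrow> bool" where
  "refinement \<rho> \<W> \<U> \<longleftrightarrow> (\<forall>W\<in>\<W>. \<rho> W \<in> \<U> \<and> W \<subseteq> \<rho> W)"

definition pullback :: "('a, 'g) gsheaf \<Rightarrow> ('a set \<Rightarrow> 'a set) \<Rightarrow> 'a set set \<Rightarrow> nat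
    \<Rightarrow> ('a, 'g) cochain \<Rightarrow> ('a, 'g) cochain" where
  "pullback F \<rho> \<W> n c =
     (\<lambda>l\<in>simplices \<W> n. res F (\<Inter>(set (map \<rho> l))) (\<Inter>(set l)) (c (map \<rho> l)))"

subsection \<open>Sheaves of abelian groups\<close>

text \<open>The group operation is written multiplicatively throughout.\<close>

definition cobdry :: "('a, 'g) gsheaf \<Rightarrow> 'a set set \<Rightarrow> nat \<Rightarrow> ('a, 'g) cochain \<Rightarrow> ('a, 'g) cochain"
  where
  "cobdry F \<U> n c = (\<lambda>l\<in>simplices \<U> (Suc n). finprod (sec F (\<Inter>(set l)))
     (\<lambda>k. if even k then face_res F c l k else inv\<^bsub>sec F (\<Inter>(set l))\<^esub> (face_res F c l k))
     {..Suc n})"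

definition cocycles :: "('a, 'g) gsheaf \<Rightarrow> 'a set set \<Rightarrow> nat \<Rightarrow> ('a, 'g) cochain set" where
  "cocycles F \<U> n = {c \<in> cochains F \<U> n. cobdry F \<U> n c = cone F \<U> (Suc n)}"

definition coboundaries :: "('a, 'g) gsheaf \<Rightarrow> 'a set set \<Rightarrow> nat \<Rightarrow> ('a, 'g) cochain set" where
  "coboundaries F \<U> n =
     (case n of 0 \<Rightarrow> {cone F \<U> 0} | Suc m \<Rightarrow> cobdry F \<U> m ` cochains F \<U> m)"

definition cech_reps :: "'a topology \<Rightarrow> ('a, 'g) gsheaf \<Rightarrow> nat
    \<Rightarrow> ('a set set \<times> ('a, 'g) cochain) set" where
  "cech_reps X F n = {(\<U>, c). open_cover X \<U> \<and> c \<in> cocycles F \<U> n}"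

definition cech_class :: "'a topology \<Rightarrow> ('a, 'g) gsheaf \<Rightarrow> nat \<Rightarrow> 'a set set \<times> ('a, 'g) cochain
    \<Rightarrow> ('a set set \<times> ('a, 'g) cochain) set" where
  "cech_class X F n = (\<lambda>(\<U>, c). {(\<V>, d) \<in> cech_reps X F n.
     \<exists>\<W> \<rho> \<rho>'. open_cover X \<W> \<and> refinement \<rho> \<W> \<U> \<and> refinement \<rho>' \<W> \<V> \<and>
       (\<exists>b\<in>coboundaries F \<W> n. pullback F \<rho> \<W> n c = cmult F \<W> n (pullback F \<rho>' \<W> n d) b)})"

definition cohom :: "'a topology \<Rightarrow> ('a, 'g) gsheaf \<Rightarrow> nat
    \<Rightarrow> ('a set set \<times> ('a, 'g) cochain) set monoid" where
  "cohom X F n =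
     \<lparr> carrier = cech_class X F n ` cech_reps X F n,
       monoid.mult = (\<lambda>K L. \<Union>{cech_class X F n (\<U>, cmult F \<U> n c d) | \<U> c d. (\<U>, c) \<in> K \<and> (\<U>, d) \<in> L}),
       one = cech_class X F n ({topspace X}, cone F {topspace X} n) \<rparr>"

text \<open>The connecting map of a short exact sequence of sheaves \<open>0 \<rightarrow> A \<rightarrow> B \<rightarrow> C \<rightarrow> 0\<close> with maps
  \<open>f\<close> and \<open>g\<close>: represent the class on a cover where it lifts to a cochain of \<open>B\<close>, and take the
  coboundary of the lift. Such a cover exists because the space is paracompact.\<close>

definition connecting :: "'a topology \<Rightarrow> ('a, 'g) gsheaf \<Rightarrow> ('a, 'h) gsheaf \<Rightarrow> ('a, 'k) gsheaf
    \<Rightarrow> ('a set \<Rightarrow> 'g \<Rightarrow> 'h) \<Rightarrow> ('a set \<Rightarrow> 'h \<Rightarrow> 'k) \<Rightarrow> nat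
    \<Rightarrow> ('a set set \<times> ('a, 'k) cochain) set \<Rightarrow> ('a set set \<times> ('a, 'g) cochain) set" where
  "connecting X A B C f g n K = (THE L. \<exists>\<U> c b a. (\<U>, c) \<in> K \<and>
     b \<in> cochains B \<U> n \<and> cmap g \<U> n b = c \<and>
     a \<in> cocycles A \<U> (Suc n) \<and> cmap f \<U> (Suc n) a = cobdry B \<U> n b \<and>
     L = cech_class X A (Suc n) (\<U>, a))"

subsection \<open>Sheaves of non-abelian groups\<close>

definition nab_reps :: "'a topology \<Rightarrow> ('a, 'g) gsheaf \<Rightarrow> ('a set set \<times> ('a, 'g) cochain) set" where
  "nab_reps X F = {(\<U>, c). open_cover X \<U> \<and> c \<in> cochains F \<U> 1 \<and>
     (\<forall>l\<in>simplices \<U> 2.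
        face_res F c l 2 \<otimes>\<^bsub>sec F (\<Inter>(set l))\<^esub> face_res F c l 0 = face_res F c l 1)}"

definition nab_class :: "'a topology \<Rightarrow> ('a, 'g) gsheaf \<Rightarrow> 'a set set \<times> ('a, 'g) cochain
    \<Rightarrow> ('a set set \<times> ('a, 'g) cochain) set" where
  "nab_class X F = (\<lambda>(\<U>, c). {(\<V>, d) \<in> nab_reps X F.
     \<exists>\<W> \<rho> \<rho>'. open_cover X \<W> \<and> refinement \<rho> \<W> \<U> \<and> refinement \<rho>' \<W> \<V> \<and>
       (\<exists>h\<in>cochains F \<W> 0. \<forall>l\<in>simplices \<W> 1.
          pullback F \<rho> \<W> 1 c l =
            face_res F h l 1 \<otimes>\<^bsub>sec F (\<Inter>(set l))\<^esub> pullback F \<rho>' \<W> 1 d l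
              \<otimes>\<^bsub>sec F (\<Inter>(set l))\<^esub> inv\<^bsub>sec F (\<Inter>(set l))\<^esub> (face_res F h l 0))})"

definition nab_basepoint :: "'a topology \<Rightarrow> ('a, 'g) gsheaf \<Rightarrow> ('a set set \<times> ('a, 'g) cochain) set"
  where
  "nab_basepoint X F = nab_class X F ({topspace X}, cone F {topspace X} 1)"


section \<open>The automorphism sheaves\<close>

text \<open>An endomorphism over \<open>U\<close> is a family of maps indexed by the open subsets of \<open>U\<close>.\<close>

type_synonym ('a, 'v) fam = "'a set \<Rightarrow> ('a, 'v) msection \<Rightarrow> ('a, 'v) msection"

definition opens_in :: "'a topology \<Rightarrow> 'a set \<Rightarrow> 'a set set" where
  "opens_in X U = {V. openin X V \<and> V \<subseteq> U}"

definition ext_automorphisms :: "('a, 'v::ab_group_add) model \<Rightarrow> 'a set \<Rightarrow> ('a, 'v) fam set" where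
  "ext_automorphisms M U = {\<alpha> \<in> extensional (opens_in (base M) U).
     (\<forall>V\<in>opens_in (base M) U.
        \<alpha> V \<in> extensional (ext_sections M V) \<and>
        bij_betw (\<alpha> V) (ext_sections M V) (ext_sections M V) \<and>
        \<alpha> V (sec_one V) = sec_one V \<and>
        (\<forall>s\<in>ext_sections M V. \<forall>t\<in>ext_sections M V.
           \<alpha> V (sec_add s t) = sec_add (\<alpha> V s) (\<alpha> V t) \<and>
           \<alpha> V (sec_wedge s t) = sec_wedge (\<alpha> V s) (\<alpha> V t)) \<and>
        (\<forall>s\<in>ext_sections M V.
           (\<forall>c. \<alpha> V (sec_scale c s) = sec_scale c (\<alpha> V s)) \<and>
           (sec_even s \<longrightarrow> sec_even (\<alpha> V s)) \<and> (sec_odd s \<longrightarrow> sec_odd (\<alpha> V s)) \<and>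
           (\<forall>W\<in>opens_in (base M) V. \<alpha> W (sec_restrict W s) = sec_restrict W (\<alpha> V s))))}"

definition Gsheaf :: "('a, 'v::ab_group_add) model \<Rightarrow> nat \<Rightarrow> ('a, ('a, 'v) fam) gsheaf" where
  "Gsheaf M k =
     \<lparr> sec = (\<lambda>U.
         \<lparr> carrier = {\<alpha> \<in> ext_automorphisms M U. \<forall>V\<in>opens_in (base M) U. \<forall>s\<in>ext_sections M V.
             sec_diff (\<alpha> V s) s \<in> J_ideal M k V},
           monoid.mult = (\<lambda>\<alpha> \<beta>. \<lambda>V\<in>opens_in (base M) U. compose (ext_sections M V) (\<alpha> V) (\<beta> V)),
           one = (\<lambda>V\<in>opens_in (base M) U. \<lambda>s\<in>ext_sections M V. s) \<rparr>),
       res = (\<lambda>U V \<alpha>. restrict \<alpha> (opens_in (base M) V)) \<rparr>"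


section \<open>The obstruction sheaf and the obstruction complex\<close>

type_synonym ('a, 'v) Qsheaf = "('a, ('a, ('a, 'v) fam) qsec) gsheaf"

definition Gquot :: "('a, 'v::ab_group_add) model \<Rightarrow> nat \<Rightarrow> nat \<Rightarrow> ('a, 'v) Qsheaf" where
  "Gquot M j k = quot_sheaf (base M) (Gsheaf M j) (Gsheaf M k)"

text \<open>\<open>\<int>\<close>-graded sheaves of abelian groups are families of sheaves indexed by integers, and their
  cohomology is the direct sum of the cohomology groups of the pieces.\<close>

definition obstr_sheaf :: "('a, 'v::ab_group_add) model \<Rightarrow> int \<Rightarrow> ('a, 'v) Qsheaf" where
  "obstr_sheaf M j = (if 2 \<le> j then Gquot M (nat j) (nat j + 1) else zero_sheaf)"

definition gr_cohom :: "'a topology \<Rightarrow> (int \<Rightarrow> ('a, 'g) gsheaf) \<Rightarrow> nat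
    \<Rightarrow> (int \<Rightarrow> ('a set set \<times> ('a, 'g) cochain) set) monoid" where
  "gr_cohom X F n = sum_group UNIV (\<lambda>j. cohom X (F j) n)"

text \<open>The degree \<open>j\<close> part of \<open>\<partial>\<close>, from \<open>H\<^sup>n(X, \<A>\<^sub>j)\<close> to \<open>H\<^sup>n\<^sup>+\<^sup>1(X, \<A>\<^sub>j\<^sub>+\<^sub>1)\<close>.\<close>

definition obstr_diff_at :: "('a, 'v::ab_group_add) model \<Rightarrow> nat \<Rightarrow> int
    \<Rightarrow> ('a set set \<times> ('a, ('a, ('a, 'v) fam) qsec) cochain) set
    \<Rightarrow> ('a set set \<times> ('a, ('a, ('a, 'v) fam) qsec) cochain) set" where
  "obstr_diff_at M n j K =
     (if j < 2 then \<one>\<^bsub>cohom (base M) (obstr_sheaf M (j + 1)) (Suc n)\<^esub>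
      else connecting (base M)
        (obstr_sheaf M (j + 1)) (Gquot M (nat j) (nat j + 2)) (obstr_sheaf M j)
        (qmap (base M) (Gsheaf M (nat j)) (Gsheaf M (nat j + 2)))
        (qmap (base M) (Gsheaf M (nat j)) (Gsheaf M (nat j + 1)))
        n K)"

text \<open>The total differential, from \<open>H\<^sup>n(X, \<A>)\<close> to \<open>H\<^sup>n\<^sup>+\<^sup>1(X, \<A>[1])\<close>: the component in degree \<open>j\<close>
  of the target is the cohomology of \<open>(\<A>[1])\<^sub>j = \<A>\<^sub>j\<^sub>+\<^sub>1\<close>.\<close>

definition obstr_diff :: "('a, 'v::ab_group_add) model \<Rightarrow> nat
    \<Rightarrow> (int \<Rightarrow> ('a set set \<times> ('a, ('a, ('a, 'v) fam) qsec) cochain) set)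
    \<Rightarrow> int \<Rightarrow> ('a set set \<times> ('a, ('a, ('a, 'v) fam) qsec) cochain) set" where
  "obstr_diff M n h = (\<lambda>j. obstr_diff_at M n j (h j))"

definition obstr_cohom1 :: "('a, 'v::ab_group_add) model
    \<Rightarrow> (int \<Rightarrow> ('a set set \<times> ('a, ('a, ('a, 'v) fam) qsec) cochain) set set) monoid" where
  "obstr_cohom1 M = sum_group UNIV (\<lambda>j.
     (cohom (base M) (obstr_sheaf M j) 1)
       \<lparr> carrier := kernel (cohom (base M) (obstr_sheaf M j) 1)
           (cohom (base M) (obstr_sheaf M (j + 1)) 2) (obstr_diff_at M 1 j) \<rparr>
     Mod (obstr_diff_at M 0 (j - 1) ` carrier (cohom (base M) (obstr_sheaf M (j - 1)) 0)))"


section \<open>Supermanifold atlases and good models\<close>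

definition smf_atlases :: "('a, 'v::ab_group_add) model \<Rightarrow> nat
    \<Rightarrow> ('a set set \<times> ('a, ('a, 'v) fam) cochain) set" where
  "smf_atlases M j = nab_reps (base M) (Gsheaf M j)"

definition obstruction :: "('a, 'v::ab_group_add) model \<Rightarrow> nat
    \<Rightarrow> 'a set set \<times> ('a, ('a, 'v) fam) cochain
    \<Rightarrow> ('a set set \<times> ('a, ('a, ('a, 'v) fam) qsec) cochain) set" where
  "obstruction M j = (\<lambda>(\<U>, g). cech_class (base M) (obstr_sheaf M (int j)) 1
     (\<U>, cmap (qproj (base M) (Gsheaf M j) (Gsheaf M (j + 1))) \<U> 1 g))"

text \<open>The map induced by the inclusion of \<open>G\<^sub>j\<close> in \<open>G\<^sub>2\<close> leaves representatives unchanged.\<close>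

definition strongly_split :: "('a, 'v::ab_group_add) model
    \<Rightarrow> 'a set set \<times> ('a, ('a, 'v) fam) cochain \<Rightarrow> bool" where
  "strongly_split M \<X> \<longleftrightarrow>
     nab_class (base M) (Gsheaf M 2) \<X> = nab_basepoint (base M) (Gsheaf M 2)"

definition exotic :: "('a, 'v::ab_group_add) model \<Rightarrow> nat
    \<Rightarrow> 'a set set \<times> ('a, ('a, 'v) fam) cochain \<Rightarrow> bool" where
  "exotic M j \<X> \<longleftrightarrow> strongly_split M \<X> \<and>
     obstruction M j \<X> \<noteq> \<one>\<^bsub>cohom (base M) (obstr_sheaf M (int j)) 1\<^esub>"

definition good_model :: "('a, 'v::ab_group_add) model \<Rightarrow> bool" where
  "good_model M \<longleftrightarrow> (\<forall>j\<ge>2. \<forall>\<X>\<in>smf_atlases M j. \<not> exotic M j \<X>)"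

end

theory Submission
  imports Defs
begin

text \<open>Goodness makes all connecting maps \<open>\<partial> : H\<^sup>0(X, \<A>\<^sub>j) \<rightarrow> H\<^sup>1(X, \<A>\<^sub>j\<^sub>+\<^sub>1)\<close> trivial. Lift a section of
  \<open>\<A>\<^sub>j\<close> over the members of a cover to sections \<open>\<beta>\<^sub>A\<close> of \<open>G\<^sub>j\<close>. The cocycle \<open>\<beta>\<^sub>A\<^sup>-\<^sup>1 \<beta>\<^sub>B\<close> has values in
  \<open>G\<^sub>j\<^sub>+\<^sub>1\<close>, so it is an atlas of order \<open>j + 1\<close>; being a coboundary in \<open>G\<^sub>j\<close>, hence in \<open>G\<^sub>2\<close>, it is
  strongly split; and its obstruction to splitting is the value of \<open>\<partial>\<close>. As the atlas is not exotic, this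
  value is trivial (\<open>connecting_0_obstruction\<close>, \<open>coboundary_strongly_split\<close>, \<open>obstr_diff_0_trivial\<close>). The
  first obstruction cohomology is therefore the direct sum of the kernels of \<open>\<partial>\<close> on \<open>H\<^sup>1(X, \<A>\<^sub>j)\<close>. It is
  trivial if and only if each of these kernels is, and as \<open>\<partial>\<close> is a homomorphism in every degree, this
  means that \<open>\<partial>\<close> is injective (\<open>trivial_sum_of_kernels_iff_inj\<close>).

  Most of the text supplies the structure that this argument takes for granted, namely that the cohomology
  sets are groups and that the connecting maps are well defined and, on \<open>H\<^sup>1\<close>, homomorphisms. There are
  three essential points.

  First, \<open>G\<^sub>j/G\<^sub>j\<^sub>+\<^sub>2\<close> is abelian (\<open>G_commutator\<close>): an automorphism in \<open>G\<^sub>j\<close> changes the sections of \<open>J\<^sup>j\<close>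
  only by sections of \<open>J\<^sup>j\<^sup>+\<^sup>2\<close> (\<open>G_displacement\<close>). Automorphisms are multiplicative, and locally a section of
  \<open>J\<^sup>m\<^sup>+\<^sup>1\<close> is a sum of products of an odd section and a section of \<open>J\<^sup>m\<close> (\<open>frame_decomposition\<close>, a
  consequence of Euler's formula), so this follows by climbing the filtration.

  Secondly, classes in the direct limit over all covers can be compared along arbitrary refinement maps,
  since all refinement maps into a cover induce the same map on cohomology (\<open>refinement_independent_1\<close>,
  \<open>refinement_independent_2\<close>).

  Thirdly, the connecting map on \<open>H\<^sup>1\<close> needs a refinement on which a 1-cochain of a quotient sheaf lifts
  over all pairwise intersections at once. It exists because manifolds are regular Lindelof spaces
  (\<open>refinement_adapted_to_pairs\<close>, \<open>lift_1_cochain\<close>).\<close>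

section \<open>Locally finite refinements of covers\<close>

text \<open>Only finitely many members meet a small neighbourhood of \<open>x\<close>; the closures of those that do
  not adhere to \<open>x\<close> are removed from it.\<close>

lemma locally_finite_neighbourhood:
  assumes "locally_finite_in X \<G>" and "x \<in> topspace X"
  obtains P where "openin X P" "x \<in> P" "\<And>G. G \<in> \<G> \<Longrightarrow> P \<inter> G \<noteq> {} \<Longrightarrow> x \<in> X closure_of G"
proof -
  obtain V where V: "openin X V" "x \<in> V" "finite {U \<in> \<G>. U \<inter> V \<noteq> {}}"
    using assms by (auto simp: locally_finite_in_def)
  define F where "F = {U \<in> \<G>. U \<inter> V \<noteq> {} \<and> x \<notin> X closure_of U}"
  have sub: "F \<subseteq> {U \<in> \<G>. U \<inter> V \<noteq> {}}" by (auto simp: F_def)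
  have fin: "finite F" by (rule finite_subset[OF sub V(3)])
  have "closedin X (\<Union>U\<in>F. X closure_of U)"
    using fin by (intro closedin_Union) auto
  then have op: "openin X (V - (\<Union>U\<in>F. X closure_of U))"
    using V(1) by (rule openin_diff[rotated])
  show thesis
  proof (rule that[OF op])
    show "x \<in> V - (\<Union>U\<in>F. X closure_of U)" using V(2) by (auto simp: F_def)
    fix G assume G: "G \<in> \<G>" "(V - (\<Union>U\<in>F. X closure_of U)) \<inter> G \<noteq> {}"
    have "G \<subseteq> topspace X" using assms(1) G(1) by (auto simp: locally_finite_in_def)
    then have "G \<subseteq> X closure_of G" by (rule closure_of_subset)
    then have "G \<notin> F" using G by blast
    then show "x \<in> X closure_of G" using G by (auto simp: F_def)
  qed
qed

text \<open>Cover the space by countably many open sets \<open>v n\<close> whose closures lie in members \<open>u n\<close> of the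
  cover, and remove from \<open>u n\<close> the closures of the earlier \<open>v m\<close>.\<close>

lemma regular_Lindelof_locally_finite_refinement:
  assumes reg: "regular_space X" and lin: "Lindelof_space X" and cov: "open_cover X \<U>"
  obtains \<G> where "open_cover X \<G>" "locally_finite_in X \<G>" "\<And>G. G \<in> \<G> \<Longrightarrow> \<exists>U\<in>\<U>. G \<subseteq> U"
proof (cases "topspace X = {}")
  case True
  show thesis
    by (rule that[of "{}"]) (auto simp: open_cover_def locally_finite_in_def True)
next
  case False
  define \<V> where "\<V> = {V. openin X V \<and> (\<exists>U\<in>\<U>. X closure_of V \<subseteq> U)}"
  have nb: "neighbourhood_base_of (closedin X) X"
    using reg by (simp add: neighbourhood_base_of_closedin)
  have "x \<in> \<Union>\<V>" if x: "x \<in> topspace X" for x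
  proof -
    obtain U where U: "U \<in> \<U>" "x \<in> U" "openin X U" using cov x by (auto simp: open_cover_def)
    obtain A C where "openin X A" "closedin X C" "x \<in> A" "A \<subseteq> C" "C \<subseteq> U"
      using nb U unfolding neighbourhood_base_of by metis
    then have "A \<in> \<V>" using U unfolding \<V>_def
      by (blast dest: closure_of_minimal)
    with \<open>x \<in> A\<close> show ?thesis by blast
  qed
  moreover have "\<forall>V\<in>\<V>. openin X V" by (auto simp: \<V>_def)
  ultimately obtain \<V>' where V': "countable \<V>'" "\<V>' \<subseteq> \<V>" "topspace X \<subseteq> \<Union>\<V>'"
    using lin unfolding Lindelof_space_alt by (metis subsetI)
  have "\<V>' \<noteq> {}" using V' False by auto
  then obtain v :: "nat \<Rightarrow> 'a set" where v: "range v = \<V>'"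
    using V'(1) by (metis range_from_nat_into)
  have vV: "v n \<in> \<V>" for n using v V'(2) by blast
  then have "\<forall>n. \<exists>U\<in>\<U>. X closure_of (v n) \<subseteq> U" by (auto simp: \<V>_def)
  then obtain u where u: "\<And>n. u n \<in> \<U>" "\<And>n. X closure_of (v n) \<subseteq> u n" by metis
  have vo: "openin X (v n)" and uo: "openin X (u n)" for n
    using vV[of n] u(1)[of n] cov by (auto simp: \<V>_def open_cover_def)
  define g where "g n = u n - (\<Union>m<n. X closure_of (v m))" for n
  have go: "openin X (g n)" for n
    unfolding g_def by (intro openin_diff uo closedin_Union) auto
  have vc: "v n \<subseteq> X closure_of (v n)" for n
    by (rule closure_of_subset[OF openin_subset[OF vo]])
  have gcov: "\<exists>n. x \<in> g n" if x: "x \<in> topspace X" for x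
  proof -
    have "\<exists>n. x \<in> u n" using x V'(3) v vc u(2) by blast
    then obtain n where n: "x \<in> u n" "\<And>m. m < n \<Longrightarrow> x \<notin> u m"
      using exists_least_iff[of "\<lambda>n. x \<in> u n"] by blast
    then show ?thesis using u(2) unfolding g_def by blast
  qed
  show thesis
  proof (rule that[of "range g"])
    show "open_cover X (range g)"
      using go gcov openin_subset[OF go] by (auto simp: open_cover_def)
    show "locally_finite_in X (range g)" unfolding locally_finite_in_def
    proof (intro conjI ballI)
      show "\<Union> (range g) \<subseteq> topspace X" using openin_subset[OF go] by blast
      fix x assume "x \<in> topspace X"
      then obtain m where m: "x \<in> v m" using V'(3) v by blast
      \<comment> \<open>The neighbourhood \<open>v m\<close> of \<open>x\<close> is removed from every later \<open>g n\<close>.\<close>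
      have "{U \<in> range g. U \<inter> v m \<noteq> {}} \<subseteq> g ` {..m}"
      proof clarify
        fix n assume "g n \<inter> v m \<noteq> {}"
        then have "\<not> m < n" using vc[of m] unfolding g_def by blast
        then show "g n \<in> g ` {..m}" by auto
      qed
      then have "finite {U \<in> range g. U \<inter> v m \<noteq> {}}" by (rule finite_subset) auto
      then show "\<exists>V. openin X V \<and> x \<in> V \<and> finite {U \<in> range g. U \<inter> V \<noteq> {}}"
        using m vo by blast
    qed
    show "\<exists>U\<in>\<U>. G \<subseteq> U" if "G \<in> range g" for G using that u(1) unfolding g_def by blast
  qed
qed

text \<open>\<open>P U V N\<close> expresses that something given on \<open>U \<inter> V\<close> is good on \<open>N\<close>. Choose a locally finite
  refinement \<open>\<G>\<close> and a locally finite cover \<open>\<H>\<close> such that each member \<open>H\<close> has its closure in a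
  member \<open>s H\<close> of \<open>\<G>\<close>. A small neighbourhood of \<open>x\<close> meets only members \<open>H\<close> whose closure contains
  \<open>x\<close>, so that \<open>s H\<close> is one of the finitely many members of \<open>\<G>\<close> through \<open>x\<close>. Hence the neighbourhood
  can be made good for all members of \<open>\<H>\<close> that it meets, and these include the one containing any
  other neighbourhood that it meets.\<close>

lemma refinement_adapted_to_pairs:
  assumes reg: "regular_space X" and lin: "Lindelof_space X" and cov: "open_cover X \<U>"
    and loc: "\<And>U V x. U \<in> \<U> \<Longrightarrow> V \<in> \<U> \<Longrightarrow> x \<in> U \<Longrightarrow> x \<in> V \<Longrightarrow> \<exists>N. openin X N \<and> x \<in> N \<and> P U V N"
    and her: "\<And>U V N N'. P U V N \<Longrightarrow> openin X N' \<Longrightarrow> N' \<subseteq> N \<Longrightarrow> P U V N'"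
    and emp: "\<And>U V. U \<in> \<U> \<Longrightarrow> V \<in> \<U> \<Longrightarrow> P U V {}"
  obtains \<W> \<rho> where "open_cover X \<W>" "refinement \<rho> \<W> \<U>"
    "\<And>W W'. W \<in> \<W> \<Longrightarrow> W' \<in> \<W> \<Longrightarrow> P (\<rho> W) (\<rho> W') (W \<inter> W')"
proof -
  obtain \<G> where G: "open_cover X \<G>" "locally_finite_in X \<G>" "\<And>G. G \<in> \<G> \<Longrightarrow> \<exists>U\<in>\<U>. G \<subseteq> U"
    using regular_Lindelof_locally_finite_refinement[OF reg lin cov] by blast
  obtain \<tau> where \<tau>: "\<And>G. G \<in> \<G> \<Longrightarrow> \<tau> G \<in> \<U> \<and> G \<subseteq> \<tau> G" using G(3) by metis
  define \<V> where "\<V> = {V. openin X V \<and> (\<exists>G\<in>\<G>. X closure_of V \<subseteq> G)}"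
  have nb: "neighbourhood_base_of (closedin X) X"
    using reg by (simp add: neighbourhood_base_of_closedin)
  have "x \<in> \<Union>\<V>" if x: "x \<in> topspace X" for x
  proof -
    obtain U where U: "U \<in> \<G>" "x \<in> U" "openin X U" using G(1) x by (auto simp: open_cover_def)
    obtain A C where "openin X A" "closedin X C" "x \<in> A" "A \<subseteq> C" "C \<subseteq> U"
      using nb U unfolding neighbourhood_base_of by metis
    then have "A \<in> \<V>" using U unfolding \<V>_def
      by (blast dest: closure_of_minimal)
    with \<open>x \<in> A\<close> show ?thesis by blast
  qed
  moreover have "\<Union>\<V> \<subseteq> topspace X" using openin_subset by (fastforce simp: \<V>_def)
  ultimately have "open_cover X \<V>" by (auto simp: open_cover_def \<V>_def)
  then obtain \<H> where H: "open_cover X \<H>" "locally_finite_in X \<H>" "\<And>H. H \<in> \<H> \<Longrightarrow> \<exists>V\<in>\<V>. H \<subseteq> V"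
    using regular_Lindelof_locally_finite_refinement[OF reg lin] by blast
  have "\<exists>G\<in>\<G>. X closure_of H \<subseteq> G" if "H \<in> \<H>" for H
    using H(3)[OF that] closure_of_mono unfolding \<V>_def by blast
  then obtain s where s: "\<And>H. H \<in> \<H> \<Longrightarrow> s H \<in> \<G> \<and> X closure_of H \<subseteq> s H" by metis
  have HX: "H \<subseteq> X closure_of H" if "H \<in> \<H>" for H
    using H(1) that by (intro closure_of_subset openin_subset) (auto simp: open_cover_def)
  have "\<exists>W H. openin X W \<and> x \<in> W \<and> H \<in> \<H> \<and> W \<subseteq> H \<and>
      (\<forall>H'\<in>\<H>. W \<inter> H' \<noteq> {} \<longrightarrow> P (\<tau> (s H)) (\<tau> (s H')) W)" if x: "x \<in> topspace X" for x
  proof -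
    obtain H0 where H0: "H0 \<in> \<H>" "x \<in> H0" "openin X H0" using H(1) x by (auto simp: open_cover_def)
    obtain P0 where P0: "openin X P0" "x \<in> P0"
        "\<And>H. H \<in> \<H> \<Longrightarrow> P0 \<inter> H \<noteq> {} \<Longrightarrow> x \<in> X closure_of H"
      using locally_finite_neighbourhood[OF H(2) x] by blast
    \<comment> \<open>The members of \<open>\<G>\<close> for which the neighbourhood of \<open>x\<close> has to be good.\<close>
    define F where "F = {G \<in> \<G>. x \<in> G}"
    obtain V where V: "x \<in> V" "finite {U \<in> \<G>. U \<inter> V \<noteq> {}}"
      using G(2) x by (auto simp: locally_finite_in_def)
    have finF: "finite F" by (rule finite_subset[OF _ V(2)]) (use V(1) in \<open>auto simp: F_def\<close>)
    have sF: "s H \<in> F" if "H \<in> \<H>" "x \<in> X closure_of H" for H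
      using s[OF that(1)] that(2) by (auto simp: F_def)
    have "\<forall>G\<in>F. \<exists>N. openin X N \<and> x \<in> N \<and> P (\<tau> (s H0)) (\<tau> G) N"
    proof
      fix G assume "G \<in> F"
      then have "\<tau> G \<in> \<U>" "x \<in> \<tau> G" using \<tau> by (auto simp: F_def)
      moreover have "\<tau> (s H0) \<in> \<U>" "x \<in> \<tau> (s H0)" using \<tau> s H0 HX by blast+
      ultimately show "\<exists>N. openin X N \<and> x \<in> N \<and> P (\<tau> (s H0)) (\<tau> G) N" by (intro loc)
    qed
    then obtain N where N: "\<And>G. G \<in> F \<Longrightarrow> openin X (N G) \<and> x \<in> N G \<and> P (\<tau> (s H0)) (\<tau> G) (N G)"
      by metis
    define W where "W = P0 \<inter> H0 \<inter> (\<Inter>G\<in>F. N G)"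
    have "s H0 \<in> F" using sF[OF H0(1)] HX H0 by blast
    then have "openin X (\<Inter>G\<in>F. N G)" using finF N by (intro openin_Inter) auto
    then have Wo: "openin X W" unfolding W_def using P0(1) H0(3) by (intro openin_Int)
    have "P (\<tau> (s H0)) (\<tau> (s H')) W" if "H' \<in> \<H>" "W \<inter> H' \<noteq> {}" for H'
    proof -
      have "x \<in> X closure_of H'" using P0(3) that by (auto simp: W_def)
      then have "s H' \<in> F" using sF that by blast
      then have "P (\<tau> (s H0)) (\<tau> (s H')) (N (s H'))" "W \<subseteq> N (s H')" using N by (auto simp: W_def)
      then show ?thesis using her Wo by blast
    qed
    moreover have "x \<in> W" "W \<subseteq> H0" using P0 H0 N by (auto simp: W_def)
    ultimately show ?thesis using Wo H0(1) by blast
  qed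
  then obtain w h where wh: "\<And>x. x \<in> topspace X \<Longrightarrow> openin X (w x) \<and> x \<in> w x \<and> h x \<in> \<H> \<and> w x \<subseteq> h x \<and>
      (\<forall>H'\<in>\<H>. w x \<inter> H' \<noteq> {} \<longrightarrow> P (\<tau> (s (h x))) (\<tau> (s H')) (w x))" by metis
  define \<W> where "\<W> = w ` topspace X"
  have "\<forall>W\<in>\<W>. \<exists>x\<in>topspace X. w x = W" by (auto simp: \<W>_def)
  then obtain c where c: "\<And>W. W \<in> \<W> \<Longrightarrow> c W \<in> topspace X \<and> w (c W) = W"
    by metis
  define \<rho> where "\<rho> W = \<tau> (s (h (c W)))" for W
  show thesis
  proof (rule that[of \<W> \<rho>])
    show "open_cover X \<W>" unfolding open_cover_def \<W>_def using wh openin_subset by fast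
    show "refinement \<rho> \<W> \<U>" unfolding refinement_def
    proof
      fix W assume W: "W \<in> \<W>"
      have h: "h (c W) \<in> \<H>" and "W \<subseteq> h (c W)" using wh[of "c W"] c[OF W] by auto
      then show "\<rho> W \<in> \<U> \<and> W \<subseteq> \<rho> W" using s[OF h] \<tau>[of "s (h (c W))"] HX[OF h] by (auto simp: \<rho>_def)
    qed
    fix W W' assume W: "W \<in> \<W>" "W' \<in> \<W>"
    show "P (\<rho> W) (\<rho> W') (W \<inter> W')"
    proof (cases "W \<inter> W' = {}")
      case True
      have "\<rho> W \<in> \<U>" "\<rho> W' \<in> \<U>" using \<open>refinement \<rho> \<W> \<U>\<close> W by (auto simp: refinement_def)
      then show ?thesis using emp True by simp
    next
      case False
      have W': "h (c W') \<in> \<H>" "W' \<subseteq> h (c W')" "openin X W'" using wh[of "c W'"] c[OF W(2)] by auto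
      then have "W \<inter> h (c W') \<noteq> {}" using False by blast
      then have P: "P (\<rho> W) (\<rho> W') W" using wh[of "c W"] c[OF W(1)] W' unfolding \<rho>_def by metis
      have "openin X W" using wh[of "c W"] c[OF W(1)] by auto
      then show ?thesis using her[OF P] W'(3) by blast
    qed
  qed
qed

lemma locally_compact_space_Cn: "locally_compact_space (Cn n)"
proof -
  have "locally_compact_space (euclidean :: complex topology)"
    unfolding locally_compact_space_def
  proof clarsimp
    fix x :: complex
    show "\<exists>U. open U \<and> (\<exists>K. compact K \<and> x \<in> U \<and> U \<subseteq> K)"
      by (intro exI[of _ "ball x 1"] exI[of _ "cball x 1"] conjI) auto
  qed
  then show ?thesis unfolding Cn_def by (simp add: locally_compact_space_product_topology)
qed

text \<open>Regularity holds because charts make the space locally compact.\<close>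

lemma complex_manifold_regular_Lindelof:
  assumes "complex_manifold X n \<A>"
  shows "regular_space X" "Lindelof_space X"
proof -
  have H: "Hausdorff_space X" "second_countable X" using assms by (auto simp: complex_manifold_def)
  show "Lindelof_space X" by (rule second_countable_imp_Lindelof_space[OF H(2)])
  have "locally_compact_space X" unfolding locally_compact_space_def
  proof
    fix x assume "x \<in> topspace X"
    then obtain W \<phi> where W: "(W, \<phi>) \<in> \<A>" "x \<in> W"
      using assms unfolding complex_manifold_def by auto
    then have o: "openin X W" "openin (Cn n) (\<phi> ` W)"
      and h: "homeomorphic_map (subtopology X W) (subtopology (Cn n) (\<phi> ` W)) \<phi>"
      using assms unfolding complex_manifold_def by auto
    have "locally_compact_space (subtopology (Cn n) (\<phi> ` W))"
      by (rule locally_compact_space_open_subset[OF disjI1 locally_compact_space_Cn o(2)])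
         (auto simp: Cn_def Hausdorff_space_product_topology)
    then have "locally_compact_space (subtopology X W)"
      using h homeomorphic_locally_compact_space homeomorphic_map_imp_homeomorphic_space by blast
    moreover have "x \<in> topspace (subtopology X W)" using W(2) openin_subset[OF o(1)] by auto
    ultimately obtain U K where "openin (subtopology X W) U" "compactin (subtopology X W) K" "x \<in> U" "U \<subseteq> K"
      unfolding locally_compact_space_def by blast
    then show "\<exists>U K. openin X U \<and> compactin X K \<and> x \<in> U \<and> U \<subseteq> K"
      using o(1) by (metis compactin_subtopology openin_open_subtopology)
  qed
  then show "regular_space X" using H locally_compact_Hausdorff_imp_regular_space by blast
qed

section \<open>Cech cochains\<close>

definition cochain_group :: "('a, 'g) gsheaf \<Rightarrow> 'a set set \<Rightarrow> nat \<Rightarrow> ('a set list \<Rightarrow> 'g) monoid" where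
  "cochain_group F \<U> n = product_group (simplices \<U> n) (\<lambda>l. sec F (\<Inter>(set l)))"

lemma carrier_cochain_group: "carrier (cochain_group F \<U> n) = cochains F \<U> n"
  by (simp add: cochain_group_def cochains_def)

lemma mult_cochain_group: "c \<otimes>\<^bsub>cochain_group F \<U> n\<^esub> d = cmult F \<U> n c d"
  by (simp add: cochain_group_def cmult_def)

lemma one_cochain_group: "\<one>\<^bsub>cochain_group F \<U> n\<^esub> = cone F \<U> n"
  by (simp add: cochain_group_def cone_def)

lemma (in comm_group) finprod_alternating_mult:
  assumes "\<And>k. k \<le> m \<Longrightarrow> a k \<in> carrier G" "\<And>k. k \<le> m \<Longrightarrow> b k \<in> carrier G"
    "\<And>k. k \<le> m \<Longrightarrow> c k = a k \<otimes> b k"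
  shows "finprod G (\<lambda>k. if even k then c k else inv c k) {..m::nat} =
    finprod G (\<lambda>k. if even k then a k else inv a k) {..m} \<otimes> finprod G (\<lambda>k. if even k then b k else inv b k) {..m}"
proof -
  have "finprod G (\<lambda>k. if even k then c k else inv c k) {..m} =
      finprod G (\<lambda>k. (if even k then a k else inv a k) \<otimes> (if even k then b k else inv b k)) {..m}"
    using assms by (intro finprod_cong') (auto simp: inv_mult)
  also have "\<dots> = finprod G (\<lambda>k. if even k then a k else inv a k) {..m} \<otimes>
      finprod G (\<lambda>k. if even k then b k else inv b k) {..m}"
    using assms by (intro finprod_multf) auto
  finally show ?thesis .
qed

lemma (in comm_group) finprod_alternating_2:
  assumes "t 0 \<in> carrier G" "t 1 \<in> carrier G"
  shows "finprod G (\<lambda>k. if even k then t k else inv t k) {..Suc 0} = inv t 1 \<otimes> t 0"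
  using assms by (subst finprod_Suc) (auto simp: le_Suc_eq)

lemma (in comm_group) finprod_alternating_3:
  assumes "t 0 \<in> carrier G" "t 1 \<in> carrier G" "t 2 \<in> carrier G"
  shows "finprod G (\<lambda>k. if even k then t k else inv t k) {..Suc 1} = t 2 \<otimes> (inv t 1 \<otimes> t 0)"
  using assms unfolding One_nat_def numeral_2_eq_2
  by (subst finprod_Suc, force simp: le_Suc_eq, subst finprod_Suc) (auto simp: le_Suc_eq)

lemma odd_three: "odd (3::nat)" by simp

lemma (in comm_group) finprod_alternating_4:
  assumes "t 0 \<in> carrier G" "t 1 \<in> carrier G" "t 2 \<in> carrier G" "t 3 \<in> carrier G"
  shows "finprod G (\<lambda>k. if even k then t k else inv t k) {..Suc 2} =
    inv t 3 \<otimes> (t 2 \<otimes> (inv t 1 \<otimes> t 0))"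
  using assms odd_three unfolding One_nat_def numeral_2_eq_2 numeral_3_eq_3
  by (subst finprod_Suc, force simp: le_Suc_eq, subst finprod_Suc, force simp: le_Suc_eq, subst finprod_Suc)
     (auto simp: le_Suc_eq)

lemma hom_finprod:
  assumes G: "comm_group G" and H: "comm_group H" and h: "h \<in> hom G H"
    and "finite A" "f \<in> A \<rightarrow> carrier G"
  shows "h (finprod G f A) = finprod H (\<lambda>i. h (f i)) A"
  using assms(4,5)
proof (induction A rule: finite_induct)
  case empty
  show ?case using hom_one[OF h] G H by (simp add: comm_group_def comm_monoid.finprod_empty)
next
  case (insert x A)
  interpret G: comm_group G by (rule G)
  interpret H: comm_group H by (rule H)
  have "f \<in> A \<rightarrow> carrier G" "f x \<in> carrier G" using insert.prems by auto
  moreover have "(\<lambda>i. h (f i)) \<in> A \<rightarrow> carrier H" "h (f x) \<in> carrier H"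
    using calculation hom_in_carrier[OF h] by blast+
  ultimately show ?case using insert by (simp add: hom_mult[OF h])
qed

lemma hom_m_inv: "group G \<Longrightarrow> group H \<Longrightarrow> h \<in> hom G H \<Longrightarrow> x \<in> carrier G \<Longrightarrow> h (inv\<^bsub>G\<^esub> x) = inv\<^bsub>H\<^esub> h x"
  by (simp add: group_hom.hom_inv group_hom.intro group_hom_axioms.intro)

lemma comm_group_product_group:
  assumes "\<And>i. i \<in> I \<Longrightarrow> comm_group (G i)"
  shows "comm_group (product_group I G)"
proof -
  interpret group "product_group I G" using assms by (simp add: comm_group.axioms)
  show ?thesis
  proof (rule group_comm_groupI)
    fix x y assume "x \<in> carrier (product_group I G)" "y \<in> carrier (product_group I G)"
    then show "x \<otimes>\<^bsub>product_group I G\<^esub> y = y \<otimes>\<^bsub>product_group I G\<^esub> x"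
      using comm_monoid.m_comm[OF comm_group.axioms(1)[OF assms]]
      by (auto simp: PiE_iff intro!: restrict_ext)
  qed
qed

abbreviation face :: "nat \<Rightarrow> 'b list \<Rightarrow> 'b list" where
  "face k l \<equiv> take k l @ drop (Suc k) l"

lemma face_in_simplices: "l \<in> simplices \<U> (Suc n) \<Longrightarrow> k \<le> Suc n \<Longrightarrow> face k l \<in> simplices \<U> n"
  by (auto simp: simplices_def dest!: in_set_takeD in_set_dropD)

lemma Inter_face_subset: "\<Inter>(set l) \<subseteq> \<Inter>(set (face k l))"
  by (auto dest: in_set_takeD in_set_dropD)

lemma openin_simplex:
  assumes "open_cover X \<U>" "l \<in> simplices \<U> n" shows "openin X (\<Inter>(set l))"
proof (rule openin_Inter)
  show "set l \<noteq> {}" using assms(2) by (auto simp: simplices_def)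
qed (use assms in \<open>auto simp: simplices_def open_cover_def\<close>)

lemma map_in_simplices:
  "refinement \<rho> \<W> \<U> \<Longrightarrow> l \<in> simplices \<W> n \<Longrightarrow> map \<rho> l \<in> simplices \<U> n"
  by (auto simp: simplices_def refinement_def)

lemma Inter_map_subset:
  "refinement \<rho> \<W> \<U> \<Longrightarrow> l \<in> simplices \<W> n \<Longrightarrow> \<Inter>(set l) \<subseteq> \<Inter>(set (map \<rho> l))"
  by (force simp: simplices_def refinement_def)

lemma refinement_comp:
  "refinement \<sigma> \<V> \<W> \<Longrightarrow> refinement \<rho> \<W> \<U> \<Longrightarrow> refinement (\<rho> \<circ> \<sigma>) \<V> \<U>"
  by (force simp: refinement_def)

lemma common_refinement:
  assumes "open_cover X \<U>" "open_cover X \<V>"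
  obtains \<W> \<rho> \<sigma> where "open_cover X \<W>" "refinement \<rho> \<W> \<U>" "refinement \<sigma> \<W> \<V>"
proof -
  define \<W> where "\<W> = {U \<inter> V |U V. U \<in> \<U> \<and> V \<in> \<V>}"
  have "\<forall>W\<in>\<W>. \<exists>U V. U \<in> \<U> \<and> V \<in> \<V> \<and> W \<subseteq> U \<and> W \<subseteq> V" unfolding \<W>_def by blast
  then obtain \<rho> \<sigma> where rs: "\<And>W. W \<in> \<W> \<Longrightarrow> \<rho> W \<in> \<U> \<and> \<sigma> W \<in> \<V> \<and> W \<subseteq> \<rho> W \<and> W \<subseteq> \<sigma> W" by metis
  have "topspace X \<subseteq> \<Union>\<W>"
  proof
    fix x assume "x \<in> topspace X"
    then have "x \<in> \<Union>\<U>" "x \<in> \<Union>\<V>" using assms by (simp_all add: open_cover_def)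
    then obtain U V where "U \<in> \<U>" "x \<in> U" "V \<in> \<V>" "x \<in> V" by blast
    then show "x \<in> \<Union>\<W>" unfolding \<W>_def by blast
  qed
  moreover have "openin X W" if "W \<in> \<W>" for W using that assms by (auto simp: open_cover_def \<W>_def)
  ultimately have "open_cover X \<W>" unfolding open_cover_def using openin_subset by fast
  then show thesis using rs by (intro that[of \<W> \<rho> \<sigma>]) (auto simp: refinement_def)
qed

lemma refinement_by_local_property:
  assumes cov: "open_cover X \<U>"
    and loc: "\<And>U x. U \<in> \<U> \<Longrightarrow> x \<in> U \<Longrightarrow> \<exists>N. openin X N \<and> x \<in> N \<and> N \<subseteq> U \<and> P U N"
  obtains \<W> \<rho> where "open_cover X \<W>" "refinement \<rho> \<W> \<U>" "\<And>W. W \<in> \<W> \<Longrightarrow> P (\<rho> W) W"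
proof -
  define \<W> where "\<W> = {N. openin X N \<and> (\<exists>U\<in>\<U>. N \<subseteq> U \<and> P U N)}"
  have "\<forall>N\<in>\<W>. \<exists>U. U \<in> \<U> \<and> N \<subseteq> U \<and> P U N" unfolding \<W>_def by blast
  then obtain \<rho> where r: "\<And>N. N \<in> \<W> \<Longrightarrow> \<rho> N \<in> \<U> \<and> N \<subseteq> \<rho> N \<and> P (\<rho> N) N" by metis
  have "topspace X \<subseteq> \<Union>\<W>"
  proof
    fix x assume "x \<in> topspace X"
    then obtain U where "U \<in> \<U>" "x \<in> U" using cov by (auto simp: open_cover_def)
    with loc[of U x] show "x \<in> \<Union>\<W>" unfolding \<W>_def by blast
  qed
  moreover have "openin X N" if "N \<in> \<W>" for N using that by (auto simp: \<W>_def)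
  ultimately have "open_cover X \<W>" unfolding open_cover_def using openin_subset by fast
  then show thesis using r by (intro that[of \<W> \<rho>]) (auto simp: refinement_def)
qed

text \<open>Identities between cochains are checked on one simplex, after restricting all the values
  involved to the same open set \<open>S\<close>.\<close>

definition rval :: "('a, 'g) gsheaf \<Rightarrow> ('a, 'g) cochain \<Rightarrow> 'a set list \<Rightarrow> 'a set \<Rightarrow> 'g" where
  "rval F c f S = res F (\<Inter>(set f)) S (c f)"

lemma face_res_rval: "face_res F c l k = rval F c (face k l) (\<Inter>(set l))"
  by (simp add: face_res_def rval_def Let_def)

locale ab_presheaf =
  fixes X :: "'a topology" and F :: "('a, 'g) gsheaf"
  assumes sec_comm_group: "openin X U \<Longrightarrow> comm_group (sec F U)"
    and res_hom: "openin X U \<Longrightarrow> openin X V \<Longrightarrow> V \<subseteq> U \<Longrightarrow> res F U V \<in> hom (sec F U) (sec F V)"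
    and res_res: "openin X U \<Longrightarrow> openin X V \<Longrightarrow> openin X W \<Longrightarrow> V \<subseteq> U \<Longrightarrow> W \<subseteq> V \<Longrightarrow>
      s \<in> carrier (sec F U) \<Longrightarrow> res F V W (res F U V s) = res F U W s"
    and res_id: "openin X U \<Longrightarrow> s \<in> carrier (sec F U) \<Longrightarrow> res F U U s = s"
begin

lemma sec_group: "openin X U \<Longrightarrow> group (sec F U)"
  using sec_comm_group by (simp add: comm_group.axioms)

lemma rval_closed:
  assumes "open_cover X \<U>" "c \<in> cochains F \<U> n" "f \<in> simplices \<U> n" "openin X S" "S \<subseteq> \<Inter>(set f)"
  shows "rval F c f S \<in> carrier (sec F S)"
  unfolding rval_def
  by (rule hom_in_carrier[OF res_hom]) (use assms openin_simplex[OF assms(1,3)] in \<open>auto simp: cochains_def PiE_iff\<close>)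

lemma res_rval:
  assumes "open_cover X \<U>" "c \<in> cochains F \<U> n" "f \<in> simplices \<U> n" "openin X T" "T \<subseteq> \<Inter>(set f)"
    "openin X S" "S \<subseteq> T"
  shows "res F T S (rval F c f T) = rval F c f S"
  unfolding rval_def
  by (rule res_res) (use assms openin_simplex[OF assms(1,3)] in \<open>auto simp: cochains_def PiE_iff\<close>)

lemma rval_self:
  assumes "open_cover X \<U>" "c \<in> cochains F \<U> n" "f \<in> simplices \<U> n"
  shows "rval F c f (\<Inter>(set f)) = c f"
  unfolding rval_def
  by (rule res_id) (use assms openin_simplex[OF assms(1,3)] in \<open>auto simp: cochains_def PiE_iff\<close>)

lemma cochain_comm_group:
  assumes "open_cover X \<U>" shows "comm_group (cochain_group F \<U> n)"
  unfolding cochain_group_def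
  by (rule comm_group_product_group) (rule sec_comm_group[OF openin_simplex[OF assms]])

lemmas cochain_group_group = comm_group.axioms(2)[OF cochain_comm_group]

lemma rval_mult:
  assumes "open_cover X \<U>" "c \<in> cochains F \<U> n" "d \<in> cochains F \<U> n" "f \<in> simplices \<U> n"
    "openin X S" "S \<subseteq> \<Inter>(set f)"
  shows "rval F (cmult F \<U> n c d) f S = rval F c f S \<otimes>\<^bsub>sec F S\<^esub> rval F d f S"
proof -
  have o: "openin X (\<Inter>(set f))" by (rule openin_simplex[OF assms(1,4)])
  have "c f \<in> carrier (sec F (\<Inter>(set f)))" "d f \<in> carrier (sec F (\<Inter>(set f)))"
    using assms by (auto simp: cochains_def PiE_iff)
  then show ?thesis using hom_mult[OF res_hom[OF o assms(5,6)]] assms(4) by (simp add: rval_def cmult_def)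
qed

lemma face_res_closed:
  assumes "open_cover X \<U>" "c \<in> cochains F \<U> n" "l \<in> simplices \<U> (Suc n)" "k \<le> Suc n"
  shows "face_res F c l k \<in> carrier (sec F (\<Inter>(set l)))"
  unfolding face_res_rval
  by (rule rval_closed[OF assms(1,2) face_in_simplices[OF assms(3,4)] openin_simplex[OF assms(1,3)] Inter_face_subset])

lemma cobdry_hom:
  assumes U: "open_cover X \<U>"
  shows "cobdry F \<U> n \<in> hom (cochain_group F \<U> n) (cochain_group F \<U> (Suc n))"
proof (rule homI, unfold carrier_cochain_group mult_cochain_group)
  have G: "comm_group (sec F (\<Inter>(set l)))" if "l \<in> simplices \<U> (Suc n)" for l
    using sec_comm_group openin_simplex[OF U that] by blast
  show "cobdry F \<U> n c \<in> cochains F \<U> (Suc n)" if c: "c \<in> cochains F \<U> n" for c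
    unfolding cochains_def cobdry_def
  proof (rule restrict_PiE_iff[THEN iffD2], rule ballI)
    fix l assume l: "l \<in> simplices \<U> (Suc n)"
    interpret comm_group "sec F (\<Inter>(set l))" by (rule G[OF l])
    show "finprod (sec F (\<Inter>(set l))) (\<lambda>k. if even k then face_res F c l k
        else inv\<^bsub>sec F (\<Inter>(set l))\<^esub> face_res F c l k) {..Suc n} \<in> carrier (sec F (\<Inter>(set l)))"
      using face_res_closed[OF U c l] by (intro finprod_closed) auto
  qed
  fix c d assume c: "c \<in> cochains F \<U> n" and d: "d \<in> cochains F \<U> n"
  show "cobdry F \<U> n (cmult F \<U> n c d) = cmult F \<U> (Suc n) (cobdry F \<U> n c) (cobdry F \<U> n d)"
    unfolding cobdry_def cmult_def[of F \<U> "Suc n"]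
  proof (rule restrict_ext)
    fix l assume l: "l \<in> simplices \<U> (Suc n)"
    interpret comm_group "sec F (\<Inter>(set l))" by (rule G[OF l])
    have "face_res F (cmult F \<U> n c d) l k = face_res F c l k \<otimes>\<^bsub>sec F (\<Inter>(set l))\<^esub> face_res F d l k"
      if "k \<le> Suc n" for k
      unfolding face_res_rval
      by (rule rval_mult[OF U c d face_in_simplices[OF l that] openin_simplex[OF U l] Inter_face_subset])
    then show "finprod (sec F (\<Inter>(set l))) (\<lambda>k. if even k then face_res F (cmult F \<U> n c d) l k
           else inv\<^bsub>sec F (\<Inter>(set l))\<^esub> face_res F (cmult F \<U> n c d) l k) {..Suc n} =
        (\<lambda>l\<in>simplices \<U> (Suc n). finprod (sec F (\<Inter>(set l))) (\<lambda>k. if even k then face_res F c l k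
           else inv\<^bsub>sec F (\<Inter>(set l))\<^esub> face_res F c l k) {..Suc n}) l \<otimes>\<^bsub>sec F (\<Inter>(set l))\<^esub>
        (\<lambda>l\<in>simplices \<U> (Suc n). finprod (sec F (\<Inter>(set l))) (\<lambda>k. if even k then face_res F d l k
           else inv\<^bsub>sec F (\<Inter>(set l))\<^esub> face_res F d l k) {..Suc n}) l"
      unfolding restrict_apply'[OF l]
      by (intro finprod_alternating_mult face_res_closed[OF U c l] face_res_closed[OF U d l])
  qed
qed

lemma pullback_hom:
  assumes U: "open_cover X \<U>" and W: "open_cover X \<W>" and r: "refinement \<rho> \<W> \<U>"
  shows "pullback F \<rho> \<W> n \<in> hom (cochain_group F \<U> n) (cochain_group F \<W> n)"
proof (rule homI, unfold carrier_cochain_group mult_cochain_group)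
  show "pullback F \<rho> \<W> n c \<in> cochains F \<W> n" if "c \<in> cochains F \<U> n" for c
    unfolding pullback_def cochains_def
    using rval_closed[OF U that map_in_simplices[OF r] openin_simplex[OF W] Inter_map_subset[OF r]]
    by (simp add: rval_def)
  fix c d assume "c \<in> cochains F \<U> n" "d \<in> cochains F \<U> n"
  then show "pullback F \<rho> \<W> n (cmult F \<U> n c d) = cmult F \<W> n (pullback F \<rho> \<W> n c) (pullback F \<rho> \<W> n d)"
    unfolding pullback_def cmult_def[of F \<W>]
    using rval_mult[OF U _ _ map_in_simplices[OF r] openin_simplex[OF W] Inter_map_subset[OF r]]
    by (simp add: rval_def cong: restrict_cong)
qed

lemma rval_pullback:
  assumes U: "open_cover X \<U>" and W: "open_cover X \<W>" and r: "refinement \<rho> \<W> \<U>"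
    and c: "c \<in> cochains F \<U> n" and f: "f \<in> simplices \<W> n" and S: "openin X S" "S \<subseteq> \<Inter>(set f)"
  shows "rval F (pullback F \<rho> \<W> n c) f S = rval F c (map \<rho> f) S"
  using res_rval[OF U c map_in_simplices[OF r f] openin_simplex[OF W f] Inter_map_subset[OF r f] S] f
  by (simp add: rval_def pullback_def)

lemma cobdry_pullback:
  assumes U: "open_cover X \<U>" and W: "open_cover X \<W>" and r: "refinement \<rho> \<W> \<U>"
    and c: "c \<in> cochains F \<U> n"
  shows "cobdry F \<W> n (pullback F \<rho> \<W> n c) = pullback F \<rho> \<W> (Suc n) (cobdry F \<U> n c)"
  unfolding pullback_def[of F \<rho> \<W> "Suc n"] cobdry_def
proof (rule restrict_ext)
  fix l assume l: "l \<in> simplices \<W> (Suc n)"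
  note l' = map_in_simplices[OF r l]
  note o = openin_simplex[OF W l] and o' = openin_simplex[OF U l']
  note sub = Inter_map_subset[OF r l]
  let ?h = "res F (\<Inter>(set (map \<rho> l))) (\<Inter>(set l))"
  have h: "?h \<in> hom (sec F (\<Inter>(set (map \<rho> l)))) (sec F (\<Inter>(set l)))" by (rule res_hom[OF o' o sub])
  interpret G: comm_group "sec F (\<Inter>(set (map \<rho> l)))" by (rule sec_comm_group[OF o'])
  interpret H: comm_group "sec F (\<Inter>(set l))" by (rule sec_comm_group[OF o])
  have fr: "face_res F (pullback F \<rho> \<W> n c) l k = ?h (face_res F c (map \<rho> l) k)" if k: "k \<le> Suc n" for k
  proof -
    have m: "map \<rho> (face k l) = face k (map \<rho> l)" by (simp add: take_map drop_map)
    have "face_res F (pullback F \<rho> \<W> n c) l k = rval F c (face k (map \<rho> l)) (\<Inter>(set l))"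
      unfolding face_res_rval
      using rval_pullback[OF U W r c face_in_simplices[OF l k] o Inter_face_subset] m by simp
    also have "\<dots> = ?h (rval F c (face k (map \<rho> l)) (\<Inter>(set (map \<rho> l))))"
      by (rule res_rval[OF U c face_in_simplices[OF l' k] o' Inter_face_subset o sub, symmetric])
    finally show ?thesis by (simp add: face_res_rval)
  qed
  have cl: "face_res F c (map \<rho> l) k \<in> carrier (sec F (\<Inter>(set (map \<rho> l))))" if "k \<le> Suc n" for k
    by (rule face_res_closed[OF U c l' that])
  have "?h (finprod (sec F (\<Inter>(set (map \<rho> l)))) (\<lambda>k. if even k then face_res F c (map \<rho> l) k
           else inv\<^bsub>sec F (\<Inter>(set (map \<rho> l)))\<^esub> face_res F c (map \<rho> l) k) {..Suc n}) =
     finprod (sec F (\<Inter>(set l))) (\<lambda>k. ?h (if even k then face_res F c (map \<rho> l) k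
           else inv\<^bsub>sec F (\<Inter>(set (map \<rho> l)))\<^esub> face_res F c (map \<rho> l) k)) {..Suc n}"
    using cl by (intro hom_finprod[OF G.comm_group_axioms H.comm_group_axioms h])
      (auto intro!: G.inv_closed simp del: set_map)
  also have "\<dots> = finprod (sec F (\<Inter>(set l))) (\<lambda>k. if even k then face_res F (pullback F \<rho> \<W> n c) l k
           else inv\<^bsub>sec F (\<Inter>(set l))\<^esub> face_res F (pullback F \<rho> \<W> n c) l k) {..Suc n}"
    using cl fr hom_in_carrier[OF h] hom_m_inv[OF G.group_axioms H.group_axioms h]
    by (intro H.finprod_cong') auto
  finally show "finprod (sec F (\<Inter>(set l))) (\<lambda>k. if even k then face_res F (pullback F \<rho> \<W> n c) l k
           else inv\<^bsub>sec F (\<Inter>(set l))\<^esub> face_res F (pullback F \<rho> \<W> n c) l k) {..Suc n} =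
     ?h ((\<lambda>l\<in>simplices \<U> (Suc n). finprod (sec F (\<Inter>(set l))) (\<lambda>k. if even k then face_res F c l k
           else inv\<^bsub>sec F (\<Inter>(set l))\<^esub> face_res F c l k) {..Suc n}) (map \<rho> l))"
    using l' by simp
qed

lemma rval_cobdry_0:
  assumes U: "open_cover X \<U>" and c: "c \<in> cochains F \<U> 0" and A: "A \<in> \<U>" "B \<in> \<U>"
    and S: "openin X S" "S \<subseteq> A" "S \<subseteq> B"
  shows "rval F (cobdry F \<U> 0 c) [A, B] S = inv\<^bsub>sec F S\<^esub> rval F c [A] S \<otimes>\<^bsub>sec F S\<^esub> rval F c [B] S"
proof -
  have l: "[A, B] \<in> simplices \<U> (Suc 0)" and fs: "[A] \<in> simplices \<U> 0" "[B] \<in> simplices \<U> 0"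
    using A by (auto simp: simplices_def)
  let ?T = "\<Inter>(set [A, B])"
  have o: "openin X ?T" by (rule openin_simplex[OF U l])
  have sub: "S \<subseteq> ?T" "?T \<subseteq> \<Inter>(set [A])" "?T \<subseteq> \<Inter>(set [B])" using S by auto
  interpret T: comm_group "sec F ?T" by (rule sec_comm_group[OF o])
  interpret S: comm_group "sec F S" by (rule sec_comm_group[OF S(1)])
  have cl: "rval F c [A] ?T \<in> carrier (sec F ?T)" "rval F c [B] ?T \<in> carrier (sec F ?T)"
    using rval_closed[OF U c fs(1) o sub(2)] rval_closed[OF U c fs(2) o sub(3)] by auto
  note h = res_hom[OF o S(1) sub(1)]
  have "cobdry F \<U> 0 c [A, B] = inv\<^bsub>sec F ?T\<^esub> rval F c [A] ?T \<otimes>\<^bsub>sec F ?T\<^esub> rval F c [B] ?T"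
    using cl unfolding cobdry_def restrict_apply'[OF l]
    by (subst T.finprod_alternating_2) (simp_all add: face_res_rval del: set_simps)
  then have "rval F (cobdry F \<U> 0 c) [A, B] S =
     res F ?T S (inv\<^bsub>sec F ?T\<^esub> rval F c [A] ?T \<otimes>\<^bsub>sec F ?T\<^esub> rval F c [B] ?T)"
    unfolding rval_def by (simp only:)
  also have "\<dots> = inv\<^bsub>sec F S\<^esub> res F ?T S (rval F c [A] ?T) \<otimes>\<^bsub>sec F S\<^esub> res F ?T S (rval F c [B] ?T)"
    using cl by (simp only: hom_mult[OF h] hom_m_inv[OF T.group_axioms S.group_axioms h] T.inv_closed)
  finally show ?thesis
    by (simp only: res_rval[OF U c fs(1) o sub(2) S(1) sub(1)] res_rval[OF U c fs(2) o sub(3) S(1) sub(1)])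
qed

lemma rval_cobdry_1:
  assumes U: "open_cover X \<U>" and c: "c \<in> cochains F \<U> 1" and A: "A \<in> \<U>" "B \<in> \<U>" "C \<in> \<U>"
    and S: "openin X S" "S \<subseteq> A" "S \<subseteq> B" "S \<subseteq> C"
  shows "rval F (cobdry F \<U> 1 c) [A, B, C] S =
    rval F c [A, B] S \<otimes>\<^bsub>sec F S\<^esub> (inv\<^bsub>sec F S\<^esub> rval F c [A, C] S \<otimes>\<^bsub>sec F S\<^esub> rval F c [B, C] S)"
proof -
  have l: "[A, B, C] \<in> simplices \<U> (Suc 1)" using A by (auto simp: simplices_def)
  have fs: "[A, B] \<in> simplices \<U> 1" "[A, C] \<in> simplices \<U> 1" "[B, C] \<in> simplices \<U> 1"
    using A by (auto simp: simplices_def)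
  let ?T = "\<Inter>(set [A, B, C])"
  have o: "openin X ?T" by (rule openin_simplex[OF U l])
  have sub: "S \<subseteq> ?T" "?T \<subseteq> \<Inter>(set [A, B])" "?T \<subseteq> \<Inter>(set [A, C])" "?T \<subseteq> \<Inter>(set [B, C])"
    using S by auto
  interpret T: comm_group "sec F ?T" by (rule sec_comm_group[OF o])
  interpret S: comm_group "sec F S" by (rule sec_comm_group[OF S(1)])
  have cl: "rval F c [A, B] ?T \<in> carrier (sec F ?T)" "rval F c [A, C] ?T \<in> carrier (sec F ?T)"
      "rval F c [B, C] ?T \<in> carrier (sec F ?T)"
    using rval_closed[OF U c fs(1) o sub(2)] rval_closed[OF U c fs(2) o sub(3)]
      rval_closed[OF U c fs(3) o sub(4)] by auto
  note h = res_hom[OF o S(1) sub(1)]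
  have "cobdry F \<U> 1 c [A, B, C] =
     rval F c [A, B] ?T \<otimes>\<^bsub>sec F ?T\<^esub> (inv\<^bsub>sec F ?T\<^esub> rval F c [A, C] ?T \<otimes>\<^bsub>sec F ?T\<^esub> rval F c [B, C] ?T)"
    using cl unfolding cobdry_def restrict_apply'[OF l]
    by (subst T.finprod_alternating_3) (simp_all add: face_res_rval del: set_simps)
  then have "rval F (cobdry F \<U> 1 c) [A, B, C] S = res F ?T S
     (rval F c [A, B] ?T \<otimes>\<^bsub>sec F ?T\<^esub> (inv\<^bsub>sec F ?T\<^esub> rval F c [A, C] ?T \<otimes>\<^bsub>sec F ?T\<^esub> rval F c [B, C] ?T))"
    unfolding rval_def by (simp only:)
  also have "\<dots> = res F ?T S (rval F c [A, B] ?T) \<otimes>\<^bsub>sec F S\<^esub>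
     (inv\<^bsub>sec F S\<^esub> res F ?T S (rval F c [A, C] ?T) \<otimes>\<^bsub>sec F S\<^esub> res F ?T S (rval F c [B, C] ?T))"
    using cl by (simp only: hom_mult[OF h] hom_m_inv[OF T.group_axioms S.group_axioms h] T.inv_closed T.m_closed)
  finally show ?thesis
    by (simp only: res_rval[OF U c fs(1) o sub(2) S(1) sub(1)] res_rval[OF U c fs(2) o sub(3) S(1) sub(1)]
      res_rval[OF U c fs(3) o sub(4) S(1) sub(1)])
qed

lemma rval_cobdry_2:
  assumes U: "open_cover X \<U>" and c: "c \<in> cochains F \<U> 2" and A: "A \<in> \<U>" "B \<in> \<U>" "C \<in> \<U>" "D \<in> \<U>"
    and S: "openin X S" "S \<subseteq> A" "S \<subseteq> B" "S \<subseteq> C" "S \<subseteq> D"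
  shows "rval F (cobdry F \<U> 2 c) [A, B, C, D] S =
    inv\<^bsub>sec F S\<^esub> rval F c [A, B, C] S \<otimes>\<^bsub>sec F S\<^esub> (rval F c [A, B, D] S \<otimes>\<^bsub>sec F S\<^esub>
      (inv\<^bsub>sec F S\<^esub> rval F c [A, C, D] S \<otimes>\<^bsub>sec F S\<^esub> rval F c [B, C, D] S))"
proof -
  have l: "[A, B, C, D] \<in> simplices \<U> (Suc 2)" using A by (auto simp: simplices_def)
  have fs: "[A, B, C] \<in> simplices \<U> 2" "[A, B, D] \<in> simplices \<U> 2" "[A, C, D] \<in> simplices \<U> 2"
      "[B, C, D] \<in> simplices \<U> 2"
    using A by (auto simp: simplices_def)
  let ?T = "\<Inter>(set [A, B, C, D])"
  have o: "openin X ?T" by (rule openin_simplex[OF U l])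
  have sub: "S \<subseteq> ?T" "?T \<subseteq> \<Inter>(set [A, B, C])" "?T \<subseteq> \<Inter>(set [A, B, D])" "?T \<subseteq> \<Inter>(set [A, C, D])"
      "?T \<subseteq> \<Inter>(set [B, C, D])"
    using S by auto
  interpret T: comm_group "sec F ?T" by (rule sec_comm_group[OF o])
  interpret S: comm_group "sec F S" by (rule sec_comm_group[OF S(1)])
  have cl: "rval F c [A, B, C] ?T \<in> carrier (sec F ?T)" "rval F c [A, B, D] ?T \<in> carrier (sec F ?T)"
      "rval F c [A, C, D] ?T \<in> carrier (sec F ?T)" "rval F c [B, C, D] ?T \<in> carrier (sec F ?T)"
    using rval_closed[OF U c fs(1) o sub(2)] rval_closed[OF U c fs(2) o sub(3)]
      rval_closed[OF U c fs(3) o sub(4)] rval_closed[OF U c fs(4) o sub(5)] by auto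
  note h = res_hom[OF o S(1) sub(1)]
  have "cobdry F \<U> 2 c [A, B, C, D] =
     inv\<^bsub>sec F ?T\<^esub> rval F c [A, B, C] ?T \<otimes>\<^bsub>sec F ?T\<^esub> (rval F c [A, B, D] ?T \<otimes>\<^bsub>sec F ?T\<^esub>
     (inv\<^bsub>sec F ?T\<^esub> rval F c [A, C, D] ?T \<otimes>\<^bsub>sec F ?T\<^esub> rval F c [B, C, D] ?T))"
    using cl unfolding cobdry_def restrict_apply'[OF l]
    by (subst T.finprod_alternating_4) (simp_all add: face_res_rval del: set_simps)
  then have "rval F (cobdry F \<U> 2 c) [A, B, C, D] S = res F ?T S
     (inv\<^bsub>sec F ?T\<^esub> rval F c [A, B, C] ?T \<otimes>\<^bsub>sec F ?T\<^esub> (rval F c [A, B, D] ?T \<otimes>\<^bsub>sec F ?T\<^esub>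
     (inv\<^bsub>sec F ?T\<^esub> rval F c [A, C, D] ?T \<otimes>\<^bsub>sec F ?T\<^esub> rval F c [B, C, D] ?T)))"
    unfolding rval_def by (simp only:)
  also have "\<dots> = inv\<^bsub>sec F S\<^esub> res F ?T S (rval F c [A, B, C] ?T) \<otimes>\<^bsub>sec F S\<^esub>
     (res F ?T S (rval F c [A, B, D] ?T) \<otimes>\<^bsub>sec F S\<^esub>
     (inv\<^bsub>sec F S\<^esub> res F ?T S (rval F c [A, C, D] ?T) \<otimes>\<^bsub>sec F S\<^esub> res F ?T S (rval F c [B, C, D] ?T)))"
    using cl by (simp only: hom_mult[OF h] hom_m_inv[OF T.group_axioms S.group_axioms h] T.inv_closed T.m_closed)
  finally show ?thesis
    by (simp only: res_rval[OF U c fs(1) o sub(2) S(1) sub(1)] res_rval[OF U c fs(2) o sub(3) S(1) sub(1)]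
      res_rval[OF U c fs(3) o sub(4) S(1) sub(1)] res_rval[OF U c fs(4) o sub(5) S(1) sub(1)])
qed

end

section \<open>Cech cocycles and coboundaries in low degrees\<close>

text \<open>The square of the coboundary on a triangle, for the values \<open>a\<close>, \<open>b\<close>, \<open>c\<close> at its vertices.\<close>

lemma (in comm_group) d_d_identity_2:
  assumes "a \<in> carrier G" "b \<in> carrier G" "c \<in> carrier G"
  shows "(inv a \<otimes> b) \<otimes> (inv (inv a \<otimes> c) \<otimes> (inv b \<otimes> c)) = \<one>"
proof -
  have "inv (inv a \<otimes> c) = a \<otimes> inv c" using assms by (simp add: inv_mult)
  then have "(inv a \<otimes> b) \<otimes> (inv (inv a \<otimes> c) \<otimes> (inv b \<otimes> c)) = (inv a \<otimes> a) \<otimes> ((b \<otimes> inv b) \<otimes> (inv c \<otimes> c))"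
    using assms by (simp only: m_ac inv_closed m_closed)
  then show ?thesis using assms by simp
qed

text \<open>The square of the coboundary on a tetrahedron, for the values on the edges \<open>AB\<close>, \<open>AC\<close>, \<open>AD\<close>,
  \<open>BC\<close>, \<open>BD\<close>, \<open>CD\<close>.\<close>

lemma (in comm_group) d_d_identity_3:
  assumes "a \<in> carrier G" "b \<in> carrier G" "c \<in> carrier G" "d \<in> carrier G" "e \<in> carrier G" "f \<in> carrier G"
  shows "inv (a \<otimes> (inv b \<otimes> d)) \<otimes> ((a \<otimes> (inv c \<otimes> e)) \<otimes> (inv (b \<otimes> (inv c \<otimes> f)) \<otimes> (d \<otimes> (inv e \<otimes> f)))) = \<one>"
proof -
  have 1: "inv (a \<otimes> (inv b \<otimes> d)) = inv a \<otimes> (b \<otimes> inv d)" "inv (b \<otimes> (inv c \<otimes> f)) = inv b \<otimes> (c \<otimes> inv f)"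
    using assms by (simp_all add: inv_mult)
  have "inv (a \<otimes> (inv b \<otimes> d)) \<otimes> ((a \<otimes> (inv c \<otimes> e)) \<otimes> (inv (b \<otimes> (inv c \<otimes> f)) \<otimes> (d \<otimes> (inv e \<otimes> f)))) =
     (inv a \<otimes> a) \<otimes> ((inv b \<otimes> b) \<otimes> ((inv c \<otimes> c) \<otimes> ((inv d \<otimes> d) \<otimes> ((inv e \<otimes> e) \<otimes> (inv f \<otimes> f)))))"
    using assms unfolding 1 by (simp only: m_ac inv_closed m_closed)
  then show ?thesis using assms by simp
qed

text \<open>A prism is cut into three tetrahedra. The last three hypotheses are the cocycle relations on
  these, \<open>p\<close> and \<open>q\<close> being the values at the two ends of the prism.\<close>

lemma (in comm_group) prism_identity:
  assumes "p \<in> carrier G" "u \<in> carrier G" "w \<in> carrier G" "h1 \<in> carrier G" "m \<in> carrier G" "t \<in> carrier G"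
    "h2 \<in> carrier G" "k \<in> carrier G" "s \<in> carrier G" "q \<in> carrier G"
    and "p \<otimes> u = w \<otimes> h1" "m \<otimes> t = w \<otimes> h2" "k \<otimes> t = s \<otimes> q"
  shows "p = q \<otimes> ((h1 \<otimes> inv h2) \<otimes> (inv (u \<otimes> inv s) \<otimes> (m \<otimes> inv k)))"
proof -
  have p: "p = (w \<otimes> h1) \<otimes> inv u" using assms by (metis inv_solve_right m_closed)
  have w: "w = (m \<otimes> t) \<otimes> inv h2" using assms by (metis inv_solve_right m_closed)
  have "t \<otimes> k = s \<otimes> q" using assms by (simp add: m_comm)
  then have t: "t = (s \<otimes> q) \<otimes> inv k" using assms by (metis inv_solve_right m_closed)
  have 1: "inv (u \<otimes> inv s) = inv u \<otimes> s" using assms by (simp add: inv_mult)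
  have "p = (((m \<otimes> ((s \<otimes> q) \<otimes> inv k)) \<otimes> inv h2) \<otimes> h1) \<otimes> inv u"
    using p[unfolded w] t by simp
  also have "\<dots> = q \<otimes> ((h1 \<otimes> inv h2) \<otimes> ((inv u \<otimes> s) \<otimes> (m \<otimes> inv k)))"
    using assms(1-10) by (simp only: m_ac inv_closed m_closed)
  finally show ?thesis unfolding 1 .
qed

lemma simplices_0_cases:
  assumes "l \<in> simplices \<U> 0" obtains A where "l = [A]" "A \<in> \<U>"
  using assms by (auto simp: simplices_def length_Suc_conv)

lemma simplices_1_cases:
  assumes "l \<in> simplices \<U> 1" obtains A B where "l = [A, B]" "A \<in> \<U>" "B \<in> \<U>"
  using assms by (auto simp: simplices_def length_Suc_conv)

lemma simplices_2_cases:
  assumes "l \<in> simplices \<U> 2" obtains A B C where "l = [A, B, C]" "A \<in> \<U>" "B \<in> \<U>" "C \<in> \<U>"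
  using assms by (auto simp: simplices_def length_Suc_conv numeral_2_eq_2)

lemma simplices_3_cases:
  assumes "l \<in> simplices \<U> 3"
  obtains A B C D where "l = [A, B, C, D]" "A \<in> \<U>" "B \<in> \<U>" "C \<in> \<U>" "D \<in> \<U>"
  using assms by (auto simp: simplices_def length_Suc_conv numeral_3_eq_3)

definition cohomologous :: "('a, 'g) gsheaf \<Rightarrow> nat \<Rightarrow> 'a set set \<Rightarrow> ('a, 'g) cochain \<Rightarrow> ('a, 'g) cochain \<Rightarrow> bool" where
  "cohomologous F n \<W> c d \<longleftrightarrow> (\<exists>b\<in>coboundaries F \<W> n. c = cmult F \<W> n d b)"

context ab_presheaf
begin

lemma cobdry_closed:
  "open_cover X \<U> \<Longrightarrow> c \<in> cochains F \<U> n \<Longrightarrow> cobdry F \<U> n c \<in> cochains F \<U> (Suc n)"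
  using hom_in_carrier[OF cobdry_hom] by (simp add: carrier_cochain_group)

lemma pullback_closed:
  "open_cover X \<U> \<Longrightarrow> open_cover X \<W> \<Longrightarrow> refinement \<rho> \<W> \<U> \<Longrightarrow> c \<in> cochains F \<U> n \<Longrightarrow>
   pullback F \<rho> \<W> n c \<in> cochains F \<W> n"
  using hom_in_carrier[OF pullback_hom] by (simp add: carrier_cochain_group)

lemma cochain_eqI:
  assumes "open_cover X \<U>" "c \<in> cochains F \<U> n" "d \<in> cochains F \<U> n"
    "\<And>l. l \<in> simplices \<U> n \<Longrightarrow> rval F c l (\<Inter>(set l)) = rval F d l (\<Inter>(set l))"
  shows "c = d"
proof (rule ext)
  fix l show "c l = d l"
  proof (cases "l \<in> simplices \<U> n")
    case True
    then show ?thesis using assms(4)[OF True] rval_self[OF assms(1,2) True] rval_self[OF assms(1,3) True] by simp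
  next
    case False
    then show ?thesis using assms(2,3) by (auto simp: cochains_def PiE_def extensional_def)
  qed
qed

lemma cone_closed: "open_cover X \<U> \<Longrightarrow> cone F \<U> n \<in> cochains F \<U> n"
  using monoid.one_closed[OF group.is_monoid[OF cochain_group_group]]
  by (metis one_cochain_group carrier_cochain_group)

lemma rval_cone:
  assumes "open_cover X \<U>" "f \<in> simplices \<U> n" "openin X S" "S \<subseteq> \<Inter>(set f)"
  shows "rval F (cone F \<U> n) f S = \<one>\<^bsub>sec F S\<^esub>"
  using hom_one[OF res_hom[OF openin_simplex[OF assms(1,2)] assms(3,4)]]
    sec_group[OF openin_simplex[OF assms(1,2)]] sec_group[OF assms(3)] assms(2)
  by (simp add: rval_def cone_def)

lemma cobdry_cobdry_0:
  assumes U: "open_cover X \<U>" and c: "c \<in> cochains F \<U> 0"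
  shows "cobdry F \<U> 1 (cobdry F \<U> 0 c) = cone F \<U> 2"
proof (rule cochain_eqI[OF U])
  have c1: "cobdry F \<U> 0 c \<in> cochains F \<U> 1" using cobdry_closed[OF U c] by simp
  show "cobdry F \<U> 1 (cobdry F \<U> 0 c) \<in> cochains F \<U> 2" "cone F \<U> 2 \<in> cochains F \<U> 2"
    using cobdry_closed[OF U c1] cone_closed[OF U] by (simp_all add: numeral_2_eq_2)
  fix l assume l: "l \<in> simplices \<U> 2"
  then obtain A B C where l': "l = [A, B, C]" "A \<in> \<U>" "B \<in> \<U>" "C \<in> \<U>" by (rule simplices_2_cases)
  let ?S = "\<Inter>(set l)"
  have S: "openin X ?S" "?S \<subseteq> A" "?S \<subseteq> B" "?S \<subseteq> C"
    using openin_simplex[OF U l] l' by auto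
  interpret comm_group "sec F ?S" by (rule sec_comm_group[OF S(1)])
  have v: "rval F c [E] ?S \<in> carrier (sec F ?S)" if "E \<in> {A, B, C}" for E
    by (rule rval_closed[OF U c _ S(1)]) (use that l' S in \<open>auto simp: simplices_def\<close>)
  have "rval F (cobdry F \<U> 1 (cobdry F \<U> 0 c)) [A, B, C] ?S = \<one>\<^bsub>sec F ?S\<^esub>"
    unfolding rval_cobdry_1[OF U c1 l'(2-4) S] rval_cobdry_0[OF U c l'(2,3) S(1-3)]
      rval_cobdry_0[OF U c l'(2,4) S(1,2,4)] rval_cobdry_0[OF U c l'(3,4) S(1,3,4)]
    by (rule d_d_identity_2; rule v; simp)
  then show "rval F (cobdry F \<U> 1 (cobdry F \<U> 0 c)) l ?S = rval F (cone F \<U> 2) l ?S"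
    unfolding rval_cone[OF U l S(1) subset_refl] by (simp only: l'(1))
qed

lemma rval_cobdry_cobdry_1:
  assumes U: "open_cover X \<U>" and c: "c \<in> cochains F \<U> 1" and A: "A \<in> \<U>" "B \<in> \<U>" "C \<in> \<U>" "D \<in> \<U>"
    and S: "openin X S" "S \<subseteq> A" "S \<subseteq> B" "S \<subseteq> C" "S \<subseteq> D"
  shows "rval F (cobdry F \<U> 2 (cobdry F \<U> 1 c)) [A, B, C, D] S = \<one>\<^bsub>sec F S\<^esub>"
proof -
  interpret comm_group "sec F S" by (rule sec_comm_group[OF S(1)])
  have c1: "cobdry F \<U> 1 c \<in> cochains F \<U> 2" using cobdry_closed[OF U c] by (simp add: numeral_2_eq_2)
  have v: "rval F c [E, E'] S \<in> carrier (sec F S)" if "E \<in> \<U>" "E' \<in> \<U>" "S \<subseteq> E" "S \<subseteq> E'" for E E'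
    by (rule rval_closed[OF U c _ S(1)]) (use that in \<open>auto simp: simplices_def\<close>)
  note v = v[OF A(1,2) S(2,3)] v[OF A(1,3) S(2,4)] v[OF A(1,4) S(2,5)]
    v[OF A(2,3) S(3,4)] v[OF A(2,4) S(3,5)] v[OF A(3,4) S(4,5)]
  show ?thesis
    unfolding rval_cobdry_2[OF U c1 A S] rval_cobdry_1[OF U c A(1,2,3) S(1-4)]
      rval_cobdry_1[OF U c A(1,2,4) S(1,2,3,5)] rval_cobdry_1[OF U c A(1,3,4) S(1,2,4,5)]
      rval_cobdry_1[OF U c A(2,3,4) S(1,3,4,5)]
    by (rule d_d_identity_3[OF v])
qed

lemma cobdry_cobdry_1:
  assumes U: "open_cover X \<U>" and c: "c \<in> cochains F \<U> 1"
  shows "cobdry F \<U> 2 (cobdry F \<U> 1 c) = cone F \<U> 3"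
proof (rule cochain_eqI[OF U])
  have c1: "cobdry F \<U> 1 c \<in> cochains F \<U> 2" using cobdry_closed[OF U c] by (simp add: numeral_2_eq_2)
  show "cobdry F \<U> 2 (cobdry F \<U> 1 c) \<in> cochains F \<U> 3"
    using cobdry_closed[OF U c1] by (simp add: eval_nat_numeral)
  show "cone F \<U> 3 \<in> cochains F \<U> 3" by (rule cone_closed[OF U])
  fix l assume l: "l \<in> simplices \<U> 3"
  then obtain A B C D where l': "l = [A, B, C, D]" "A \<in> \<U>" "B \<in> \<U>" "C \<in> \<U>" "D \<in> \<U>"
    by (rule simplices_3_cases)
  have S: "openin X (\<Inter>(set l))" "\<Inter>(set l) \<subseteq> A" "\<Inter>(set l) \<subseteq> B" "\<Inter>(set l) \<subseteq> C" "\<Inter>(set l) \<subseteq> D"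
    using openin_simplex[OF U l] l' by auto
  show "rval F (cobdry F \<U> 2 (cobdry F \<U> 1 c)) l (\<Inter>(set l)) = rval F (cone F \<U> 3) l (\<Inter>(set l))"
    using rval_cone[OF U l S(1) subset_refl] rval_cobdry_cobdry_1[OF U c l'(2-5) S] by (simp only: l'(1))
qed

lemma subgroup_coboundaries:
  assumes U: "open_cover X \<U>"
  shows "subgroup (coboundaries F \<U> n) (cochain_group F \<U> n)"
proof (cases n)
  case 0
  then show ?thesis using group.triv_subgroup[OF cochain_group_group[OF U]]
    by (simp add: coboundaries_def one_cochain_group)
next
  case (Suc m)
  interpret group_hom "cochain_group F \<U> m" "cochain_group F \<U> (Suc m)" "cobdry F \<U> m"
    using cochain_group_group[OF U] cobdry_hom[OF U] by (simp add: group_hom_def group_hom_axioms_def)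
  show ?thesis using img_is_subgroup by (simp add: coboundaries_def Suc carrier_cochain_group)
qed

lemma pullback_coboundaries:
  assumes U: "open_cover X \<U>" and W: "open_cover X \<W>" and r: "refinement \<rho> \<W> \<U>"
    and b: "b \<in> coboundaries F \<U> n"
  shows "pullback F \<rho> \<W> n b \<in> coboundaries F \<W> n"
proof (cases n)
  case 0
  then show ?thesis
    using b hom_one[OF pullback_hom[OF U W r, of 0]] cochain_group_group[OF U] cochain_group_group[OF W]
    by (simp add: coboundaries_def one_cochain_group)
next
  case (Suc m)
  then obtain e where e: "e \<in> cochains F \<U> m" "b = cobdry F \<U> m e" using b by (auto simp: coboundaries_def)
  have "pullback F \<rho> \<W> n b = cobdry F \<W> m (pullback F \<rho> \<W> m e)"
    using cobdry_pullback[OF U W r e(1)] e(2) Suc by simp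
  then show ?thesis unfolding Suc coboundaries_def using pullback_closed[OF U W r e(1)] by auto
qed

lemma subgroup_cocycles:
  assumes U: "open_cover X \<U>"
  shows "subgroup (cocycles F \<U> n) (cochain_group F \<U> n)"
proof -
  interpret group_hom "cochain_group F \<U> n" "cochain_group F \<U> (Suc n)" "cobdry F \<U> n"
    using cochain_group_group[OF U] cobdry_hom[OF U] by (simp add: group_hom_def group_hom_axioms_def)
  show ?thesis using subgroup_kernel
    by (simp add: cocycles_def kernel_def carrier_cochain_group one_cochain_group)
qed

lemma pullback_cocycles:
  assumes U: "open_cover X \<U>" and W: "open_cover X \<W>" and r: "refinement \<rho> \<W> \<U>"
    and c: "c \<in> cocycles F \<U> n"
  shows "pullback F \<rho> \<W> n c \<in> cocycles F \<W> n"
  using c cobdry_pullback[OF U W r] pullback_closed[OF U W r]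
    hom_one[OF pullback_hom[OF U W r, of "Suc n"]] cochain_group_group[OF U] cochain_group_group[OF W]
  by (simp add: cocycles_def one_cochain_group)

lemma pullback_pullback:
  assumes U: "open_cover X \<U>" and W: "open_cover X \<W>" and V: "open_cover X \<V>"
    and r: "refinement \<rho> \<W> \<U>" and s: "refinement \<sigma> \<V> \<W>" and c: "c \<in> cochains F \<U> n"
  shows "pullback F \<sigma> \<V> n (pullback F \<rho> \<W> n c) = pullback F (\<rho> \<circ> \<sigma>) \<V> n c"
proof (rule cochain_eqI[OF V])
  note rs = refinement_comp[OF s r]
  note p = pullback_closed[OF U W r c]
  show "pullback F \<sigma> \<V> n (pullback F \<rho> \<W> n c) \<in> cochains F \<V> n"
    "pullback F (\<rho> \<circ> \<sigma>) \<V> n c \<in> cochains F \<V> n"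
    by (rule pullback_closed[OF W V s p] pullback_closed[OF U V rs c])+
  fix l assume l: "l \<in> simplices \<V> n"
  note o = openin_simplex[OF V l]
  have "rval F (pullback F \<sigma> \<V> n (pullback F \<rho> \<W> n c)) l (\<Inter>(set l)) = rval F (pullback F \<rho> \<W> n c) (map \<sigma> l) (\<Inter>(set l))"
    by (rule rval_pullback[OF W V s p l o subset_refl])
  also have "\<dots> = rval F c (map \<rho> (map \<sigma> l)) (\<Inter>(set l))"
    by (rule rval_pullback[OF U W r c map_in_simplices[OF s l] o Inter_map_subset[OF s l]])
  also have "\<dots> = rval F (pullback F (\<rho> \<circ> \<sigma>) \<V> n c) l (\<Inter>(set l))"
    using rval_pullback[OF U V rs c l o subset_refl] by simp
  finally show "rval F (pullback F \<sigma> \<V> n (pullback F \<rho> \<W> n c)) l (\<Inter>(set l)) =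
    rval F (pullback F (\<rho> \<circ> \<sigma>) \<V> n c) l (\<Inter>(set l))" .
qed

lemma cohomologous_iff:
  assumes U: "open_cover X \<U>" and c: "c \<in> cochains F \<U> n" and d: "d \<in> cochains F \<U> n"
  shows "cohomologous F n \<U> c d \<longleftrightarrow>
    inv\<^bsub>cochain_group F \<U> n\<^esub> d \<otimes>\<^bsub>cochain_group F \<U> n\<^esub> c \<in> coboundaries F \<U> n"
proof -
  interpret G: comm_group "cochain_group F \<U> n" by (rule cochain_comm_group[OF U])
  interpret B: subgroup "coboundaries F \<U> n" "cochain_group F \<U> n" by (rule subgroup_coboundaries[OF U])
  note cd = c[folded carrier_cochain_group] d[folded carrier_cochain_group]
  have "c = d \<otimes>\<^bsub>cochain_group F \<U> n\<^esub> b \<longleftrightarrow> b = inv\<^bsub>cochain_group F \<U> n\<^esub> d \<otimes>\<^bsub>cochain_group F \<U> n\<^esub> c"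
    if "b \<in> coboundaries F \<U> n" for b
    using B.mem_carrier[OF that] by (metis G.inv_solve_left cd)
  then show ?thesis unfolding cohomologous_def mult_cochain_group[symmetric] by auto
qed

lemma cohomologous_refl:
  assumes U: "open_cover X \<U>" and c: "c \<in> cochains F \<U> n"
  shows "cohomologous F n \<U> c c"
proof -
  interpret G: comm_group "cochain_group F \<U> n" by (rule cochain_comm_group[OF U])
  interpret B: subgroup "coboundaries F \<U> n" "cochain_group F \<U> n" by (rule subgroup_coboundaries[OF U])
  show ?thesis using c B.one_closed unfolding cohomologous_iff[OF U c c]
    by (simp add: carrier_cochain_group[symmetric])
qed

lemma cohomologous_sym:
  assumes U: "open_cover X \<U>" and c: "c \<in> cochains F \<U> n" and d: "d \<in> cochains F \<U> n"
    and "cohomologous F n \<U> c d"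
  shows "cohomologous F n \<U> d c"
proof -
  interpret G: comm_group "cochain_group F \<U> n" by (rule cochain_comm_group[OF U])
  interpret B: subgroup "coboundaries F \<U> n" "cochain_group F \<U> n" by (rule subgroup_coboundaries[OF U])
  note [simp] = c[folded carrier_cochain_group] d[folded carrier_cochain_group]
  have "inv\<^bsub>cochain_group F \<U> n\<^esub> c \<otimes>\<^bsub>cochain_group F \<U> n\<^esub> d =
      inv\<^bsub>cochain_group F \<U> n\<^esub> (inv\<^bsub>cochain_group F \<U> n\<^esub> d \<otimes>\<^bsub>cochain_group F \<U> n\<^esub> c)"
    by (simp add: G.inv_mult_group)
  then show ?thesis using assms(4) B.m_inv_closed unfolding cohomologous_iff[OF U c d] cohomologous_iff[OF U d c]
    by simp
qed

lemma cohomologous_trans: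
  assumes U: "open_cover X \<U>" and c: "c \<in> cochains F \<U> n" and d: "d \<in> cochains F \<U> n" and e: "e \<in> cochains F \<U> n"
    and "cohomologous F n \<U> c d" "cohomologous F n \<U> d e"
  shows "cohomologous F n \<U> c e"
proof -
  interpret G: comm_group "cochain_group F \<U> n" by (rule cochain_comm_group[OF U])
  interpret B: subgroup "coboundaries F \<U> n" "cochain_group F \<U> n" by (rule subgroup_coboundaries[OF U])
  note [simp] = c[folded carrier_cochain_group] d[folded carrier_cochain_group] e[folded carrier_cochain_group]
  obtain b b' where b: "b \<in> coboundaries F \<U> n" "b' \<in> coboundaries F \<U> n"
      "c = d \<otimes>\<^bsub>cochain_group F \<U> n\<^esub> b" "d = e \<otimes>\<^bsub>cochain_group F \<U> n\<^esub> b'"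
    using assms(5,6) unfolding cohomologous_def mult_cochain_group[symmetric] by blast
  then have "c = e \<otimes>\<^bsub>cochain_group F \<U> n\<^esub> (b' \<otimes>\<^bsub>cochain_group F \<U> n\<^esub> b)"
    by (simp add: G.m_assoc)
  then show ?thesis using b B.m_closed unfolding cohomologous_def mult_cochain_group[symmetric] by blast
qed

lemma cohomologous_mult:
  assumes U: "open_cover X \<U>" and c: "c \<in> cochains F \<U> n" "c' \<in> cochains F \<U> n"
    and d: "d \<in> cochains F \<U> n" "d' \<in> cochains F \<U> n"
    and "cohomologous F n \<U> c d" "cohomologous F n \<U> c' d'"
  shows "cohomologous F n \<U> (cmult F \<U> n c c') (cmult F \<U> n d d')"
proof -
  interpret G: comm_group "cochain_group F \<U> n" by (rule cochain_comm_group[OF U])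
  interpret B: subgroup "coboundaries F \<U> n" "cochain_group F \<U> n" by (rule subgroup_coboundaries[OF U])
  note [simp] = c[folded carrier_cochain_group] d[folded carrier_cochain_group]
  obtain b b' where b: "b \<in> coboundaries F \<U> n" "b' \<in> coboundaries F \<U> n"
      "c = d \<otimes>\<^bsub>cochain_group F \<U> n\<^esub> b" "c' = d' \<otimes>\<^bsub>cochain_group F \<U> n\<^esub> b'"
    using assms(6,7) unfolding cohomologous_def mult_cochain_group[symmetric] by blast
  then have "c \<otimes>\<^bsub>cochain_group F \<U> n\<^esub> c' =
      (d \<otimes>\<^bsub>cochain_group F \<U> n\<^esub> d') \<otimes>\<^bsub>cochain_group F \<U> n\<^esub> (b \<otimes>\<^bsub>cochain_group F \<U> n\<^esub> b')"
    by (simp add: G.m_ac)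
  then show ?thesis using b B.m_closed unfolding cohomologous_def mult_cochain_group[symmetric] by blast
qed

lemma cohomologous_pullback:
  assumes U: "open_cover X \<U>" and W: "open_cover X \<W>" and r: "refinement \<rho> \<W> \<U>"
    and d: "d \<in> cochains F \<U> n" and cd: "cohomologous F n \<U> c d"
  shows "cohomologous F n \<W> (pullback F \<rho> \<W> n c) (pullback F \<rho> \<W> n d)"
proof -
  obtain b where b: "b \<in> coboundaries F \<U> n" "c = d \<otimes>\<^bsub>cochain_group F \<U> n\<^esub> b"
    using cd unfolding cohomologous_def mult_cochain_group[symmetric] by blast
  have "b \<in> carrier (cochain_group F \<U> n)" using subgroup.mem_carrier[OF subgroup_coboundaries[OF U] b(1)] .
  then show ?thesis
    using b hom_mult[OF pullback_hom[OF U W r]] d pullback_coboundaries[OF U W r b(1)]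
    unfolding cohomologous_def mult_cochain_group[symmetric] carrier_cochain_group[symmetric] by blast
qed

lemma cocycle_0_eq:
  assumes U: "open_cover X \<U>" and c: "c \<in> cocycles F \<U> 0" and A: "A \<in> \<U>" "B \<in> \<U>"
    and S: "openin X S" "S \<subseteq> A" "S \<subseteq> B"
  shows "rval F c [A] S = rval F c [B] S"
proof -
  have c0: "c \<in> cochains F \<U> 0" using c by (simp add: cocycles_def)
  interpret comm_group "sec F S" by (rule sec_comm_group[OF S(1)])
  have l: "[A, B] \<in> simplices \<U> (Suc 0)" using A by (auto simp: simplices_def)
  have v: "rval F c [E] S \<in> carrier (sec F S)" if "E \<in> {A, B}" for E
    by (rule rval_closed[OF U c0 _ S(1)]) (use that A S in \<open>auto simp: simplices_def\<close>)
  have "inv\<^bsub>sec F S\<^esub> rval F c [A] S \<otimes>\<^bsub>sec F S\<^esub> rval F c [B] S = \<one>\<^bsub>sec F S\<^esub>"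
    using rval_cobdry_0[OF U c0 A S] rval_cone[OF U l S(1)] S c by (simp add: cocycles_def)
  then show ?thesis using v[of A] v[of B] by (metis insertI1 insert_subset inv_solve_left' one_closed r_one subset_insertI)
qed

lemma cocycle_1_eq:
  assumes U: "open_cover X \<U>" and c: "c \<in> cocycles F \<U> 1" and A: "A \<in> \<U>" "B \<in> \<U>" "C \<in> \<U>"
    and S: "openin X S" "S \<subseteq> A" "S \<subseteq> B" "S \<subseteq> C"
  shows "rval F c [A, B] S \<otimes>\<^bsub>sec F S\<^esub> rval F c [B, C] S = rval F c [A, C] S"
proof -
  have c0: "c \<in> cochains F \<U> 1" using c by (simp add: cocycles_def)
  interpret comm_group "sec F S" by (rule sec_comm_group[OF S(1)])
  have l: "[A, B, C] \<in> simplices \<U> (Suc 1)" using A by (auto simp: simplices_def)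
  have v: "rval F c [E, E'] S \<in> carrier (sec F S)" if "E \<in> {A, B, C}" "E' \<in> {A, B, C}" for E E'
    by (rule rval_closed[OF U c0 _ S(1)]) (use that A S in \<open>auto simp: simplices_def\<close>)
  have "rval F c [A, B] S \<otimes>\<^bsub>sec F S\<^esub> (inv\<^bsub>sec F S\<^esub> rval F c [A, C] S \<otimes>\<^bsub>sec F S\<^esub> rval F c [B, C] S) = \<one>\<^bsub>sec F S\<^esub>"
    using rval_cobdry_1[OF U c0 A S] rval_cone[OF U l S(1)] S c by (simp add: cocycles_def)
  then have "inv\<^bsub>sec F S\<^esub> rval F c [A, C] S \<otimes>\<^bsub>sec F S\<^esub> (rval F c [A, B] S \<otimes>\<^bsub>sec F S\<^esub> rval F c [B, C] S) = \<one>\<^bsub>sec F S\<^esub>"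
    using v by (simp add: m_lcomm)
  then show ?thesis using v by (metis insertCI inv_solve_left' m_closed one_closed r_one)
qed

lemma cocycle_2_eq:
  assumes U: "open_cover X \<U>" and c: "c \<in> cocycles F \<U> 2" and A: "A \<in> \<U>" "B \<in> \<U>" "C \<in> \<U>" "D \<in> \<U>"
    and S: "openin X S" "S \<subseteq> A" "S \<subseteq> B" "S \<subseteq> C" "S \<subseteq> D"
  shows "rval F c [B, C, D] S \<otimes>\<^bsub>sec F S\<^esub> rval F c [A, B, D] S =
    rval F c [A, C, D] S \<otimes>\<^bsub>sec F S\<^esub> rval F c [A, B, C] S"
proof -
  have c0: "c \<in> cochains F \<U> 2" using c by (simp add: cocycles_def)
  interpret comm_group "sec F S" by (rule sec_comm_group[OF S(1)])
  have l: "[A, B, C, D] \<in> simplices \<U> (Suc 2)" using A by (auto simp: simplices_def)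
  let ?p = "rval F c [B, C, D] S" and ?q = "rval F c [A, B, D] S"
  let ?r = "rval F c [A, C, D] S" and ?s = "rval F c [A, B, C] S"
  have v: "?p \<in> carrier (sec F S)" "?q \<in> carrier (sec F S)" "?r \<in> carrier (sec F S)" "?s \<in> carrier (sec F S)"
    by (rule rval_closed[OF U c0 _ S(1)], use A S in \<open>auto simp: simplices_def\<close>)+
  have "inv\<^bsub>sec F S\<^esub> ?s \<otimes>\<^bsub>sec F S\<^esub> (?q \<otimes>\<^bsub>sec F S\<^esub> (inv\<^bsub>sec F S\<^esub> ?r \<otimes>\<^bsub>sec F S\<^esub> ?p)) = \<one>\<^bsub>sec F S\<^esub>"
    using rval_cobdry_2[OF U c0 A S] rval_cone[OF U l S(1)] S c by (simp add: cocycles_def)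
  then have "inv\<^bsub>sec F S\<^esub> (?r \<otimes>\<^bsub>sec F S\<^esub> ?s) \<otimes>\<^bsub>sec F S\<^esub> (?p \<otimes>\<^bsub>sec F S\<^esub> ?q) = \<one>\<^bsub>sec F S\<^esub>"
    using v by (simp add: inv_mult m_ac)
  then show ?thesis using v by (metis inv_solve_left' m_closed one_closed r_one)
qed

end

section \<open>Independence of the refinement map\<close>

context ab_presheaf
begin

text \<open>This makes the relation that defines the Cech classes transitive.\<close>

definition refinement_independent :: "nat \<Rightarrow> bool" where
  "refinement_independent n \<longleftrightarrow> (\<forall>\<U> \<W> \<rho> \<sigma> c. open_cover X \<U> \<longrightarrow> open_cover X \<W> \<longrightarrow>
     refinement \<rho> \<W> \<U> \<longrightarrow> refinement \<sigma> \<W> \<U> \<longrightarrow> c \<in> cocycles F \<U> n \<longrightarrow>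
     cohomologous F n \<W> (pullback F \<rho> \<W> n c) (pullback F \<sigma> \<W> n c))"

lemma cocycles_cochains: "c \<in> cocycles F \<U> n \<Longrightarrow> c \<in> cochains F \<U> n"
  by (simp add: cocycles_def)

lemma refinement_independent_0: "refinement_independent 0"
  unfolding refinement_independent_def
proof (intro allI impI)
  fix \<U> \<W> \<rho> \<sigma> c
  assume U: "open_cover X \<U>" and W: "open_cover X \<W>" and r: "refinement \<rho> \<W> \<U>" and s: "refinement \<sigma> \<W> \<U>"
    and c: "c \<in> cocycles F \<U> 0"
  note c0 = cocycles_cochains[OF c]
  have "pullback F \<rho> \<W> 0 c = pullback F \<sigma> \<W> 0 c"
  proof (rule cochain_eqI[OF W pullback_closed[OF U W r c0] pullback_closed[OF U W s c0]])
    fix l assume l: "l \<in> simplices \<W> 0"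
    then obtain A where A: "l = [A]" "A \<in> \<W>" by (rule simplices_0_cases)
    note o = openin_simplex[OF W l]
    have m: "\<rho> A \<in> \<U>" "\<sigma> A \<in> \<U>" "\<Inter>(set l) \<subseteq> \<rho> A" "\<Inter>(set l) \<subseteq> \<sigma> A"
      using r s A by (auto simp: refinement_def)
    show "rval F (pullback F \<rho> \<W> 0 c) l (\<Inter>(set l)) = rval F (pullback F \<sigma> \<W> 0 c) l (\<Inter>(set l))"
      unfolding rval_pullback[OF U W r c0 l o subset_refl] rval_pullback[OF U W s c0 l o subset_refl]
      using cocycle_0_eq[OF U c m(1,2) o m(3,4)] by (simp add: A(1))
  qed
  then show "cohomologous F 0 \<W> (pullback F \<rho> \<W> 0 c) (pullback F \<sigma> \<W> 0 c)"
    using cohomologous_refl[OF W pullback_closed[OF U W s c0]] by simp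
qed

text \<open>The homotopy between the two pullbacks of \<open>c\<close> is \<open>[A] \<mapsto> c(\<sigma>A, \<rho>A)\<close>.\<close>

lemma refinement_independent_1: "refinement_independent 1"
  unfolding refinement_independent_def
proof (intro allI impI)
  fix \<U> \<W> \<rho> \<sigma> c
  assume U: "open_cover X \<U>" and W: "open_cover X \<W>" and r: "refinement \<rho> \<W> \<U>" and s: "refinement \<sigma> \<W> \<U>"
    and c: "c \<in> cocycles F \<U> 1"
  note c0 = cocycles_cochains[OF c]
  define e where "e = (\<lambda>l\<in>simplices \<W> 0. rval F c [\<sigma> (hd l), \<rho> (hd l)] (\<Inter>(set l)))"
  have m: "\<rho> A \<in> \<U>" "\<sigma> A \<in> \<U>" "A \<subseteq> \<rho> A" "A \<subseteq> \<sigma> A" if "A \<in> \<W>" for A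
    using r s that by (auto simp: refinement_def)
  have e: "e \<in> cochains F \<W> 0" unfolding e_def cochains_def
  proof (rule restrict_PiE_iff[THEN iffD2], rule ballI)
    fix l assume l: "l \<in> simplices \<W> 0"
    then obtain A where A: "l = [A]" "A \<in> \<W>" by (rule simplices_0_cases)
    show "rval F c [\<sigma> (hd l), \<rho> (hd l)] (\<Inter>(set l)) \<in> carrier (sec F (\<Inter>(set l)))"
      by (rule rval_closed[OF U c0 _ openin_simplex[OF W l]]) (use A m in \<open>auto simp: simplices_def\<close>)
  qed
  have ve: "rval F e [A] S = rval F c [\<sigma> A, \<rho> A] S" if "A \<in> \<W>" "openin X S" "S \<subseteq> A" for A S
  proof -
    have l: "[A] \<in> simplices \<W> 0" and f: "[\<sigma> A, \<rho> A] \<in> simplices \<U> 1" using that m by (auto simp: simplices_def)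
    have "openin X A" using W that(1) by (auto simp: open_cover_def)
    then show ?thesis using res_rval[OF U c0 f, of A S] that m l unfolding rval_def[of F e] by (simp add: e_def)
  qed
  note de = cobdry_closed[OF W e, unfolded One_nat_def[symmetric]]
  note pr = pullback_closed[OF U W r c0] and ps = pullback_closed[OF U W s c0]
  have "pullback F \<rho> \<W> 1 c = cmult F \<W> 1 (pullback F \<sigma> \<W> 1 c) (cobdry F \<W> 0 e)"
  proof (rule cochain_eqI[OF W pr])
    show "cmult F \<W> 1 (pullback F \<sigma> \<W> 1 c) (cobdry F \<W> 0 e) \<in> cochains F \<W> 1"
      using monoid.m_closed[OF group.is_monoid[OF cochain_group_group[OF W]]] ps de
      by (metis carrier_cochain_group mult_cochain_group)
    fix l assume l: "l \<in> simplices \<W> 1"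
    then obtain A B where A: "l = [A, B]" "A \<in> \<W>" "B \<in> \<W>" by (rule simplices_1_cases)
    note o = openin_simplex[OF W l]
    let ?S = "\<Inter>(set l)"
    have S: "?S \<subseteq> A" "?S \<subseteq> B" using A by auto
    have S': "?S \<subseteq> \<rho> A" "?S \<subseteq> \<rho> B" "?S \<subseteq> \<sigma> A" "?S \<subseteq> \<sigma> B" using S m[OF A(2)] m[OF A(3)] by auto
    interpret comm_group "sec F ?S" by (rule sec_comm_group[OF o])
    have v: "rval F c [E, E'] ?S \<in> carrier (sec F ?S)"
      if "E \<in> {\<rho> A, \<rho> B, \<sigma> A, \<sigma> B}" "E' \<in> {\<rho> A, \<rho> B, \<sigma> A, \<sigma> B}" for E E'
      by (rule rval_closed[OF U c0 _ o]) (use that A m S' in \<open>auto simp: simplices_def\<close>)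
    let ?p = "rval F c [\<rho> A, \<rho> B] ?S" and ?q = "rval F c [\<sigma> A, \<sigma> B] ?S"
    let ?a = "rval F c [\<sigma> A, \<rho> A] ?S" and ?b = "rval F c [\<sigma> B, \<rho> B] ?S"
    have cl: "?p \<in> carrier (sec F ?S)" "?q \<in> carrier (sec F ?S)" "?a \<in> carrier (sec F ?S)" "?b \<in> carrier (sec F ?S)"
      by (rule v; simp)+
    have "?a \<otimes>\<^bsub>sec F ?S\<^esub> ?p = ?q \<otimes>\<^bsub>sec F ?S\<^esub> ?b"
      using cocycle_1_eq[OF U c m(2)[OF A(2)] m(1)[OF A(2)] m(1)[OF A(3)] o S'(3,1,2)]
        cocycle_1_eq[OF U c m(2)[OF A(2)] m(2)[OF A(3)] m(1)[OF A(3)] o S'(3,4,2)] by simp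
    then have "?p = inv\<^bsub>sec F ?S\<^esub> ?a \<otimes>\<^bsub>sec F ?S\<^esub> (?q \<otimes>\<^bsub>sec F ?S\<^esub> ?b)"
      using cl by (simp add: inv_solve_left)
    then have pq: "?p = ?q \<otimes>\<^bsub>sec F ?S\<^esub> (inv\<^bsub>sec F ?S\<^esub> ?a \<otimes>\<^bsub>sec F ?S\<^esub> ?b)" using cl by (simp add: m_lcomm)
    have "rval F (cmult F \<W> 1 (pullback F \<sigma> \<W> 1 c) (cobdry F \<W> 0 e)) l ?S =
        rval F c (map \<sigma> l) ?S \<otimes>\<^bsub>sec F ?S\<^esub> rval F (cobdry F \<W> 0 e) [A, B] ?S"
      unfolding rval_mult[OF W ps de l o subset_refl] rval_pullback[OF U W s c0 l o subset_refl]
      by (simp only: A(1))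
    also have "\<dots> = ?q \<otimes>\<^bsub>sec F ?S\<^esub> (inv\<^bsub>sec F ?S\<^esub> ?a \<otimes>\<^bsub>sec F ?S\<^esub> ?b)"
      unfolding rval_cobdry_0[OF W e A(2,3) o S] ve[OF A(2) o S(1)] ve[OF A(3) o S(2)] by (simp add: A(1))
    also have "\<dots> = rval F (pullback F \<rho> \<W> 1 c) l ?S"
      unfolding rval_pullback[OF U W r c0 l o subset_refl] using pq by (simp add: A(1))
    finally show "rval F (pullback F \<rho> \<W> 1 c) l ?S =
       rval F (cmult F \<W> 1 (pullback F \<sigma> \<W> 1 c) (cobdry F \<W> 0 e)) l ?S" by (rule sym)
  qed
  then show "cohomologous F 1 \<W> (pullback F \<rho> \<W> 1 c) (pullback F \<sigma> \<W> 1 c)"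
    using e unfolding cohomologous_def coboundaries_def by auto
qed

text \<open>The prism operator sends \<open>c\<close> to \<open>[A, B] \<mapsto> c(\<sigma>A, \<rho>A, \<rho>B) c(\<sigma>A, \<sigma>B, \<rho>B)\<^sup>-\<^sup>1\<close>; the three
  tetrahedra of the prism over \<open>[A, B, C]\<close> give the three cocycle relations that are combined.\<close>

lemma refinement_independent_2: "refinement_independent 2"
  unfolding refinement_independent_def
proof (intro allI impI)
  fix \<U> \<W> \<rho> \<sigma> c
  assume U: "open_cover X \<U>" and W: "open_cover X \<W>" and r: "refinement \<rho> \<W> \<U>" and s: "refinement \<sigma> \<W> \<U>"
    and c: "c \<in> cocycles F \<U> 2"
  note c0 = cocycles_cochains[OF c]
  define h where "h A B S = rval F c [\<sigma> A, \<rho> A, \<rho> B] S \<otimes>\<^bsub>sec F S\<^esub> inv\<^bsub>sec F S\<^esub> rval F c [\<sigma> A, \<sigma> B, \<rho> B] S" for A B S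
  define e where "e = (\<lambda>l\<in>simplices \<W> 1. h (l ! 0) (l ! 1) (\<Inter>(set l)))"
  have m: "\<rho> A \<in> \<U>" "\<sigma> A \<in> \<U>" "A \<subseteq> \<rho> A" "A \<subseteq> \<sigma> A" if "A \<in> \<W>" for A
    using r s that by (auto simp: refinement_def)
  have fs: "[\<sigma> A, \<rho> A, \<rho> B] \<in> simplices \<U> 2" "[\<sigma> A, \<sigma> B, \<rho> B] \<in> simplices \<U> 2"
    if "A \<in> \<W>" "B \<in> \<W>" for A B using m that by (auto simp: simplices_def)
  have sub: "S \<subseteq> \<Inter>(set [\<sigma> A, \<rho> A, \<rho> B])" "S \<subseteq> \<Inter>(set [\<sigma> A, \<sigma> B, \<rho> B])"
    if "A \<in> \<W>" "B \<in> \<W>" "S \<subseteq> A" "S \<subseteq> B" for A B S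
    using m[OF that(1)] m[OF that(2)] that(3,4) by auto
  have hc: "h A B S \<in> carrier (sec F S)" if "A \<in> \<W>" "B \<in> \<W>" "openin X S" "S \<subseteq> A" "S \<subseteq> B" for A B S
  proof -
    interpret comm_group "sec F S" by (rule sec_comm_group[OF that(3)])
    show ?thesis unfolding h_def
      by (intro m_closed inv_closed rval_closed[OF U c0] fs sub that)
  qed
  have e: "e \<in> cochains F \<W> 1" unfolding e_def cochains_def
  proof (rule restrict_PiE_iff[THEN iffD2], rule ballI)
    fix l assume l: "l \<in> simplices \<W> 1"
    then obtain A B where A: "l = [A, B]" "A \<in> \<W>" "B \<in> \<W>" by (rule simplices_1_cases)
    show "h (l ! 0) (l ! 1) (\<Inter>(set l)) \<in> carrier (sec F (\<Inter>(set l)))"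
      by (rule hc[OF _ _ openin_simplex[OF W l]]) (use A in auto)
  qed
  have ve: "rval F e [A, B] S = h A B S" if "A \<in> \<W>" "B \<in> \<W>" "openin X S" "S \<subseteq> A" "S \<subseteq> B" for A B S
  proof -
    have l: "[A, B] \<in> simplices \<W> 1" using that by (auto simp: simplices_def)
    let ?T = "\<Inter>(set [A, B])"
    have T: "openin X ?T" "?T \<subseteq> A" "?T \<subseteq> B" "S \<subseteq> ?T" using openin_simplex[OF W l] that by auto
    note hm = res_hom[OF T(1) that(3) T(4)]
    have cl: "rval F c [\<sigma> A, \<rho> A, \<rho> B] ?T \<in> carrier (sec F ?T)" "rval F c [\<sigma> A, \<sigma> B, \<rho> B] ?T \<in> carrier (sec F ?T)"
      by (intro rval_closed[OF U c0] fs sub that T)+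
    have "rval F e [A, B] S = res F ?T S (h A B ?T)" using l by (simp add: rval_def e_def)
    also have "\<dots> = res F ?T S (rval F c [\<sigma> A, \<rho> A, \<rho> B] ?T) \<otimes>\<^bsub>sec F S\<^esub>
        inv\<^bsub>sec F S\<^esub> res F ?T S (rval F c [\<sigma> A, \<sigma> B, \<rho> B] ?T)"
      unfolding h_def using cl group.inv_closed[OF sec_group[OF T(1)]]
      by (simp only: hom_mult[OF hm] hom_m_inv[OF sec_group[OF T(1)] sec_group[OF that(3)] hm])
    also have "\<dots> = h A B S" unfolding h_def
      using res_rval[OF U c0 fs(1)[OF that(1,2)] T(1) sub(1)[OF that(1,2) T(2,3)] that(3) T(4)]
        res_rval[OF U c0 fs(2)[OF that(1,2)] T(1) sub(2)[OF that(1,2) T(2,3)] that(3) T(4)] by (simp only:)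
    finally show ?thesis .
  qed
  note de = cobdry_closed[OF W e, unfolded Suc_1]
  note pr = pullback_closed[OF U W r c0] and ps = pullback_closed[OF U W s c0]
  have "pullback F \<rho> \<W> 2 c = cmult F \<W> 2 (pullback F \<sigma> \<W> 2 c) (cobdry F \<W> 1 e)"
  proof (rule cochain_eqI[OF W pr])
    show "cmult F \<W> 2 (pullback F \<sigma> \<W> 2 c) (cobdry F \<W> 1 e) \<in> cochains F \<W> 2"
      using monoid.m_closed[OF group.is_monoid[OF cochain_group_group[OF W]]] ps de
      by (metis carrier_cochain_group mult_cochain_group)
    fix l assume l: "l \<in> simplices \<W> 2"
    then obtain A B C where A: "l = [A, B, C]" "A \<in> \<W>" "B \<in> \<W>" "C \<in> \<W>" by (rule simplices_2_cases)
    note o = openin_simplex[OF W l]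
    let ?S = "\<Inter>(set l)"
    have S: "?S \<subseteq> A" "?S \<subseteq> B" "?S \<subseteq> C" using A by auto
    have S': "?S \<subseteq> \<rho> A" "?S \<subseteq> \<rho> B" "?S \<subseteq> \<rho> C" "?S \<subseteq> \<sigma> A" "?S \<subseteq> \<sigma> B" "?S \<subseteq> \<sigma> C"
      using S m[OF A(2)] m[OF A(3)] m[OF A(4)] by auto
    note mA = m(1,2)[OF A(2)] and mB = m(1,2)[OF A(3)] and mC = m(1,2)[OF A(4)]
    interpret comm_group "sec F ?S" by (rule sec_comm_group[OF o])
    have v: "rval F c [E, E', E''] ?S \<in> carrier (sec F ?S)"
      if "E \<in> {\<rho> A, \<rho> B, \<rho> C, \<sigma> A, \<sigma> B, \<sigma> C}" "E' \<in> {\<rho> A, \<rho> B, \<rho> C, \<sigma> A, \<sigma> B, \<sigma> C}"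
        "E'' \<in> {\<rho> A, \<rho> B, \<rho> C, \<sigma> A, \<sigma> B, \<sigma> C}" for E E' E''
      by (rule rval_closed[OF U c0 _ o]) (use that mA mB mC S' in \<open>auto simp: simplices_def\<close>)
    have key: "rval F c [\<rho> A, \<rho> B, \<rho> C] ?S = rval F c [\<sigma> A, \<sigma> B, \<sigma> C] ?S \<otimes>\<^bsub>sec F ?S\<^esub>
       (h A B ?S \<otimes>\<^bsub>sec F ?S\<^esub> (inv\<^bsub>sec F ?S\<^esub> h A C ?S \<otimes>\<^bsub>sec F ?S\<^esub> h B C ?S))"
      unfolding h_def
    proof (rule prism_identity)
      show "rval F c [\<rho> A, \<rho> B, \<rho> C] ?S \<otimes>\<^bsub>sec F ?S\<^esub> rval F c [\<sigma> A, \<rho> A, \<rho> C] ?S =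
          rval F c [\<sigma> A, \<rho> B, \<rho> C] ?S \<otimes>\<^bsub>sec F ?S\<^esub> rval F c [\<sigma> A, \<rho> A, \<rho> B] ?S"
        by (rule cocycle_2_eq[OF U c mA(2) mA(1) mB(1) mC(1) o S'(4,1,2,3)])
      show "rval F c [\<sigma> B, \<rho> B, \<rho> C] ?S \<otimes>\<^bsub>sec F ?S\<^esub> rval F c [\<sigma> A, \<sigma> B, \<rho> C] ?S =
          rval F c [\<sigma> A, \<rho> B, \<rho> C] ?S \<otimes>\<^bsub>sec F ?S\<^esub> rval F c [\<sigma> A, \<sigma> B, \<rho> B] ?S"
        by (rule cocycle_2_eq[OF U c mA(2) mB(2) mB(1) mC(1) o S'(4,5,2,3)])
      show "rval F c [\<sigma> B, \<sigma> C, \<rho> C] ?S \<otimes>\<^bsub>sec F ?S\<^esub> rval F c [\<sigma> A, \<sigma> B, \<rho> C] ?S =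
          rval F c [\<sigma> A, \<sigma> C, \<rho> C] ?S \<otimes>\<^bsub>sec F ?S\<^esub> rval F c [\<sigma> A, \<sigma> B, \<sigma> C] ?S"
        by (rule cocycle_2_eq[OF U c mA(2) mB(2) mC(2) mC(1) o S'(4,5,6,3)])
    qed (rule v; simp)+
    have "rval F (cmult F \<W> 2 (pullback F \<sigma> \<W> 2 c) (cobdry F \<W> 1 e)) l ?S =
        rval F c (map \<sigma> l) ?S \<otimes>\<^bsub>sec F ?S\<^esub> rval F (cobdry F \<W> 1 e) [A, B, C] ?S"
      unfolding rval_mult[OF W ps de l o subset_refl] rval_pullback[OF U W s c0 l o subset_refl]
      by (simp only: A(1))
    also have "\<dots> = rval F c [\<sigma> A, \<sigma> B, \<sigma> C] ?S \<otimes>\<^bsub>sec F ?S\<^esub>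
       (h A B ?S \<otimes>\<^bsub>sec F ?S\<^esub> (inv\<^bsub>sec F ?S\<^esub> h A C ?S \<otimes>\<^bsub>sec F ?S\<^esub> h B C ?S))"
      unfolding rval_cobdry_1[OF W e A(2-4) o S] ve[OF A(2,3) o S(1,2)] ve[OF A(2,4) o S(1,3)]
        ve[OF A(3,4) o S(2,3)] by (simp add: A(1))
    also have "\<dots> = rval F (pullback F \<rho> \<W> 2 c) l ?S"
      unfolding rval_pullback[OF U W r c0 l o subset_refl] key[symmetric] by (simp add: A(1))
    finally show "rval F (pullback F \<rho> \<W> 2 c) l ?S =
       rval F (cmult F \<W> 2 (pullback F \<sigma> \<W> 2 c) (cobdry F \<W> 1 e)) l ?S" by (rule sym)
  qed
  then show "cohomologous F 2 \<W> (pullback F \<rho> \<W> 2 c) (pullback F \<sigma> \<W> 2 c)"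
    using e unfolding cohomologous_def coboundaries_def by (auto simp: numeral_2_eq_2)
qed

end

section \<open>Cech cohomology groups\<close>

lemma open_cover_topspace: "open_cover X {topspace X}"
  by (simp add: open_cover_def)

lemma refinement_topspace: "open_cover X \<W> \<Longrightarrow> refinement (\<lambda>_. topspace X) \<W> {topspace X}"
  by (auto simp: refinement_def open_cover_def)

lemma refinement_id: "refinement id \<W> \<W>"
  by (simp add: refinement_def)

lemma cech_reps_iff: "(\<U>, c) \<in> cech_reps X F n \<longleftrightarrow> open_cover X \<U> \<and> c \<in> cocycles F \<U> n"
  by (simp add: cech_reps_def)

lemma mem_cech_class_iff:
  "(\<V>, d) \<in> cech_class X F n (\<U>, c) \<longleftrightarrow> (\<V>, d) \<in> cech_reps X F n \<and>
     (\<exists>\<W> \<rho> \<rho>'. open_cover X \<W> \<and> refinement \<rho> \<W> \<U> \<and> refinement \<rho>' \<W> \<V> \<and>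
        cohomologous F n \<W> (pullback F \<rho> \<W> n c) (pullback F \<rho>' \<W> n d))"
  by (simp add: cech_class_def cohomologous_def)

context ab_presheaf
begin

lemma pullback_id:
  assumes U: "open_cover X \<U>" and c: "c \<in> cochains F \<U> n"
  shows "pullback F id \<U> n c = c"
  by (rule cochain_eqI[OF U pullback_closed[OF U U refinement_id c] c])
     (simp add: rval_pullback[OF U U refinement_id c] openin_simplex[OF U])

lemma cocycles_mult:
  assumes "open_cover X \<U>" "c \<in> cocycles F \<U> n" "d \<in> cocycles F \<U> n"
  shows "cmult F \<U> n c d \<in> cocycles F \<U> n"
  using subgroup.m_closed[OF subgroup_cocycles[OF assms(1)] assms(2,3)] by (simp add: mult_cochain_group)

lemma cone_cocycle: "open_cover X \<U> \<Longrightarrow> cone F \<U> n \<in> cocycles F \<U> n"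
  using subgroup.one_closed[OF subgroup_cocycles] by (metis one_cochain_group)

lemma pullback_mult:
  assumes "open_cover X \<U>" "open_cover X \<W>" "refinement \<rho> \<W> \<U>" "c \<in> cochains F \<U> n" "d \<in> cochains F \<U> n"
  shows "pullback F \<rho> \<W> n (cmult F \<U> n c d) = cmult F \<W> n (pullback F \<rho> \<W> n c) (pullback F \<rho> \<W> n d)"
  using hom_mult[OF pullback_hom[OF assms(1-3)]] assms(4,5)
  by (simp add: mult_cochain_group carrier_cochain_group)

lemma pullback_cone:
  assumes "open_cover X \<U>" "open_cover X \<W>" "refinement \<rho> \<W> \<U>"
  shows "pullback F \<rho> \<W> n (cone F \<U> n) = cone F \<W> n"
  using hom_one[OF pullback_hom[OF assms]] cochain_group_group[OF assms(1)] cochain_group_group[OF assms(2)]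
  by (simp add: one_cochain_group)

end

locale cech_degree = ab_presheaf +
  fixes n :: nat
  assumes indep: "refinement_independent n"
begin

lemma pullbacks_cohomologous:
  assumes "open_cover X \<U>" "open_cover X \<W>" "refinement \<rho> \<W> \<U>" "refinement \<sigma> \<W> \<U>" "c \<in> cocycles F \<U> n"
  shows "cohomologous F n \<W> (pullback F \<rho> \<W> n c) (pullback F \<sigma> \<W> n c)"
  using indep assms unfolding refinement_independent_def by blast

text \<open>As the choice of refinement maps does not matter, equivalent representatives are cohomologous
  on every sufficiently fine cover along any refinement maps, and not only on the one cover given by
  the definition.\<close>

lemma mem_class_fine:
  assumes p: "(\<U>, c) \<in> cech_reps X F n" and q: "(\<V>, d) \<in> cech_class X F n (\<U>, c)"
  obtains \<T> where "open_cover X \<T>"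
    "\<And>\<W> \<tau> \<rho> \<rho>'. open_cover X \<W> \<Longrightarrow> refinement \<tau> \<W> \<T> \<Longrightarrow> refinement \<rho> \<W> \<U> \<Longrightarrow> refinement \<rho>' \<W> \<V> \<Longrightarrow>
       cohomologous F n \<W> (pullback F \<rho> \<W> n c) (pullback F \<rho>' \<W> n d)"
proof -
  have U: "open_cover X \<U>" and c: "c \<in> cocycles F \<U> n" using p by (auto simp: cech_reps_iff)
  have V: "open_cover X \<V>" and d: "d \<in> cocycles F \<V> n" using q by (auto simp: cech_reps_iff mem_cech_class_iff)
  note c0 = cocycles_cochains[OF c] and d0 = cocycles_cochains[OF d]
  obtain \<T> \<mu> \<mu>' where T: "open_cover X \<T>" "refinement \<mu> \<T> \<U>" "refinement \<mu>' \<T> \<V>"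
      "cohomologous F n \<T> (pullback F \<mu> \<T> n c) (pullback F \<mu>' \<T> n d)"
    using q by (auto simp: mem_cech_class_iff)
  show thesis
  proof (rule that[OF T(1)])
    fix \<W> \<tau> \<rho> \<rho>' assume W: "open_cover X \<W>" "refinement \<tau> \<W> \<T>" "refinement \<rho> \<W> \<U>" "refinement \<rho>' \<W> \<V>"
    note m = refinement_comp[OF W(2) T(2)] and m' = refinement_comp[OF W(2) T(3)]
    have "cohomologous F n \<W> (pullback F (\<mu> \<circ> \<tau>) \<W> n c) (pullback F (\<mu>' \<circ> \<tau>) \<W> n d)"
      using cohomologous_pullback[OF T(1) W(1,2) pullback_closed[OF V T(1,3) d0] T(4)]
        pullback_pullback[OF U T(1) W(1) T(2) W(2) c0] pullback_pullback[OF V T(1) W(1) T(3) W(2) d0] by simp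
    then have "cohomologous F n \<W> (pullback F \<rho> \<W> n c) (pullback F (\<mu>' \<circ> \<tau>) \<W> n d)"
      by (rule cohomologous_trans[OF W(1) pullback_closed[OF U W(1,3) c0] pullback_closed[OF U W(1) m c0]
            pullback_closed[OF V W(1) m' d0] pullbacks_cohomologous[OF U W(1,3) m c]])
    then show "cohomologous F n \<W> (pullback F \<rho> \<W> n c) (pullback F \<rho>' \<W> n d)"
      by (rule cohomologous_trans[OF W(1) pullback_closed[OF U W(1,3) c0] pullback_closed[OF V W(1) m' d0]
            pullback_closed[OF V W(1,4) d0] _ pullbacks_cohomologous[OF V W(1) m' W(4) d]])
  qed
qed

lemma self_mem_class:
  assumes "(\<U>, c) \<in> cech_reps X F n" shows "(\<U>, c) \<in> cech_class X F n (\<U>, c)"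
proof -
  have U: "open_cover X \<U>" and c: "c \<in> cocycles F \<U> n" using assms by (auto simp: cech_reps_iff)
  show ?thesis unfolding mem_cech_class_iff
    using assms U refinement_id pullbacks_cohomologous[OF U U refinement_id refinement_id c] by blast
qed

lemma mem_class_sym:
  assumes p: "(\<U>, c) \<in> cech_reps X F n" and q: "(\<V>, d) \<in> cech_class X F n (\<U>, c)"
  shows "(\<U>, c) \<in> cech_class X F n (\<V>, d)"
proof -
  have U: "open_cover X \<U>" and c: "c \<in> cocycles F \<U> n" using p by (auto simp: cech_reps_iff)
  have V: "open_cover X \<V>" and d: "d \<in> cocycles F \<V> n" using q by (auto simp: cech_reps_iff mem_cech_class_iff)
  obtain \<T> \<mu> \<mu>' where T: "open_cover X \<T>" "refinement \<mu> \<T> \<U>" "refinement \<mu>' \<T> \<V>"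
      "cohomologous F n \<T> (pullback F \<mu> \<T> n c) (pullback F \<mu>' \<T> n d)"
    using q by (auto simp: mem_cech_class_iff)
  have "cohomologous F n \<T> (pullback F \<mu>' \<T> n d) (pullback F \<mu> \<T> n c)"
    by (rule cohomologous_sym[OF T(1) pullback_closed[OF U T(1,2) cocycles_cochains[OF c]]
        pullback_closed[OF V T(1,3) cocycles_cochains[OF d]] T(4)])
  then show ?thesis unfolding mem_cech_class_iff using p T(1-3) by blast
qed

lemma mem_class_trans:
  assumes p: "(\<U>, c) \<in> cech_reps X F n" and q: "(\<V>, d) \<in> cech_class X F n (\<U>, c)"
    and r: "(\<Z>, e) \<in> cech_class X F n (\<V>, d)"
  shows "(\<Z>, e) \<in> cech_class X F n (\<U>, c)"
proof -
  have q': "(\<V>, d) \<in> cech_reps X F n" using q by (auto simp: mem_cech_class_iff)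
  have r': "(\<Z>, e) \<in> cech_reps X F n" using r by (auto simp: mem_cech_class_iff)
  have U: "open_cover X \<U>" "c \<in> cocycles F \<U> n" and V: "open_cover X \<V>" "d \<in> cocycles F \<V> n"
    and Z: "open_cover X \<Z>" "e \<in> cocycles F \<Z> n" using p q' r' by (auto simp: cech_reps_iff)
  obtain \<T> where T: "open_cover X \<T>"
    "\<And>\<W> \<tau> \<rho> \<rho>'. open_cover X \<W> \<Longrightarrow> refinement \<tau> \<W> \<T> \<Longrightarrow> refinement \<rho> \<W> \<U> \<Longrightarrow> refinement \<rho>' \<W> \<V> \<Longrightarrow>
       cohomologous F n \<W> (pullback F \<rho> \<W> n c) (pullback F \<rho>' \<W> n d)"
    by (rule mem_class_fine[OF p q]) blast
  obtain \<T>' where T': "open_cover X \<T>'"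
    "\<And>\<W> \<tau> \<rho> \<rho>'. open_cover X \<W> \<Longrightarrow> refinement \<tau> \<W> \<T>' \<Longrightarrow> refinement \<rho> \<W> \<V> \<Longrightarrow> refinement \<rho>' \<W> \<Z> \<Longrightarrow>
       cohomologous F n \<W> (pullback F \<rho> \<W> n d) (pullback F \<rho>' \<W> n e)"
    by (rule mem_class_fine[OF q' r]) blast
  obtain \<S> \<alpha> \<beta> where S: "open_cover X \<S>" "refinement \<alpha> \<S> \<T>" "refinement \<beta> \<S> \<T>'"
    by (rule common_refinement[OF T(1) T'(1)])
  obtain \<R> \<gamma> \<rho>2 where R: "open_cover X \<R>" "refinement \<gamma> \<R> \<S>" "refinement \<rho>2 \<R> \<V>"
    by (rule common_refinement[OF S(1) V(1)])
  obtain \<Q> \<delta> \<rho>1 where Q: "open_cover X \<Q>" "refinement \<delta> \<Q> \<R>" "refinement \<rho>1 \<Q> \<U>"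
    by (rule common_refinement[OF R(1) U(1)])
  obtain \<W> \<epsilon> \<rho>3 where W: "open_cover X \<W>" "refinement \<epsilon> \<W> \<Q>" "refinement \<rho>3 \<W> \<Z>"
    by (rule common_refinement[OF Q(1) Z(1)])
  note WS = refinement_comp[OF refinement_comp[OF W(2) Q(2)] R(2)]
  note wU = refinement_comp[OF W(2) Q(3)] and wV = refinement_comp[OF refinement_comp[OF W(2) Q(2)] R(3)]
  have "cohomologous F n \<W> (pullback F (\<rho>1 \<circ> \<epsilon>) \<W> n c) (pullback F \<rho>3 \<W> n e)"
    by (rule cohomologous_trans[OF W(1) pullback_closed[OF U(1) W(1) wU cocycles_cochains[OF U(2)]]
          pullback_closed[OF V(1) W(1) wV cocycles_cochains[OF V(2)]]
          pullback_closed[OF Z(1) W(1,3) cocycles_cochains[OF Z(2)]]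
          T(2)[OF W(1) refinement_comp[OF WS S(2)] wU wV] T'(2)[OF W(1) refinement_comp[OF WS S(3)] wV W(3)]])
  then show ?thesis unfolding mem_cech_class_iff using r' W(1,3) wU by blast
qed

lemma class_eq_iff:
  assumes p: "(\<U>, c) \<in> cech_reps X F n" and q: "(\<V>, d) \<in> cech_reps X F n"
  shows "cech_class X F n (\<U>, c) = cech_class X F n (\<V>, d) \<longleftrightarrow> (\<V>, d) \<in> cech_class X F n (\<U>, c)"
proof
  assume "cech_class X F n (\<U>, c) = cech_class X F n (\<V>, d)"
  then show "(\<V>, d) \<in> cech_class X F n (\<U>, c)" using self_mem_class[OF q] by simp
next
  assume r: "(\<V>, d) \<in> cech_class X F n (\<U>, c)"
  note r' = mem_class_sym[OF p r]
  have "(\<Z>, e) \<in> cech_class X F n (\<U>, c) \<longleftrightarrow> (\<Z>, e) \<in> cech_class X F n (\<V>, d)" for \<Z> e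
    using mem_class_trans[OF p r] mem_class_trans[OF q r'] by blast
  then show "cech_class X F n (\<U>, c) = cech_class X F n (\<V>, d)" by auto
qed

lemma pullback_rep:
  assumes p: "(\<U>, c) \<in> cech_reps X F n" and W: "open_cover X \<W>" "refinement \<rho> \<W> \<U>"
  shows "(\<W>, pullback F \<rho> \<W> n c) \<in> cech_reps X F n"
    and "cech_class X F n (\<W>, pullback F \<rho> \<W> n c) = cech_class X F n (\<U>, c)"
proof -
  have U: "open_cover X \<U>" and c: "c \<in> cocycles F \<U> n" using p by (auto simp: cech_reps_iff)
  note pc = pullback_cocycles[OF U W c]
  show q: "(\<W>, pullback F \<rho> \<W> n c) \<in> cech_reps X F n" using pc W by (simp add: cech_reps_iff)
  have "cohomologous F n \<W> (pullback F \<rho> \<W> n c) (pullback F id \<W> n (pullback F \<rho> \<W> n c))"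
    using cohomologous_refl[OF W(1)] cocycles_cochains[OF pc] by (simp add: pullback_id[OF W(1)])
  then have "(\<W>, pullback F \<rho> \<W> n c) \<in> cech_class X F n (\<U>, c)"
    unfolding mem_cech_class_iff using q W refinement_id by blast
  then show "cech_class X F n (\<W>, pullback F \<rho> \<W> n c) = cech_class X F n (\<U>, c)"
    using class_eq_iff[OF p q] by simp
qed

lemma class_eq_if_cohomologous:
  assumes p: "(\<U>, c) \<in> cech_reps X F n" and q: "(\<U>, d) \<in> cech_reps X F n" and cd: "cohomologous F n \<U> c d"
  shows "cech_class X F n (\<U>, c) = cech_class X F n (\<U>, d)"
proof -
  have U: "open_cover X \<U>" and c: "c \<in> cochains F \<U> n" and d: "d \<in> cochains F \<U> n"
    using p q by (auto simp: cech_reps_iff cocycles_def)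
  show ?thesis unfolding class_eq_iff[OF p q] mem_cech_class_iff
    by (intro conjI q exI[of _ \<U>] exI[of _ id] U refinement_id)
       (simp add: cd pullback_id[OF U c] pullback_id[OF U d])
qed

lemma class_eqE:
  assumes p: "(\<U>, c) \<in> cech_reps X F n" and q: "(\<V>, d) \<in> cech_reps X F n"
    and "cech_class X F n (\<U>, c) = cech_class X F n (\<V>, d)"
  obtains \<W> \<rho> \<sigma> where "open_cover X \<W>" "refinement \<rho> \<W> \<U>" "refinement \<sigma> \<W> \<V>"
    "cohomologous F n \<W> (pullback F \<rho> \<W> n c) (pullback F \<sigma> \<W> n d)"
  using assms class_eq_iff[OF p q] by (auto simp: mem_cech_class_iff)

lemma carrier_cohomE:
  assumes "K \<in> carrier (cohom X F n)"
  obtains \<U> c where "(\<U>, c) \<in> cech_reps X F n" "K = cech_class X F n (\<U>, c)"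
  using assms by (auto simp: cohom_def)

lemma class_in_cohom: "(\<U>, c) \<in> cech_reps X F n \<Longrightarrow> cech_class X F n (\<U>, c) \<in> carrier (cohom X F n)"
  by (simp add: cohom_def)

lemma cohom_common_cover:
  assumes "K \<in> carrier (cohom X F n)" and W: "open_cover X \<W>"
  obtains \<V> \<nu> c where "open_cover X \<V>" "refinement \<nu> \<V> \<W>" "(\<V>, c) \<in> cech_reps X F n" "K = cech_class X F n (\<V>, c)"
proof -
  obtain \<U> c where c: "(\<U>, c) \<in> cech_reps X F n" "K = cech_class X F n (\<U>, c)"
    using assms(1) by (rule carrier_cohomE)
  then have U: "open_cover X \<U>" by (simp add: cech_reps_iff)
  obtain \<V> \<rho> \<nu> where V: "open_cover X \<V>" "refinement \<rho> \<V> \<U>" "refinement \<nu> \<V> \<W>"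
    by (rule common_refinement[OF U W])
  show thesis using that[OF V(1,3) pullback_rep(1)[OF c(1) V(1,2)]] pullback_rep(2)[OF c(1) V(1,2)] c(2) by simp
qed

lemma mult_rep:
  "(\<U>, c) \<in> cech_reps X F n \<Longrightarrow> (\<U>, d) \<in> cech_reps X F n \<Longrightarrow> (\<U>, cmult F \<U> n c d) \<in> cech_reps X F n"
  using cocycles_mult by (simp add: cech_reps_iff)

text \<open>The products of any other representatives of the two classes over a common cover become
  cohomologous to this one on a refinement, so the union in the definition of the product is over a
  single class.\<close>

lemma mult_class:
  assumes p: "(\<U>, c) \<in> cech_reps X F n" and q: "(\<U>, d) \<in> cech_reps X F n"
  shows "cech_class X F n (\<U>, c) \<otimes>\<^bsub>cohom X F n\<^esub> cech_class X F n (\<U>, d) = cech_class X F n (\<U>, cmult F \<U> n c d)"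
proof -
  have U: "open_cover X \<U>" and c: "c \<in> cocycles F \<U> n" and d: "d \<in> cocycles F \<U> n"
    using p q by (auto simp: cech_reps_iff)
  note pq = mult_rep[OF p q]
  have eq: "cech_class X F n (\<V>, cmult F \<V> n c' d') = cech_class X F n (\<U>, cmult F \<U> n c d)"
    if c': "(\<V>, c') \<in> cech_class X F n (\<U>, c)" and d': "(\<V>, d') \<in> cech_class X F n (\<U>, d)" for \<V> c' d'
  proof -
    have p': "(\<V>, c') \<in> cech_reps X F n" and q': "(\<V>, d') \<in> cech_reps X F n"
      using c' d' by (auto simp: mem_cech_class_iff)
    then have V: "open_cover X \<V>" and c'0: "c' \<in> cochains F \<V> n" and d'0: "d' \<in> cochains F \<V> n"
      by (auto simp: cech_reps_iff cocycles_def)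
    note c0 = cocycles_cochains[OF c] and d0 = cocycles_cochains[OF d]
    obtain \<T> where T: "open_cover X \<T>"
      "\<And>\<W> \<tau> \<rho> \<rho>'. open_cover X \<W> \<Longrightarrow> refinement \<tau> \<W> \<T> \<Longrightarrow> refinement \<rho> \<W> \<U> \<Longrightarrow> refinement \<rho>' \<W> \<V> \<Longrightarrow>
         cohomologous F n \<W> (pullback F \<rho> \<W> n c) (pullback F \<rho>' \<W> n c')"
      by (rule mem_class_fine[OF p c']) blast
    obtain \<T>' where T': "open_cover X \<T>'"
      "\<And>\<W> \<tau> \<rho> \<rho>'. open_cover X \<W> \<Longrightarrow> refinement \<tau> \<W> \<T>' \<Longrightarrow> refinement \<rho> \<W> \<U> \<Longrightarrow> refinement \<rho>' \<W> \<V> \<Longrightarrow>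
         cohomologous F n \<W> (pullback F \<rho> \<W> n d) (pullback F \<rho>' \<W> n d')"
      by (rule mem_class_fine[OF q d']) blast
    obtain \<S> \<alpha> \<beta> where S: "open_cover X \<S>" "refinement \<alpha> \<S> \<T>" "refinement \<beta> \<S> \<T>'"
      by (rule common_refinement[OF T(1) T'(1)])
    obtain \<R> \<gamma> \<rho>2 where R: "open_cover X \<R>" "refinement \<gamma> \<R> \<S>" "refinement \<rho>2 \<R> \<V>"
      by (rule common_refinement[OF S(1) V(1)])
    obtain \<W> \<epsilon> \<rho>1 where W: "open_cover X \<W>" "refinement \<epsilon> \<W> \<R>" "refinement \<rho>1 \<W> \<U>"
      by (rule common_refinement[OF R(1) U])
    note WS = refinement_comp[OF W(2) R(2)] and wV = refinement_comp[OF W(2) R(3)]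
    have "cohomologous F n \<W> (pullback F \<rho>1 \<W> n (cmult F \<U> n c d)) (pullback F (\<rho>2 \<circ> \<epsilon>) \<W> n (cmult F \<V> n c' d'))"
      unfolding pullback_mult[OF U W(1,3) c0 d0] pullback_mult[OF V W(1) wV c'0 d'0]
      by (rule cohomologous_mult[OF W(1) pullback_closed[OF U W(1,3) c0] pullback_closed[OF U W(1,3) d0]
            pullback_closed[OF V W(1) wV c'0] pullback_closed[OF V W(1) wV d'0]
            T(2)[OF W(1) refinement_comp[OF WS S(2)] W(3) wV] T'(2)[OF W(1) refinement_comp[OF WS S(3)] W(3) wV]])
    then have "(\<V>, cmult F \<V> n c' d') \<in> cech_class X F n (\<U>, cmult F \<U> n c d)"
      unfolding mem_cech_class_iff using mult_rep[OF p' q'] W(1,3) wV by blast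
    then show ?thesis using class_eq_iff[OF pq mult_rep[OF p' q']] by simp
  qed
  have "{cech_class X F n (\<V>, cmult F \<V> n c' d') | \<V> c' d'. (\<V>, c') \<in> cech_class X F n (\<U>, c) \<and>
      (\<V>, d') \<in> cech_class X F n (\<U>, d)} = {cech_class X F n (\<U>, cmult F \<U> n c d)}"
    using eq self_mem_class[OF p] self_mem_class[OF q] by blast
  then show ?thesis by (simp add: cohom_def)
qed

lemma one_class:
  assumes U: "open_cover X \<U>"
  shows "\<one>\<^bsub>cohom X F n\<^esub> = cech_class X F n (\<U>, cone F \<U> n)"
proof -
  have "({topspace X}, cone F {topspace X} n) \<in> cech_reps X F n"
    using cone_cocycle[OF open_cover_topspace] by (simp add: cech_reps_iff open_cover_topspace)
  from pullback_rep(2)[OF this U refinement_topspace[OF U]] show ?thesis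
    by (simp add: cohom_def pullback_cone[OF open_cover_topspace U refinement_topspace[OF U]])
qed

lemma cohom_comm_group: "comm_group (cohom X F n)"
proof (rule comm_groupI)
  have two: "\<exists>\<U> c d. (\<U>, c) \<in> cech_reps X F n \<and> (\<U>, d) \<in> cech_reps X F n \<and> K = cech_class X F n (\<U>, c) \<and> L = cech_class X F n (\<U>, d)"
    if KL: "K \<in> carrier (cohom X F n)" "L \<in> carrier (cohom X F n)" for K L
  proof -
    obtain \<U> c where c: "(\<U>, c) \<in> cech_reps X F n" "K = cech_class X F n (\<U>, c)"
      using KL(1) by (rule carrier_cohomE)
    then have U: "open_cover X \<U>" by (simp add: cech_reps_iff)
    obtain \<V> \<nu> d where "open_cover X \<V>" "refinement \<nu> \<V> \<U>" "(\<V>, d) \<in> cech_reps X F n" "L = cech_class X F n (\<V>, d)"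
      by (rule cohom_common_cover[OF KL(2) U])
    then show ?thesis using pullback_rep[OF c(1)] c(2) by metis
  qed
  show "K \<otimes>\<^bsub>cohom X F n\<^esub> L \<in> carrier (cohom X F n)"
    if KL: "K \<in> carrier (cohom X F n)" "L \<in> carrier (cohom X F n)" for K L
    using two[OF KL] mult_class mult_rep class_in_cohom by metis
  show "\<one>\<^bsub>cohom X F n\<^esub> \<in> carrier (cohom X F n)"
    using one_class[OF open_cover_topspace] class_in_cohom cone_cocycle[OF open_cover_topspace]
    by (metis cech_reps_iff open_cover_topspace)
  show "K \<otimes>\<^bsub>cohom X F n\<^esub> L = L \<otimes>\<^bsub>cohom X F n\<^esub> K"
    if KL: "K \<in> carrier (cohom X F n)" "L \<in> carrier (cohom X F n)" for K L
  proof -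
    obtain \<U> c d where c: "(\<U>, c) \<in> cech_reps X F n" "(\<U>, d) \<in> cech_reps X F n" "K = cech_class X F n (\<U>, c)"
      "L = cech_class X F n (\<U>, d)" using two[OF KL] by blast
    then have U: "open_cover X \<U>" by (simp add: cech_reps_iff)
    interpret G: comm_group "cochain_group F \<U> n" by (rule cochain_comm_group[OF U])
    have "cmult F \<U> n c d = cmult F \<U> n d c" unfolding mult_cochain_group[symmetric]
      using c(1,2) by (intro G.m_comm) (auto simp: cech_reps_iff cocycles_def carrier_cochain_group)
    then show ?thesis using mult_class[OF c(1,2)] mult_class[OF c(2,1)] c(3,4) by simp
  qed
  show "\<one>\<^bsub>cohom X F n\<^esub> \<otimes>\<^bsub>cohom X F n\<^esub> K = K" if K: "K \<in> carrier (cohom X F n)" for K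
  proof -
    obtain \<U> c where c: "(\<U>, c) \<in> cech_reps X F n" "K = cech_class X F n (\<U>, c)"
      using K by (rule carrier_cohomE)
    then have U: "open_cover X \<U>" by (simp add: cech_reps_iff)
    interpret G: comm_group "cochain_group F \<U> n" by (rule cochain_comm_group[OF U])
    have "cmult F \<U> n (cone F \<U> n) c = c" unfolding mult_cochain_group[symmetric] one_cochain_group[symmetric]
      using c(1) by (intro G.l_one) (auto simp: cech_reps_iff cocycles_def carrier_cochain_group)
    moreover have "(\<U>, cone F \<U> n) \<in> cech_reps X F n" using U cone_cocycle[OF U] by (simp add: cech_reps_iff)
    ultimately show ?thesis using mult_class[OF _ c(1)] one_class[OF U] c(2) by metis
  qed
  show "\<exists>L\<in>carrier (cohom X F n). L \<otimes>\<^bsub>cohom X F n\<^esub> K = \<one>\<^bsub>cohom X F n\<^esub>" if K: "K \<in> carrier (cohom X F n)" for K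
  proof -
    obtain \<U> c where c: "(\<U>, c) \<in> cech_reps X F n" "K = cech_class X F n (\<U>, c)"
      using K by (rule carrier_cohomE)
    then have U: "open_cover X \<U>" and c': "c \<in> cocycles F \<U> n" by (simp_all add: cech_reps_iff)
    interpret G: comm_group "cochain_group F \<U> n" by (rule cochain_comm_group[OF U])
    let ?i = "inv\<^bsub>cochain_group F \<U> n\<^esub> c"
    have i: "(\<U>, ?i) \<in> cech_reps X F n"
      using U subgroup.m_inv_closed[OF subgroup_cocycles[OF U] c'] by (simp add: cech_reps_iff)
    have "cmult F \<U> n ?i c = cone F \<U> n" unfolding mult_cochain_group[symmetric] one_cochain_group[symmetric]
      using c(1) by (intro G.l_inv) (auto simp: cech_reps_iff cocycles_def carrier_cochain_group)
    then have "cech_class X F n (\<U>, ?i) \<otimes>\<^bsub>cohom X F n\<^esub> K = \<one>\<^bsub>cohom X F n\<^esub>"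
      using mult_class[OF i c(1)] one_class[OF U] c(2) by simp
    then show ?thesis using class_in_cohom[OF i] by blast
  qed
  show "K \<otimes>\<^bsub>cohom X F n\<^esub> L \<otimes>\<^bsub>cohom X F n\<^esub> M = K \<otimes>\<^bsub>cohom X F n\<^esub> (L \<otimes>\<^bsub>cohom X F n\<^esub> M)"
    if KLM: "K \<in> carrier (cohom X F n)" "L \<in> carrier (cohom X F n)" "M \<in> carrier (cohom X F n)" for K L M
  proof -
    obtain \<U> c d where c: "(\<U>, c) \<in> cech_reps X F n" "(\<U>, d) \<in> cech_reps X F n" "K = cech_class X F n (\<U>, c)"
      "L = cech_class X F n (\<U>, d)" using two[OF KLM(1,2)] by blast
    then have U: "open_cover X \<U>" by (simp add: cech_reps_iff)
    obtain \<V> \<nu> e where V: "open_cover X \<V>" "refinement \<nu> \<V> \<U>" "(\<V>, e) \<in> cech_reps X F n" "M = cech_class X F n (\<V>, e)"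
      by (rule cohom_common_cover[OF KLM(3) U])
    let ?c = "pullback F \<nu> \<V> n c" and ?d = "pullback F \<nu> \<V> n d"
    have cd: "(\<V>, ?c) \<in> cech_reps X F n" "(\<V>, ?d) \<in> cech_reps X F n" "K = cech_class X F n (\<V>, ?c)" "L = cech_class X F n (\<V>, ?d)"
      using pullback_rep[OF c(1) V(1,2)] pullback_rep[OF c(2) V(1,2)] c(3,4) by auto
    interpret G: comm_group "cochain_group F \<V> n" by (rule cochain_comm_group[OF V(1)])
    have "cmult F \<V> n (cmult F \<V> n ?c ?d) e = cmult F \<V> n ?c (cmult F \<V> n ?d e)" unfolding mult_cochain_group[symmetric]
      using cd(1,2) V(3) by (intro G.m_assoc) (auto simp: cech_reps_iff cocycles_def carrier_cochain_group)
    then show ?thesis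
      using mult_class[OF cd(1,2)] mult_class[OF mult_rep[OF cd(1,2)] V(3)] mult_class[OF cd(2) V(3)]
        mult_class[OF cd(1) mult_rep[OF cd(2) V(3)]] cd(3,4) V(4) by simp
  qed
qed

end

section \<open>Lifting cochains along a surjection of sheaves\<close>

locale presheaf_morphism = F: ab_presheaf X F + G: ab_presheaf X G
  for X :: "'a topology" and F :: "('a, 'g) gsheaf" and G :: "('a, 'h) gsheaf" +
  fixes f :: "'a set \<Rightarrow> 'g \<Rightarrow> 'h"
  assumes map_hom: "openin X U \<Longrightarrow> f U \<in> hom (sec F U) (sec G U)"
    and map_res: "openin X U \<Longrightarrow> openin X V \<Longrightarrow> V \<subseteq> U \<Longrightarrow> s \<in> carrier (sec F U) \<Longrightarrow>
      res G U V (f U s) = f V (res F U V s)"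
begin

lemma cmap_closed:
  assumes U: "open_cover X \<U>" and c: "c \<in> cochains F \<U> n"
  shows "cmap f \<U> n c \<in> cochains G \<U> n"
  using c hom_in_carrier[OF map_hom[OF openin_simplex[OF U]]]
  by (simp add: cmap_def cochains_def PiE_iff)

lemma rval_cmap:
  assumes U: "open_cover X \<U>" and c: "c \<in> cochains F \<U> n" and l: "l \<in> simplices \<U> n"
    and S: "openin X S" "S \<subseteq> \<Inter>(set l)"
  shows "rval G (cmap f \<U> n c) l S = f S (rval F c l S)"
  using map_res[OF openin_simplex[OF U l] S] c l by (simp add: rval_def cmap_def cochains_def PiE_iff)

lemma cmap_hom:
  assumes U: "open_cover X \<U>"
  shows "cmap f \<U> n \<in> hom (cochain_group F \<U> n) (cochain_group G \<U> n)"
proof (rule homI, unfold carrier_cochain_group mult_cochain_group)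
  show "cmap f \<U> n c \<in> cochains G \<U> n" if "c \<in> cochains F \<U> n" for c by (rule cmap_closed[OF U that])
  fix c d assume cd: "c \<in> cochains F \<U> n" "d \<in> cochains F \<U> n"
  show "cmap f \<U> n (cmult F \<U> n c d) = cmult G \<U> n (cmap f \<U> n c) (cmap f \<U> n d)"
    unfolding cmap_def[of f \<U> n "cmult F \<U> n c d"] cmult_def[of G]
  proof (rule restrict_ext)
    fix l assume l: "l \<in> simplices \<U> n"
    then show "f (\<Inter>(set l)) (cmult F \<U> n c d l) = cmap f \<U> n c l \<otimes>\<^bsub>sec G (\<Inter>(set l))\<^esub> cmap f \<U> n d l"
      using hom_mult[OF map_hom[OF openin_simplex[OF U l]]] cd by (simp add: cmult_def cmap_def cochains_def PiE_iff)
  qed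
qed

lemma cmap_mult:
  assumes U: "open_cover X \<U>" and "c \<in> cochains F \<U> n" "d \<in> cochains F \<U> n"
  shows "cmap f \<U> n (cmult F \<U> n c d) = cmult G \<U> n (cmap f \<U> n c) (cmap f \<U> n d)"
  using hom_mult[OF cmap_hom[OF U]] assms(2,3) by (simp add: carrier_cochain_group mult_cochain_group)

lemma cmap_cone:
  assumes U: "open_cover X \<U>" shows "cmap f \<U> n (cone F \<U> n) = cone G \<U> n"
  using hom_one[OF cmap_hom[OF U]] F.cochain_group_group[OF U] G.cochain_group_group[OF U]
  by (simp add: one_cochain_group)

lemma cmap_pullback:
  assumes U: "open_cover X \<U>" and W: "open_cover X \<W>" and r: "refinement \<rho> \<W> \<U>"
    and c: "c \<in> cochains F \<U> n"
  shows "cmap f \<W> n (pullback F \<rho> \<W> n c) = pullback G \<rho> \<W> n (cmap f \<U> n c)"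
proof (rule G.cochain_eqI[OF W])
  note p = F.pullback_closed[OF U W r c] and q = cmap_closed[OF U c]
  show "cmap f \<W> n (pullback F \<rho> \<W> n c) \<in> cochains G \<W> n" by (rule cmap_closed[OF W p])
  show "pullback G \<rho> \<W> n (cmap f \<U> n c) \<in> cochains G \<W> n" by (rule G.pullback_closed[OF U W r q])
  fix l assume l: "l \<in> simplices \<W> n"
  note o = openin_simplex[OF W l]
  show "rval G (cmap f \<W> n (pullback F \<rho> \<W> n c)) l (\<Inter>(set l)) =
      rval G (pullback G \<rho> \<W> n (cmap f \<U> n c)) l (\<Inter>(set l))"
    unfolding rval_cmap[OF W p l o subset_refl] F.rval_pullback[OF U W r c l o subset_refl]
      G.rval_pullback[OF U W r q l o subset_refl]
      rval_cmap[OF U c map_in_simplices[OF r l] o Inter_map_subset[OF r l]] ..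
qed

lemma cmap_cobdry:
  assumes U: "open_cover X \<U>" and c: "c \<in> cochains F \<U> n"
  shows "cmap f \<U> (Suc n) (cobdry F \<U> n c) = cobdry G \<U> n (cmap f \<U> n c)"
  unfolding cmap_def[of f \<U> "Suc n"] cobdry_def
proof (rule restrict_ext)
  fix l assume l: "l \<in> simplices \<U> (Suc n)"
  let ?S = "\<Inter>(set l)"
  note o = openin_simplex[OF U l]
  interpret SF: comm_group "sec F ?S" by (rule F.sec_comm_group[OF o])
  interpret SG: comm_group "sec G ?S" by (rule G.sec_comm_group[OF o])
  note h = map_hom[OF o]
  have cl: "face_res F c l k \<in> carrier (sec F ?S)" if "k \<le> Suc n" for k by (rule F.face_res_closed[OF U c l that])
  have fr: "face_res G (cmap f \<U> n c) l k = f ?S (face_res F c l k)" if "k \<le> Suc n" for k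
    unfolding face_res_rval by (rule rval_cmap[OF U c face_in_simplices[OF l that] o Inter_face_subset])
  have "f ?S (finprod (sec F ?S) (\<lambda>k. if even k then face_res F c l k else inv\<^bsub>sec F ?S\<^esub> face_res F c l k) {..Suc n}) =
      finprod (sec G ?S) (\<lambda>k. f ?S (if even k then face_res F c l k else inv\<^bsub>sec F ?S\<^esub> face_res F c l k)) {..Suc n}"
    using cl by (intro hom_finprod[OF SF.comm_group_axioms SG.comm_group_axioms h]) auto
  also have "\<dots> = finprod (sec G ?S) (\<lambda>k. if even k then face_res G (cmap f \<U> n c) l k
      else inv\<^bsub>sec G ?S\<^esub> face_res G (cmap f \<U> n c) l k) {..Suc n}"
    using cl fr hom_in_carrier[OF h] hom_m_inv[OF SF.group_axioms SG.group_axioms h]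
    by (intro SG.finprod_cong') auto
  finally show "f ?S ((\<lambda>l\<in>simplices \<U> (Suc n). finprod (sec F (\<Inter>(set l))) (\<lambda>k. if even k then face_res F c l k
        else inv\<^bsub>sec F (\<Inter>(set l))\<^esub> face_res F c l k) {..Suc n}) l) =
     finprod (sec G ?S) (\<lambda>k. if even k then face_res G (cmap f \<U> n c) l k
        else inv\<^bsub>sec G ?S\<^esub> face_res G (cmap f \<U> n c) l k) {..Suc n}"
    unfolding restrict_apply'[OF l] .
qed

end

locale short_exact_sheaves =
  f: presheaf_morphism X A B f + g: presheaf_morphism X B C g
  for X :: "'a topology" and A :: "('a, 'g) gsheaf" and B :: "('a, 'h) gsheaf" and C :: "('a, 'k) gsheaf"
    and f :: "'a set \<Rightarrow> 'g \<Rightarrow> 'h" and g :: "'a set \<Rightarrow> 'h \<Rightarrow> 'k" +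
  assumes f_inj: "openin X U \<Longrightarrow> inj_on (f U) (carrier (sec A U))"
    and exact: "openin X U \<Longrightarrow> b \<in> carrier (sec B U) \<Longrightarrow> g U b = \<one>\<^bsub>sec C U\<^esub> \<Longrightarrow> b \<in> f U ` carrier (sec A U)"
    and locally_surj: "openin X U \<Longrightarrow> c \<in> carrier (sec C U) \<Longrightarrow> x \<in> U \<Longrightarrow>
      \<exists>V b. openin X V \<and> x \<in> V \<and> V \<subseteq> U \<and> b \<in> carrier (sec B V) \<and> g V b = res C U V c"
    and sec_empty: "c \<in> carrier (sec C {}) \<Longrightarrow> c = \<one>\<^bsub>sec C {}\<^esub>"
    and regular: "regular_space X" and Lindelof: "Lindelof_space X"
begin

text \<open>The data from which the connecting map is read off: a lift \<open>b\<close> of the cocycle \<open>c\<close>, and the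
  cocycle \<open>a\<close> that its coboundary comes from.\<close>

definition lift_data :: "nat \<Rightarrow> 'a set set \<Rightarrow> ('a, 'k) cochain \<Rightarrow> ('a, 'h) cochain \<Rightarrow> ('a, 'g) cochain \<Rightarrow> bool" where
  "lift_data n \<U> c b a \<longleftrightarrow> open_cover X \<U> \<and> c \<in> cocycles C \<U> n \<and> b \<in> cochains B \<U> n \<and> cmap g \<U> n b = c \<and>
     a \<in> cocycles A \<U> (Suc n) \<and> cmap f \<U> (Suc n) a = cobdry B \<U> n b"

lemma cmap_f_inj:
  assumes U: "open_cover X \<U>" and a: "a \<in> cochains A \<U> n" "a' \<in> cochains A \<U> n"
    and eq: "cmap f \<U> n a = cmap f \<U> n a'"
  shows "a = a'"
proof (rule ext)
  fix l show "a l = a' l"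
  proof (cases "l \<in> simplices \<U> n")
    case True
    have "f (\<Inter>(set l)) (a l) = f (\<Inter>(set l)) (a' l)" using fun_cong[OF eq, of l] True by (simp add: cmap_def)
    then show ?thesis using inj_onD[OF f_inj[OF openin_simplex[OF U True]]] a True by (simp add: cochains_def PiE_iff)
  next
    case False
    then show ?thesis using a by (auto simp: cochains_def PiE_def extensional_def)
  qed
qed

lemma cmap_exact:
  assumes U: "open_cover X \<U>" and b: "b \<in> cochains B \<U> n" and gb: "cmap g \<U> n b = cone C \<U> n"
  obtains a where "a \<in> cochains A \<U> n" "cmap f \<U> n a = b"
proof -
  have "\<forall>l\<in>simplices \<U> n. \<exists>s. s \<in> carrier (sec A (\<Inter>(set l))) \<and> f (\<Inter>(set l)) s = b l"
  proof
    fix l assume l: "l \<in> simplices \<U> n"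
    have "g (\<Inter>(set l)) (b l) = \<one>\<^bsub>sec C (\<Inter>(set l))\<^esub>" using fun_cong[OF gb, of l] l by (simp add: cmap_def cone_def)
    moreover have "b l \<in> carrier (sec B (\<Inter>(set l)))" using b l by (simp add: cochains_def PiE_iff)
    ultimately have "b l \<in> f (\<Inter>(set l)) ` carrier (sec A (\<Inter>(set l)))"
      using exact[OF openin_simplex[OF U l]] by blast
    then show "\<exists>s. s \<in> carrier (sec A (\<Inter>(set l))) \<and> f (\<Inter>(set l)) s = b l" by auto
  qed
  then obtain s where s: "\<And>l. l \<in> simplices \<U> n \<Longrightarrow> s l \<in> carrier (sec A (\<Inter>(set l))) \<and> f (\<Inter>(set l)) (s l) = b l"
    by metis
  show thesis
  proof (rule that)
    show "restrict s (simplices \<U> n) \<in> cochains A \<U> n" using s by (auto simp: cochains_def)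
    show "cmap f \<U> n (restrict s (simplices \<U> n)) = b"
    proof (rule ext)
      fix l show "cmap f \<U> n (restrict s (simplices \<U> n)) l = b l"
        using s b by (cases "l \<in> simplices \<U> n") (auto simp: cmap_def cochains_def PiE_iff extensional_def)
    qed
  qed
qed

lemma lift_data_exists:
  assumes U: "open_cover X \<U>" and c: "c \<in> cocycles C \<U> n" and b: "b \<in> cochains B \<U> n" and gb: "cmap g \<U> n b = c"
    and dd: "cobdry B \<U> (Suc n) (cobdry B \<U> n b) = cone B \<U> (Suc (Suc n))"
  obtains a where "lift_data n \<U> c b a"
proof -
  note db = f.G.cobdry_closed[OF U b]
  have "cmap g \<U> (Suc n) (cobdry B \<U> n b) = cone C \<U> (Suc n)"
    using g.cmap_cobdry[OF U b] c gb by (simp add: cocycles_def)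
  then obtain a where a: "a \<in> cochains A \<U> (Suc n)" "cmap f \<U> (Suc n) a = cobdry B \<U> n b"
    by (rule cmap_exact[OF U db])
  have "cmap f \<U> (Suc (Suc n)) (cobdry A \<U> (Suc n) a) = cmap f \<U> (Suc (Suc n)) (cone A \<U> (Suc (Suc n)))"
    using f.cmap_cobdry[OF U a(1)] a(2) dd f.cmap_cone[OF U] by simp
  then have "cobdry A \<U> (Suc n) a = cone A \<U> (Suc (Suc n))"
    by (rule cmap_f_inj[OF U f.F.cobdry_closed[OF U a(1)] f.F.cone_closed[OF U]])
  then show thesis using that U c b gb a by (simp add: lift_data_def cocycles_def)
qed

lemma lift_data_pullback:
  assumes D: "lift_data n \<U> c b a" and W: "open_cover X \<W>" "refinement \<rho> \<W> \<U>"
  shows "lift_data n \<W> (pullback C \<rho> \<W> n c) (pullback B \<rho> \<W> n b) (pullback A \<rho> \<W> (Suc n) a)"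
proof -
  have U: "open_cover X \<U>" and c: "c \<in> cocycles C \<U> n" and b: "b \<in> cochains B \<U> n" and a: "a \<in> cocycles A \<U> (Suc n)"
    using D by (auto simp: lift_data_def)
  note a0 = f.F.cocycles_cochains[OF a]
  show ?thesis
    using W(1) g.G.pullback_cocycles[OF U W c] f.G.pullback_closed[OF U W b] f.F.pullback_cocycles[OF U W a]
      g.cmap_pullback[OF U W b] f.cmap_pullback[OF U W a0] f.G.cobdry_pullback[OF U W b] D
    by (simp add: lift_data_def)
qed

text \<open>The lift \<open>b\<close> is \<open>b'\<close> times \<open>x\<close> times the image of a cochain of \<open>A\<close>. As \<open>x\<close> has trivial
  coboundary, \<open>a\<close> and \<open>a'\<close> differ by the coboundary of the latter.\<close>

lemma lift_data_same_cover:
  assumes D: "lift_data n \<U> c b a" and D': "lift_data n \<U> c' b' a'"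
    and x: "x \<in> cochains B \<U> n" "cobdry B \<U> n x = cone B \<U> (Suc n)" and c: "c = cmult C \<U> n c' (cmap g \<U> n x)"
  shows "cohomologous A (Suc n) \<U> a a'"
proof -
  have U: "open_cover X \<U>" and b: "b \<in> cochains B \<U> n" "b' \<in> cochains B \<U> n"
    and a: "a \<in> cochains A \<U> (Suc n)" "a' \<in> cochains A \<U> (Suc n)"
    and gb: "cmap g \<U> n b = c" "cmap g \<U> n b' = c'"
    and fa: "cmap f \<U> (Suc n) a = cobdry B \<U> n b" "cmap f \<U> (Suc n) a' = cobdry B \<U> n b'"
    using D D' by (auto simp: lift_data_def cocycles_def)
  interpret GA: comm_group "cochain_group A \<U> (Suc n)" by (rule f.F.cochain_comm_group[OF U])
  interpret GB: comm_group "cochain_group B \<U> n" by (rule f.G.cochain_comm_group[OF U])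
  interpret GC: comm_group "cochain_group C \<U> n" by (rule g.G.cochain_comm_group[OF U])
  interpret GB': comm_group "cochain_group B \<U> (Suc n)" by (rule f.G.cochain_comm_group[OF U])
  let ?y = "cmult B \<U> n b' x"
  note y = GB.m_closed[OF b(2)[folded carrier_cochain_group] x(1)[folded carrier_cochain_group],
      unfolded mult_cochain_group]
  let ?q = "inv\<^bsub>cochain_group B \<U> n\<^esub> ?y \<otimes>\<^bsub>cochain_group B \<U> n\<^esub> b"
  note bb = b[folded carrier_cochain_group]
  have q: "?q \<in> cochains B \<U> n" using GB.m_closed[OF GB.inv_closed[OF y] bb(1)] by (simp add: carrier_cochain_group)
  note hg = g.cmap_hom[OF U, of n]
  have gy: "cmap g \<U> n ?y = c" using g.cmap_mult[OF U b(2) x(1)] gb c by simp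
  have "cmap g \<U> n ?q = \<one>\<^bsub>cochain_group C \<U> n\<^esub>"
    using hom_mult[OF hg GB.inv_closed[OF y] bb(1)] hom_m_inv[OF GB.group_axioms GC.group_axioms hg y] gy gb(1)
      hom_in_carrier[OF hg bb(1)] by simp
  then obtain a2 where a2: "a2 \<in> cochains A \<U> n" "cmap f \<U> n a2 = ?q"
    by (metis cmap_exact[OF U q] one_cochain_group)
  have bq: "b = cmult B \<U> n ?y ?q" unfolding mult_cochain_group[symmetric]
    using y bb by (simp add: GB.m_assoc[symmetric] mult_cochain_group[symmetric])
  have dy: "cobdry B \<U> n ?y = cobdry B \<U> n b'"
    using hom_mult[OF f.G.cobdry_hom[OF U] bb(2) x(1)[folded carrier_cochain_group]] x(2)
      hom_in_carrier[OF f.G.cobdry_hom[OF U] bb(2)]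
    by (simp add: mult_cochain_group[symmetric] one_cochain_group[symmetric])
  note da2 = f.F.cobdry_closed[OF U a2(1)]
  have "cobdry B \<U> n b = cmult B \<U> (Suc n) (cobdry B \<U> n ?y) (cobdry B \<U> n ?q)"
    using bq hom_mult[OF f.G.cobdry_hom[OF U] y q[folded carrier_cochain_group]] by (simp add: mult_cochain_group)
  also have "\<dots> = cmap f \<U> (Suc n) (cmult A \<U> (Suc n) a' (cobdry A \<U> n a2))"
    unfolding f.cmap_mult[OF U a(2) da2] dy fa(2) f.cmap_cobdry[OF U a2(1)] a2(2) ..
  finally have "cmap f \<U> (Suc n) a = cmap f \<U> (Suc n) (cmult A \<U> (Suc n) a' (cobdry A \<U> n a2))" by (simp add: fa)
  moreover have "cmult A \<U> (Suc n) a' (cobdry A \<U> n a2) \<in> cochains A \<U> (Suc n)"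
    using GA.m_closed a(2) da2 by (simp add: mult_cochain_group carrier_cochain_group)
  ultimately have "a = cmult A \<U> (Suc n) a' (cobdry A \<U> n a2)" by (rule cmap_f_inj[OF U a(1), rotated])
  then show ?thesis unfolding cohomologous_def coboundaries_def using a2(1) by auto
qed

lemma lift_0_cochain:
  assumes U: "open_cover X \<U>" and c: "c \<in> cochains C \<U> 0"
  obtains \<W> \<rho> b where "open_cover X \<W>" "refinement \<rho> \<W> \<U>" "b \<in> cochains B \<W> 0" "cmap g \<W> 0 b = pullback C \<rho> \<W> 0 c"
proof -
  have "\<exists>N. openin X N \<and> x \<in> N \<and> N \<subseteq> U \<and> (\<exists>b\<in>carrier (sec B N). g N b = res C U N (c [U]))"
    if "U \<in> \<U>" "x \<in> U" for U x
  proof -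
    have "c [U] \<in> carrier (sec C (\<Inter>(set [U])))"
      using that c unfolding cochains_def by (intro PiE_mem[of c]) (auto simp: simplices_def)
    moreover have "openin X U" using that U by (simp add: open_cover_def)
    ultimately show ?thesis using locally_surj[of U "c [U]" x] that by (simp add: Bex_def)
  qed
  then obtain \<W> \<rho> where W: "open_cover X \<W>" "refinement \<rho> \<W> \<U>"
      "\<And>W. W \<in> \<W> \<Longrightarrow> \<exists>b\<in>carrier (sec B W). g W b = res C (\<rho> W) W (c [\<rho> W])"
    using refinement_by_local_property[OF U, of "\<lambda>U N. \<exists>b\<in>carrier (sec B N). g N b = res C U N (c [U])"] by blast
  then obtain s where s: "\<And>W. W \<in> \<W> \<Longrightarrow> s W \<in> carrier (sec B W) \<and> g W (s W) = res C (\<rho> W) W (c [\<rho> W])"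
    by metis
  show thesis
  proof (rule that[OF W(1,2)])
    show "(\<lambda>l\<in>simplices \<W> 0. s (hd l)) \<in> cochains B \<W> 0" unfolding cochains_def
      by (rule restrict_PiE_iff[THEN iffD2]) (auto simp: s elim!: simplices_0_cases)
    show "cmap g \<W> 0 (\<lambda>l\<in>simplices \<W> 0. s (hd l)) = pullback C \<rho> \<W> 0 c"
      unfolding cmap_def pullback_def by (rule restrict_ext) (auto simp: s elim!: simplices_0_cases)
  qed
qed

text \<open>In degree 1 the lifts are needed on the pairwise intersections of the members of a cover, and it is
  here that the topology of \<open>X\<close> enters.\<close>

lemma lift_1_cochain:
  assumes U: "open_cover X \<U>" and c: "c \<in> cochains C \<U> (Suc 0)"
  obtains \<W> \<rho> b where "open_cover X \<W>" "refinement \<rho> \<W> \<U>" "b \<in> cochains B \<W> (Suc 0)"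
    "cmap g \<W> (Suc 0) b = pullback C \<rho> \<W> (Suc 0) c"
proof -
  define P where "P U V N \<longleftrightarrow> openin X N \<and> N \<subseteq> U \<and> N \<subseteq> V \<and> U \<in> \<U> \<and> V \<in> \<U> \<and>
    (\<exists>b\<in>carrier (sec B N). g N b = rval C c [U, V] N)" for U V N
  have l: "[U, V] \<in> simplices \<U> (Suc 0)" if "U \<in> \<U>" "V \<in> \<U>" for U V using that by (auto simp: simplices_def)
  have 1: "\<exists>N. openin X N \<and> x \<in> N \<and> P U V N" if UV: "U \<in> \<U>" "V \<in> \<U>" "x \<in> U" "x \<in> V" for U V x
  proof -
    note l = l[OF UV(1,2)]
    have o: "openin X (U \<inter> V)" using openin_simplex[OF U l] by simp
    have "c [U, V] \<in> carrier (sec C (U \<inter> V))" using c l by (force simp: cochains_def PiE_iff)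
    then obtain N b where "openin X N" "x \<in> N" "N \<subseteq> U \<inter> V" "b \<in> carrier (sec B N)" "g N b = res C (U \<inter> V) N (c [U, V])"
      using locally_surj[OF o] UV(3,4) by blast
    then show ?thesis using UV unfolding P_def rval_def by auto
  qed
  have 2: "P U V N'" if P: "P U V N" and N': "openin X N'" "N' \<subseteq> N" for U V N N'
  proof -
    have N: "openin X N" "N \<subseteq> \<Inter>(set [U, V])" and UV: "U \<in> \<U>" "V \<in> \<U>" using P by (auto simp: P_def)
    obtain b where b: "b \<in> carrier (sec B N)" "g N b = rval C c [U, V] N" using P by (auto simp: P_def)
    have "g N' (res B N N' b) = rval C c [U, V] N'"
      using g.map_res[OF N(1) N' b(1)] g.G.res_rval[OF U c l[OF UV] N N'] b(2) by simp
    moreover have "res B N N' b \<in> carrier (sec B N')" by (rule hom_in_carrier[OF f.G.res_hom[OF N(1) N'] b(1)])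
    ultimately show ?thesis using P N' unfolding P_def by blast
  qed
  have 3: "P U V {}" if UV: "U \<in> \<U>" "V \<in> \<U>" for U V
  proof -
    have o: "openin X {}" by simp
    have "rval C c [U, V] {} = \<one>\<^bsub>sec C {}\<^esub>"
      by (intro sec_empty g.G.rval_closed[OF U c l[OF UV]]) auto
    then have "g {} \<one>\<^bsub>sec B {}\<^esub> = rval C c [U, V] {}"
      using hom_one[OF g.map_hom[OF o]] f.G.sec_group[OF o] g.G.sec_group[OF o] by simp
    moreover have "\<one>\<^bsub>sec B {}\<^esub> \<in> carrier (sec B {})" using f.G.sec_group[OF o] by (simp add: group.is_monoid)
    ultimately show ?thesis using UV unfolding P_def by auto
  qed
  have "\<exists>\<W> \<rho>. open_cover X \<W> \<and> refinement \<rho> \<W> \<U> \<and> (\<forall>W\<in>\<W>. \<forall>W'\<in>\<W>. P (\<rho> W) (\<rho> W') (W \<inter> W'))"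
  proof (rule refinement_adapted_to_pairs[where P = P, OF regular Lindelof U], erule (3) 1, erule (2) 2, erule (1) 3)
    fix \<W> \<rho> assume "open_cover X \<W>" "refinement \<rho> \<W> \<U>"
      "\<And>W W'. W \<in> \<W> \<Longrightarrow> W' \<in> \<W> \<Longrightarrow> P (\<rho> W) (\<rho> W') (W \<inter> W')"
    then show ?thesis by auto
  qed
  then obtain \<W> \<rho> where W: "open_cover X \<W>" "refinement \<rho> \<W> \<U>"
      "\<forall>W\<in>\<W>. \<forall>W'\<in>\<W>. P (\<rho> W) (\<rho> W') (W \<inter> W')" by (elim exE conjE)
  then have "\<forall>W W'. \<exists>b. W \<in> \<W> \<longrightarrow> W' \<in> \<W> \<longrightarrow>
      b \<in> carrier (sec B (W \<inter> W')) \<and> g (W \<inter> W') b = rval C c [\<rho> W, \<rho> W'] (W \<inter> W')" unfolding P_def by blast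
  then obtain s where s: "\<And>W W'. W \<in> \<W> \<Longrightarrow> W' \<in> \<W> \<Longrightarrow>
      s W W' \<in> carrier (sec B (W \<inter> W')) \<and> g (W \<inter> W') (s W W') = rval C c [\<rho> W, \<rho> W'] (W \<inter> W')" by metis
  show thesis
  proof (rule that[OF W(1,2)])
    show "(\<lambda>l\<in>simplices \<W> (Suc 0). s (l ! 0) (l ! 1)) \<in> cochains B \<W> (Suc 0)" unfolding cochains_def
      by (rule restrict_PiE_iff[THEN iffD2]) (auto simp: s elim!: simplices_1_cases[unfolded One_nat_def])
    show "cmap g \<W> (Suc 0) (\<lambda>l\<in>simplices \<W> (Suc 0). s (l ! 0) (l ! 1)) = pullback C \<rho> \<W> (Suc 0) c"
      unfolding cmap_def pullback_def
      by (rule restrict_ext) (auto simp: s rval_def elim!: simplices_1_cases[unfolded One_nat_def])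
  qed
qed

end

section \<open>The connecting maps\<close>

context short_exact_sheaves
begin

sublocale H0C: cech_degree X C 0
  by unfold_locales (rule g.G.refinement_independent_0)

sublocale H1C: cech_degree X C "Suc 0"
  by unfold_locales (rule g.G.refinement_independent_1[unfolded One_nat_def])

sublocale H1A: cech_degree X A "Suc 0"
  by unfold_locales (rule f.F.refinement_independent_1[unfolded One_nat_def])

sublocale H2A: cech_degree X A "Suc (Suc 0)"
  by unfold_locales (rule f.F.refinement_independent_2[unfolded numeral_2_eq_2])

lemma lift_data_reps:
  assumes "lift_data n \<U> c b a"
  shows "(\<U>, c) \<in> cech_reps X C n" "(\<U>, a) \<in> cech_reps X A (Suc n)"
  using assms by (auto simp: lift_data_def cech_reps_iff)

text \<open>On a fine cover \<open>c\<close> and \<open>c'\<close> differ by a coboundary \<open>\<delta>e\<close>, and \<open>e\<close> lifts to a cochain \<open>x\<close> of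
  \<open>B\<close>. Then \<open>\<delta>x\<close> is a lift of \<open>\<delta>e\<close> with trivial coboundary.\<close>

lemma lift_data_class_unique:
  assumes D: "lift_data (Suc 0) \<U> c b a" and D': "lift_data (Suc 0) \<V> c' b' a'"
    and eq: "cech_class X C (Suc 0) (\<U>, c) = cech_class X C (Suc 0) (\<V>, c')"
  shows "cech_class X A (Suc (Suc 0)) (\<U>, a) = cech_class X A (Suc (Suc 0)) (\<V>, a')"
proof -
  note r = lift_data_reps[OF D] and r' = lift_data_reps[OF D']
  have U: "open_cover X \<U>" and V: "open_cover X \<V>" using D D' by (auto simp: lift_data_def)
  have c: "c \<in> cochains C \<U> (Suc 0)" and c': "c' \<in> cochains C \<V> (Suc 0)"
    using D D' by (auto simp: lift_data_def cocycles_def)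
  obtain \<S> \<rho> \<sigma> where S: "open_cover X \<S>" "refinement \<rho> \<S> \<U>" "refinement \<sigma> \<S> \<V>"
      and coh: "cohomologous C (Suc 0) \<S> (pullback C \<rho> \<S> (Suc 0) c) (pullback C \<sigma> \<S> (Suc 0) c')"
    by (rule H1C.class_eqE[OF r(1) r'(1) eq])
  obtain e where e: "e \<in> cochains C \<S> 0"
      and ce: "pullback C \<rho> \<S> (Suc 0) c = cmult C \<S> (Suc 0) (pullback C \<sigma> \<S> (Suc 0) c') (cobdry C \<S> 0 e)"
    using coh unfolding cohomologous_def coboundaries_def by auto
  obtain \<W> \<tau> x where W: "open_cover X \<W>" "refinement \<tau> \<W> \<S>"
      and x: "x \<in> cochains B \<W> 0" "cmap g \<W> 0 x = pullback C \<tau> \<W> 0 e"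
    by (rule lift_0_cochain[OF S(1) e])
  note R = refinement_comp[OF W(2) S(2)] and R' = refinement_comp[OF W(2) S(3)]
  note DW = lift_data_pullback[OF D W(1) R] and DW' = lift_data_pullback[OF D' W(1) R']
  note dx = f.G.cobdry_closed[OF W(1) x(1)]
  have "pullback C (\<rho> \<circ> \<tau>) \<W> (Suc 0) c = pullback C \<tau> \<W> (Suc 0) (pullback C \<rho> \<S> (Suc 0) c)"
    by (rule g.G.pullback_pullback[OF U S(1) W(1) S(2) W(2) c, symmetric])
  also have "\<dots> = cmult C \<W> (Suc 0) (pullback C \<tau> \<W> (Suc 0) (pullback C \<sigma> \<S> (Suc 0) c'))
      (pullback C \<tau> \<W> (Suc 0) (cobdry C \<S> 0 e))"
    unfolding ce by (rule g.G.pullback_mult[OF S(1) W g.G.pullback_closed[OF V S(1,3) c'] g.G.cobdry_closed[OF S(1) e]])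
  also have "\<dots> = cmult C \<W> (Suc 0) (pullback C (\<sigma> \<circ> \<tau>) \<W> (Suc 0) c') (cmap g \<W> (Suc 0) (cobdry B \<W> 0 x))"
    unfolding g.G.pullback_pullback[OF V S(1) W(1) S(3) W(2) c'] g.G.cobdry_pullback[OF S(1) W e, symmetric]
      g.cmap_cobdry[OF W(1) x(1)] x(2) ..
  finally have "cohomologous A (Suc (Suc 0)) \<W> (pullback A (\<rho> \<circ> \<tau>) \<W> (Suc (Suc 0)) a) (pullback A (\<sigma> \<circ> \<tau>) \<W> (Suc (Suc 0)) a')"
    by (rule lift_data_same_cover[OF DW DW' dx f.G.cobdry_cobdry_0[OF W(1) x(1), unfolded One_nat_def numeral_2_eq_2]])
  then show ?thesis
    using H2A.class_eq_if_cohomologous[OF H2A.pullback_rep(1)[OF r(2) W(1) R] H2A.pullback_rep(1)[OF r'(2) W(1) R']]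
      H2A.pullback_rep(2)[OF r(2) W(1) R] H2A.pullback_rep(2)[OF r'(2) W(1) R'] by simp
qed

lemma connecting_1_eq:
  assumes D: "lift_data (Suc 0) \<U> c b a"
  shows "connecting X A B C f g (Suc 0) (cech_class X C (Suc 0) (\<U>, c)) = cech_class X A (Suc (Suc 0)) (\<U>, a)"
  unfolding connecting_def
proof (rule the_equality)
  note r = lift_data_reps[OF D]
  show "\<exists>\<U>' c' b a'. (\<U>', c') \<in> cech_class X C (Suc 0) (\<U>, c) \<and> b \<in> cochains B \<U>' (Suc 0) \<and> cmap g \<U>' (Suc 0) b = c' \<and>
      a' \<in> cocycles A \<U>' (Suc (Suc 0)) \<and> cmap f \<U>' (Suc (Suc 0)) a' = cobdry B \<U>' (Suc 0) b \<and>
      cech_class X A (Suc (Suc 0)) (\<U>, a) = cech_class X A (Suc (Suc 0)) (\<U>', a')"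
    using H1C.self_mem_class[OF r(1)] D unfolding lift_data_def by blast
  fix L assume "\<exists>\<U>' c' b a'. (\<U>', c') \<in> cech_class X C (Suc 0) (\<U>, c) \<and> b \<in> cochains B \<U>' (Suc 0) \<and> cmap g \<U>' (Suc 0) b = c' \<and>
      a' \<in> cocycles A \<U>' (Suc (Suc 0)) \<and> cmap f \<U>' (Suc (Suc 0)) a' = cobdry B \<U>' (Suc 0) b \<and>
      L = cech_class X A (Suc (Suc 0)) (\<U>', a')"
  then obtain \<V> c' b' a' where *: "(\<V>, c') \<in> cech_class X C (Suc 0) (\<U>, c)" "b' \<in> cochains B \<V> (Suc 0)"
      "cmap g \<V> (Suc 0) b' = c'" "a' \<in> cocycles A \<V> (Suc (Suc 0))"
      "cmap f \<V> (Suc (Suc 0)) a' = cobdry B \<V> (Suc 0) b'" "L = cech_class X A (Suc (Suc 0)) (\<V>, a')" by blast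
  have p: "(\<V>, c') \<in> cech_reps X C (Suc 0)" using *(1) by (simp add: mem_cech_class_iff)
  have D': "lift_data (Suc 0) \<V> c' b' a'" using * p by (simp add: lift_data_def cech_reps_iff)
  show "L = cech_class X A (Suc (Suc 0)) (\<U>, a)"
    using lift_data_class_unique[OF D D'] *(1,6) H1C.class_eq_iff[OF r(1) p] by simp
qed

lemma lift_data_1_exists:
  assumes K: "K \<in> carrier (cohom X C (Suc 0))"
  obtains \<U> c b a where "lift_data (Suc 0) \<U> c b a" "K = cech_class X C (Suc 0) (\<U>, c)"
proof -
  obtain \<V> c where c: "(\<V>, c) \<in> cech_reps X C (Suc 0)" "K = cech_class X C (Suc 0) (\<V>, c)"
    using K by (rule H1C.carrier_cohomE)
  then have V: "open_cover X \<V>" and c0: "c \<in> cochains C \<V> (Suc 0)" by (auto simp: cech_reps_iff cocycles_def)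
  obtain \<W> \<rho> b where W: "open_cover X \<W>" "refinement \<rho> \<W> \<V>" "b \<in> cochains B \<W> (Suc 0)"
    "cmap g \<W> (Suc 0) b = pullback C \<rho> \<W> (Suc 0) c" by (rule lift_1_cochain[OF V c0])
  note p = H1C.pullback_rep[OF c(1) W(1,2)]
  have "cobdry B \<W> (Suc (Suc 0)) (cobdry B \<W> (Suc 0) b) = cone B \<W> (Suc (Suc (Suc 0)))"
    by (rule f.G.cobdry_cobdry_1[OF W(1), unfolded One_nat_def numeral_2_eq_2 numeral_3_eq_3, OF W(3)])
  then obtain a where "lift_data (Suc 0) \<W> (pullback C \<rho> \<W> (Suc 0) c) b a"
    using lift_data_exists[OF W(1) _ W(3,4)] p(1) by (auto simp: cech_reps_iff)
  then show thesis using that p(2) c(2) by metis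
qed

theorem connecting_1_hom:
  "connecting X A B C f g (Suc 0) \<in> hom (cohom X C (Suc 0)) (cohom X A (Suc (Suc 0)))"
proof (rule homI)
  fix K assume "K \<in> carrier (cohom X C (Suc 0))"
  then obtain \<U> c b a where D: "lift_data (Suc 0) \<U> c b a" "K = cech_class X C (Suc 0) (\<U>, c)"
    by (rule lift_data_1_exists)
  then show "connecting X A B C f g (Suc 0) K \<in> carrier (cohom X A (Suc (Suc 0)))"
    using connecting_1_eq[OF D(1)] H2A.class_in_cohom[OF lift_data_reps(2)[OF D(1)]] by simp
next
  fix K L assume K: "K \<in> carrier (cohom X C (Suc 0))" and L: "L \<in> carrier (cohom X C (Suc 0))"
  obtain \<U> c b a where D: "lift_data (Suc 0) \<U> c b a" "K = cech_class X C (Suc 0) (\<U>, c)"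
    using K by (rule lift_data_1_exists)
  obtain \<V> c' b' a' where D': "lift_data (Suc 0) \<V> c' b' a'" "L = cech_class X C (Suc 0) (\<V>, c')"
    using L by (rule lift_data_1_exists)
  note r = lift_data_reps[OF D(1)] and r' = lift_data_reps[OF D'(1)]
  have UV: "open_cover X \<U>" "open_cover X \<V>" using D D' by (auto simp: lift_data_def)
  obtain \<W> \<rho> \<sigma> where W: "open_cover X \<W>" "refinement \<rho> \<W> \<U>" "refinement \<sigma> \<W> \<V>"
    by (rule common_refinement[OF UV])
  let ?c = "pullback C \<rho> \<W> (Suc 0) c" and ?c' = "pullback C \<sigma> \<W> (Suc 0) c'"
  let ?b = "pullback B \<rho> \<W> (Suc 0) b" and ?b' = "pullback B \<sigma> \<W> (Suc 0) b'"
  let ?a = "pullback A \<rho> \<W> (Suc (Suc 0)) a" and ?a' = "pullback A \<sigma> \<W> (Suc (Suc 0)) a'"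
  have E: "lift_data (Suc 0) \<W> ?c ?b ?a" and E': "lift_data (Suc 0) \<W> ?c' ?b' ?a'"
    by (rule lift_data_pullback[OF D(1) W(1,2)] lift_data_pullback[OF D'(1) W(1,3)])+
  note s = lift_data_reps[OF E] and s' = lift_data_reps[OF E']
  interpret GB: comm_group "cochain_group B \<W> (Suc 0)" by (rule f.G.cochain_comm_group[OF W(1)])
  have bs: "?b \<in> cochains B \<W> (Suc 0)" "?b' \<in> cochains B \<W> (Suc 0)" using E E' by (auto simp: lift_data_def)
  have as: "?a \<in> cochains A \<W> (Suc (Suc 0))" "?a' \<in> cochains A \<W> (Suc (Suc 0))"
    using E E' by (auto simp: lift_data_def cocycles_def)
  have F: "lift_data (Suc 0) \<W> (cmult C \<W> (Suc 0) ?c ?c') (cmult B \<W> (Suc 0) ?b ?b') (cmult A \<W> (Suc (Suc 0)) ?a ?a')"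
    unfolding lift_data_def
  proof (intro conjI W(1))
    show "cmult C \<W> (Suc 0) ?c ?c' \<in> cocycles C \<W> (Suc 0)"
      using E E' by (intro g.G.cocycles_mult[OF W(1)]) (auto simp: lift_data_def)
    show "cmult B \<W> (Suc 0) ?b ?b' \<in> cochains B \<W> (Suc 0)"
      using GB.m_closed bs by (simp add: carrier_cochain_group mult_cochain_group)
    show "cmap g \<W> (Suc 0) (cmult B \<W> (Suc 0) ?b ?b') = cmult C \<W> (Suc 0) ?c ?c'"
      using g.cmap_mult[OF W(1) bs] E E' by (simp add: lift_data_def)
    show "cmult A \<W> (Suc (Suc 0)) ?a ?a' \<in> cocycles A \<W> (Suc (Suc 0))"
      using E E' by (intro f.F.cocycles_mult[OF W(1)]) (auto simp: lift_data_def)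
    show "cmap f \<W> (Suc (Suc 0)) (cmult A \<W> (Suc (Suc 0)) ?a ?a') = cobdry B \<W> (Suc 0) (cmult B \<W> (Suc 0) ?b ?b')"
      using f.cmap_mult[OF W(1) as] E E' hom_mult[OF f.G.cobdry_hom[OF W(1), of "Suc 0"]] bs
      by (simp add: lift_data_def carrier_cochain_group mult_cochain_group)
  qed
  show "connecting X A B C f g (Suc 0) (K \<otimes>\<^bsub>cohom X C (Suc 0)\<^esub> L) =
      connecting X A B C f g (Suc 0) K \<otimes>\<^bsub>cohom X A (Suc (Suc 0))\<^esub> connecting X A B C f g (Suc 0) L"
    unfolding D(2) D'(2) connecting_1_eq[OF D(1)] connecting_1_eq[OF D'(1)]
    unfolding H1C.pullback_rep(2)[OF r(1) W(1,2), symmetric] H1C.pullback_rep(2)[OF r'(1) W(1,3), symmetric]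
      H2A.pullback_rep(2)[OF r(2) W(1,2), symmetric] H2A.pullback_rep(2)[OF r'(2) W(1,3), symmetric]
      H1C.mult_class[OF s(1) s'(1)] H2A.mult_class[OF s(2) s'(2)] connecting_1_eq[OF F] ..
qed

text \<open>All cocycles from which the value of the connecting map could be read off have the same class,
  so that the definite description is meaningful.\<close>

lemma connecting_0_trivial:
  assumes triv: "\<And>\<U> c b a. lift_data 0 \<U> c b a \<Longrightarrow> cech_class X A (Suc 0) (\<U>, a) = \<one>\<^bsub>cohom X A (Suc 0)\<^esub>"
    and K: "K \<in> carrier (cohom X C 0)"
  shows "connecting X A B C f g 0 K = \<one>\<^bsub>cohom X A (Suc 0)\<^esub>"
  unfolding connecting_def
proof (rule the_equality)
  obtain \<V> c where c: "(\<V>, c) \<in> cech_reps X C 0" "K = cech_class X C 0 (\<V>, c)"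
    using K by (rule H0C.carrier_cohomE)
  then have V: "open_cover X \<V>" and c0: "c \<in> cochains C \<V> 0" by (auto simp: cech_reps_iff cocycles_def)
  obtain \<W> \<rho> b where W: "open_cover X \<W>" "refinement \<rho> \<W> \<V>" "b \<in> cochains B \<W> 0"
    "cmap g \<W> 0 b = pullback C \<rho> \<W> 0 c" by (rule lift_0_cochain[OF V c0])
  note p = H0C.pullback_rep[OF c(1) W(1,2)]
  have "cobdry B \<W> (Suc 0) (cobdry B \<W> 0 b) = cone B \<W> (Suc (Suc 0))"
    by (rule f.G.cobdry_cobdry_0[OF W(1), unfolded One_nat_def numeral_2_eq_2, OF W(3)])
  then obtain a where D: "lift_data 0 \<W> (pullback C \<rho> \<W> 0 c) b a"
    using lift_data_exists[OF W(1) _ W(3,4)] p(1) by (auto simp: cech_reps_iff)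
  have "(\<W>, pullback C \<rho> \<W> 0 c) \<in> K" using H0C.self_mem_class[OF p(1)] p(2) c(2) by simp
  then show "\<exists>\<U> c b a. (\<U>, c) \<in> K \<and> b \<in> cochains B \<U> 0 \<and> cmap g \<U> 0 b = c \<and>
      a \<in> cocycles A \<U> (Suc 0) \<and> cmap f \<U> (Suc 0) a = cobdry B \<U> 0 b \<and>
      \<one>\<^bsub>cohom X A (Suc 0)\<^esub> = cech_class X A (Suc 0) (\<U>, a)"
    using D triv[OF D] unfolding lift_data_def by metis
  fix L assume "\<exists>\<U> c b a. (\<U>, c) \<in> K \<and> b \<in> cochains B \<U> 0 \<and> cmap g \<U> 0 b = c \<and>
      a \<in> cocycles A \<U> (Suc 0) \<and> cmap f \<U> (Suc 0) a = cobdry B \<U> 0 b \<and> L = cech_class X A (Suc 0) (\<U>, a)"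
  then obtain \<U>' c' b' a' where *: "(\<U>', c') \<in> K" "b' \<in> cochains B \<U>' 0" "cmap g \<U>' 0 b' = c'"
      "a' \<in> cocycles A \<U>' (Suc 0)" "cmap f \<U>' (Suc 0) a' = cobdry B \<U>' 0 b'" "L = cech_class X A (Suc 0) (\<U>', a')" by blast
  have "(\<U>', c') \<in> cech_reps X C 0" using *(1) c(2) by (simp add: mem_cech_class_iff)
  then have "lift_data 0 \<U>' c' b' a'" using * by (simp add: lift_data_def cech_reps_iff)
  then show "L = \<one>\<^bsub>cohom X A (Suc 0)\<^esub>" using triv *(6) by blast
qed

end

section \<open>Quotient sheaves\<close>

locale group_presheaf =
  fixes X :: "'a topology" and G :: "('a, 'g) gsheaf"
  assumes sec_group: "openin X U \<Longrightarrow> group (sec G U)"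
    and res_hom: "openin X U \<Longrightarrow> openin X V \<Longrightarrow> V \<subseteq> U \<Longrightarrow> res G U V \<in> hom (sec G U) (sec G V)"
    and res_res: "openin X U \<Longrightarrow> openin X V \<Longrightarrow> openin X W \<Longrightarrow> V \<subseteq> U \<Longrightarrow> W \<subseteq> V \<Longrightarrow>
      s \<in> carrier (sec G U) \<Longrightarrow> res G V W (res G U V s) = res G U W s"
    and res_id: "openin X U \<Longrightarrow> s \<in> carrier (sec G U) \<Longrightarrow> res G U U s = s"
begin

lemma res_closed: "openin X U \<Longrightarrow> openin X V \<Longrightarrow> V \<subseteq> U \<Longrightarrow> s \<in> carrier (sec G U) \<Longrightarrow> res G U V s \<in> carrier (sec G V)"
  by (rule hom_in_carrier[OF res_hom])

lemma res_mult:
  "openin X U \<Longrightarrow> openin X V \<Longrightarrow> V \<subseteq> U \<Longrightarrow> s \<in> carrier (sec G U) \<Longrightarrow> t \<in> carrier (sec G U) \<Longrightarrow>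
   res G U V (s \<otimes>\<^bsub>sec G U\<^esub> t) = res G U V s \<otimes>\<^bsub>sec G V\<^esub> res G U V t"
  by (rule hom_mult[OF res_hom])

lemma res_inv:
  "openin X U \<Longrightarrow> openin X V \<Longrightarrow> V \<subseteq> U \<Longrightarrow> s \<in> carrier (sec G U) \<Longrightarrow>
   res G U V (inv\<^bsub>sec G U\<^esub> s) = inv\<^bsub>sec G V\<^esub> res G U V s"
  by (rule hom_m_inv[OF sec_group sec_group res_hom])

lemma res_one: "openin X U \<Longrightarrow> openin X V \<Longrightarrow> V \<subseteq> U \<Longrightarrow> res G U V \<one>\<^bsub>sec G U\<^esub> = \<one>\<^bsub>sec G V\<^esub>"
  using hom_one[OF res_hom] sec_group by blast

lemma one_closed: "openin X U \<Longrightarrow> \<one>\<^bsub>sec G U\<^esub> \<in> carrier (sec G U)"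
  using sec_group by (simp add: group.is_monoid)

lemma mult_closed: "openin X U \<Longrightarrow> s \<in> carrier (sec G U) \<Longrightarrow> t \<in> carrier (sec G U) \<Longrightarrow> s \<otimes>\<^bsub>sec G U\<^esub> t \<in> carrier (sec G U)"
  using sec_group by (simp add: group.is_monoid monoid.m_closed)

lemma inv_closed: "openin X U \<Longrightarrow> s \<in> carrier (sec G U) \<Longrightarrow> inv\<^bsub>sec G U\<^esub> s \<in> carrier (sec G U)"
  using sec_group by simp

end

lemma (in group) cancel_inv_left:
  assumes "x \<in> carrier G" "y \<in> carrier G"
  shows "x \<otimes> (inv x \<otimes> y) = y" "inv x \<otimes> (x \<otimes> y) = y"
  using assms by (simp_all add: m_assoc[symmetric])

text \<open>A subgroup containing all commutators is normal, so that congruence modulo it is compatible with products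
  and inverses.\<close>

lemma (in group) commutator_subgroup_congruence:
  assumes H: "subgroup H G"
    and comm: "\<And>x y. x \<in> carrier G \<Longrightarrow> y \<in> carrier G \<Longrightarrow> inv x \<otimes> inv y \<otimes> x \<otimes> y \<in> H"
    and a: "a \<in> carrier G" "a' \<in> carrier G" and b: "b \<in> carrier G" "b' \<in> carrier G"
    and aa: "inv a \<otimes> a' \<in> H" and bb: "inv b \<otimes> b' \<in> H"
  shows "inv (a \<otimes> b) \<otimes> (a' \<otimes> b') \<in> H" and "inv (inv a) \<otimes> inv a' \<in> H"
proof -
  have conj: "inv y \<otimes> h \<otimes> y \<in> H" if h: "h \<in> H" and y: "y \<in> carrier G" for h y
  proof -
    have hc: "h \<in> carrier G" by (rule subgroup.mem_carrier[OF H h])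
    have "inv y \<otimes> h \<otimes> y = h \<otimes> (inv h \<otimes> inv y \<otimes> h \<otimes> y)"
      using hc y by (simp add: m_assoc cancel_inv_left)
    then show ?thesis using subgroup.m_closed[OF H h comm[OF hc y]] by simp
  qed
  have "inv (a \<otimes> b) \<otimes> (a' \<otimes> b') = (inv b \<otimes> (inv a \<otimes> a') \<otimes> b) \<otimes> (inv b \<otimes> b')"
    using a b by (simp add: inv_mult_group m_assoc cancel_inv_left)
  then show "inv (a \<otimes> b) \<otimes> (a' \<otimes> b') \<in> H"
    using subgroup.m_closed[OF H conj[OF aa b(1)] bb] by simp
  have "inv (inv a) \<otimes> inv a' = inv (inv (inv a) \<otimes> (inv a \<otimes> a') \<otimes> inv a)"
    using a by (simp add: inv_mult_group m_assoc)
  then show "inv (inv a) \<otimes> inv a' \<in> H"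
    using subgroup.m_inv_closed[OF H conj[OF aa inv_closed[OF a(1)]]] by simp
qed

lemma UN_eq_constant: "p \<in> P \<Longrightarrow> (\<And>p. p \<in> P \<Longrightarrow> F p = c) \<Longrightarrow> (\<Union>p\<in>P. F p) = c"
  by blast

locale abelian_quotient = group_presheaf X G for X :: "'a topology" and G :: "('a, 'g) gsheaf" +
  fixes H :: "('a, 'g) gsheaf"
  assumes subgroup_H: "openin X U \<Longrightarrow> subgroup (carrier (sec H U)) (sec G U)"
    and res_H: "openin X U \<Longrightarrow> openin X V \<Longrightarrow> V \<subseteq> U \<Longrightarrow> h \<in> carrier (sec H U) \<Longrightarrow> res G U V h \<in> carrier (sec H V)"
    and commutator_H: "openin X U \<Longrightarrow> \<alpha> \<in> carrier (sec G U) \<Longrightarrow> \<beta> \<in> carrier (sec G U) \<Longrightarrow>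
      inv\<^bsub>sec G U\<^esub> \<alpha> \<otimes>\<^bsub>sec G U\<^esub> inv\<^bsub>sec G U\<^esub> \<beta> \<otimes>\<^bsub>sec G U\<^esub> \<alpha> \<otimes>\<^bsub>sec G U\<^esub> \<beta> \<in> carrier (sec H U)"
begin

definition congr :: "'a set \<Rightarrow> 'g \<Rightarrow> 'g \<Rightarrow> bool" where
  "congr U \<alpha> \<beta> \<longleftrightarrow> inv\<^bsub>sec G U\<^esub> \<alpha> \<otimes>\<^bsub>sec G U\<^esub> \<beta> \<in> carrier (sec H U)"

lemma congr_refl:
  assumes "openin X U" "\<alpha> \<in> carrier (sec G U)" shows "congr U \<alpha> \<alpha>"
proof -
  interpret group "sec G U" by (rule sec_group[OF assms(1)])
  show ?thesis using assms subgroup.one_closed[OF subgroup_H[OF assms(1)]] by (simp add: congr_def)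
qed

lemma congr_sym:
  assumes "openin X U" "\<alpha> \<in> carrier (sec G U)" "\<beta> \<in> carrier (sec G U)" "congr U \<alpha> \<beta>" shows "congr U \<beta> \<alpha>"
proof -
  interpret group "sec G U" by (rule sec_group[OF assms(1)])
  show ?thesis using assms(2-) subgroup.m_inv_closed[OF subgroup_H[OF assms(1)]]
    by (force simp: congr_def inv_mult_group)
qed

lemma congr_trans:
  assumes "openin X U" "\<alpha> \<in> carrier (sec G U)" "\<beta> \<in> carrier (sec G U)" "\<gamma> \<in> carrier (sec G U)"
    "congr U \<alpha> \<beta>" "congr U \<beta> \<gamma>" shows "congr U \<alpha> \<gamma>"
proof -
  interpret group "sec G U" by (rule sec_group[OF assms(1)])
  have "inv\<^bsub>sec G U\<^esub> \<alpha> \<otimes>\<^bsub>sec G U\<^esub> \<gamma> =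
     (inv\<^bsub>sec G U\<^esub> \<alpha> \<otimes>\<^bsub>sec G U\<^esub> \<beta>) \<otimes>\<^bsub>sec G U\<^esub> (inv\<^bsub>sec G U\<^esub> \<beta> \<otimes>\<^bsub>sec G U\<^esub> \<gamma>)"
    using assms(2-4) by (simp add: m_assoc cancel_inv_left)
  then show ?thesis using assms(5,6) subgroup.m_closed[OF subgroup_H[OF assms(1)]] by (simp add: congr_def)
qed

lemma congr_mult:
  assumes "openin X U" "\<alpha> \<in> carrier (sec G U)" "\<alpha>' \<in> carrier (sec G U)" "\<beta> \<in> carrier (sec G U)" "\<beta>' \<in> carrier (sec G U)"
    "congr U \<alpha> \<alpha>'" "congr U \<beta> \<beta>'"
  shows "congr U (\<alpha> \<otimes>\<^bsub>sec G U\<^esub> \<beta>) (\<alpha>' \<otimes>\<^bsub>sec G U\<^esub> \<beta>')"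
  unfolding congr_def
  by (rule group.commutator_subgroup_congruence(1)[OF sec_group[OF assms(1)] subgroup_H[OF assms(1)]
      commutator_H[OF assms(1)] assms(2-5) assms(6,7)[unfolded congr_def]])

lemma congr_inv:
  assumes "openin X U" "\<alpha> \<in> carrier (sec G U)" "\<beta> \<in> carrier (sec G U)" "congr U \<alpha> \<beta>"
  shows "congr U (inv\<^bsub>sec G U\<^esub> \<alpha>) (inv\<^bsub>sec G U\<^esub> \<beta>)"
  unfolding congr_def
  by (rule group.commutator_subgroup_congruence(2)[OF sec_group[OF assms(1)] subgroup_H[OF assms(1)]
      commutator_H[OF assms(1)] assms(2,3) assms(2,3) assms(4)[unfolded congr_def] assms(4)[unfolded congr_def]])

lemma congr_commute:
  assumes "openin X U" "\<alpha> \<in> carrier (sec G U)" "\<beta> \<in> carrier (sec G U)"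
  shows "congr U (\<alpha> \<otimes>\<^bsub>sec G U\<^esub> \<beta>) (\<beta> \<otimes>\<^bsub>sec G U\<^esub> \<alpha>)"
proof -
  interpret group "sec G U" by (rule sec_group[OF assms(1)])
  show ?thesis using commutator_H[OF assms(1,3,2)] assms(2,3) by (simp add: congr_def inv_mult_group m_assoc)
qed

lemma congr_res:
  assumes "openin X U" "openin X V" "V \<subseteq> U" "\<alpha> \<in> carrier (sec G U)" "\<beta> \<in> carrier (sec G U)" "congr U \<alpha> \<beta>"
  shows "congr V (res G U V \<alpha>) (res G U V \<beta>)"
  using res_H[OF assms(1-3)] assms(6) unfolding congr_def
  by (metis assms(1-5) inv_closed res_inv res_mult)

definition represents :: "'a \<Rightarrow> 'a set \<times> 'g \<Rightarrow> bool" where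
  "represents x p \<longleftrightarrow> openin X (fst p) \<and> x \<in> fst p \<and> snd p \<in> carrier (sec G (fst p))"

lemma mem_qgerm_iff:
  "(W, \<beta>) \<in> qgerm X G H x (V, \<alpha>) \<longleftrightarrow> represents x (W, \<beta>) \<and>
    (\<exists>N. openin X N \<and> x \<in> N \<and> N \<subseteq> V \<and> N \<subseteq> W \<and> congr N (res G V N \<alpha>) (res G W N \<beta>))"
  by (auto simp: qgerm_def congr_def represents_def)

lemma mem_qgerm_self: "represents x (V, \<alpha>) \<Longrightarrow> (V, \<alpha>) \<in> qgerm X G H x (V, \<alpha>)"
  unfolding mem_qgerm_iff using congr_refl res_closed by (auto simp: represents_def)

lemma mem_qgerm_trans:
  assumes p: "represents x (V, \<alpha>)" and q: "(W, \<beta>) \<in> qgerm X G H x (V, \<alpha>)" and r: "(Z, \<gamma>) \<in> qgerm X G H x (W, \<beta>)"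
  shows "(Z, \<gamma>) \<in> qgerm X G H x (V, \<alpha>)"
proof -
  have q': "represents x (W, \<beta>)" and r': "represents x (Z, \<gamma>)" using q r by (simp_all add: mem_qgerm_iff)
  obtain N where N: "openin X N" "x \<in> N" "N \<subseteq> V" "N \<subseteq> W" "congr N (res G V N \<alpha>) (res G W N \<beta>)"
    using q by (auto simp: mem_qgerm_iff)
  obtain M where M: "openin X M" "x \<in> M" "M \<subseteq> W" "M \<subseteq> Z" "congr M (res G W M \<beta>) (res G Z M \<gamma>)"
    using r by (auto simp: mem_qgerm_iff)
  let ?S = "N \<inter> M"
  have S: "openin X ?S" "x \<in> ?S" "?S \<subseteq> V" "?S \<subseteq> W" "?S \<subseteq> Z" "?S \<subseteq> N" "?S \<subseteq> M" using N M by auto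
  have V: "openin X V" "\<alpha> \<in> carrier (sec G V)" and W: "openin X W" "\<beta> \<in> carrier (sec G W)"
    and Z: "openin X Z" "\<gamma> \<in> carrier (sec G Z)" using p q' r' by (auto simp: represents_def)
  have "congr ?S (res G V ?S \<alpha>) (res G W ?S \<beta>)"
    using congr_res[OF N(1) S(1,6) res_closed[OF V(1) N(1,3) V(2)] res_closed[OF W(1) N(1,4) W(2)] N(5)]
    by (simp add: res_res[OF V(1) N(1) S(1) N(3) S(6) V(2)] res_res[OF W(1) N(1) S(1) N(4) S(6) W(2)])
  moreover have "congr ?S (res G W ?S \<beta>) (res G Z ?S \<gamma>)"
    using congr_res[OF M(1) S(1,7) res_closed[OF W(1) M(1,3) W(2)] res_closed[OF Z(1) M(1,4) Z(2)] M(5)]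
    by (simp add: res_res[OF W(1) M(1) S(1) M(3) S(7) W(2)] res_res[OF Z(1) M(1) S(1) M(4) S(7) Z(2)])
  ultimately have "congr ?S (res G V ?S \<alpha>) (res G Z ?S \<gamma>)"
    by (rule congr_trans[OF S(1) res_closed[OF V(1) S(1,3) V(2)] res_closed[OF W(1) S(1,4) W(2)] res_closed[OF Z(1) S(1,5) Z(2)]])
  then show ?thesis unfolding mem_qgerm_iff using r' S by blast
qed

lemma mem_qgerm_sym:
  assumes p: "represents x (V, \<alpha>)" and q: "(W, \<beta>) \<in> qgerm X G H x (V, \<alpha>)"
  shows "(V, \<alpha>) \<in> qgerm X G H x (W, \<beta>)"
proof -
  have q': "represents x (W, \<beta>)" using q by (simp_all add: mem_qgerm_iff)
  obtain N where N: "openin X N" "x \<in> N" "N \<subseteq> V" "N \<subseteq> W" "congr N (res G V N \<alpha>) (res G W N \<beta>)"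
    using q by (auto simp: mem_qgerm_iff)
  have V: "openin X V" "\<alpha> \<in> carrier (sec G V)" and W: "openin X W" "\<beta> \<in> carrier (sec G W)"
    using p q' by (auto simp: represents_def)
  have "congr N (res G W N \<beta>) (res G V N \<alpha>)"
    by (rule congr_sym[OF N(1) res_closed[OF V(1) N(1,3) V(2)] res_closed[OF W(1) N(1,4) W(2)] N(5)])
  then show ?thesis unfolding mem_qgerm_iff using p N by blast
qed

lemma qgerm_eq_iff:
  assumes p: "represents x (V, \<alpha>)" and q: "represents x (W, \<beta>)"
  shows "qgerm X G H x (V, \<alpha>) = qgerm X G H x (W, \<beta>) \<longleftrightarrow>
    (\<exists>N. openin X N \<and> x \<in> N \<and> N \<subseteq> V \<and> N \<subseteq> W \<and> congr N (res G V N \<alpha>) (res G W N \<beta>))"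
proof -
  have "qgerm X G H x (V, \<alpha>) = qgerm X G H x (W, \<beta>) \<longleftrightarrow> (W, \<beta>) \<in> qgerm X G H x (V, \<alpha>)"
  proof
    assume "qgerm X G H x (V, \<alpha>) = qgerm X G H x (W, \<beta>)"
    then show "(W, \<beta>) \<in> qgerm X G H x (V, \<alpha>)" using mem_qgerm_self[OF q] by simp
  next
    assume r: "(W, \<beta>) \<in> qgerm X G H x (V, \<alpha>)"
    have "(Z, \<gamma>) \<in> qgerm X G H x (V, \<alpha>) \<longleftrightarrow> (Z, \<gamma>) \<in> qgerm X G H x (W, \<beta>)" for Z \<gamma>
      using mem_qgerm_trans[OF p r] mem_qgerm_trans[OF q mem_qgerm_sym[OF p r]] by blast
    then show "qgerm X G H x (V, \<alpha>) = qgerm X G H x (W, \<beta>)" by auto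
  qed
  then show ?thesis using q by (simp add: mem_qgerm_iff)
qed

lemma mem_qgerm_eq:
  assumes "represents x (V, \<alpha>)" "(W, \<beta>) \<in> qgerm X G H x (V, \<alpha>)"
  shows "represents x (W, \<beta>)" "qgerm X G H x (W, \<beta>) = qgerm X G H x (V, \<alpha>)"
  using assms qgerm_eq_iff[OF assms(1), of W \<beta>] by (auto simp: mem_qgerm_iff)

lemma represents_res: "represents x (V, \<alpha>) \<Longrightarrow> openin X W \<Longrightarrow> x \<in> W \<Longrightarrow> W \<subseteq> V \<Longrightarrow> represents x (W, res G V W \<alpha>)"
  using res_closed by (auto simp: represents_def)

lemma qgerm_res:
  assumes p: "represents x (V, \<alpha>)" and W: "openin X W" "x \<in> W" "W \<subseteq> V"
  shows "qgerm X G H x (W, res G V W \<alpha>) = qgerm X G H x (V, \<alpha>)"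
proof -
  have V: "openin X V" "\<alpha> \<in> carrier (sec G V)" using p by (auto simp: represents_def)
  note r = res_closed[OF V(1) W(1,3) V(2)]
  show ?thesis unfolding qgerm_eq_iff[OF represents_res[OF p W] p]
    using W congr_refl[OF W(1) r] by (auto simp: res_id[OF W(1) r])
qed

definition germ_mult :: "'a \<Rightarrow> ('a set \<times> 'g) set \<Rightarrow> ('a set \<times> 'g) set \<Rightarrow> ('a set \<times> 'g) set" where
  "germ_mult x P Q = (\<Union>(V, \<alpha>)\<in>P. \<Union>(W, \<beta>)\<in>Q.
     qgerm X G H x (V \<inter> W, res G V (V \<inter> W) \<alpha> \<otimes>\<^bsub>sec G (V \<inter> W)\<^esub> res G W (V \<inter> W) \<beta>))"

text \<open>Congruence modulo \<open>H\<close> is compatible with products, so the union in the definition of the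
  product of germs is over a constant family.\<close>

lemma germ_mult_qgerm:
  assumes p: "represents x (V, \<alpha>)" and q: "represents x (V, \<beta>)"
  shows "germ_mult x (qgerm X G H x (V, \<alpha>)) (qgerm X G H x (V, \<beta>)) = qgerm X G H x (V, \<alpha> \<otimes>\<^bsub>sec G V\<^esub> \<beta>)"
proof -
  have V: "openin X V" "x \<in> V" "\<alpha> \<in> carrier (sec G V)" "\<beta> \<in> carrier (sec G V)" using p q by (auto simp: represents_def)
  have pq: "represents x (V, \<alpha> \<otimes>\<^bsub>sec G V\<^esub> \<beta>)" using V mult_closed by (simp add: represents_def)
  have eq: "qgerm X G H x (W \<inter> Z, res G W (W \<inter> Z) \<gamma> \<otimes>\<^bsub>sec G (W \<inter> Z)\<^esub> res G Z (W \<inter> Z) \<delta>) = qgerm X G H x (V, \<alpha> \<otimes>\<^bsub>sec G V\<^esub> \<beta>)"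
    if c: "(W, \<gamma>) \<in> qgerm X G H x (V, \<alpha>)" and d: "(Z, \<delta>) \<in> qgerm X G H x (V, \<beta>)" for W \<gamma> Z \<delta>
  proof -
    have W: "openin X W" "x \<in> W" "\<gamma> \<in> carrier (sec G W)" and Z: "openin X Z" "x \<in> Z" "\<delta> \<in> carrier (sec G Z)"
      using c d by (auto simp: mem_qgerm_iff represents_def)
    obtain N where N: "openin X N" "x \<in> N" "N \<subseteq> V" "N \<subseteq> W" "congr N (res G V N \<alpha>) (res G W N \<gamma>)"
      using c by (auto simp: mem_qgerm_iff)
    obtain M where M: "openin X M" "x \<in> M" "M \<subseteq> V" "M \<subseteq> Z" "congr M (res G V M \<beta>) (res G Z M \<delta>)"
      using d by (auto simp: mem_qgerm_iff)
    let ?S = "N \<inter> M" and ?I = "W \<inter> Z"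
    have S: "openin X ?S" "x \<in> ?S" "?S \<subseteq> V" "?S \<subseteq> W" "?S \<subseteq> Z" "?S \<subseteq> N" "?S \<subseteq> M" "?S \<subseteq> ?I" using N M by auto
    have I: "openin X ?I" "x \<in> ?I" "?I \<subseteq> W" "?I \<subseteq> Z" using W Z by auto
    note cI = res_closed[OF W(1) I(1,3) W(3)] and dI = res_closed[OF Z(1) I(1,4) Z(3)]
    have r: "represents x (?I, res G W ?I \<gamma> \<otimes>\<^bsub>sec G ?I\<^esub> res G Z ?I \<delta>)"
      using I mult_closed[OF I(1) cI dI] by (simp add: represents_def)
    have 1: "congr ?S (res G V ?S \<alpha>) (res G W ?S \<gamma>)"
      using congr_res[OF N(1) S(1,6) res_closed[OF V(1) N(1,3) V(3)] res_closed[OF W(1) N(1,4) W(3)] N(5)]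
      by (simp add: res_res[OF V(1) N(1) S(1) N(3) S(6) V(3)] res_res[OF W(1) N(1) S(1) N(4) S(6) W(3)])
    have 2: "congr ?S (res G V ?S \<beta>) (res G Z ?S \<delta>)"
      using congr_res[OF M(1) S(1,7) res_closed[OF V(1) M(1,3) V(4)] res_closed[OF Z(1) M(1,4) Z(3)] M(5)]
      by (simp add: res_res[OF V(1) M(1) S(1) M(3) S(7) V(4)] res_res[OF Z(1) M(1) S(1) M(4) S(7) Z(3)])
    note Sc = res_closed[OF V(1) S(1,3) V(3)] res_closed[OF W(1) S(1,4) W(3)]
      res_closed[OF V(1) S(1,3) V(4)] res_closed[OF Z(1) S(1,5) Z(3)]
    have "congr ?S (res G V ?S \<alpha> \<otimes>\<^bsub>sec G ?S\<^esub> res G V ?S \<beta>) (res G W ?S \<gamma> \<otimes>\<^bsub>sec G ?S\<^esub> res G Z ?S \<delta>)"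
      by (rule congr_mult[OF S(1) Sc 1 2])
    then have "congr ?S (res G V ?S (\<alpha> \<otimes>\<^bsub>sec G V\<^esub> \<beta>)) (res G ?I ?S (res G W ?I \<gamma> \<otimes>\<^bsub>sec G ?I\<^esub> res G Z ?I \<delta>))"
      unfolding res_mult[OF V(1) S(1,3) V(3,4)] res_mult[OF I(1) S(1,8) cI dI]
        res_res[OF W(1) I(1) S(1) I(3) S(8) W(3)] res_res[OF Z(1) I(1) S(1) I(4) S(8) Z(3)] .
    then have "qgerm X G H x (V, \<alpha> \<otimes>\<^bsub>sec G V\<^esub> \<beta>) = qgerm X G H x (?I, res G W ?I \<gamma> \<otimes>\<^bsub>sec G ?I\<^esub> res G Z ?I \<delta>)"
      unfolding qgerm_eq_iff[OF pq r] using S(1,2,3,8) by blast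
    then show ?thesis by simp
  qed
  show ?thesis unfolding germ_mult_def
  proof (rule UN_eq_constant[OF mem_qgerm_self[OF p]], clarify, rule UN_eq_constant[OF mem_qgerm_self[OF q]], clarify)
    show "qgerm X G H x (W \<inter> Z, res G W (W \<inter> Z) \<gamma> \<otimes>\<^bsub>sec G (W \<inter> Z)\<^esub> res G Z (W \<inter> Z) \<delta>) =
        qgerm X G H x (V, \<alpha> \<otimes>\<^bsub>sec G V\<^esub> \<beta>)"
      if "(W, \<gamma>) \<in> qgerm X G H x (V, \<alpha>)" "(Z, \<delta>) \<in> qgerm X G H x (V, \<beta>)" for W \<gamma> Z \<delta>
      by (rule eq[OF that])
  qed
qed

definition germ_inv :: "'a \<Rightarrow> ('a set \<times> 'g) set \<Rightarrow> ('a set \<times> 'g) set" where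
  "germ_inv x P = (\<Union>(V, \<alpha>)\<in>P. qgerm X G H x (V, inv\<^bsub>sec G V\<^esub> \<alpha>))"

lemma germ_inv_qgerm:
  assumes p: "represents x (V, \<alpha>)"
  shows "germ_inv x (qgerm X G H x (V, \<alpha>)) = qgerm X G H x (V, inv\<^bsub>sec G V\<^esub> \<alpha>)"
proof -
  have V: "openin X V" "x \<in> V" "\<alpha> \<in> carrier (sec G V)" using p by (auto simp: represents_def)
  have pi: "represents x (V, inv\<^bsub>sec G V\<^esub> \<alpha>)" using V inv_closed by (simp add: represents_def)
  have eq: "qgerm X G H x (W, inv\<^bsub>sec G W\<^esub> \<gamma>) = qgerm X G H x (V, inv\<^bsub>sec G V\<^esub> \<alpha>)"
    if c: "(W, \<gamma>) \<in> qgerm X G H x (V, \<alpha>)" for W \<gamma>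
  proof -
    have W: "openin X W" "x \<in> W" "\<gamma> \<in> carrier (sec G W)" using c by (auto simp: mem_qgerm_iff represents_def)
    have r: "represents x (W, inv\<^bsub>sec G W\<^esub> \<gamma>)" using W inv_closed by (simp add: represents_def)
    obtain N where N: "openin X N" "x \<in> N" "N \<subseteq> V" "N \<subseteq> W" "congr N (res G V N \<alpha>) (res G W N \<gamma>)"
      using c by (auto simp: mem_qgerm_iff)
    have "congr N (res G V N (inv\<^bsub>sec G V\<^esub> \<alpha>)) (res G W N (inv\<^bsub>sec G W\<^esub> \<gamma>))"
      unfolding res_inv[OF V(1) N(1,3) V(3)] res_inv[OF W(1) N(1,4) W(3)]
      by (rule congr_inv[OF N(1) res_closed[OF V(1) N(1,3) V(3)] res_closed[OF W(1) N(1,4) W(3)] N(5)])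
    then have "qgerm X G H x (V, inv\<^bsub>sec G V\<^esub> \<alpha>) = qgerm X G H x (W, inv\<^bsub>sec G W\<^esub> \<gamma>)"
      unfolding qgerm_eq_iff[OF pi r] using N by blast
    then show ?thesis by simp
  qed
  show ?thesis unfolding germ_inv_def
  proof (rule UN_eq_constant[OF mem_qgerm_self[OF p]], clarify)
    show "qgerm X G H x (W, inv\<^bsub>sec G W\<^esub> \<gamma>) = qgerm X G H x (V, inv\<^bsub>sec G V\<^esub> \<alpha>)"
      if "(W, \<gamma>) \<in> qgerm X G H x (V, \<alpha>)" for W \<gamma> by (rule eq[OF that])
  qed
qed

abbreviation Q where "Q \<equiv> quot_sheaf X G H"

lemma carrier_quot: "\<sigma> \<in> carrier (sec Q U) \<longleftrightarrow> \<sigma> \<in> extensional U \<and>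
   (\<forall>x\<in>U. \<exists>V \<alpha>. openin X V \<and> x \<in> V \<and> V \<subseteq> U \<and> \<alpha> \<in> carrier (sec G V) \<and> (\<forall>y\<in>V. \<sigma> y = qgerm X G H y (V, \<alpha>)))"
  by (simp add: quot_sheaf_def)

lemma mult_quot: "\<sigma> \<otimes>\<^bsub>sec Q U\<^esub> \<tau> = (\<lambda>x\<in>U. germ_mult x (\<sigma> x) (\<tau> x))"
  by (simp add: quot_sheaf_def germ_mult_def)

lemma one_quot: "\<one>\<^bsub>sec Q U\<^esub> = qproj X G H U \<one>\<^bsub>sec G U\<^esub>"
  by (simp add: quot_sheaf_def)

lemma res_quot: "res Q U V \<sigma> = restrict \<sigma> V"
  by (simp add: quot_sheaf_def)

lemma quot_local_rep:
  assumes "\<sigma> \<in> carrier (sec Q U)" "x \<in> U" "openin X W" "x \<in> W"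
  obtains V \<alpha> where "openin X V" "x \<in> V" "V \<subseteq> U" "V \<subseteq> W" "\<alpha> \<in> carrier (sec G V)"
    "\<forall>y\<in>V. \<sigma> y = qgerm X G H y (V, \<alpha>)"
proof -
  have "\<exists>V \<alpha>. openin X V \<and> x \<in> V \<and> V \<subseteq> U \<and> \<alpha> \<in> carrier (sec G V) \<and> (\<forall>y\<in>V. \<sigma> y = qgerm X G H y (V, \<alpha>))"
    using assms(1,2) unfolding carrier_quot by blast
  then obtain V \<alpha> where V: "openin X V" "x \<in> V" "V \<subseteq> U" "\<alpha> \<in> carrier (sec G V)" "\<forall>y\<in>V. \<sigma> y = qgerm X G H y (V, \<alpha>)"
    by (elim exE conjE)
  have rep: "represents y (V, \<alpha>)" if "y \<in> V" for y using that V(1,4) by (simp add: represents_def)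
  have o: "openin X (V \<inter> W)" using V(1) assms(3) by auto
  show thesis
  proof (rule that[of "V \<inter> W" "res G V (V \<inter> W) \<alpha>"])
    show "res G V (V \<inter> W) \<alpha> \<in> carrier (sec G (V \<inter> W))" by (rule res_closed[OF V(1) o Int_lower1 V(4)])
    show "\<forall>y\<in>V \<inter> W. \<sigma> y = qgerm X G H y (V \<inter> W, res G V (V \<inter> W) \<alpha>)"
    proof
      fix y assume y: "y \<in> V \<inter> W"
      then have "y \<in> V" by simp
      show "\<sigma> y = qgerm X G H y (V \<inter> W, res G V (V \<inter> W) \<alpha>)"
        unfolding qgerm_res[OF rep[OF \<open>y \<in> V\<close>] o y Int_lower1] using V(5) \<open>y \<in> V\<close> by (rule bspec)
    qed
    show "V \<inter> W \<subseteq> U" using V(3) by blast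
    show "x \<in> V \<inter> W" using V(2) assms(4) by blast
  qed (rule o, rule Int_lower2)
qed

lemma quot_local_rep2:
  assumes "\<sigma> \<in> carrier (sec Q U)" "\<tau> \<in> carrier (sec Q U)" "x \<in> U" "openin X W" "x \<in> W"
  obtains V \<alpha> \<beta> where "openin X V" "x \<in> V" "V \<subseteq> U" "V \<subseteq> W" "\<alpha> \<in> carrier (sec G V)" "\<beta> \<in> carrier (sec G V)"
    "\<forall>y\<in>V. \<sigma> y = qgerm X G H y (V, \<alpha>)" "\<forall>y\<in>V. \<tau> y = qgerm X G H y (V, \<beta>)"
proof -
  obtain Z \<alpha> where Z: "openin X Z" "x \<in> Z" "Z \<subseteq> U" "Z \<subseteq> W" "\<alpha> \<in> carrier (sec G Z)"
    "\<forall>y\<in>Z. \<sigma> y = qgerm X G H y (Z, \<alpha>)"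
    by (rule quot_local_rep[OF assms(1,3-5)])
  obtain V \<beta> where V: "openin X V" "x \<in> V" "V \<subseteq> U" "V \<subseteq> Z" "\<beta> \<in> carrier (sec G V)"
    "\<forall>y\<in>V. \<tau> y = qgerm X G H y (V, \<beta>)"
    by (rule quot_local_rep[OF assms(2,3) Z(1,2)])
  show thesis
  proof (rule that[of V "res G Z V \<alpha>" \<beta>])
    show "res G Z V \<alpha> \<in> carrier (sec G V)" by (rule res_closed[OF Z(1) V(1,4) Z(5)])
    show "\<forall>y\<in>V. \<sigma> y = qgerm X G H y (V, res G Z V \<alpha>)"
    proof
      fix y assume y: "y \<in> V"
      with V(4) have yZ: "y \<in> Z" by (rule subsetD)
      have "represents y (Z, \<alpha>)" using yZ Z(1,5) by (simp add: represents_def)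
      then show "\<sigma> y = qgerm X G H y (V, res G Z V \<alpha>)"
        unfolding qgerm_res[OF \<open>represents y (Z, \<alpha>)\<close> V(1) y V(4)] using Z(6) yZ by blast
    qed
    show "V \<subseteq> W" using V(4) Z(4) by blast
  qed (rule V)+
qed

lemma quotI:
  assumes "\<sigma> \<in> extensional U"
    and "\<And>x. x \<in> U \<Longrightarrow> \<exists>V \<alpha>. openin X V \<and> x \<in> V \<and> V \<subseteq> U \<and> \<alpha> \<in> carrier (sec G V) \<and> (\<forall>y\<in>V. \<sigma> y = qgerm X G H y (V, \<alpha>))"
  shows "\<sigma> \<in> carrier (sec Q U)"
  using assms by (simp add: carrier_quot)

lemma quot_eqI:
  assumes "\<sigma> \<in> carrier (sec Q U)" "\<tau> \<in> carrier (sec Q U)" "\<And>x. x \<in> U \<Longrightarrow> \<sigma> x = \<tau> x" shows "\<sigma> = \<tau>"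
  by (rule extensionalityI[of _ U]) (use assms in \<open>auto simp: carrier_quot\<close>)

lemma qproj_closed:
  assumes "openin X U" "\<alpha> \<in> carrier (sec G U)" shows "qproj X G H U \<alpha> \<in> carrier (sec Q U)"
  by (rule quotI) (use assms in \<open>auto simp: qproj_def\<close>)

lemma qproj_res:
  assumes "openin X U" "openin X V" "V \<subseteq> U" "\<alpha> \<in> carrier (sec G U)"
  shows "qproj X G H V (res G U V \<alpha>) = restrict (qproj X G H U \<alpha>) V"
  unfolding qproj_def
proof (rule ext)
  fix x show "(\<lambda>x\<in>V. qgerm X G H x (V, res G U V \<alpha>)) x = restrict (\<lambda>x\<in>U. qgerm X G H x (U, \<alpha>)) V x"
    using qgerm_res[of x U \<alpha> V] assms by (cases "x \<in> V") (auto simp: represents_def)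
qed

lemma qproj_mult:
  assumes "openin X U" "\<alpha> \<in> carrier (sec G U)" "\<beta> \<in> carrier (sec G U)"
  shows "qproj X G H U (\<alpha> \<otimes>\<^bsub>sec G U\<^esub> \<beta>) = qproj X G H U \<alpha> \<otimes>\<^bsub>sec Q U\<^esub> qproj X G H U \<beta>"
  unfolding qproj_def mult_quot
  by (rule restrict_ext) (use assms germ_mult_qgerm in \<open>auto simp: represents_def\<close>)

lemma qproj_eq_iff:
  assumes "openin X U" "\<alpha> \<in> carrier (sec G U)" "\<beta> \<in> carrier (sec G U)"
  shows "qproj X G H U \<alpha> = qproj X G H U \<beta> \<longleftrightarrow>
    (\<forall>x\<in>U. \<exists>N. openin X N \<and> x \<in> N \<and> N \<subseteq> U \<and> congr N (res G U N \<alpha>) (res G U N \<beta>))"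
proof -
  have "qproj X G H U \<alpha> = qproj X G H U \<beta> \<longleftrightarrow> (\<forall>x\<in>U. qgerm X G H x (U, \<alpha>) = qgerm X G H x (U, \<beta>))"
    unfolding qproj_def by (auto simp: fun_eq_iff restrict_def)
  also have "\<dots> \<longleftrightarrow> (\<forall>x\<in>U. \<exists>N. openin X N \<and> x \<in> N \<and> N \<subseteq> U \<and> congr N (res G U N \<alpha>) (res G U N \<beta>))"
    using assms by (intro ball_cong refl, subst qgerm_eq_iff) (auto simp: represents_def)
  finally show ?thesis .
qed

lemma mult_quot_local_rep:
  assumes s: "\<sigma> \<in> carrier (sec Q U)" and t: "\<tau> \<in> carrier (sec Q U)" and V: "openin X V" "V \<subseteq> U"
    and a: "\<alpha> \<in> carrier (sec G V)" "\<forall>y\<in>V. \<sigma> y = qgerm X G H y (V, \<alpha>)"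
    and b: "\<beta> \<in> carrier (sec G V)" "\<forall>y\<in>V. \<tau> y = qgerm X G H y (V, \<beta>)"
    and y: "y \<in> V"
  shows "(\<sigma> \<otimes>\<^bsub>sec Q U\<^esub> \<tau>) y = qgerm X G H y (V, \<alpha> \<otimes>\<^bsub>sec G V\<^esub> \<beta>)"
proof -
  have "(\<sigma> \<otimes>\<^bsub>sec Q U\<^esub> \<tau>) y = germ_mult y (\<sigma> y) (\<tau> y)" using y V(2) by (auto simp: mult_quot)
  also have "\<dots> = qgerm X G H y (V, \<alpha> \<otimes>\<^bsub>sec G V\<^esub> \<beta>)"
    using germ_mult_qgerm[of y V \<alpha> \<beta>] V a b y by (simp add: represents_def)
  finally show ?thesis .
qed

lemma mult_quot_closed:
  assumes s: "\<sigma> \<in> carrier (sec Q U)" and t: "\<tau> \<in> carrier (sec Q U)"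
  shows "\<sigma> \<otimes>\<^bsub>sec Q U\<^esub> \<tau> \<in> carrier (sec Q U)"
proof (rule quotI)
  show "\<sigma> \<otimes>\<^bsub>sec Q U\<^esub> \<tau> \<in> extensional U" by (simp add: mult_quot)
  fix x assume x: "x \<in> U"
  have "openin X (topspace X)" "x \<in> topspace X"
    using s x openin_subset by (fastforce simp: carrier_quot)+
  then obtain V \<alpha> \<beta> where V: "openin X V" "x \<in> V" "V \<subseteq> U" "V \<subseteq> topspace X" "\<alpha> \<in> carrier (sec G V)" "\<beta> \<in> carrier (sec G V)"
      "\<forall>y\<in>V. \<sigma> y = qgerm X G H y (V, \<alpha>)" "\<forall>y\<in>V. \<tau> y = qgerm X G H y (V, \<beta>)"
    by (rule quot_local_rep2[OF s t x])
  then have "\<forall>y\<in>V. (\<sigma> \<otimes>\<^bsub>sec Q U\<^esub> \<tau>) y = qgerm X G H y (V, \<alpha> \<otimes>\<^bsub>sec G V\<^esub> \<beta>)"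
    using mult_quot_local_rep[OF s t V(1,3) V(5,7) V(6,8)] by blast
  then show "\<exists>V \<alpha>. openin X V \<and> x \<in> V \<and> V \<subseteq> U \<and> \<alpha> \<in> carrier (sec G V) \<and>
      (\<forall>y\<in>V. (\<sigma> \<otimes>\<^bsub>sec Q U\<^esub> \<tau>) y = qgerm X G H y (V, \<alpha>))"
    using V(1-3) mult_closed[OF V(1,5,6)] by blast
qed

lemma restrict_quot_closed:
  assumes s: "\<sigma> \<in> carrier (sec Q U)" and V: "openin X V" "V \<subseteq> U"
  shows "restrict \<sigma> V \<in> carrier (sec Q V)"
proof (rule quotI)
  fix x assume x: "x \<in> V"
  with V have xU: "x \<in> U" by auto
  obtain W \<alpha> where "openin X W" "x \<in> W" "W \<subseteq> U" "W \<subseteq> V" "\<alpha> \<in> carrier (sec G W)" "\<forall>y\<in>W. \<sigma> y = qgerm X G H y (W, \<alpha>)"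
    by (rule quot_local_rep[OF s xU V(1) x])
  then show "\<exists>W \<alpha>. openin X W \<and> x \<in> W \<and> W \<subseteq> V \<and> \<alpha> \<in> carrier (sec G W) \<and>
      (\<forall>y\<in>W. restrict \<sigma> V y = qgerm X G H y (W, \<alpha>))"
    by (intro exI[of _ W] exI[of _ \<alpha>]) auto
qed simp

lemma quot_comm_group:
  assumes U: "openin X U" shows "comm_group (sec Q U)"
proof (rule comm_groupI)
  show "\<sigma> \<otimes>\<^bsub>sec Q U\<^esub> \<tau> \<in> carrier (sec Q U)" if "\<sigma> \<in> carrier (sec Q U)" "\<tau> \<in> carrier (sec Q U)" for \<sigma> \<tau>
    by (rule mult_quot_closed[OF that])
  show one: "\<one>\<^bsub>sec Q U\<^esub> \<in> carrier (sec Q U)" unfolding one_quot by (rule qproj_closed[OF U one_closed[OF U]])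
  show "\<sigma> \<otimes>\<^bsub>sec Q U\<^esub> \<tau> = \<tau> \<otimes>\<^bsub>sec Q U\<^esub> \<sigma>" if st: "\<sigma> \<in> carrier (sec Q U)" "\<tau> \<in> carrier (sec Q U)" for \<sigma> \<tau>
  proof (rule quot_eqI[OF mult_quot_closed[OF st] mult_quot_closed[OF st(2,1)]])
    fix x assume x: "x \<in> U"
    obtain V \<alpha> \<beta> where V: "openin X V" "x \<in> V" "V \<subseteq> U" "V \<subseteq> U" "\<alpha> \<in> carrier (sec G V)" "\<beta> \<in> carrier (sec G V)"
        "\<forall>y\<in>V. \<sigma> y = qgerm X G H y (V, \<alpha>)" "\<forall>y\<in>V. \<tau> y = qgerm X G H y (V, \<beta>)"
      by (rule quot_local_rep2[OF st x U x])
    have "qgerm X G H x (V, \<alpha> \<otimes>\<^bsub>sec G V\<^esub> \<beta>) = qgerm X G H x (V, \<beta> \<otimes>\<^bsub>sec G V\<^esub> \<alpha>)"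
      using V(1,2,5,6) mult_closed[OF V(1)] congr_commute[OF V(1,5,6)]
      by (subst qgerm_eq_iff) (auto simp: represents_def res_id intro!: exI[of _ V])
    then show "(\<sigma> \<otimes>\<^bsub>sec Q U\<^esub> \<tau>) x = (\<tau> \<otimes>\<^bsub>sec Q U\<^esub> \<sigma>) x"
      using mult_quot_local_rep[OF st V(1,3) V(5,7) V(6,8) V(2)] mult_quot_local_rep[OF st(2,1) V(1,3) V(6,8) V(5,7) V(2)] by simp
  qed
  show "\<one>\<^bsub>sec Q U\<^esub> \<otimes>\<^bsub>sec Q U\<^esub> \<sigma> = \<sigma>" if s: "\<sigma> \<in> carrier (sec Q U)" for \<sigma>
  proof (rule quot_eqI[OF mult_quot_closed[OF one s] s])
    fix x assume x: "x \<in> U"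
    obtain V \<alpha> where V: "openin X V" "x \<in> V" "V \<subseteq> U" "V \<subseteq> U" "\<alpha> \<in> carrier (sec G V)"
        "\<forall>y\<in>V. \<sigma> y = qgerm X G H y (V, \<alpha>)"
      by (rule quot_local_rep[OF s x U x])
    have "\<one>\<^bsub>sec Q U\<^esub> y = qgerm X G H y (V, \<one>\<^bsub>sec G V\<^esub>)" if "y \<in> V" for y
      using qgerm_res[of y U "\<one>\<^bsub>sec G U\<^esub>" V] that V(1,3) U one_closed[OF U] res_one[OF U V(1,3)]
      by (auto simp: one_quot qproj_def represents_def)
    then have 1: "\<forall>y\<in>V. \<one>\<^bsub>sec Q U\<^esub> y = qgerm X G H y (V, \<one>\<^bsub>sec G V\<^esub>)" by blast
    show "(\<one>\<^bsub>sec Q U\<^esub> \<otimes>\<^bsub>sec Q U\<^esub> \<sigma>) x = \<sigma> x"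
      using mult_quot_local_rep[OF one s V(1,3) one_closed[OF V(1)] 1 V(5,6,2)] V(2,6)
        monoid.l_one[OF group.is_monoid[OF sec_group[OF V(1)]] V(5)] by simp
  qed
  show "\<exists>\<tau>\<in>carrier (sec Q U). \<tau> \<otimes>\<^bsub>sec Q U\<^esub> \<sigma> = \<one>\<^bsub>sec Q U\<^esub>" if s: "\<sigma> \<in> carrier (sec Q U)" for \<sigma>
  proof
    let ?t = "\<lambda>x\<in>U. germ_inv x (\<sigma> x)"
    have loc: "\<exists>V \<alpha>. openin X V \<and> x \<in> V \<and> V \<subseteq> U \<and> \<alpha> \<in> carrier (sec G V) \<and> (\<forall>y\<in>V. \<sigma> y = qgerm X G H y (V, \<alpha>)) \<and>
        (\<forall>y\<in>V. ?t y = qgerm X G H y (V, inv\<^bsub>sec G V\<^esub> \<alpha>))" if x: "x \<in> U" for x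
    proof -
      obtain V \<alpha> where V: "openin X V" "x \<in> V" "V \<subseteq> U" "V \<subseteq> U" "\<alpha> \<in> carrier (sec G V)"
          "\<forall>y\<in>V. \<sigma> y = qgerm X G H y (V, \<alpha>)"
        by (rule quot_local_rep[OF s x U x])
      have "?t y = qgerm X G H y (V, inv\<^bsub>sec G V\<^esub> \<alpha>)" if y: "y \<in> V" for y
      proof -
        have "represents y (V, \<alpha>)" using y V(1,5) by (simp add: represents_def)
        then show ?thesis using germ_inv_qgerm V(3,6) y by auto
      qed
      then show ?thesis by (intro exI[of _ V] exI[of _ \<alpha>] conjI ballI V(1-3,5,6)) (use V(6) in blast)+
    qed
    show t: "?t \<in> carrier (sec Q U)"
    proof (rule quotI)
      fix x assume "x \<in> U"
      from loc[OF this] obtain V \<alpha> where V: "openin X V" "x \<in> V" "V \<subseteq> U" "\<alpha> \<in> carrier (sec G V)"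
        "\<forall>y\<in>V. \<sigma> y = qgerm X G H y (V, \<alpha>)"
        "\<forall>y\<in>V. ?t y = qgerm X G H y (V, inv\<^bsub>sec G V\<^esub> \<alpha>)" by (elim exE conjE)
      then show "\<exists>V \<alpha>. openin X V \<and> x \<in> V \<and> V \<subseteq> U \<and> \<alpha> \<in> carrier (sec G V) \<and> (\<forall>y\<in>V. ?t y = qgerm X G H y (V, \<alpha>))"
        by (intro exI[of _ V] exI[of _ "inv\<^bsub>sec G V\<^esub> \<alpha>"] conjI V(1-3) inv_closed[OF V(1,4)] V(6))
    qed simp
    show "?t \<otimes>\<^bsub>sec Q U\<^esub> \<sigma> = \<one>\<^bsub>sec Q U\<^esub>"
    proof (rule quot_eqI[OF mult_quot_closed[OF t s] one])
      fix x assume x: "x \<in> U"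
      from loc[OF x] obtain V \<alpha> where V: "openin X V" "x \<in> V" "V \<subseteq> U" "\<alpha> \<in> carrier (sec G V)" "\<forall>y\<in>V. \<sigma> y = qgerm X G H y (V, \<alpha>)"
        "\<forall>y\<in>V. ?t y = qgerm X G H y (V, inv\<^bsub>sec G V\<^esub> \<alpha>)" by (elim exE conjE)
      have "(?t \<otimes>\<^bsub>sec Q U\<^esub> \<sigma>) x = qgerm X G H x (V, inv\<^bsub>sec G V\<^esub> \<alpha> \<otimes>\<^bsub>sec G V\<^esub> \<alpha>)"
        by (rule mult_quot_local_rep[OF t s V(1,3) inv_closed[OF V(1,4)] V(6) V(4,5,2)])
      also have "\<dots> = qgerm X G H x (V, res G U V \<one>\<^bsub>sec G U\<^esub>)"
        using group.l_inv[OF sec_group[OF V(1)] V(4)] res_one[OF U V(1,3)] by simp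
      also have "\<dots> = \<one>\<^bsub>sec Q U\<^esub> x"
        using qgerm_res[of x U "\<one>\<^bsub>sec G U\<^esub>" V] x V U one_closed[OF U] by (simp add: one_quot qproj_def represents_def)
      finally show "(?t \<otimes>\<^bsub>sec Q U\<^esub> \<sigma>) x = \<one>\<^bsub>sec Q U\<^esub> x" .
    qed
  qed
  show "\<sigma> \<otimes>\<^bsub>sec Q U\<^esub> \<tau> \<otimes>\<^bsub>sec Q U\<^esub> \<upsilon> = \<sigma> \<otimes>\<^bsub>sec Q U\<^esub> (\<tau> \<otimes>\<^bsub>sec Q U\<^esub> \<upsilon>)"
    if st: "\<sigma> \<in> carrier (sec Q U)" "\<tau> \<in> carrier (sec Q U)" "\<upsilon> \<in> carrier (sec Q U)" for \<sigma> \<tau> \<upsilon>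
  proof (rule quot_eqI[OF mult_quot_closed[OF mult_quot_closed[OF st(1,2)] st(3)] mult_quot_closed[OF st(1) mult_quot_closed[OF st(2,3)]]])
    fix x assume x: "x \<in> U"
    obtain W \<alpha>' \<beta>' where W: "openin X W" "x \<in> W" "W \<subseteq> U" "W \<subseteq> U" "\<alpha>' \<in> carrier (sec G W)" "\<beta>' \<in> carrier (sec G W)"
        "\<forall>y\<in>W. \<sigma> y = qgerm X G H y (W, \<alpha>')" "\<forall>y\<in>W. \<tau> y = qgerm X G H y (W, \<beta>')"
      by (rule quot_local_rep2[OF st(1,2) x U x])
    obtain V \<gamma> where V: "openin X V" "x \<in> V" "V \<subseteq> U" "V \<subseteq> W" "\<gamma> \<in> carrier (sec G V)"
        "\<forall>y\<in>V. \<upsilon> y = qgerm X G H y (V, \<gamma>)"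
      by (rule quot_local_rep[OF st(3) x W(1,2)])
    let ?a = "res G W V \<alpha>'" and ?b = "res G W V \<beta>'"
    have a: "?a \<in> carrier (sec G V)" "?b \<in> carrier (sec G V)"
      by (rule res_closed[OF W(1) V(1,4) W(5)] res_closed[OF W(1) V(1,4) W(6)])+
    have "\<sigma> y = qgerm X G H y (V, ?a) \<and> \<tau> y = qgerm X G H y (V, ?b)" if "y \<in> V" for y
      using qgerm_res[of y W \<alpha>' V] qgerm_res[of y W \<beta>' V] W(1,5-8) V(1,4) that by (auto simp: represents_def)
    then have ay: "\<forall>y\<in>V. \<sigma> y = qgerm X G H y (V, ?a)" "\<forall>y\<in>V. \<tau> y = qgerm X G H y (V, ?b)" by blast+
    have 1: "\<forall>y\<in>V. (\<sigma> \<otimes>\<^bsub>sec Q U\<^esub> \<tau>) y = qgerm X G H y (V, ?a \<otimes>\<^bsub>sec G V\<^esub> ?b)"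
      using mult_quot_local_rep[OF st(1,2) V(1,3) a(1) ay(1) a(2) ay(2)] by blast
    have 2: "\<forall>y\<in>V. (\<tau> \<otimes>\<^bsub>sec Q U\<^esub> \<upsilon>) y = qgerm X G H y (V, ?b \<otimes>\<^bsub>sec G V\<^esub> \<gamma>)"
      using mult_quot_local_rep[OF st(2,3) V(1,3) a(2) ay(2) V(5,6)] by blast
    have "(\<sigma> \<otimes>\<^bsub>sec Q U\<^esub> \<tau> \<otimes>\<^bsub>sec Q U\<^esub> \<upsilon>) x = qgerm X G H x (V, ?a \<otimes>\<^bsub>sec G V\<^esub> ?b \<otimes>\<^bsub>sec G V\<^esub> \<gamma>)"
      by (rule mult_quot_local_rep[OF mult_quot_closed[OF st(1,2)] st(3) V(1,3) mult_closed[OF V(1) a] 1 V(5,6,2)])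
    also have "\<dots> = qgerm X G H x (V, ?a \<otimes>\<^bsub>sec G V\<^esub> (?b \<otimes>\<^bsub>sec G V\<^esub> \<gamma>))"
      using monoid.m_assoc[OF group.is_monoid[OF sec_group[OF V(1)]] a V(5)] by simp
    also have "\<dots> = (\<sigma> \<otimes>\<^bsub>sec Q U\<^esub> (\<tau> \<otimes>\<^bsub>sec Q U\<^esub> \<upsilon>)) x"
      by (rule mult_quot_local_rep[OF st(1) mult_quot_closed[OF st(2,3)] V(1,3) a(1) ay(1) mult_closed[OF V(1) a(2) V(5)] 2 V(2), symmetric])
    finally show "(\<sigma> \<otimes>\<^bsub>sec Q U\<^esub> \<tau> \<otimes>\<^bsub>sec Q U\<^esub> \<upsilon>) x = (\<sigma> \<otimes>\<^bsub>sec Q U\<^esub> (\<tau> \<otimes>\<^bsub>sec Q U\<^esub> \<upsilon>)) x" .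
  qed
qed

lemma quot_ab_presheaf: "ab_presheaf X Q"
proof (rule ab_presheaf.intro)
  show "comm_group (sec Q U)" if "openin X U" for U by (rule quot_comm_group[OF that])
  show "res Q U V \<in> hom (sec Q U) (sec Q V)" if "openin X U" and V: "openin X V" "V \<subseteq> U" for U V
  proof (rule homI, unfold res_quot)
    show "restrict \<sigma> V \<in> carrier (sec Q V)" if "\<sigma> \<in> carrier (sec Q U)" for \<sigma>
      by (rule restrict_quot_closed[OF that V])
    show "restrict (\<sigma> \<otimes>\<^bsub>sec Q U\<^esub> \<tau>) V = restrict \<sigma> V \<otimes>\<^bsub>sec Q V\<^esub> restrict \<tau> V" for \<sigma> \<tau>
      using V(2) by (auto simp: mult_quot fun_eq_iff)
  qed
  show "res Q V W (res Q U V s) = res Q U W s" if "W \<subseteq> V" for U V W s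
    using that by (simp add: res_quot Int_absorb1)
  show "res Q U U s = s" if "s \<in> carrier (sec Q U)" for U s
    using that by (simp add: res_quot carrier_quot extensional_restrict)
qed

end

section \<open>Exact sequences of quotient sheaves\<close>

locale quotient_map =
  dom: abelian_quotient X G H + cod: abelian_quotient X G' H'
  for X :: "'a topology" and G H G' H' :: "('a, 'g) gsheaf" +
  assumes sec_sub: "openin X U \<Longrightarrow> sec G U = (sec G' U)\<lparr>carrier := carrier (sec G U)\<rparr>"
    and carrier_sub: "openin X U \<Longrightarrow> carrier (sec G U) \<subseteq> carrier (sec G' U)"
    and res_eq: "res G = res G'"
    and H_sub: "openin X U \<Longrightarrow> carrier (sec H U) \<subseteq> carrier (sec H' U)"
begin

lemma subgroup_sec: "openin X U \<Longrightarrow> subgroup (carrier (sec G U)) (sec G' U)"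
proof (rule group.group_incl_imp_subgroup[OF cod.sec_group])
  assume U: "openin X U"
  show "carrier (sec G U) \<subseteq> carrier (sec G' U)" by (rule carrier_sub[OF U])
  show "group ((sec G' U)\<lparr>carrier := carrier (sec G U)\<rparr>)" using dom.sec_group[OF U] sec_sub[OF U] by simp
qed

lemma mult_eq: "openin X U \<Longrightarrow> x \<otimes>\<^bsub>sec G U\<^esub> y = x \<otimes>\<^bsub>sec G' U\<^esub> y"
  by (subst sec_sub) simp_all

lemma inv_eq: "openin X U \<Longrightarrow> x \<in> carrier (sec G U) \<Longrightarrow> inv\<^bsub>sec G U\<^esub> x = inv\<^bsub>sec G' U\<^esub> x"
  using group.m_inv_consistent[OF cod.sec_group subgroup_sec] sec_sub by metis

lemma represents_cod: "dom.represents x p \<Longrightarrow> cod.represents x p"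
  using carrier_sub by (auto simp: dom.represents_def cod.represents_def)

lemma congr_cod:
  assumes "openin X U" "\<alpha> \<in> carrier (sec G U)" "dom.congr U \<alpha> \<beta>"
  shows "cod.congr U \<alpha> \<beta>"
proof -
  have "inv\<^bsub>sec G' U\<^esub> \<alpha> \<otimes>\<^bsub>sec G' U\<^esub> \<beta> = inv\<^bsub>sec G U\<^esub> \<alpha> \<otimes>\<^bsub>sec G U\<^esub> \<beta>"
    by (simp only: mult_eq[OF assms(1)] inv_eq[OF assms(1,2)])
  then show ?thesis using assms(3) H_sub[OF assms(1)] unfolding dom.congr_def cod.congr_def by auto
qed

lemma qgerm_cod:
  assumes p: "dom.represents x (V, \<alpha>)" and q: "(W, \<beta>) \<in> qgerm X G H x (V, \<alpha>)"
  shows "qgerm X G' H' x (W, \<beta>) = qgerm X G' H' x (V, \<alpha>)"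
proof -
  have q': "dom.represents x (W, \<beta>)" by (rule dom.mem_qgerm_eq(1)[OF p q])
  obtain N where N: "openin X N" "x \<in> N" "N \<subseteq> V" "N \<subseteq> W" "dom.congr N (res G V N \<alpha>) (res G W N \<beta>)"
    using q unfolding dom.mem_qgerm_iff by (elim exE conjE)
  have V: "openin X V" "\<alpha> \<in> carrier (sec G V)" using p by (auto simp: dom.represents_def)
  have "cod.congr N (res G' V N \<alpha>) (res G' W N \<beta>)"
    using congr_cod[OF N(1) dom.res_closed[OF V(1) N(1,3) V(2)] N(5)] by (simp only: res_eq)
  then have "qgerm X G' H' x (V, \<alpha>) = qgerm X G' H' x (W, \<beta>)"
    unfolding cod.qgerm_eq_iff[OF represents_cod[OF p] represents_cod[OF q']]
    by (intro exI[of _ N] conjI N(1-4))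
  then show ?thesis by (rule sym)
qed

lemma UN_qgerm_cod:
  assumes p: "dom.represents x (V, \<alpha>)"
  shows "(\<Union>p\<in>qgerm X G H x (V, \<alpha>). qgerm X G' H' x p) = qgerm X G' H' x (V, \<alpha>)"
proof (rule UN_eq_constant[OF dom.mem_qgerm_self[OF p]])
  fix q assume q: "q \<in> qgerm X G H x (V, \<alpha>)"
  obtain W \<beta> where "q = (W, \<beta>)" by (rule prod.exhaust)
  with q qgerm_cod[OF p] show "qgerm X G' H' x q = qgerm X G' H' x (V, \<alpha>)" by simp
qed

lemma qmap_at:
  assumes "\<sigma> x = qgerm X G H x (V, \<alpha>)" "openin X V" "\<alpha> \<in> carrier (sec G V)" "x \<in> V" "x \<in> U"
  shows "qmap X G' H' U \<sigma> x = qgerm X G' H' x (V, \<alpha>)"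
  using UN_qgerm_cod[of x V \<alpha>] assms by (simp add: qmap_def dom.represents_def)

lemma qmap_closed:
  assumes U: "openin X U" and s: "\<sigma> \<in> carrier (sec dom.Q U)"
  shows "qmap X G' H' U \<sigma> \<in> carrier (sec cod.Q U)"
proof (rule cod.quotI)
  show "qmap X G' H' U \<sigma> \<in> extensional U" by (simp add: qmap_def)
  fix x assume x: "x \<in> U"
  obtain V \<alpha> where V: "openin X V" "x \<in> V" "V \<subseteq> U" "V \<subseteq> U" "\<alpha> \<in> carrier (sec G V)"
      "\<forall>y\<in>V. \<sigma> y = qgerm X G H y (V, \<alpha>)"
    by (rule dom.quot_local_rep[OF s x U x])
  have "\<forall>y\<in>V. qmap X G' H' U \<sigma> y = qgerm X G' H' y (V, \<alpha>)"
  proof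
    fix y assume y: "y \<in> V"
    then show "qmap X G' H' U \<sigma> y = qgerm X G' H' y (V, \<alpha>)"
      by (intro qmap_at[where \<sigma> = \<sigma>, OF bspec[OF V(6)] V(1,5)] subsetD[OF V(3)])
  qed
  then show "\<exists>V \<alpha>. openin X V \<and> x \<in> V \<and> V \<subseteq> U \<and> \<alpha> \<in> carrier (sec G' V) \<and>
      (\<forall>y\<in>V. qmap X G' H' U \<sigma> y = qgerm X G' H' y (V, \<alpha>))"
    by (intro exI[of _ V] exI[of _ \<alpha>] conjI V(1-3) subsetD[OF carrier_sub[OF V(1)] V(5)])
qed

lemma qmap_mult:
  assumes U: "openin X U" and s: "\<sigma> \<in> carrier (sec dom.Q U)" and t: "\<tau> \<in> carrier (sec dom.Q U)"
  shows "qmap X G' H' U (\<sigma> \<otimes>\<^bsub>sec dom.Q U\<^esub> \<tau>) = qmap X G' H' U \<sigma> \<otimes>\<^bsub>sec cod.Q U\<^esub> qmap X G' H' U \<tau>"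
proof (rule cod.quot_eqI[OF qmap_closed[OF U dom.mult_quot_closed[OF s t]]
      cod.mult_quot_closed[OF qmap_closed[OF U s] qmap_closed[OF U t]]])
  fix x assume x: "x \<in> U"
  obtain V \<alpha> \<beta> where V: "openin X V" "x \<in> V" "V \<subseteq> U" "V \<subseteq> U" "\<alpha> \<in> carrier (sec G V)" "\<beta> \<in> carrier (sec G V)"
      "\<forall>y\<in>V. \<sigma> y = qgerm X G H y (V, \<alpha>)" "\<forall>y\<in>V. \<tau> y = qgerm X G H y (V, \<beta>)"
    by (rule dom.quot_local_rep2[OF s t x U x])
  have st: "(\<sigma> \<otimes>\<^bsub>sec dom.Q U\<^esub> \<tau>) x = qgerm X G H x (V, \<alpha> \<otimes>\<^bsub>sec G V\<^esub> \<beta>)"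
    by (rule dom.mult_quot_local_rep[OF s t V(1,3) V(5,7) V(6,8) V(2)])
  have l: "qmap X G' H' U (\<sigma> \<otimes>\<^bsub>sec dom.Q U\<^esub> \<tau>) x = qgerm X G' H' x (V, \<alpha> \<otimes>\<^bsub>sec G' V\<^esub> \<beta>)"
    using qmap_at[where \<sigma> = "\<sigma> \<otimes>\<^bsub>sec dom.Q U\<^esub> \<tau>", OF st V(1) dom.mult_closed[OF V(1,5,6)] V(2) x] by (simp only: mult_eq[OF V(1)])
  have a: "\<forall>y\<in>V. qmap X G' H' U \<sigma> y = qgerm X G' H' y (V, \<alpha>)"
    by (intro ballI qmap_at[where \<sigma> = \<sigma>, OF bspec[OF V(7)] V(1,5)] subsetD[OF V(3)])
  have b: "\<forall>y\<in>V. qmap X G' H' U \<tau> y = qgerm X G' H' y (V, \<beta>)"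
    by (intro ballI qmap_at[where \<sigma> = \<tau>, OF bspec[OF V(8)] V(1,6)] subsetD[OF V(3)])
  show "qmap X G' H' U (\<sigma> \<otimes>\<^bsub>sec dom.Q U\<^esub> \<tau>) x = (qmap X G' H' U \<sigma> \<otimes>\<^bsub>sec cod.Q U\<^esub> qmap X G' H' U \<tau>) x"
    unfolding l
    by (rule cod.mult_quot_local_rep[OF qmap_closed[OF U s] qmap_closed[OF U t] V(1,3)
        subsetD[OF carrier_sub[OF V(1)] V(5)] a subsetD[OF carrier_sub[OF V(1)] V(6)] b V(2), symmetric])
qed

lemma qmap_qproj:
  assumes U: "openin X U" and a: "\<alpha> \<in> carrier (sec G U)"
  shows "qmap X G' H' U (qproj X G H U \<alpha>) = qproj X G' H' U \<alpha>"
proof (rule ext)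
  fix x show "qmap X G' H' U (qproj X G H U \<alpha>) x = qproj X G' H' U \<alpha> x"
  proof (cases "x \<in> U")
    case True
    then show ?thesis using qmap_at[of "qproj X G H U \<alpha>" x U \<alpha> U] U a by (simp add: qproj_def)
  next
    case False
    then show ?thesis by (simp add: qproj_def qmap_def)
  qed
qed

lemma qmap_presheaf_morphism: "presheaf_morphism X dom.Q cod.Q (qmap X G' H')"
proof (intro presheaf_morphism.intro presheaf_morphism_axioms.intro dom.quot_ab_presheaf cod.quot_ab_presheaf homI)
  show "qmap X G' H' U \<sigma> \<in> carrier (sec cod.Q U)" if "openin X U" "\<sigma> \<in> carrier (sec dom.Q U)" for U \<sigma>
    by (rule qmap_closed[OF that])
  show "qmap X G' H' U (\<sigma> \<otimes>\<^bsub>sec dom.Q U\<^esub> \<tau>) = qmap X G' H' U \<sigma> \<otimes>\<^bsub>sec cod.Q U\<^esub> qmap X G' H' U \<tau>"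
    if "openin X U" "\<sigma> \<in> carrier (sec dom.Q U)" "\<tau> \<in> carrier (sec dom.Q U)" for U \<sigma> \<tau>
    by (rule qmap_mult[OF that])
  show "res cod.Q U V (qmap X G' H' U \<sigma>) = qmap X G' H' V (res dom.Q U V \<sigma>)" if "V \<subseteq> U" for U V \<sigma>
    unfolding cod.res_quot dom.res_quot qmap_def using that by (auto simp: fun_eq_iff)
qed

end

text \<open>Sheaves of groups \<open>G \<supseteq> G1 \<supseteq> H\<close>, where \<open>H\<close> contains the commutators of \<open>G\<close>. As \<open>G1\<close> is a sheaf,
  its sections can be recognised locally.\<close>

locale quotient_sequence =
  GH: abelian_quotient X G H + GG1: abelian_quotient X G G1 + G1H: abelian_quotient X G1 H
  for X :: "'a topology" and G G1 H :: "('a, 'g) gsheaf" +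
  assumes sec_G1: "openin X U \<Longrightarrow> sec G1 U = (sec G U)\<lparr>carrier := carrier (sec G1 U)\<rparr>"
    and res_G1: "res G1 = res G"
    and local_G1: "openin X U \<Longrightarrow> \<alpha> \<in> carrier (sec G U) \<Longrightarrow>
      (\<And>x. x \<in> U \<Longrightarrow> \<exists>N. openin X N \<and> x \<in> N \<and> N \<subseteq> U \<and> res G U N \<alpha> \<in> carrier (sec G1 N)) \<Longrightarrow>
      \<alpha> \<in> carrier (sec G1 U)"
    and regular_X: "regular_space X" and Lindelof_X: "Lindelof_space X"
begin

abbreviation incl where "incl \<equiv> qmap X G H"
abbreviation proj where "proj \<equiv> qmap X G G1"

sublocale i: quotient_map X G1 H G H
proof (intro quotient_map.intro quotient_map_axioms.intro G1H.abelian_quotient_axioms GH.abelian_quotient_axioms)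
  show "sec G1 U = (sec G U)\<lparr>carrier := carrier (sec G1 U)\<rparr>" if "openin X U" for U by (rule sec_G1[OF that])
  show "carrier (sec G1 U) \<subseteq> carrier (sec G U)" if "openin X U" for U
    by (rule subgroup.subset[OF GG1.subgroup_H[OF that]])
  show "res G1 = res G" by (rule res_G1)
qed simp

sublocale p: quotient_map X G H G G1
proof (intro quotient_map.intro quotient_map_axioms.intro GG1.abelian_quotient_axioms GH.abelian_quotient_axioms)
  show "carrier (sec H U) \<subseteq> carrier (sec G1 U)" if "openin X U" for U
    by (rule subgroup.subset[OF G1H.subgroup_H[OF that]])
qed simp_all

lemma congr_G1:
  assumes "openin X U" "\<alpha> \<in> carrier (sec G1 U)" "GH.congr U \<alpha> \<beta>"
  shows "G1H.congr U \<alpha> \<beta>"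
  using assms(3) unfolding GH.congr_def G1H.congr_def
  by (simp only: i.mult_eq[OF assms(1)] i.inv_eq[OF assms(1,2)])

lemma qgerm_G1:
  assumes p: "G1H.represents x (V, \<alpha>)" and q: "G1H.represents x (W, \<beta>)"
    and eq: "qgerm X G H x (V, \<alpha>) = qgerm X G H x (W, \<beta>)"
  shows "qgerm X G1 H x (V, \<alpha>) = qgerm X G1 H x (W, \<beta>)"
proof -
  obtain N where N: "openin X N" "x \<in> N" "N \<subseteq> V" "N \<subseteq> W" "GH.congr N (res G V N \<alpha>) (res G W N \<beta>)"
    using eq unfolding GH.qgerm_eq_iff[OF i.represents_cod[OF p] i.represents_cod[OF q]] by (elim exE conjE)
  have V: "openin X V" "\<alpha> \<in> carrier (sec G1 V)" using p by (auto simp: G1H.represents_def)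
  have "G1H.congr N (res G1 V N \<alpha>) (res G1 W N \<beta>)"
    using congr_G1[OF N(1) G1H.res_closed[OF V(1) N(1,3) V(2), unfolded res_G1] N(5)] by (simp only: res_G1)
  then show ?thesis unfolding G1H.qgerm_eq_iff[OF p q] by (intro exI[of _ N] conjI N(1-4))
qed

lemma incl_inj:
  assumes U: "openin X U" shows "inj_on (incl U) (carrier (sec G1H.Q U))"
proof (rule inj_onI)
  fix \<sigma> \<tau> assume s: "\<sigma> \<in> carrier (sec G1H.Q U)" and t: "\<tau> \<in> carrier (sec G1H.Q U)" and eq: "incl U \<sigma> = incl U \<tau>"
  show "\<sigma> = \<tau>"
  proof (rule G1H.quot_eqI[OF s t])
    fix x assume x: "x \<in> U"
    obtain V \<alpha> \<beta> where V: "openin X V" "x \<in> V" "V \<subseteq> U" "V \<subseteq> U" "\<alpha> \<in> carrier (sec G1 V)" "\<beta> \<in> carrier (sec G1 V)"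
        "\<forall>y\<in>V. \<sigma> y = qgerm X G1 H y (V, \<alpha>)" "\<forall>y\<in>V. \<tau> y = qgerm X G1 H y (V, \<beta>)"
      by (rule G1H.quot_local_rep2[OF s t x U x])
    have "qgerm X G H x (V, \<alpha>) = qgerm X G H x (V, \<beta>)"
      using i.qmap_at[where \<sigma> = \<sigma>, OF bspec[OF V(7,2)] V(1,5,2) x] i.qmap_at[where \<sigma> = \<tau>, OF bspec[OF V(8,2)] V(1,6,2) x] eq by simp
    then have "qgerm X G1 H x (V, \<alpha>) = qgerm X G1 H x (V, \<beta>)"
      by (rule qgerm_G1[rotated 2]) (use V(1,2,5,6) in \<open>simp_all add: G1H.represents_def\<close>)
    then show "\<sigma> x = \<tau> x" using bspec[OF V(7,2)] bspec[OF V(8,2)] by simp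
  qed
qed

text \<open>If \<open>\<sigma>\<close> is trivial modulo \<open>G1\<close>, it is locally represented by sections of \<open>G1\<close>. Its preimage is
  obtained by keeping from each germ only those of its representatives that are sections of \<open>G1\<close>.\<close>

lemma incl_proj_exact:
  assumes U: "openin X U" and s: "\<sigma> \<in> carrier (sec GH.Q U)" and one: "proj U \<sigma> = \<one>\<^bsub>sec GG1.Q U\<^esub>"
  shows "\<sigma> \<in> incl U ` carrier (sec G1H.Q U)"
proof -
  define \<tau> where "\<tau> = (\<lambda>y\<in>U. \<sigma> y \<inter> {(W, \<beta>). \<beta> \<in> carrier (sec G1 W)})"
  have loc: "\<exists>N \<beta>. openin X N \<and> x \<in> N \<and> N \<subseteq> U \<and> \<beta> \<in> carrier (sec G1 N) \<and>
      (\<forall>y\<in>N. \<sigma> y = qgerm X G H y (N, \<beta>)) \<and> (\<forall>y\<in>N. \<tau> y = qgerm X G1 H y (N, \<beta>))" if x: "x \<in> U" for x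
  proof -
    obtain V \<alpha> where V: "openin X V" "x \<in> V" "V \<subseteq> U" "V \<subseteq> U" "\<alpha> \<in> carrier (sec G V)"
        "\<forall>y\<in>V. \<sigma> y = qgerm X G H y (V, \<alpha>)"
      by (rule GH.quot_local_rep[OF s x U x])
    note oU = GH.one_closed[OF U]
    have "qgerm X G G1 x (V, \<alpha>) = qgerm X G G1 x (U, \<one>\<^bsub>sec G U\<^esub>)"
      using p.qmap_at[where \<sigma> = \<sigma>, OF bspec[OF V(6,2)] V(1,5,2) x] one x by (simp add: GG1.one_quot qproj_def)
    moreover have reps: "GG1.represents x (V, \<alpha>)" "GG1.represents x (U, \<one>\<^bsub>sec G U\<^esub>)"
      using V(1,2,5) x U oU by (simp_all add: GG1.represents_def)
    ultimately have "\<exists>N. openin X N \<and> x \<in> N \<and> N \<subseteq> V \<and> N \<subseteq> U \<and> GG1.congr N (res G V N \<alpha>) (res G U N \<one>\<^bsub>sec G U\<^esub>)"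
      by (simp only: GG1.qgerm_eq_iff)
    then obtain N where N: "openin X N" "x \<in> N" "N \<subseteq> V" "N \<subseteq> U"
        "GG1.congr N (res G V N \<alpha>) (res G U N \<one>\<^bsub>sec G U\<^esub>)"
      by (elim exE conjE)
    let ?b = "res G V N \<alpha>"
    have bG: "?b \<in> carrier (sec G N)" by (rule GH.res_closed[OF V(1) N(1,3) V(5)])
    interpret N: group "sec G N" by (rule GH.sec_group[OF N(1)])
    have "inv\<^bsub>sec G N\<^esub> ?b \<in> carrier (sec G1 N)"
      using N(5) bG by (simp add: GG1.congr_def GH.res_one[OF U N(1,4)])
    then have b: "?b \<in> carrier (sec G1 N)"
      using subgroup.m_inv_closed[OF GG1.subgroup_H[OF N(1)]] bG by fastforce
    have sy: "\<sigma> y = qgerm X G H y (N, ?b)" if y: "y \<in> N" for y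
    proof -
      have "GH.represents y (V, \<alpha>)" using V(1,5) y N(3) by (auto simp: GH.represents_def)
      then show ?thesis using bspec[OF V(6) subsetD[OF N(3) y]] GH.qgerm_res[of y V \<alpha> N] y N(1,3) by simp
    qed
    have ty: "\<tau> y = qgerm X G1 H y (N, ?b)" if y: "y \<in> N" for y
    proof -
      have r: "G1H.represents y (N, ?b)" using N(1) y b by (simp add: G1H.represents_def)
      have "(W, \<gamma>) \<in> \<tau> y \<longleftrightarrow> (W, \<gamma>) \<in> qgerm X G1 H y (N, ?b)" for W \<gamma>
      proof -
        have "(W, \<gamma>) \<in> \<tau> y \<longleftrightarrow> (W, \<gamma>) \<in> qgerm X G H y (N, ?b) \<and> \<gamma> \<in> carrier (sec G1 W)"
          using y N(4) sy[OF y] by (auto simp: \<tau>_def)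
        also have "\<dots> \<longleftrightarrow> (W, \<gamma>) \<in> qgerm X G1 H y (N, ?b)"
        proof
          assume *: "(W, \<gamma>) \<in> qgerm X G H y (N, ?b) \<and> \<gamma> \<in> carrier (sec G1 W)"
          note m = GH.mem_qgerm_eq[OF i.represents_cod[OF r] conjunct1[OF *]]
          have r': "G1H.represents y (W, \<gamma>)" using m(1) * by (simp add: GH.represents_def G1H.represents_def)
          show "(W, \<gamma>) \<in> qgerm X G1 H y (N, ?b)"
            using qgerm_G1[OF r' r m(2)] G1H.mem_qgerm_self[OF r'] by simp
        next
          assume *: "(W, \<gamma>) \<in> qgerm X G1 H y (N, ?b)"
          note r' = G1H.mem_qgerm_eq(1)[OF r *]
          have "qgerm X G H y (W, \<gamma>) = qgerm X G H y (N, ?b)" by (rule i.qgerm_cod[OF r *])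
          then show "(W, \<gamma>) \<in> qgerm X G H y (N, ?b) \<and> \<gamma> \<in> carrier (sec G1 W)"
            using GH.mem_qgerm_self[OF i.represents_cod[OF r']] r' by (simp add: G1H.represents_def)
        qed
        finally show ?thesis .
      qed
      then show ?thesis by auto
    qed
    show ?thesis by (intro exI[of _ N] exI[of _ ?b] conjI ballI N(1,2,4) b sy ty)
  qed
  have t: "\<tau> \<in> carrier (sec G1H.Q U)"
  proof (rule G1H.quotI)
    show "\<tau> \<in> extensional U" by (simp add: \<tau>_def)
    fix x assume x: "x \<in> U"
    from loc[OF x] obtain N \<beta> where N: "openin X N" "x \<in> N" "N \<subseteq> U" "\<beta> \<in> carrier (sec G1 N)"
      "\<forall>y\<in>N. \<sigma> y = qgerm X G H y (N, \<beta>)" "\<forall>y\<in>N. \<tau> y = qgerm X G1 H y (N, \<beta>)" by (elim exE conjE)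
    show "\<exists>V \<alpha>. openin X V \<and> x \<in> V \<and> V \<subseteq> U \<and> \<alpha> \<in> carrier (sec G1 V) \<and> (\<forall>y\<in>V. \<tau> y = qgerm X G1 H y (V, \<alpha>))"
      by (intro exI[of _ N] exI[of _ \<beta>] conjI N(1-4,6))
  qed
  have "\<sigma> = incl U \<tau>"
  proof (rule GH.quot_eqI[OF s i.qmap_closed[OF U t]])
    fix x assume x: "x \<in> U"
    from loc[OF x] obtain N \<beta> where N: "openin X N" "x \<in> N" "N \<subseteq> U" "\<beta> \<in> carrier (sec G1 N)"
      "\<forall>y\<in>N. \<sigma> y = qgerm X G H y (N, \<beta>)" "\<forall>y\<in>N. \<tau> y = qgerm X G1 H y (N, \<beta>)" by (elim exE conjE)
    show "\<sigma> x = incl U \<tau> x"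
      using bspec[OF N(5,2)] i.qmap_at[where \<sigma> = \<tau>, OF bspec[OF N(6,2)] N(1,4,2) x] by simp
  qed
  then show ?thesis using t by (rule image_eqI)
qed

sublocale short_exact_sheaves X G1H.Q GH.Q GG1.Q incl proj
proof (intro short_exact_sheaves.intro short_exact_sheaves_axioms.intro i.qmap_presheaf_morphism p.qmap_presheaf_morphism
    regular_X Lindelof_X)
  show "inj_on (incl U) (carrier (sec G1H.Q U))" if "openin X U" for U by (rule incl_inj[OF that])
  show "b \<in> incl U ` carrier (sec G1H.Q U)"
    if "openin X U" "b \<in> carrier (sec GH.Q U)" "proj U b = \<one>\<^bsub>sec GG1.Q U\<^esub>" for U b
    by (rule incl_proj_exact[OF that])
  show "\<exists>V b. openin X V \<and> x \<in> V \<and> V \<subseteq> U \<and> b \<in> carrier (sec GH.Q V) \<and> proj V b = res GG1.Q U V c"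
    if U: "openin X U" and c: "c \<in> carrier (sec GG1.Q U)" and x: "x \<in> U" for U c x
  proof -
    obtain V \<alpha> where V: "openin X V" "x \<in> V" "V \<subseteq> U" "V \<subseteq> U" "\<alpha> \<in> carrier (sec G V)"
        "\<forall>y\<in>V. c y = qgerm X G G1 y (V, \<alpha>)"
      by (rule GG1.quot_local_rep[OF c x U x])
    have "qproj X G G1 V \<alpha> = restrict c V"
      unfolding qproj_def using V(6) by (intro restrict_ext) simp
    then have "proj V (qproj X G H V \<alpha>) = res GG1.Q U V c"
      by (simp only: p.qmap_qproj[OF V(1,5)] GG1.res_quot)
    then show ?thesis
      by (intro exI[of _ V] exI[of _ "qproj X G H V \<alpha>"] conjI V(1-3) GH.qproj_closed[OF V(1,5)])
  qed
  show "c = \<one>\<^bsub>sec GG1.Q {}\<^esub>" if "c \<in> carrier (sec GG1.Q {})" for c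
    using that by (auto simp: GG1.carrier_quot GG1.one_quot qproj_def)
qed

text \<open>A section of \<open>G / G1\<close> lifts to sections \<open>\<beta> W\<close> of \<open>G\<close> over the members of a cover, and
  \<open>(\<beta> A)\<^sup>-\<^sup>1 (\<beta> B)\<close> is then a cocycle of \<open>G1\<close> that is trivial in \<open>G\<close>. The class of its image in
  \<open>G1 / H\<close> is the value of the connecting map.\<close>

lemma connecting_0_obstruction:
  assumes triv: "\<And>\<W> u h. (\<W>, u) \<in> nab_reps X G1 \<Longrightarrow> h \<in> cochains G \<W> 0 \<Longrightarrow>
      (\<And>A B. A \<in> \<W> \<Longrightarrow> B \<in> \<W> \<Longrightarrow> u [A, B] =
         res G A (A \<inter> B) (h [A]) \<otimes>\<^bsub>sec G (A \<inter> B)\<^esub> inv\<^bsub>sec G (A \<inter> B)\<^esub> res G B (A \<inter> B) (h [B])) \<Longrightarrow>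
      cech_class X G1H.Q 1 (\<W>, cmap (qproj X G1 H) \<W> 1 u) = \<one>\<^bsub>cohom X G1H.Q 1\<^esub>"
    and D: "lift_data 0 \<U> c b a"
  shows "cech_class X G1H.Q (Suc 0) (\<U>, a) = \<one>\<^bsub>cohom X G1H.Q (Suc 0)\<^esub>"
proof -
  have U: "open_cover X \<U>" and b: "b \<in> cochains GH.Q \<U> 0" using D by (auto simp: lift_data_def)
  have "\<exists>N. openin X N \<and> x \<in> N \<and> N \<subseteq> U \<and> (\<exists>\<beta>. \<beta> \<in> carrier (sec G N) \<and> restrict (b [U]) N = qproj X G H N \<beta>)"
    if "U \<in> \<U>" "x \<in> U" for U x
  proof -
    have "b [U] \<in> carrier (sec GH.Q (\<Inter>(set [U])))"
      using that b unfolding cochains_def by (intro PiE_mem[of b]) (auto simp: simplices_def)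
    then have bU: "b [U] \<in> carrier (sec GH.Q U)" by simp
    have oU: "openin X U" using that(1) U by (simp add: open_cover_def)
    note xU = that(2)
    obtain V \<beta> where V: "openin X V" "x \<in> V" "V \<subseteq> U" "V \<subseteq> U" "\<beta> \<in> carrier (sec G V)"
        "\<forall>y\<in>V. b [U] y = qgerm X G H y (V, \<beta>)"
      by (rule GH.quot_local_rep[OF bU xU oU xU])
    have "restrict (b [U]) V = qproj X G H V \<beta>" unfolding qproj_def using V(6) by (intro restrict_ext) simp
    then show ?thesis using V(1,2,3,5) by blast
  qed
  then obtain \<W> \<rho> where W: "open_cover X \<W>" "refinement \<rho> \<W> \<U>"
      "\<And>W. W \<in> \<W> \<Longrightarrow> \<exists>\<beta>. \<beta> \<in> carrier (sec G W) \<and> restrict (b [\<rho> W]) W = qproj X G H W \<beta>"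
    using refinement_by_local_property[OF U, of "\<lambda>U N. \<exists>\<beta>. \<beta> \<in> carrier (sec G N) \<and> restrict (b [U]) N = qproj X G H N \<beta>"]
    by blast
  then obtain \<beta> where \<beta>: "\<And>W. W \<in> \<W> \<Longrightarrow> \<beta> W \<in> carrier (sec G W)"
      "\<And>W. W \<in> \<W> \<Longrightarrow> restrict (b [\<rho> W]) W = qproj X G H W (\<beta> W)" by metis
  let ?c = "pullback GG1.Q \<rho> \<W> 0 c" and ?b = "pullback GH.Q \<rho> \<W> 0 b" and ?a = "pullback G1H.Q \<rho> \<W> (Suc 0) a"
  have E: "lift_data 0 \<W> ?c ?b ?a" by (rule lift_data_pullback[OF D W(1,2)])
  then have b': "?b \<in> cochains GH.Q \<W> 0" and c': "?c \<in> cocycles GG1.Q \<W> 0" and a': "?a \<in> cochains G1H.Q \<W> (Suc 0)"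
    and gb: "cmap proj \<W> 0 ?b = ?c" and fa: "cmap incl \<W> (Suc 0) ?a = cobdry GH.Q \<W> 0 ?b"
    by (auto simp: lift_data_def cocycles_def)
  have oW: "openin X A" if "A \<in> \<W>" for A using W(1) that by (simp add: open_cover_def)
  have rb: "rval GH.Q ?b [A] S = qproj X G H S (res G A S (\<beta> A))" if A: "A \<in> \<W>" and S: "openin X S" "S \<subseteq> A" for A S
  proof -
    have "[A] \<in> simplices \<W> 0" using A by (simp add: simplices_def)
    then have "rval GH.Q ?b [A] S = restrict (restrict (b [\<rho> A]) A) S"
      by (simp add: rval_def pullback_def GH.res_quot)
    then show ?thesis using \<beta>(2)[OF A] GH.qproj_res[OF oW[OF A] S \<beta>(1)[OF A]] by simp
  qed
  define v where "v A B S = inv\<^bsub>sec G S\<^esub> res G A S (\<beta> A) \<otimes>\<^bsub>sec G S\<^esub> res G B S (\<beta> B)" for A B S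
  have r: "res G A S (\<beta> A) \<in> carrier (sec G S)" if "A \<in> \<W>" "openin X S" "S \<subseteq> A" for A S
    by (rule GH.res_closed[OF oW[OF that(1)] that(2,3) \<beta>(1)[OF that(1)]])
  have vG: "v A B S \<in> carrier (sec G S)" if "A \<in> \<W>" "B \<in> \<W>" "openin X S" "S \<subseteq> A" "S \<subseteq> B" for A B S
    unfolding v_def by (intro GH.mult_closed GH.inv_closed r that)
  have v_res: "res G S T (v A B S) = v A B T"
    if "A \<in> \<W>" "B \<in> \<W>" "openin X S" "S \<subseteq> A" "S \<subseteq> B" "openin X T" "T \<subseteq> S" for A B S T
    unfolding v_def
    by (simp only: GH.res_mult[OF that(3,6,7) GH.inv_closed[OF that(3) r[OF that(1,3,4)]] r[OF that(2,3,5)]]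
        GH.res_inv[OF that(3,6,7) r[OF that(1,3,4)]]
        GH.res_res[OF oW[OF that(1)] that(3,6,4,7) \<beta>(1)[OF that(1)]]
        GH.res_res[OF oW[OF that(2)] that(3,6,5,7) \<beta>(1)[OF that(2)]])
  \<comment> \<open>The lifts agree modulo \<open>G1\<close> because \<open>c\<close> is a cocycle.\<close>
  have vG1: "v A B S \<in> carrier (sec G1 S)" if A: "A \<in> \<W>" "B \<in> \<W>" and S: "openin X S" "S \<subseteq> A" "S \<subseteq> B" for A B S
  proof (rule local_G1[OF S(1) vG[OF A S]])
    have rc: "rval GG1.Q ?c [C] S = qproj X G G1 S (res G C S (\<beta> C))" if C: "C \<in> \<W>" "S \<subseteq> C" for C
    proof -
      have l: "[C] \<in> simplices \<W> 0" using C by (simp add: simplices_def)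
      have "rval GG1.Q ?c [C] S = proj S (rval GH.Q ?b [C] S)"
        unfolding gb[symmetric] by (rule g.rval_cmap[OF W(1) b' l S(1)]) (use C in simp)
      then show ?thesis using rb[OF C(1) S(1) C(2)] p.qmap_qproj[OF S(1) r[OF C(1) S(1) C(2)]] by simp
    qed
    have "qproj X G G1 S (res G A S (\<beta> A)) = qproj X G G1 S (res G B S (\<beta> B))"
      using g.G.cocycle_0_eq[OF W(1) c' A S] rc[OF A(1) S(2)] rc[OF A(2) S(3)] by simp
    then have *: "\<forall>x\<in>S. \<exists>N. openin X N \<and> x \<in> N \<and> N \<subseteq> S \<and> GG1.congr N (res G S N (res G A S (\<beta> A))) (res G S N (res G B S (\<beta> B)))"
      using GG1.qproj_eq_iff[OF S(1) r[OF A(1) S(1,2)] r[OF A(2) S(1,3)]] by simp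
    fix x assume x: "x \<in> S"
    obtain N where N: "openin X N" "x \<in> N" "N \<subseteq> S" "GG1.congr N (res G S N (res G A S (\<beta> A))) (res G S N (res G B S (\<beta> B)))"
      using bspec[OF * x] by (elim exE conjE)
    have "res G S N (v A B S) = inv\<^bsub>sec G N\<^esub> res G S N (res G A S (\<beta> A)) \<otimes>\<^bsub>sec G N\<^esub> res G S N (res G B S (\<beta> B))"
      unfolding v_def
      by (simp only: GH.res_mult[OF S(1) N(1,3) GH.inv_closed[OF S(1) r[OF A(1) S(1,2)]] r[OF A(2) S(1,3)]]
          GH.res_inv[OF S(1) N(1,3) r[OF A(1) S(1,2)]])
    then have "res G S N (v A B S) \<in> carrier (sec G1 N)" using N(4) by (simp only: GG1.congr_def)
    then show "\<exists>N. openin X N \<and> x \<in> N \<and> N \<subseteq> S \<and> res G S N (v A B S) \<in> carrier (sec G1 N)"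
      by (intro exI[of _ N] conjI N(1-3))
  qed
  define u where "u = (\<lambda>l\<in>simplices \<W> 1. v (l ! 0) (l ! 1) (\<Inter>(set l)))"
  have uAB: "u [A, B] = v A B (A \<inter> B)" if "A \<in> \<W>" "B \<in> \<W>" for A B using that by (simp add: u_def simplices_def)
  have u: "u \<in> cochains G1 \<W> 1" unfolding u_def cochains_def
  proof (rule restrict_PiE_iff[THEN iffD2], rule ballI)
    fix l assume l: "l \<in> simplices \<W> 1"
    then obtain A B where A: "l = [A, B]" "A \<in> \<W>" "B \<in> \<W>" by (rule simplices_1_cases)
    show "v (l ! 0) (l ! 1) (\<Inter>(set l)) \<in> carrier (sec G1 (\<Inter>(set l)))"
      by (rule vG1[OF _ _ openin_simplex[OF W(1) l]]) (use A in auto)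
  qed
  have ur: "res G1 (A \<inter> B) S (u [A, B]) = v A B S" if "A \<in> \<W>" "B \<in> \<W>" "openin X S" "S \<subseteq> A" "S \<subseteq> B" for A B S
    unfolding uAB[OF that(1,2)] res_G1
    by (rule v_res[OF that(1,2)]) (use that oW in auto)
  have nab: "(\<W>, u) \<in> nab_reps X G1" unfolding nab_reps_def mem_Collect_eq case_prod_conv
  proof (intro conjI W(1) u ballI)
    fix l assume l: "l \<in> simplices \<W> 2"
    then obtain A B C where A: "l = [A, B, C]" "A \<in> \<W>" "B \<in> \<W>" "C \<in> \<W>" by (rule simplices_2_cases)
    let ?S = "\<Inter>(set l)"
    have S: "openin X ?S" "?S \<subseteq> A" "?S \<subseteq> B" "?S \<subseteq> C" using openin_simplex[OF W(1) l] A(1) by auto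
    interpret S: group "sec G ?S" by (rule GH.sec_group[OF S(1)])
    have "face_res G1 u l 2 = v A B ?S" "face_res G1 u l 0 = v B C ?S" "face_res G1 u l 1 = v A C ?S"
      using ur[OF A(2,3) S(1-3)] ur[OF A(3,4) S(1,3,4)] ur[OF A(2,4) S(1,2,4)]
      by (simp_all add: face_res_def A(1) numeral_2_eq_2)
    moreover have "v A B ?S \<otimes>\<^bsub>sec G ?S\<^esub> v B C ?S = v A C ?S"
      using r[OF A(2) S(1,2)] r[OF A(3) S(1,3)] r[OF A(4) S(1,4)]
      unfolding v_def by (simp add: S.m_assoc S.cancel_inv_left)
    ultimately show "face_res G1 u l 2 \<otimes>\<^bsub>sec G1 ?S\<^esub> face_res G1 u l 0 = face_res G1 u l 1"
      by (simp only: i.mult_eq[OF S(1)])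
  qed
  define h where "h = (\<lambda>l\<in>simplices \<W> 0. inv\<^bsub>sec G (hd l)\<^esub> \<beta> (hd l))"
  have h: "h \<in> cochains G \<W> 0" unfolding h_def cochains_def
    by (rule restrict_PiE_iff[THEN iffD2]) (auto elim!: simplices_0_cases intro!: GH.inv_closed oW \<beta>(1))
  have "cech_class X G1H.Q 1 (\<W>, cmap (qproj X G1 H) \<W> 1 u) = \<one>\<^bsub>cohom X G1H.Q 1\<^esub>"
  proof (rule triv[OF nab h])
    fix A B assume A: "A \<in> \<W>" "B \<in> \<W>"
    have o: "openin X (A \<inter> B)" using oW A by blast
    interpret S: group "sec G (A \<inter> B)" by (rule GH.sec_group[OF o])
    have hA: "h [C] = inv\<^bsub>sec G C\<^esub> \<beta> C" if "C \<in> \<W>" for C using that by (simp add: h_def simplices_def)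
    show "u [A, B] = res G A (A \<inter> B) (h [A]) \<otimes>\<^bsub>sec G (A \<inter> B)\<^esub> inv\<^bsub>sec G (A \<inter> B)\<^esub> res G B (A \<inter> B) (h [B])"
      unfolding uAB[OF A] v_def hA[OF A(1)] hA[OF A(2)]
        GH.res_inv[OF oW[OF A(1)] o Int_lower1 \<beta>(1)[OF A(1)]] GH.res_inv[OF oW[OF A(2)] o Int_lower2 \<beta>(1)[OF A(2)]]
        S.inv_inv[OF r[OF A(2) o Int_lower2]] ..
  qed
  moreover have "?a = cmap (qproj X G1 H) \<W> (Suc 0) u"
  proof (rule cmap_f_inj[OF W(1) a'])
    show 1: "cmap (qproj X G1 H) \<W> (Suc 0) u \<in> cochains G1H.Q \<W> (Suc 0)"
      unfolding cmap_def cochains_def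
    proof (rule restrict_PiE_iff[THEN iffD2], rule ballI)
      fix l assume l: "l \<in> simplices \<W> (Suc 0)"
      have "u l \<in> carrier (sec G1 (\<Inter>(set l)))" using u l by (simp add: cochains_def PiE_iff)
      then show "qproj X G1 H (\<Inter>(set l)) (u l) \<in> carrier (sec G1H.Q (\<Inter>(set l)))"
        by (rule G1H.qproj_closed[OF openin_simplex[OF W(1) l]])
    qed
    show "cmap incl \<W> (Suc 0) ?a = cmap incl \<W> (Suc 0) (cmap (qproj X G1 H) \<W> (Suc 0) u)"
      unfolding fa
    proof (rule f.G.cochain_eqI[OF W(1) f.G.cobdry_closed[OF W(1) b'] f.cmap_closed[OF W(1) 1]])
      fix l assume l: "l \<in> simplices \<W> (Suc 0)"
      then obtain A B where A: "l = [A, B]" "A \<in> \<W>" "B \<in> \<W>" by (rule simplices_1_cases[unfolded One_nat_def])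
      let ?S = "\<Inter>(set l)"
      have S: "openin X ?S" "?S \<subseteq> A" "?S \<subseteq> B" using openin_simplex[OF W(1) l] A(1) by auto
      have S': "?S = A \<inter> B" using A(1) by simp
      have ul: "u l = v A B ?S" using uAB[OF A(2,3)] A(1) by simp
      interpret Q: comm_group "sec GH.Q ?S" by (rule GH.quot_comm_group[OF S(1)])
      note rA = r[OF A(2) S(1,2)] and rB = r[OF A(3) S(1,3)]
      have "rval GH.Q (cmap incl \<W> (Suc 0) (cmap (qproj X G1 H) \<W> (Suc 0) u)) l ?S = incl ?S (qproj X G1 H ?S (u l))"
        using f.G.rval_self[OF W(1) f.cmap_closed[OF W(1) 1] l] l by (simp add: cmap_def)
      also have "\<dots> = qproj X G H ?S (v A B ?S)"
        unfolding ul by (rule i.qmap_qproj[OF S(1) vG1[OF A(2,3) S]])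
      also have "\<dots> = qproj X G H ?S (inv\<^bsub>sec G ?S\<^esub> res G A ?S (\<beta> A)) \<otimes>\<^bsub>sec GH.Q ?S\<^esub> qproj X G H ?S (res G B ?S (\<beta> B))"
        unfolding v_def by (rule GH.qproj_mult[OF S(1) GH.inv_closed[OF S(1) rA] rB])
      also have "qproj X G H ?S (inv\<^bsub>sec G ?S\<^esub> res G A ?S (\<beta> A)) = inv\<^bsub>sec GH.Q ?S\<^esub> qproj X G H ?S (res G A ?S (\<beta> A))"
        by (rule hom_m_inv[OF GH.sec_group[OF S(1)] Q.group_axioms _ rA])
           (rule homI, rule GH.qproj_closed[OF S(1)], assumption, rule GH.qproj_mult[OF S(1)], assumption+)
      also have "inv\<^bsub>sec GH.Q ?S\<^esub> qproj X G H ?S (res G A ?S (\<beta> A)) \<otimes>\<^bsub>sec GH.Q ?S\<^esub> qproj X G H ?S (res G B ?S (\<beta> B)) =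
          rval GH.Q (cobdry GH.Q \<W> 0 ?b) [A, B] ?S"
        unfolding f.G.rval_cobdry_0[OF W(1) b' A(2,3) S] rb[OF A(2) S(1,2)] rb[OF A(3) S(1,3)] ..
      finally show "rval GH.Q (cobdry GH.Q \<W> 0 ?b) l ?S =
          rval GH.Q (cmap incl \<W> (Suc 0) (cmap (qproj X G1 H) \<W> (Suc 0) u)) l ?S" by (simp only: A(1))
    qed
  qed
  ultimately have "cech_class X G1H.Q (Suc 0) (\<W>, ?a) = \<one>\<^bsub>cohom X G1H.Q (Suc 0)\<^esub>" by (simp only: One_nat_def)
  then show ?thesis using H1A.pullback_rep(2)[OF lift_data_reps(2)[OF D] W(1,2)] by simp
qed

end

section \<open>Holomorphic functions\<close>

lemma holo_CnI:
  assumes "openin (Cn n) D"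
    and "\<And>p. p \<in> D \<Longrightarrow> \<exists>c. \<forall>\<epsilon>>0. \<exists>\<delta>>0. \<forall>z\<in>D. (\<forall>i<n. norm (z i - p i) < \<delta>) \<longrightarrow>
        norm (f z - f p - (\<Sum>i<n. c i * (z i - p i))) \<le> \<epsilon> * (\<Sum>i<n. norm (z i - p i))"
  shows "holo_Cn n D f"
  using assms unfolding holo_Cn_def by blast

lemma holo_CnE:
  assumes "holo_Cn n D f" "p \<in> D"
  obtains c where "\<And>\<epsilon>. \<epsilon> > 0 \<Longrightarrow> \<exists>\<delta>>0. \<forall>z\<in>D. (\<forall>i<n. norm (z i - p i) < \<delta>) \<longrightarrow>
        norm (f z - f p - (\<Sum>i<n. c i * (z i - p i))) \<le> \<epsilon> * (\<Sum>i<n. norm (z i - p i))"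
  using assms unfolding holo_Cn_def by blast

lemma holo_Cn_cong: "(\<And>z. z \<in> D \<Longrightarrow> f z = g z) \<Longrightarrow> holo_Cn n D f \<longleftrightarrow> holo_Cn n D g"
  unfolding holo_Cn_def by simp

lemma holo_Cn_const: "openin (Cn n) D \<Longrightarrow> holo_Cn n D (\<lambda>_. a)"
proof (rule holo_CnI)
  fix p assume "p \<in> D"
  show "\<exists>c. \<forall>\<epsilon>>0. \<exists>\<delta>>0. \<forall>z\<in>D. (\<forall>i<n. norm (z i - p i) < \<delta>) \<longrightarrow>
        norm (a - a - (\<Sum>i<n. c i * (z i - p i))) \<le> \<epsilon> * (\<Sum>i<n. norm (z i - p i))"
    by (intro exI[of _ "\<lambda>_. 0"] allI impI exI[of _ 1]) (auto intro!: mult_nonneg_nonneg sum_nonneg)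
qed

lemma holo_Cn_subset: "holo_Cn n D f \<Longrightarrow> openin (Cn n) D' \<Longrightarrow> D' \<subseteq> D \<Longrightarrow> holo_Cn n D' f"
proof (rule holo_CnI)
  fix p assume D: "holo_Cn n D f" "openin (Cn n) D'" "D' \<subseteq> D" and p: "p \<in> D'"
  then have "p \<in> D" by blast
  with D(1) obtain c where c: "\<And>\<epsilon>. \<epsilon> > 0 \<Longrightarrow> \<exists>\<delta>>0. \<forall>z\<in>D. (\<forall>i<n. norm (z i - p i) < \<delta>) \<longrightarrow>
        norm (f z - f p - (\<Sum>i<n. c i * (z i - p i))) \<le> \<epsilon> * (\<Sum>i<n. norm (z i - p i))"
    by (rule holo_CnE) blast
  show "\<exists>c. \<forall>\<epsilon>>0. \<exists>\<delta>>0. \<forall>z\<in>D'. (\<forall>i<n. norm (z i - p i) < \<delta>) \<longrightarrow>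
        norm (f z - f p - (\<Sum>i<n. c i * (z i - p i))) \<le> \<epsilon> * (\<Sum>i<n. norm (z i - p i))"
  proof (intro exI[of _ c] allI impI)
    fix \<epsilon> :: real assume "\<epsilon> > 0"
    from c[OF this] D(3) show "\<exists>\<delta>>0. \<forall>z\<in>D'. (\<forall>i<n. norm (z i - p i) < \<delta>) \<longrightarrow>
        norm (f z - f p - (\<Sum>i<n. c i * (z i - p i))) \<le> \<epsilon> * (\<Sum>i<n. norm (z i - p i))" by blast
  qed
qed

lemma holo_Cn_add:
  assumes f: "holo_Cn n D f" and g: "holo_Cn n D g" shows "holo_Cn n D (\<lambda>z. f z + g z)"
proof (rule holo_CnI)
  show "openin (Cn n) D" using f by (simp add: holo_Cn_def)
  fix p assume p: "p \<in> D"
  obtain c where c: "\<And>\<epsilon>. \<epsilon> > 0 \<Longrightarrow> \<exists>\<delta>>0. \<forall>z\<in>D. (\<forall>i<n. norm (z i - p i) < \<delta>) \<longrightarrow>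
        norm (f z - f p - (\<Sum>i<n. c i * (z i - p i))) \<le> \<epsilon> * (\<Sum>i<n. norm (z i - p i))"
    using f p by (rule holo_CnE) blast
  obtain d where d: "\<And>\<epsilon>. \<epsilon> > 0 \<Longrightarrow> \<exists>\<delta>>0. \<forall>z\<in>D. (\<forall>i<n. norm (z i - p i) < \<delta>) \<longrightarrow>
        norm (g z - g p - (\<Sum>i<n. d i * (z i - p i))) \<le> \<epsilon> * (\<Sum>i<n. norm (z i - p i))"
    using g p by (rule holo_CnE) blast
  show "\<exists>c. \<forall>\<epsilon>>0. \<exists>\<delta>>0. \<forall>z\<in>D. (\<forall>i<n. norm (z i - p i) < \<delta>) \<longrightarrow>
        norm (f z + g z - (f p + g p) - (\<Sum>i<n. c i * (z i - p i))) \<le> \<epsilon> * (\<Sum>i<n. norm (z i - p i))"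
  proof (intro exI[of _ "\<lambda>i. c i + d i"] allI impI)
    fix \<epsilon> :: real assume "\<epsilon> > 0"
    then have e: "\<epsilon> / 2 > 0" by simp
    obtain \<delta>1 where 1: "\<delta>1 > 0" "\<forall>z\<in>D. (\<forall>i<n. norm (z i - p i) < \<delta>1) \<longrightarrow>
        norm (f z - f p - (\<Sum>i<n. c i * (z i - p i))) \<le> \<epsilon> / 2 * (\<Sum>i<n. norm (z i - p i))" using c[OF e] by blast
    obtain \<delta>2 where 2: "\<delta>2 > 0" "\<forall>z\<in>D. (\<forall>i<n. norm (z i - p i) < \<delta>2) \<longrightarrow>
        norm (g z - g p - (\<Sum>i<n. d i * (z i - p i))) \<le> \<epsilon> / 2 * (\<Sum>i<n. norm (z i - p i))" using d[OF e] by blast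
    show "\<exists>\<delta>>0. \<forall>z\<in>D. (\<forall>i<n. norm (z i - p i) < \<delta>) \<longrightarrow>
        norm (f z + g z - (f p + g p) - (\<Sum>i<n. (c i + d i) * (z i - p i))) \<le> \<epsilon> * (\<Sum>i<n. norm (z i - p i))"
    proof (intro exI[of _ "min \<delta>1 \<delta>2"] conjI ballI impI)
      show "min \<delta>1 \<delta>2 > 0" using 1 2 by simp
      fix z assume z: "z \<in> D" and zp: "\<forall>i<n. norm (z i - p i) < min \<delta>1 \<delta>2"
      let ?F = "f z - f p - (\<Sum>i<n. c i * (z i - p i))" and ?G = "g z - g p - (\<Sum>i<n. d i * (z i - p i))"
      have "(\<Sum>i<n. (c i + d i) * (z i - p i)) = (\<Sum>i<n. c i * (z i - p i)) + (\<Sum>i<n. d i * (z i - p i))"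
        by (simp add: distrib_right sum.distrib)
      then have "f z + g z - (f p + g p) - (\<Sum>i<n. (c i + d i) * (z i - p i)) = ?F + ?G"
        by simp
      moreover have "norm ?F \<le> \<epsilon> / 2 * (\<Sum>i<n. norm (z i - p i))" "norm ?G \<le> \<epsilon> / 2 * (\<Sum>i<n. norm (z i - p i))"
        using 1(2) 2(2) z zp by auto
      ultimately show "norm (f z + g z - (f p + g p) - (\<Sum>i<n. (c i + d i) * (z i - p i))) \<le> \<epsilon> * (\<Sum>i<n. norm (z i - p i))"
        using norm_triangle_ineq[of ?F ?G] by (simp only:)
    qed
  qed
qed

lemma norm_linear_form_le:
  fixes c h :: "nat \<Rightarrow> complex"
  shows "norm (\<Sum>i<n. c i * h i) \<le> (\<Sum>i<n. norm (c i)) * (\<Sum>i<n. norm (h i))"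
proof -
  have "norm (\<Sum>i<n. c i * h i) \<le> (\<Sum>i<n. norm (c i) * norm (h i))"
    by (rule order.trans[OF norm_sum]) (simp add: norm_mult)
  also have "\<dots> \<le> (\<Sum>i<n. norm (c i) * (\<Sum>j<n. norm (h j)))"
    by (intro sum_mono mult_left_mono member_le_sum) auto
  finally show ?thesis by (simp add: sum_distrib_right)
qed

text \<open>If \<open>F\<close> and \<open>G\<close> are the remainders of the first-order expansions of \<open>f\<close> and \<open>g\<close> at \<open>p\<close>, the
  remainder of the product is \<open>f(p) G + g(p) F + (f - f(p)) (g - g(p))\<close>, whose last term is of
  second order.\<close>

lemma holo_Cn_mult:
  assumes f: "holo_Cn n D f" and g: "holo_Cn n D g" shows "holo_Cn n D (\<lambda>z. f z * g z)"
proof (rule holo_CnI)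
  show "openin (Cn n) D" using f by (simp add: holo_Cn_def)
  fix p assume p: "p \<in> D"
  obtain c where c: "\<And>\<epsilon>. \<epsilon> > 0 \<Longrightarrow> \<exists>\<delta>>0. \<forall>z\<in>D. (\<forall>i<n. norm (z i - p i) < \<delta>) \<longrightarrow>
        norm (f z - f p - (\<Sum>i<n. c i * (z i - p i))) \<le> \<epsilon> * (\<Sum>i<n. norm (z i - p i))"
    using f p by (rule holo_CnE) blast
  obtain d where d: "\<And>\<epsilon>. \<epsilon> > 0 \<Longrightarrow> \<exists>\<delta>>0. \<forall>z\<in>D. (\<forall>i<n. norm (z i - p i) < \<delta>) \<longrightarrow>
        norm (g z - g p - (\<Sum>i<n. d i * (z i - p i))) \<le> \<epsilon> * (\<Sum>i<n. norm (z i - p i))"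
    using g p by (rule holo_CnE) blast
  define A where "A = 1 + (\<Sum>i<n. norm (c i))"
  define B where "B = 1 + (\<Sum>i<n. norm (d i))"
  have AB: "A > 0" "B > 0" unfolding A_def B_def by (auto intro!: add_pos_nonneg sum_nonneg)
  define K where "K = 1 + norm (f p) + norm (g p)"
  have K: "K > 0" "norm (f p) + norm (g p) \<le> K" unfolding K_def by (simp_all add: add_pos_nonneg)
  show "\<exists>c. \<forall>\<epsilon>>0. \<exists>\<delta>>0. \<forall>z\<in>D. (\<forall>i<n. norm (z i - p i) < \<delta>) \<longrightarrow>
        norm (f z * g z - f p * g p - (\<Sum>i<n. c i * (z i - p i))) \<le> \<epsilon> * (\<Sum>i<n. norm (z i - p i))"
  proof (intro exI[of _ "\<lambda>i. f p * d i + g p * c i"] allI impI)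
    fix \<epsilon> :: real assume e: "\<epsilon> > 0"
    then have e': "\<epsilon> / (2 * K) > 0" using K by simp
    obtain \<delta>1 where 1: "\<delta>1 > 0" "\<forall>z\<in>D. (\<forall>i<n. norm (z i - p i) < \<delta>1) \<longrightarrow>
        norm (f z - f p - (\<Sum>i<n. c i * (z i - p i))) \<le> \<epsilon> / (2 * K) * (\<Sum>i<n. norm (z i - p i))" using c[OF e'] by blast
    obtain \<delta>2 where 2: "\<delta>2 > 0" "\<forall>z\<in>D. (\<forall>i<n. norm (z i - p i) < \<delta>2) \<longrightarrow>
        norm (g z - g p - (\<Sum>i<n. d i * (z i - p i))) \<le> \<epsilon> / (2 * K) * (\<Sum>i<n. norm (z i - p i))" using d[OF e'] by blast
    obtain \<delta>3 where 3: "\<delta>3 > 0" "\<forall>z\<in>D. (\<forall>i<n. norm (z i - p i) < \<delta>3) \<longrightarrow>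
        norm (f z - f p - (\<Sum>i<n. c i * (z i - p i))) \<le> 1 * (\<Sum>i<n. norm (z i - p i))" using c[of 1] by auto
    obtain \<delta>4 where 4: "\<delta>4 > 0" "\<forall>z\<in>D. (\<forall>i<n. norm (z i - p i) < \<delta>4) \<longrightarrow>
        norm (g z - g p - (\<Sum>i<n. d i * (z i - p i))) \<le> 1 * (\<Sum>i<n. norm (z i - p i))" using d[of 1] by auto
    define N where "N = real n + 1"
    have N: "N > 0" unfolding N_def by simp
    \<comment> \<open>Makes the second-order term at most \<open>\<epsilon> / 2\<close> times the sum of the \<open>norm (z i - p i)\<close>.\<close>
    define \<delta>5 where "\<delta>5 = \<epsilon> / (2 * A * B * N)"
    have 5: "\<delta>5 > 0" unfolding \<delta>5_def using e AB N by simp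
    show "\<exists>\<delta>>0. \<forall>z\<in>D. (\<forall>i<n. norm (z i - p i) < \<delta>) \<longrightarrow>
        norm (f z * g z - f p * g p - (\<Sum>i<n. (f p * d i + g p * c i) * (z i - p i))) \<le> \<epsilon> * (\<Sum>i<n. norm (z i - p i))"
    proof (intro exI[of _ "min \<delta>1 (min \<delta>2 (min \<delta>3 (min \<delta>4 \<delta>5)))"] conjI ballI impI)
      show "min \<delta>1 (min \<delta>2 (min \<delta>3 (min \<delta>4 \<delta>5))) > 0" using 1 2 3 4 5 by simp
      fix z assume z: "z \<in> D" and zp: "\<forall>i<n. norm (z i - p i) < min \<delta>1 (min \<delta>2 (min \<delta>3 (min \<delta>4 \<delta>5)))"
      define S where "S = (\<Sum>i<n. norm (z i - p i))"
      define F where "F = f z - f p - (\<Sum>i<n. c i * (z i - p i))"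
      define G where "G = g z - g p - (\<Sum>i<n. d i * (z i - p i))"
      have S0: "S \<ge> 0" unfolding S_def by (rule sum_nonneg) simp
      have F1: "norm F \<le> \<epsilon> / (2 * K) * S" and F3: "norm F \<le> S"
        using 1(2) 3(2) z zp unfolding F_def S_def by auto
      have G1: "norm G \<le> \<epsilon> / (2 * K) * S" and G3: "norm G \<le> S"
        using 2(2) 4(2) z zp unfolding G_def S_def by auto
      have "norm (f z - f p) = norm (F + (\<Sum>i<n. c i * (z i - p i)))" by (simp add: F_def)
      also have "\<dots> \<le> S + (\<Sum>i<n. norm (c i)) * S"
        using norm_triangle_ineq[of F "\<Sum>i<n. c i * (z i - p i)"] F3
          norm_linear_form_le[of c "\<lambda>i. z i - p i" n] unfolding S_def by linarith
      finally have df: "norm (f z - f p) \<le> A * S" by (simp add: A_def algebra_simps)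
      have "norm (g z - g p) = norm (G + (\<Sum>i<n. d i * (z i - p i)))" by (simp add: G_def)
      also have "\<dots> \<le> S + (\<Sum>i<n. norm (d i)) * S"
        using norm_triangle_ineq[of G "\<Sum>i<n. d i * (z i - p i)"] G3
          norm_linear_form_le[of d "\<lambda>i. z i - p i" n] unfolding S_def by linarith
      finally have dg: "norm (g z - g p) \<le> B * S" by (simp add: B_def algebra_simps)
      have "S \<le> (\<Sum>i<n. \<delta>5)" unfolding S_def by (intro sum_mono) (use zp in \<open>auto intro: less_imp_le\<close>)
      then have "S \<le> real n * \<delta>5" by simp
      also have "\<dots> \<le> N * \<delta>5" using 5 by (simp add: N_def)
      also have "\<dots> = \<epsilon> / (2 * A * B)" unfolding \<delta>5_def using N by simp
      finally have "A * B * S \<le> \<epsilon> / 2" using AB by (simp add: field_simps)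
      then have Q: "A * B * S * S \<le> \<epsilon> / 2 * S" using S0 by (rule mult_right_mono)
      have "norm ((f z - f p) * (g z - g p)) \<le> (A * S) * (B * S)"
        unfolding norm_mult using df dg AB S0 by (intro mult_mono) auto
      then have q: "norm ((f z - f p) * (g z - g p)) \<le> \<epsilon> / 2 * S" using Q by (simp add: mult_ac)
      have "norm (f p * G) \<le> norm (f p) * (\<epsilon> / (2 * K) * S)" "norm (g p * F) \<le> norm (g p) * (\<epsilon> / (2 * K) * S)"
        unfolding norm_mult by (rule mult_left_mono[OF G1 norm_ge_zero] mult_left_mono[OF F1 norm_ge_zero])+
      then have "norm (f p * G) + norm (g p * F) \<le> (norm (f p) + norm (g p)) * (\<epsilon> / (2 * K) * S)"
        unfolding distrib_right by (rule add_mono)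
      also have "\<dots> \<le> K * (\<epsilon> / (2 * K) * S)" by (intro mult_right_mono K(2) mult_nonneg_nonneg[OF less_imp_le[OF e'] S0])
      also have "\<dots> = \<epsilon> / 2 * S" using K by simp
      finally have r: "norm (f p * G) + norm (g p * F) \<le> \<epsilon> / 2 * S" .
      have "f z * g z - f p * g p - (\<Sum>i<n. (f p * d i + g p * c i) * (z i - p i)) =
          f p * G + g p * F + (f z - f p) * (g z - g p)"
      proof -
        have "(\<Sum>i<n. (f p * d i + g p * c i) * (z i - p i)) =
            f p * (\<Sum>i<n. d i * (z i - p i)) + g p * (\<Sum>i<n. c i * (z i - p i))"
          by (simp add: distrib_right sum.distrib sum_distrib_left mult.assoc)
        then show ?thesis by (simp add: F_def G_def algebra_simps)
      qed
      then have "norm (f z * g z - f p * g p - (\<Sum>i<n. (f p * d i + g p * c i) * (z i - p i))) \<le>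
          norm (f p * G) + norm (g p * F) + norm ((f z - f p) * (g z - g p))"
        using norm_triangle_ineq[of "f p * G + g p * F" "(f z - f p) * (g z - g p)"]
          norm_triangle_ineq[of "f p * G" "g p * F"] by simp
      then show "norm (f z * g z - f p * g p - (\<Sum>i<n. (f p * d i + g p * c i) * (z i - p i))) \<le>
          \<epsilon> * (\<Sum>i<n. norm (z i - p i))"
        using q r unfolding S_def[symmetric] by linarith
    qed
  qed
qed

locale manifold =
  fixes X :: "'a topology" and n :: nat and \<A> :: "'a chart set"
  assumes manifold: "complex_manifold X n \<A>"
begin

lemma chart:
  assumes "(W, \<phi>) \<in> \<A>"
  shows "openin X W" "openin (Cn n) (\<phi> ` W)" "homeomorphic_map (subtopology X W) (subtopology (Cn n) (\<phi> ` W)) \<phi>"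
  using manifold assms unfolding complex_manifold_def by auto

lemma chart_inj: assumes "(W, \<phi>) \<in> \<A>" shows "inj_on \<phi> W"
  using homeomorphic_imp_injective_map[OF chart(3)[OF assms]] openin_subset[OF chart(1)[OF assms]]
  by (simp add: Int_absorb1)

lemma chart_image_open:
  assumes c: "(W, \<phi>) \<in> \<A>" and U: "openin X U" shows "openin (Cn n) (\<phi> ` (U \<inter> W))"
proof -
  have "openin (subtopology X W) (U \<inter> W)" using U by (rule openin_subtopology_Int)
  then have "openin (subtopology (Cn n) (\<phi> ` W)) (\<phi> ` (U \<inter> W))"
    using homeomorphic_imp_open_map[OF chart(3)[OF c]] by (simp add: open_map_def)
  then show ?thesis using chart(2)[OF c] by (simp add: openin_open_subtopology)
qed

lemma holo_fun_cong:
  assumes "\<And>x. x \<in> U \<Longrightarrow> f x = g x" shows "holo_fun n \<A> U f \<longleftrightarrow> holo_fun n \<A> U g"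
proof -
  have "holo_Cn n (\<phi> ` (U \<inter> W)) (\<lambda>z. f (inv_into W \<phi> z)) \<longleftrightarrow> holo_Cn n (\<phi> ` (U \<inter> W)) (\<lambda>z. g (inv_into W \<phi> z))"
    if c: "(W, \<phi>) \<in> \<A>" for W \<phi>
  proof (rule holo_Cn_cong)
    fix z assume "z \<in> \<phi> ` (U \<inter> W)"
    then obtain x where "x \<in> U" "x \<in> W" "z = \<phi> x" by blast
    then show "f (inv_into W \<phi> z) = g (inv_into W \<phi> z)" using chart_inj[OF c] assms by simp
  qed
  then show ?thesis unfolding holo_fun_def by auto
qed

lemma holo_fun_const: "openin X U \<Longrightarrow> holo_fun n \<A> U (\<lambda>_. a)"
  unfolding holo_fun_def using chart_image_open by (auto intro: holo_Cn_const)

lemma holo_fun_add: "holo_fun n \<A> U f \<Longrightarrow> holo_fun n \<A> U g \<Longrightarrow> holo_fun n \<A> U (\<lambda>x. f x + g x)"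
  unfolding holo_fun_def by (auto intro: holo_Cn_add)

lemma holo_fun_mult: "holo_fun n \<A> U f \<Longrightarrow> holo_fun n \<A> U g \<Longrightarrow> holo_fun n \<A> U (\<lambda>x. f x * g x)"
  unfolding holo_fun_def by (auto intro: holo_Cn_mult)

lemma holo_fun_scale: "openin X U \<Longrightarrow> holo_fun n \<A> U f \<Longrightarrow> holo_fun n \<A> U (\<lambda>x. a * f x)"
  by (intro holo_fun_mult holo_fun_const)

lemma holo_fun_sum:
  assumes "openin X U" "\<And>i. i < (k::nat) \<Longrightarrow> holo_fun n \<A> U (f i)"
  shows "holo_fun n \<A> U (\<lambda>x. \<Sum>i<k. f i x)"
  using assms(2) by (induction k) (simp_all add: holo_fun_const[OF assms(1)] holo_fun_add)

lemma holo_fun_subset: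
  assumes "holo_fun n \<A> U f" "openin X V" "V \<subseteq> U" shows "holo_fun n \<A> V f"
  unfolding holo_fun_def
proof clarify
  fix W \<phi> assume c: "(W, \<phi>) \<in> \<A>"
  then have "holo_Cn n (\<phi> ` (U \<inter> W)) (\<lambda>z. f (inv_into W \<phi> z))" using assms(1) unfolding holo_fun_def by auto
  then show "holo_Cn n (\<phi> ` (V \<inter> W)) (\<lambda>z. f (inv_into W \<phi> z))"
    by (rule holo_Cn_subset[OF _ chart_image_open[OF c assms(2)]]) (use assms(3) in blast)
qed

end

section \<open>Multivectors and the wedge product\<close>

text \<open>Multivectors at a point, in terms of the space \<open>D\<close> of covectors at this point alone.\<close>

definition alternating :: "('v \<Rightarrow> complex) set \<Rightarrow> 'v mvec \<Rightarrow> bool" where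
  "alternating D \<omega> \<longleftrightarrow>
     (\<forall>as\<in>lists D. \<forall>bs\<in>lists D. \<forall>\<theta>\<in>D. \<forall>\<eta>\<in>D. \<forall>c.
          \<omega> (as @ (\<lambda>v. c * \<theta> v + \<eta> v) # bs) = c * \<omega> (as @ \<theta> # bs) + \<omega> (as @ \<eta> # bs)) \<and>
     (\<forall>xs\<in>lists D. \<not> distinct xs \<longrightarrow> \<omega> xs = 0) \<and> (\<forall>xs. xs \<notin> lists D \<longrightarrow> \<omega> xs = 0)"

lemma multivectors_alternating: "\<omega> \<in> multivectors M x \<longleftrightarrow> alternating (dual_fib M x) \<omega>"
  by (simp add: multivectors_def alternating_def)

lemma wedge_cong:
  "(\<And>ys. set ys \<subseteq> set xs \<Longrightarrow> \<omega> ys = \<omega>' ys) \<Longrightarrow> (\<And>ys. set ys \<subseteq> set xs \<Longrightarrow> \<eta> ys = \<eta>' ys) \<Longrightarrow>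
   wedge \<omega> \<eta> xs = wedge \<omega>' \<eta>' xs"
proof (induction xs arbitrary: \<omega> \<omega>' \<eta> \<eta>')
  case Nil
  then show ?case by simp
next
  case (Cons x xs)
  have "wedge (\<lambda>ys. \<omega> (x # ys)) \<eta> xs = wedge (\<lambda>ys. \<omega>' (x # ys)) \<eta>' xs"
    by (rule Cons.IH; rule Cons.prems; auto)
  moreover have "wedge (\<lambda>ys. (-1) ^ length ys * \<omega> ys) (\<lambda>ys. \<eta> (x # ys)) xs =
      wedge (\<lambda>ys. (-1) ^ length ys * \<omega>' ys) (\<lambda>ys. \<eta>' (x # ys)) xs"
    by (rule Cons.IH; (rule arg_cong2[where f = "(*)", OF refl])?; rule Cons.prems; auto)
  ultimately show ?case by simp
qed

lemma wedge_linear_left: "wedge (\<lambda>ys. a * \<omega> ys + \<omega>' ys) \<eta> xs = a * wedge \<omega> \<eta> xs + wedge \<omega>' \<eta> xs"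
proof (induction xs arbitrary: \<omega> \<omega>' \<eta>)
  case Nil
  then show ?case by (simp add: algebra_simps)
next
  case (Cons x xs)
  have "wedge (\<lambda>ys. (-1) ^ length ys * (a * \<omega> ys + \<omega>' ys)) (\<lambda>ys. \<eta> (x # ys)) xs =
      wedge (\<lambda>ys. a * ((-1) ^ length ys * \<omega> ys) + (-1) ^ length ys * \<omega>' ys) (\<lambda>ys. \<eta> (x # ys)) xs"
    by (rule wedge_cong) (simp_all add: algebra_simps)
  then show ?case using Cons.IH by (simp add: algebra_simps)
qed

lemma wedge_linear_right: "wedge \<omega> (\<lambda>ys. a * \<eta> ys + \<eta>' ys) xs = a * wedge \<omega> \<eta> xs + wedge \<omega> \<eta>' xs"
  by (induction xs arbitrary: \<omega> \<eta> \<eta>') (simp_all add: algebra_simps)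

lemma wedge_zero_left: "wedge (\<lambda>_. 0) \<eta> xs = 0"
  using wedge_linear_left[of "-1" "\<lambda>_. 0" "\<lambda>_. 0" \<eta> xs] by simp

lemma wedge_zero_right: "wedge \<omega> (\<lambda>_. 0) xs = 0"
  using wedge_linear_right[of \<omega> "-1" "\<lambda>_. 0" "\<lambda>_. 0" xs] by simp

lemma wedge_uminus_left: "wedge (\<lambda>ys. - \<omega> ys) \<eta> xs = - wedge \<omega> \<eta> xs"
  using wedge_linear_left[of "-1" \<omega> "\<lambda>_. 0" \<eta> xs] by (simp add: wedge_zero_left)

lemma wedge_scalar_left: "wedge (\<lambda>ys. if ys = [] then a else 0) \<eta> xs = a * \<eta> xs"
proof (induction xs arbitrary: \<eta>)
  case Nil
  then show ?case by simp
next
  case (Cons x xs)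
  have "wedge (\<lambda>ys. (-1) ^ length ys * (if ys = [] then a else 0)) (\<lambda>ys. \<eta> (x # ys)) xs =
      wedge (\<lambda>ys. if ys = [] then a else 0) (\<lambda>ys. \<eta> (x # ys)) xs"
    by (rule wedge_cong) auto
  then show ?case using Cons.IH by (simp add: wedge_zero_left)
qed

lemma wedge_order:
  "(\<And>ys. length ys < a \<Longrightarrow> \<omega> ys = 0) \<Longrightarrow> (\<And>ys. length ys < b \<Longrightarrow> \<eta> ys = 0) \<Longrightarrow> length xs < a + b \<Longrightarrow>
   wedge \<omega> \<eta> xs = 0"
proof (induction xs arbitrary: \<omega> \<eta> a b)
  case Nil
  then show ?case by (cases a) auto
next
  case (Cons x xs)
  have "wedge (\<lambda>ys. \<omega> (x # ys)) \<eta> xs = 0"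
    by (rule Cons.IH[of "a - 1" _ b]) (use Cons.prems in auto)
  moreover have "wedge (\<lambda>ys. (-1) ^ length ys * \<omega> ys) (\<lambda>ys. \<eta> (x # ys)) xs = 0"
    by (rule Cons.IH[of a _ "b - 1"]) (use Cons.prems in auto)
  ultimately show ?case by simp
qed

text \<open>The degree-1 multivector of a vector \<open>e\<close>: evaluation of covectors at \<open>e\<close>.\<close>

definition evaluation :: "('v \<Rightarrow> complex) set \<Rightarrow> 'v \<Rightarrow> 'v mvec" where
  "evaluation D e ys = (case ys of [] \<Rightarrow> 0 | x # zs \<Rightarrow> if zs = [] \<and> x \<in> D then x e else 0)"

locale covector_space =
  fixes D :: "('v \<Rightarrow> complex) set"
  assumes zero: "(\<lambda>_. 0) \<in> D" and lin: "\<theta> \<in> D \<Longrightarrow> \<eta> \<in> D \<Longrightarrow> (\<lambda>v. c * \<theta> v + \<eta> v) \<in> D"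
begin

lemma alternating_linear:
  "alternating D \<omega> \<Longrightarrow> as \<in> lists D \<Longrightarrow> bs \<in> lists D \<Longrightarrow> \<theta> \<in> D \<Longrightarrow> \<eta> \<in> D \<Longrightarrow>
   \<omega> (as @ (\<lambda>v. c * \<theta> v + \<eta> v) # bs) = c * \<omega> (as @ \<theta> # bs) + \<omega> (as @ \<eta> # bs)"
  unfolding alternating_def by blast

lemma alternating_distinct: "alternating D \<omega> \<Longrightarrow> \<not> distinct xs \<Longrightarrow> \<omega> xs = 0"
  unfolding alternating_def by blast

lemma alternating_outside: "alternating D \<omega> \<Longrightarrow> xs \<notin> lists D \<Longrightarrow> \<omega> xs = 0"
  unfolding alternating_def by blast

lemma alternatingI:
  assumes "\<And>as bs \<theta> \<eta> c. as \<in> lists D \<Longrightarrow> bs \<in> lists D \<Longrightarrow> \<theta> \<in> D \<Longrightarrow> \<eta> \<in> D \<Longrightarrow>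
      \<omega> (as @ (\<lambda>v. c * \<theta> v + \<eta> v) # bs) = c * \<omega> (as @ \<theta> # bs) + \<omega> (as @ \<eta> # bs)"
    and "\<And>xs. xs \<in> lists D \<Longrightarrow> \<not> distinct xs \<Longrightarrow> \<omega> xs = 0" and "\<And>xs. xs \<notin> lists D \<Longrightarrow> \<omega> xs = 0"
  shows "alternating D \<omega>"
  using assms unfolding alternating_def by blast

lemma alternating_zero: "alternating D (\<lambda>_. 0)"
  by (simp add: alternating_def)

lemma alternating_add:
  assumes "alternating D \<omega>" "alternating D \<eta>" shows "alternating D (\<lambda>xs. \<omega> xs + \<eta> xs)"
proof (rule alternatingI)
  fix as bs \<theta> \<tau> c assume *: "as \<in> lists D" "bs \<in> lists D" "\<theta> \<in> D" "\<tau> \<in> D"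
  show "\<omega> (as @ (\<lambda>v. c * \<theta> v + \<tau> v) # bs) + \<eta> (as @ (\<lambda>v. c * \<theta> v + \<tau> v) # bs) =
      c * (\<omega> (as @ \<theta> # bs) + \<eta> (as @ \<theta> # bs)) + (\<omega> (as @ \<tau> # bs) + \<eta> (as @ \<tau> # bs))"
    unfolding alternating_linear[OF assms(1) *] alternating_linear[OF assms(2) *] by (simp add: algebra_simps)
qed (simp_all add: alternating_distinct[OF assms(1)] alternating_distinct[OF assms(2)]
       alternating_outside[OF assms(1)] alternating_outside[OF assms(2)])

lemma alternating_weight:
  assumes "alternating D \<omega>" shows "alternating D (\<lambda>xs. w (length xs) * \<omega> xs)"
proof (rule alternatingI)
  fix as bs \<theta> \<tau> c assume *: "as \<in> lists D" "bs \<in> lists D" "\<theta> \<in> D" "\<tau> \<in> D"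
  show "w (length (as @ (\<lambda>v. c * \<theta> v + \<tau> v) # bs)) * \<omega> (as @ (\<lambda>v. c * \<theta> v + \<tau> v) # bs) =
      c * (w (length (as @ \<theta> # bs)) * \<omega> (as @ \<theta> # bs)) + w (length (as @ \<tau> # bs)) * \<omega> (as @ \<tau> # bs)"
    unfolding alternating_linear[OF assms(1) *] by (simp add: distrib_left)
qed (simp_all add: alternating_distinct[OF assms(1)] alternating_outside[OF assms(1)])

lemma alternating_contract:
  assumes "alternating D \<omega>" "x \<in> D" shows "alternating D (\<lambda>xs. \<omega> (x # xs))"
proof (rule alternatingI)
  fix as bs \<theta> \<eta> c assume "as \<in> lists D" "bs \<in> lists D" "\<theta> \<in> D" "\<eta> \<in> D"
  then show "\<omega> (x # as @ (\<lambda>v. c * \<theta> v + \<eta> v) # bs) = c * \<omega> (x # as @ \<theta> # bs) + \<omega> (x # as @ \<eta> # bs)"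
    using alternating_linear[OF assms(1), of "x # as" bs \<theta> \<eta> c] assms(2) by simp
qed (use alternating_distinct[OF assms(1)] alternating_outside[OF assms(1)] in simp_all)

lemma alternating_sign: "alternating D \<omega> \<Longrightarrow> alternating D (\<lambda>ys. (-1) ^ length ys * \<omega> ys)"
  by (rule alternating_weight)

lemma wedge_outside:
  "alternating D \<omega> \<Longrightarrow> alternating D \<eta> \<Longrightarrow> xs \<notin> lists D \<Longrightarrow> wedge \<omega> \<eta> xs = 0"
proof (induction xs arbitrary: \<omega> \<eta>)
  case Nil
  then show ?case by simp
next
  case (Cons x xs)
  show ?case
  proof (cases "x \<in> D")
    case True
    then have "xs \<notin> lists D" using Cons.prems by simp
    then show ?thesis
      using Cons.IH[OF alternating_contract[OF Cons.prems(1) True] Cons.prems(2)]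
        Cons.IH[OF alternating_sign[OF Cons.prems(1)] alternating_contract[OF Cons.prems(2) True]] by simp
  next
    case False
    then have "\<omega> (x # ys) = 0" "\<eta> (x # ys) = 0" for ys
      using alternating_outside[OF Cons.prems(1)] alternating_outside[OF Cons.prems(2)] by simp_all
    then show ?thesis by (simp add: wedge_zero_left wedge_zero_right)
  qed
qed

lemma wedge_multilinear:
  "alternating D \<omega> \<Longrightarrow> alternating D \<eta> \<Longrightarrow> as \<in> lists D \<Longrightarrow> bs \<in> lists D \<Longrightarrow> \<theta> \<in> D \<Longrightarrow> \<tau> \<in> D \<Longrightarrow>
   wedge \<omega> \<eta> (as @ (\<lambda>v. c * \<theta> v + \<tau> v) # bs) = c * wedge \<omega> \<eta> (as @ \<theta> # bs) + wedge \<omega> \<eta> (as @ \<tau> # bs)"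
proof (induction as arbitrary: \<omega> \<eta>)
  case Nil
  let ?l = "\<lambda>v. c * \<theta> v + \<tau> v"
  have bs: "ys \<in> lists D" if "set ys \<subseteq> set bs" for ys using that Nil.prems(4) by auto
  have "wedge (\<lambda>ys. \<omega> (?l # ys)) \<eta> bs = wedge (\<lambda>ys. c * \<omega> (\<theta> # ys) + \<omega> (\<tau> # ys)) \<eta> bs"
    using alternating_linear[OF Nil.prems(1), of "[]" _ \<theta> \<tau> c] Nil.prems(5,6) bs by (intro wedge_cong) auto
  moreover have "wedge (\<lambda>ys. (-1) ^ length ys * \<omega> ys) (\<lambda>ys. \<eta> (?l # ys)) bs =
      wedge (\<lambda>ys. (-1) ^ length ys * \<omega> ys) (\<lambda>ys. c * \<eta> (\<theta> # ys) + \<eta> (\<tau> # ys)) bs"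
    using alternating_linear[OF Nil.prems(2), of "[]" _ \<theta> \<tau> c] Nil.prems(5,6) bs by (intro wedge_cong) auto
  ultimately show ?case unfolding append_Nil wedge.simps
    by (simp only: wedge_linear_left wedge_linear_right) (simp add: algebra_simps)
next
  case (Cons a as)
  then have a: "a \<in> D" "as \<in> lists D" by simp_all
  show ?case
    using Cons.IH[OF alternating_contract[OF Cons.prems(1) a(1)] Cons.prems(2) a(2) Cons.prems(4-6)]
      Cons.IH[OF alternating_sign[OF Cons.prems(1)] alternating_contract[OF Cons.prems(2) a(1)] a(2) Cons.prems(4-6)]
    by (simp add: algebra_simps)
qed

lemma wedge_repeat:
  assumes "alternating D \<omega>" "alternating D \<eta>" shows "wedge \<omega> \<eta> (x # x # xs) = 0"
proof -
  have 0: "\<omega> (x # x # ys) = 0" "\<eta> (x # x # ys) = 0" for ys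
    using alternating_distinct[OF assms(1)] alternating_distinct[OF assms(2)] by simp_all
  have "wedge (\<lambda>ys. - ((-1) ^ length ys * \<omega> (x # ys))) (\<lambda>ys. \<eta> (x # ys)) xs =
      - wedge (\<lambda>ys. (-1) ^ length ys * \<omega> (x # ys)) (\<lambda>ys. \<eta> (x # ys)) xs"
    by (rule wedge_uminus_left)
  then show ?thesis by (simp add: 0 wedge_zero_left wedge_zero_right)
qed

lemma wedge_swap:
  assumes "alternating D \<omega>" "alternating D \<eta>" "x \<in> D" "y \<in> D" "xs \<in> lists D"
  shows "wedge \<omega> \<eta> (x # y # xs) = - wedge \<omega> \<eta> (y # x # xs)"
proof -
  let ?s = "\<lambda>v. 1 * x v + y v"
  have s: "?s \<in> D" using lin[OF assms(3,4), of 1] by simp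
  have "wedge \<omega> \<eta> (?s # ?s # xs) = wedge \<omega> \<eta> (x # ?s # xs) + wedge \<omega> \<eta> (y # ?s # xs)"
    using wedge_multilinear[OF assms(1,2), of "[]" "?s # xs" x y 1] assms(3-5) s by simp
  also have "\<dots> = wedge \<omega> \<eta> (x # x # xs) + wedge \<omega> \<eta> (x # y # xs) + (wedge \<omega> \<eta> (y # x # xs) + wedge \<omega> \<eta> (y # y # xs))"
    using wedge_multilinear[OF assms(1,2), of "[x]" xs x y 1] wedge_multilinear[OF assms(1,2), of "[y]" xs x y 1]
      assms(3-5) by simp
  finally show ?thesis by (simp only: wedge_repeat[OF assms(1,2)]) (simp add: add_eq_0_iff)
qed

text \<open>The second of two equal arguments is moved next to the first by transpositions.\<close>

lemma wedge_repeat_apart: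
  "alternating D \<omega> \<Longrightarrow> alternating D \<eta> \<Longrightarrow> x \<in> D \<Longrightarrow> as \<in> lists D \<Longrightarrow> bs \<in> lists D \<Longrightarrow>
   wedge \<omega> \<eta> (x # as @ x # bs) = 0"
proof (induction as arbitrary: \<omega> \<eta>)
  case Nil
  then show ?case using wedge_repeat by simp
next
  case (Cons a as)
  then have a: "a \<in> D" "as \<in> lists D" by simp_all
  have "wedge \<omega> \<eta> (x # a # as @ x # bs) = - wedge \<omega> \<eta> (a # x # as @ x # bs)"
    by (rule wedge_swap) (use Cons.prems a in auto)
  moreover have "wedge \<omega> \<eta> (a # x # as @ x # bs) = 0"
    using Cons.IH[OF alternating_contract[OF Cons.prems(1) a(1)] Cons.prems(2,3) a(2) Cons.prems(5)]
      Cons.IH[OF alternating_sign[OF Cons.prems(1)] alternating_contract[OF Cons.prems(2) a(1)] Cons.prems(3) a(2) Cons.prems(5)]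
    by (subst wedge.simps) simp
  ultimately show ?case by (simp only: append_Cons minus_zero)
qed

lemma wedge_not_distinct:
  "alternating D \<omega> \<Longrightarrow> alternating D \<eta> \<Longrightarrow> xs \<in> lists D \<Longrightarrow> \<not> distinct xs \<Longrightarrow> wedge \<omega> \<eta> xs = 0"
proof (induction xs arbitrary: \<omega> \<eta>)
  case Nil
  then show ?case by simp
next
  case (Cons x xs)
  then have x: "x \<in> D" "xs \<in> lists D" by simp_all
  show ?case
  proof (cases "distinct xs")
    case True
    then have "x \<in> set xs" using Cons.prems by simp
    then obtain as bs where "xs = as @ x # bs" by (meson split_list)
    then show ?thesis using wedge_repeat_apart[OF Cons.prems(1,2) x(1), of as bs] x(2) by simp
  next
    case False
    then show ?thesis
      using Cons.IH[OF alternating_contract[OF Cons.prems(1) x(1)] Cons.prems(2) x(2)]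
        Cons.IH[OF alternating_sign[OF Cons.prems(1)] alternating_contract[OF Cons.prems(2) x(1)] x(2)] by simp
  qed
qed

lemma alternating_wedge:
  assumes "alternating D \<omega>" "alternating D \<eta>" shows "alternating D (wedge \<omega> \<eta>)"
  by (rule alternatingI)
     (simp_all add: wedge_multilinear[OF assms] wedge_not_distinct[OF assms] wedge_outside[OF assms])

lemma alternating_swap:
  assumes u: "alternating D u" and "x \<in> D" "y \<in> D" "xs \<in> lists D"
  shows "u (x # y # xs) = - u (y # x # xs)"
proof -
  let ?s = "\<lambda>v. 1 * x v + y v"
  have s: "?s \<in> D" using lin[OF assms(2,3), of 1] by simp
  have 0: "u (z # z # xs) = 0" for z by (rule alternating_distinct[OF u]) simp
  have "u (?s # ?s # xs) = u (x # ?s # xs) + u (y # ?s # xs)"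
    using alternating_linear[OF u, of "[]" "?s # xs" x y 1] assms(2-4) s by simp
  also have "\<dots> = u (x # x # xs) + u (x # y # xs) + (u (y # x # xs) + u (y # y # xs))"
    using alternating_linear[OF u, of "[x]" xs x y 1] alternating_linear[OF u, of "[y]" xs x y 1] assms(2-4) by simp
  finally show ?thesis by (simp only: 0) (simp add: add_eq_0_iff)
qed

lemma alternating_sum:
  fixes r :: nat
  assumes u: "alternating D u" and xs: "xs \<in> lists D" and \<theta>: "\<And>i. i < r \<Longrightarrow> \<theta> i \<in> D"
  shows "(\<lambda>v. \<Sum>i<r. c i * \<theta> i v) \<in> D \<and> u ((\<lambda>v. \<Sum>i<r. c i * \<theta> i v) # xs) = (\<Sum>i<r. c i * u (\<theta> i # xs))"
  using \<theta>
proof (induction r)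
  case 0
  have "u ((\<lambda>_. 0) # xs) = 0"
    using alternating_linear[OF u, of "[]" xs "\<lambda>_. 0" "\<lambda>_. 0" 1] zero xs by simp
  then show ?case using zero by simp
next
  case (Suc r)
  let ?s = "\<lambda>v. \<Sum>i<r. c i * \<theta> i v"
  have IH: "?s \<in> D" "u (?s # xs) = (\<Sum>i<r. c i * u (\<theta> i # xs))" using Suc by auto
  have t: "\<theta> r \<in> D" using Suc.prems by simp
  have eq: "(\<lambda>v. \<Sum>i<Suc r. c i * \<theta> i v) = (\<lambda>v. c r * \<theta> r v + ?s v)" by (simp add: add.commute)
  show ?case unfolding eq
    using lin[OF t IH(1), of "c r"] alternating_linear[OF u, of "[]" xs "\<theta> r" ?s "c r"] t IH xs by simp
qed

lemma alternating_evaluation: "alternating D (evaluation D e)"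
proof (rule alternatingI)
  fix as bs \<theta> \<eta> c assume "as \<in> lists D" "bs \<in> lists D" and t: "\<theta> \<in> D" "\<eta> \<in> D"
  then show "evaluation D e (as @ (\<lambda>v. c * \<theta> v + \<eta> v) # bs) = c * evaluation D e (as @ \<theta> # bs) + evaluation D e (as @ \<eta> # bs)"
    using lin[OF t, of c] by (cases as) (auto simp: evaluation_def)
qed (auto simp: evaluation_def split: list.splits)

lemma wedge_evaluation:
  assumes "x \<in> D"
  shows "wedge (evaluation D e) v (x # xs) = x e * v xs - wedge (evaluation D e) (\<lambda>ys. v (x # ys)) xs"
proof -
  have "wedge (\<lambda>ys. evaluation D e (x # ys)) v xs = wedge (\<lambda>ys. if ys = [] then x e else 0) v xs"
    by (rule wedge_cong) (use assms in \<open>auto simp: evaluation_def\<close>)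
  moreover have "wedge (\<lambda>ys. (-1) ^ length ys * evaluation D e ys) (\<lambda>ys. v (x # ys)) xs =
      wedge (\<lambda>ys. - evaluation D e ys) (\<lambda>ys. v (x # ys)) xs"
    by (rule wedge_cong) (auto simp: evaluation_def split: list.splits)
  ultimately show ?thesis by (simp add: wedge_scalar_left wedge_uminus_left)
qed

text \<open>Euler's formula: wedging with a basis undoes contraction with the dual basis, up to the degree.\<close>

lemma euler_formula:
  fixes r :: nat
  assumes \<theta>: "\<And>i. i < r \<Longrightarrow> \<theta> i \<in> D" and coord: "\<And>x. x \<in> D \<Longrightarrow> x = (\<lambda>v. \<Sum>i<r. x (e i) * \<theta> i v)"
  shows "alternating D u \<Longrightarrow> xs \<in> lists D \<Longrightarrow>
    (\<Sum>i<r. wedge (evaluation D (e i)) (\<lambda>ys. u (\<theta> i # ys)) xs) = of_nat (length xs) * u xs"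
proof (induction xs arbitrary: u)
  case Nil
  then show ?case by (simp add: evaluation_def)
next
  case (Cons x xs)
  then have x: "x \<in> D" "xs \<in> lists D" by simp_all
  have "(\<Sum>i<r. wedge (evaluation D (e i)) (\<lambda>ys. u (\<theta> i # ys)) (x # xs)) =
      (\<Sum>i<r. x (e i) * u (\<theta> i # xs)) - (\<Sum>i<r. wedge (evaluation D (e i)) (\<lambda>ys. u (\<theta> i # x # ys)) xs)"
    by (simp only: wedge_evaluation[OF x(1)] sum_subtractf)
  also have "(\<Sum>i<r. x (e i) * u (\<theta> i # xs)) = u ((\<lambda>v. \<Sum>i<r. x (e i) * \<theta> i v) # xs)"
    by (rule conjunct2[OF alternating_sum[where c = "\<lambda>i. x (e i)" and \<theta> = \<theta>, OF Cons.prems(1) x(2)], symmetric]) (rule \<theta>)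
  also have "(\<lambda>v. \<Sum>i<r. x (e i) * \<theta> i v) = x" by (rule coord[OF x(1), symmetric])
  also have "(\<Sum>i<r. wedge (evaluation D (e i)) (\<lambda>ys. u (\<theta> i # x # ys)) xs) =
      (\<Sum>i<r. - wedge (evaluation D (e i)) (\<lambda>ys. u (x # \<theta> i # ys)) xs)"
  proof (rule sum.cong[OF refl])
    fix i assume i: "i \<in> {..<r}"
    have "wedge (evaluation D (e i)) (\<lambda>ys. u (\<theta> i # x # ys)) xs = wedge (evaluation D (e i)) (\<lambda>ys. (-1) * u (x # \<theta> i # ys) + 0) xs"
    proof (rule wedge_cong)
      fix ys assume "set ys \<subseteq> set xs"
      then have "ys \<in> lists D" using x(2) by auto
      then show "u (\<theta> i # x # ys) = (-1) * u (x # \<theta> i # ys) + 0"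
        using alternating_swap[OF Cons.prems(1) \<theta> x(1)] i by simp
    qed simp
    then show "wedge (evaluation D (e i)) (\<lambda>ys. u (\<theta> i # x # ys)) xs = - wedge (evaluation D (e i)) (\<lambda>ys. u (x # \<theta> i # ys)) xs"
      unfolding wedge_linear_right by (simp add: wedge_zero_right)
  qed
  also have "\<dots> = - (of_nat (length xs) * u (x # xs))"
    using Cons.IH[OF alternating_contract[OF Cons.prems(1) x(1)] x(2)] by (simp add: sum_negf)
  finally show ?case by (simp add: algebra_simps)
qed

end

section \<open>Sections of the exterior algebra bundle\<close>

locale bundle_model =
  fixes M :: "('a, 'v::ab_group_add) model"
  assumes model: "is_model M"
begin

sublocale manifold "base M" "dm M" "charts M"
  using model by (unfold_locales) (simp add: is_model_def)

sublocale vs: vector_space "scl M"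
  using model by (simp add: is_model_def holomorphic_bundle_def)

abbreviation r where "r \<equiv> rk M"

lemma frame:
  assumes "(W, e) \<in> frames M"
  shows "openin (base M) W"
    and "x \<in> W \<Longrightarrow> inj_on (\<lambda>i. e i x) {..<r}"
    and "x \<in> W \<Longrightarrow> vs.independent ((\<lambda>i. e i x) ` {..<r})"
    and "x \<in> W \<Longrightarrow> vs.span ((\<lambda>i. e i x) ` {..<r}) = fib M x"
  using model assms unfolding is_model_def holomorphic_bundle_def by auto

lemma frame_at:
  assumes "x \<in> topspace (base M)" obtains W e where "(W, e) \<in> frames M" "x \<in> W"
proof -
  have "x \<in> (\<Union>(W, e)\<in>frames M. W)" using model assms unfolding is_model_def holomorphic_bundle_def by simp
  then show thesis using that by blast
qed

sublocale D: covector_space "dual_fib M x" for x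
  by unfold_locales (auto simp: dual_fib_def algebra_simps)

lemma frame_in_fib: "(W, e) \<in> frames M \<Longrightarrow> x \<in> W \<Longrightarrow> i < r \<Longrightarrow> e i x \<in> fib M x"
  using frame(4)[of W e x] vs.span_base[of "e i x" "(\<lambda>i. e i x) ` {..<r}"] by simp

lemma dual_frame_in_dual:
  assumes F: "(W, e) \<in> frames M" "x \<in> W"
  shows "dual_frame M e i x \<in> dual_fib M x"
proof -
  let ?B = "(\<lambda>k. e k x) ` {..<r}"
  note ind = frame(3)[OF F] and sp = frame(4)[OF F]
  show ?thesis unfolding dual_fib_def dual_frame_def mem_Collect_eq
  proof (intro conjI ballI allI impI)
    fix v w assume "v \<in> fib M x" "w \<in> fib M x"
    then show "vs.representation ?B (v + w) (e i x) = vs.representation ?B v (e i x) + vs.representation ?B w (e i x)"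
      using vs.representation_add[OF ind] sp by simp
  next
    fix a v assume "v \<in> fib M x"
    then show "vs.representation ?B (scl M a v) (e i x) = a * vs.representation ?B v (e i x)"
      using vs.representation_scale[OF ind] sp by simp
  next
    fix v assume "v \<notin> fib M x"
    then show "vs.representation ?B v (e i x) = 0" using sp by (simp add: vs.representation_def)
  qed
qed

lemma dual_frame_basis:
  assumes F: "(W, e) \<in> frames M" "x \<in> W" and i: "i < r" "k < r"
  shows "dual_frame M e k x (e i x) = (if k = i then 1 else 0)"
proof -
  have "vs.representation ((\<lambda>k. e k x) ` {..<r}) (e i x) = (\<lambda>v. if v = e i x then 1 else 0)"
    by (rule vs.representation_basis[OF frame(3)[OF F]]) (use i in simp)
  moreover have "e k x = e i x \<longleftrightarrow> k = i"
    using inj_on_eq_iff[OF frame(2)[OF F], of k i] i by simp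
  ultimately show ?thesis by (simp add: dual_frame_def)
qed

lemma covector_sum:
  assumes F: "(W, e) \<in> frames M" "x \<in> W" and \<theta>: "\<theta> \<in> dual_fib M x"
  shows "k \<le> r \<Longrightarrow> (\<Sum>i<k. scl M (a i) (e i x)) \<in> fib M x \<and> \<theta> (\<Sum>i<k. scl M (a i) (e i x)) = (\<Sum>i<k. a i * \<theta> (e i x))"
proof (induction k)
  case 0
  have 0: "0 \<in> fib M x" using frame(4)[OF F] vs.span_zero by blast
  then have "\<theta> (scl M 0 0) = 0 * \<theta> 0" using \<theta> unfolding dual_fib_def by blast
  then show ?case using 0 by simp
next
  case (Suc k)
  have e: "e k x \<in> fib M x" using frame_in_fib[OF F] Suc.prems by simp
  have s: "scl M (a k) (e k x) \<in> fib M x" using e frame(4)[OF F] vs.span_scale by blast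
  have "\<theta> (scl M (a k) (e k x)) = a k * \<theta> (e k x)" using \<theta> e unfolding dual_fib_def by blast
  moreover have "\<theta> ((\<Sum>i<k. scl M (a i) (e i x)) + scl M (a k) (e k x)) =
      \<theta> (\<Sum>i<k. scl M (a i) (e i x)) + \<theta> (scl M (a k) (e k x))"
    using \<theta> s Suc unfolding dual_fib_def by simp
  moreover have "(\<Sum>i<k. scl M (a i) (e i x)) + scl M (a k) (e k x) \<in> fib M x"
    using Suc s frame(4)[OF F] vs.span_add by (metis Suc_leD)
  ultimately show ?case using Suc by simp
qed

lemma covector_coordinates:
  assumes F: "(W, e) \<in> frames M" "x \<in> W" and \<theta>: "\<theta> \<in> dual_fib M x"
  shows "\<theta> = (\<lambda>v. \<Sum>i<r. \<theta> (e i x) * dual_frame M e i x v)"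
proof
  fix v
  let ?B = "(\<lambda>k. e k x) ` {..<r}"
  show "\<theta> v = (\<Sum>i<r. \<theta> (e i x) * dual_frame M e i x v)"
  proof (cases "v \<in> fib M x")
    case True
    then have sp: "v \<in> vs.span ?B" using frame(4)[OF F] by simp
    have "(\<Sum>b\<in>?B. scl M (vs.representation ?B v b) b) = v"
      by (rule vs.sum_representation_eq[OF frame(3)[OF F] sp]) auto
    moreover have "(\<Sum>b\<in>?B. scl M (vs.representation ?B v b) b) = (\<Sum>i<r. scl M (dual_frame M e i x v) (e i x))"
      unfolding sum.reindex[OF frame(2)[OF F]] by (simp add: dual_frame_def)
    ultimately have "\<theta> v = \<theta> (\<Sum>i<r. scl M (dual_frame M e i x v) (e i x))" by (simp only:)
    also have "\<dots> = (\<Sum>i<r. dual_frame M e i x v * \<theta> (e i x))"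
      by (rule conjunct2[OF covector_sum[OF F \<theta> order_refl]])
    finally show ?thesis by (simp only: mult.commute)
  next
    case False
    then show ?thesis using \<theta> dual_frame_in_dual[OF F] by (simp add: dual_fib_def)
  qed
qed

lemma dual_frame_change_holo:
  assumes F: "(W, e) \<in> frames M" and F': "(W', e') \<in> frames M" and i: "i < r" "k < r"
  shows "holo_fun (dm M) (charts M) (W \<inter> W') (\<lambda>x. dual_frame M e k x (e' i x))"
proof -
  have "\<forall>(W, e)\<in>frames M. \<forall>(W', e')\<in>frames M.
        \<exists>g. (\<forall>i<r. \<forall>j<r. holo_fun (dm M) (charts M) (W \<inter> W') (g i j)) \<and>
            (\<forall>x\<in>W \<inter> W'. \<forall>j<r. e' j x = (\<Sum>i<r. scl M (g i j x) (e i x)))"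
    using model unfolding is_model_def holomorphic_bundle_def by (elim conjE)
  from bspec[OF bspec[OF this F, unfolded prod.case] F'] obtain g where g: "\<forall>i<r. \<forall>j<r. holo_fun (dm M) (charts M) (W \<inter> W') (g i j)"
      "\<forall>x\<in>W \<inter> W'. \<forall>j<r. e' j x = (\<Sum>i<r. scl M (g i j x) (e i x))"
    unfolding prod.case by (elim exE conjE)
  have "holo_fun (dm M) (charts M) (W \<inter> W') (\<lambda>x. dual_frame M e k x (e' i x)) \<longleftrightarrow>
      holo_fun (dm M) (charts M) (W \<inter> W') (g k i)"
  proof (rule holo_fun_cong)
    fix x assume x: "x \<in> W \<inter> W'"
    have xW: "x \<in> W" using x by simp
    have "dual_frame M e k x (e' i x) = (\<Sum>l<r. g l i x * dual_frame M e k x (e l x))"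
      using covector_sum[OF F xW dual_frame_in_dual[OF F xW], of r "\<lambda>l. g l i x" k] g(2) x i by simp
    also have "\<dots> = (\<Sum>l<r. if k = l then g l i x else 0)"
      by (rule sum.cong) (simp_all add: dual_frame_basis[OF F xW] i)
    finally show "dual_frame M e k x (e' i x) = g k i x" using i by simp
  qed
  moreover have "holo_fun (dm M) (charts M) (W \<inter> W') (g k i)" using g(1) i by simp
  ultimately show ?thesis by (rule iffD2)
qed

abbreviation ext where "ext \<equiv> ext_sections M"
abbreviation opn where "opn \<equiv> openin (base M)"

lemma ext_sections_iff:
  "s \<in> ext U \<longleftrightarrow> (\<forall>x\<in>U. alternating (dual_fib M x) (s x)) \<and> (\<forall>x. x \<notin> U \<longrightarrow> s x = (\<lambda>_. 0)) \<and>
    (\<forall>W e is. (W, e) \<in> frames M \<longrightarrow> is \<in> lists {..<r} \<longrightarrow>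
        holo_fun (dm M) (charts M) (U \<inter> W) (\<lambda>x. s x (map (\<lambda>i. dual_frame M e i x) is)))"
  unfolding ext_sections_def mem_Collect_eq multivectors_alternating by fast

lemma extI:
  assumes "\<And>x. x \<in> U \<Longrightarrow> alternating (dual_fib M x) (s x)" "\<And>x. x \<notin> U \<Longrightarrow> s x = (\<lambda>_. 0)"
    "\<And>W e is. (W, e) \<in> frames M \<Longrightarrow> is \<in> lists {..<r} \<Longrightarrow>
        holo_fun (dm M) (charts M) (U \<inter> W) (\<lambda>x. s x (map (\<lambda>i. dual_frame M e i x) is))"
  shows "s \<in> ext U"
  unfolding ext_sections_iff by (intro conjI ballI allI impI assms)

lemma extD:
  assumes "s \<in> ext U"
  shows "x \<in> U \<Longrightarrow> alternating (dual_fib M x) (s x)" "x \<notin> U \<Longrightarrow> s x = (\<lambda>_. 0)"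
    "(W, e) \<in> frames M \<Longrightarrow> is \<in> lists {..<r} \<Longrightarrow>
        holo_fun (dm M) (charts M) (U \<inter> W) (\<lambda>x. s x (map (\<lambda>i. dual_frame M e i x) is))"
proof -
  note * = assms[unfolded ext_sections_iff]
  show "x \<in> U \<Longrightarrow> alternating (dual_fib M x) (s x)" by (rule bspec[OF conjunct1[OF *]])
  show "x \<notin> U \<Longrightarrow> s x = (\<lambda>_. 0)" by (rule mp[OF spec[OF conjunct1[OF conjunct2[OF *]]]])
  show "(W, e) \<in> frames M \<Longrightarrow> is \<in> lists {..<r} \<Longrightarrow>
      holo_fun (dm M) (charts M) (U \<inter> W) (\<lambda>x. s x (map (\<lambda>i. dual_frame M e i x) is))"
    by (rule conjunct2[OF conjunct2[OF *], rule_format])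
qed

lemma frame_Int_open: "opn U \<Longrightarrow> (W, e) \<in> frames M \<Longrightarrow> opn (U \<inter> W)"
  using frame(1) by blast

lemma ext_zero: assumes "opn U" shows "(\<lambda>_ _. 0) \<in> ext U"
  by (rule extI, rule D.alternating_zero, rule refl, rule holo_fun_const[OF frame_Int_open[OF assms]])

lemma ext_add: assumes "s \<in> ext U" "t \<in> ext U" shows "sec_add s t \<in> ext U"
  unfolding sec_add_def
proof (rule extI)
  show "(\<lambda>xs. s x xs + t x xs) = (\<lambda>_. 0)" if "x \<notin> U" for x
    unfolding extD(2)[OF assms(1) that] extD(2)[OF assms(2) that] by simp
qed (intro D.alternating_add holo_fun_add extD[OF assms(1)] extD[OF assms(2)]; assumption)+

lemma ext_weight: assumes "opn U" "s \<in> ext U" shows "(\<lambda>x xs. w (length xs) * s x xs) \<in> ext U"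
proof (rule extI)
  show "(\<lambda>xs. w (length xs) * s x xs) = (\<lambda>_. 0)" if "x \<notin> U" for x
    unfolding extD(2)[OF assms(2) that] by simp
  show "alternating (dual_fib M x) (\<lambda>xs. w (length xs) * s x xs)" if "x \<in> U" for x
    by (rule D.alternating_weight[OF extD(1)[OF assms(2) that]])
  show "holo_fun (dm M) (charts M) (U \<inter> W) (\<lambda>x. w (length (map (\<lambda>i. dual_frame M e i x) is)) * s x (map (\<lambda>i. dual_frame M e i x) is))"
    if F: "(W, e) \<in> frames M" and "is": "is \<in> lists {..<r}" for W e "is"
    unfolding length_map by (rule holo_fun_scale[OF frame_Int_open[OF assms(1) F] extD(3)[OF assms(2) F "is"]])
qed

lemma ext_scale: assumes "opn U" "s \<in> ext U" shows "sec_scale c s \<in> ext U"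
  unfolding sec_scale_def by (rule ext_weight[OF assms])

lemma sec_diff_eq: "sec_diff s t = sec_add s (sec_scale (-1) t)"
  by (simp add: sec_diff_def sec_add_def sec_scale_def)

lemma ext_diff: "opn U \<Longrightarrow> s \<in> ext U \<Longrightarrow> t \<in> ext U \<Longrightarrow> sec_diff s t \<in> ext U"
  unfolding sec_diff_eq by (intro ext_add ext_scale)

lemma ext_one: assumes "opn U" shows "sec_one U \<in> ext U"
proof (rule extI)
  fix x assume x: "x \<in> U"
  show "alternating (dual_fib M x) (sec_one U x)"
    by (rule D.alternatingI) (auto simp: sec_one_def)
next
  fix W e "is" assume F: "(W, e) \<in> frames M"
  have "holo_fun (dm M) (charts M) (U \<inter> W) (\<lambda>x. sec_one U x (map (\<lambda>i. dual_frame M e i x) is)) \<longleftrightarrow>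
      holo_fun (dm M) (charts M) (U \<inter> W) (\<lambda>_. if is = [] then 1 else 0)"
    by (rule holo_fun_cong) (simp add: sec_one_def)
  then show "holo_fun (dm M) (charts M) (U \<inter> W) (\<lambda>x. sec_one U x (map (\<lambda>i. dual_frame M e i x) is))"
    using holo_fun_const[OF frame_Int_open[OF assms F]] by simp
qed (simp add: sec_one_def)

lemma ext_restrict:
  assumes s: "s \<in> ext U" and V: "opn V" "V \<subseteq> U" shows "sec_restrict V s \<in> ext V"
proof (rule extI)
  show "alternating (dual_fib M x) (sec_restrict V s x)" if "x \<in> V" for x
    using extD(1)[OF s] that V(2) by (auto simp: sec_restrict_def)
  fix W e "is" assume F: "(W, e) \<in> frames M" "is \<in> lists {..<r}"
  have "holo_fun (dm M) (charts M) (V \<inter> W) (\<lambda>x. s x (map (\<lambda>i. dual_frame M e i x) is))"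
    by (rule holo_fun_subset[OF extD(3)[OF s F] frame_Int_open[OF V(1) F(1)]]) (use V(2) in blast)
  moreover have "holo_fun (dm M) (charts M) (V \<inter> W) (\<lambda>x. sec_restrict V s x (map (\<lambda>i. dual_frame M e i x) is)) \<longleftrightarrow>
     holo_fun (dm M) (charts M) (V \<inter> W) (\<lambda>x. s x (map (\<lambda>i. dual_frame M e i x) is))"
    by (rule holo_fun_cong) (simp add: sec_restrict_def)
  ultimately show "holo_fun (dm M) (charts M) (V \<inter> W) (\<lambda>x. sec_restrict V s x (map (\<lambda>i. dual_frame M e i x) is))"
    by simp
qed (simp add: sec_restrict_def)

lemma wedge_coefficients_holo:
  assumes Z: "opn Z"
  shows "(\<And>js. js \<in> lists {..<r} \<Longrightarrow> holo_fun (dm M) (charts M) Z (\<lambda>x. \<omega> x (map (\<lambda>i. \<theta> i x) js))) \<Longrightarrow>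
    (\<And>js. js \<in> lists {..<r} \<Longrightarrow> holo_fun (dm M) (charts M) Z (\<lambda>x. \<eta> x (map (\<lambda>i. \<theta> i x) js))) \<Longrightarrow>
    is \<in> lists {..<r} \<Longrightarrow> holo_fun (dm M) (charts M) Z (\<lambda>x. wedge (\<omega> x) (\<eta> x) (map (\<lambda>i. \<theta> i x) is))"
proof (induction "is" arbitrary: \<omega> \<eta>)
  case Nil
  show ?case using holo_fun_mult[OF Nil.prems(1)[of "[]"] Nil.prems(2)[of "[]"]] by simp
next
  case (Cons i "is")
  then have i: "i < r" "is \<in> lists {..<r}" by auto
  have "holo_fun (dm M) (charts M) Z (\<lambda>x. wedge (\<lambda>ys. \<omega> x (\<theta> i x # ys)) (\<eta> x) (map (\<lambda>i. \<theta> i x) is))"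
  proof (rule Cons.IH[of "\<lambda>x ys. \<omega> x (\<theta> i x # ys)" \<eta>])
    show "is \<in> lists {..<r}" by (rule i(2))
    show "holo_fun (dm M) (charts M) Z (\<lambda>x. \<eta> x (map (\<lambda>i. \<theta> i x) js))" if "js \<in> lists {..<r}" for js
      by (rule Cons.prems(2)[OF that])
    show "holo_fun (dm M) (charts M) Z (\<lambda>x. \<omega> x (\<theta> i x # map (\<lambda>i. \<theta> i x) js))" if "js \<in> lists {..<r}" for js
      using Cons.prems(1)[of "i # js"] that i by simp
  qed
  moreover have "holo_fun (dm M) (charts M) Z (\<lambda>x. wedge (\<lambda>ys. (-1) ^ length ys * \<omega> x ys) (\<lambda>ys. \<eta> x (\<theta> i x # ys)) (map (\<lambda>i. \<theta> i x) is))"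
  proof (rule Cons.IH[of "\<lambda>x ys. (-1) ^ length ys * \<omega> x ys" "\<lambda>x ys. \<eta> x (\<theta> i x # ys)", OF _ _ i(2)])
    show "holo_fun (dm M) (charts M) Z (\<lambda>x. (-1) ^ length (map (\<lambda>i. \<theta> i x) js) * \<omega> x (map (\<lambda>i. \<theta> i x) js))"
      if "js \<in> lists {..<r}" for js using holo_fun_scale[OF Z Cons.prems(1)[OF that]] by simp
    show "holo_fun (dm M) (charts M) Z (\<lambda>x. \<eta> x (\<theta> i x # map (\<lambda>i. \<theta> i x) js))" if "js \<in> lists {..<r}" for js
      using Cons.prems(2)[of "i # js"] that i by simp
  qed
  ultimately show ?case using holo_fun_add by simp
qed

lemma ext_wedge:
  assumes U: "opn U" and s: "s \<in> ext U" and t: "t \<in> ext U" shows "sec_wedge s t \<in> ext U"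
  unfolding sec_wedge_def
proof (rule extI)
  show "alternating (dual_fib M x) (wedge (s x) (t x))" if "x \<in> U" for x
    by (rule D.alternating_wedge[OF extD(1)[OF s that] extD(1)[OF t that]])
  show "wedge (s x) (t x) = (\<lambda>_. 0)" if "x \<notin> U" for x
    unfolding extD(2)[OF s that] by (rule HOL.ext) (rule wedge_zero_left)
  show "holo_fun (dm M) (charts M) (U \<inter> W) (\<lambda>x. wedge (s x) (t x) (map (\<lambda>i. dual_frame M e i x) is))"
    if F: "(W, e) \<in> frames M" and "is": "is \<in> lists {..<r}" for W e "is"
  proof (rule wedge_coefficients_holo[of _ s "dual_frame M e" t])
    show "opn (U \<inter> W)" by (rule frame_Int_open[OF U F])
    show "is \<in> lists {..<r}" by (rule "is")
  qed (rule extD(3)[OF s F] extD(3)[OF t F], assumption)+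
qed

definition frame_section :: "(nat \<Rightarrow> 'a \<Rightarrow> 'v) \<Rightarrow> nat \<Rightarrow> 'a set \<Rightarrow> ('a, 'v) msection" where
  "frame_section e i V = (\<lambda>x ys. if x \<in> V then evaluation (dual_fib M x) (e i x) ys else 0)"

lemma ext_frame_section:
  assumes F: "(W, e) \<in> frames M" and V: "opn V" "V \<subseteq> W" and i: "i < r"
  shows "frame_section e i V \<in> ext V"
proof (rule extI)
  show "alternating (dual_fib M x) (frame_section e i V x)" if "x \<in> V" for x
    using D.alternating_evaluation that by (simp add: frame_section_def)
  fix W' e' "is" assume F': "(W', e') \<in> frames M" and "is": "is \<in> lists {..<r}"
  note o = frame_Int_open[OF V(1) F']
  show "holo_fun (dm M) (charts M) (V \<inter> W') (\<lambda>x. frame_section e i V x (map (\<lambda>i. dual_frame M e' i x) is))"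
  proof (cases "\<exists>k. is = [k]")
    case True
    then obtain k where k: "is = [k]" "k < r" using "is" by auto
    have h: "holo_fun (dm M) (charts M) (V \<inter> W') (\<lambda>x. dual_frame M e' k x (e i x))"
      by (rule holo_fun_subset[OF dual_frame_change_holo[OF F' F i k(2)] o]) (use V(2) in blast)
    have "holo_fun (dm M) (charts M) (V \<inter> W') (\<lambda>x. frame_section e i V x (map (\<lambda>i. dual_frame M e' i x) is)) \<longleftrightarrow>
        holo_fun (dm M) (charts M) (V \<inter> W') (\<lambda>x. dual_frame M e' k x (e i x))"
      by (rule holo_fun_cong) (simp add: frame_section_def evaluation_def k dual_frame_in_dual[OF F'])
    then show ?thesis using h by simp
  next
    case False
    have "holo_fun (dm M) (charts M) (V \<inter> W') (\<lambda>x. frame_section e i V x (map (\<lambda>i. dual_frame M e' i x) is)) \<longleftrightarrow>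
        holo_fun (dm M) (charts M) (V \<inter> W') (\<lambda>_. 0)"
      by (rule holo_fun_cong) (use False in \<open>auto simp: frame_section_def evaluation_def split: list.splits\<close>)
    then show ?thesis using holo_fun_const[OF o] by simp
  qed
qed (simp add: frame_section_def)

text \<open>In the dual of another frame, the coordinates of a dual frame covector are transition
  functions, hence holomorphic.\<close>

lemma ext_contract:
  assumes F: "(W, e) \<in> frames M" and V: "opn V" "V \<subseteq> W" and i: "i < r" and s: "s \<in> ext V"
  shows "(\<lambda>x ys. s x (dual_frame M e i x # ys)) \<in> ext V"
proof (rule extI)
  show "alternating (dual_fib M x) (\<lambda>ys. s x (dual_frame M e i x # ys))" if "x \<in> V" for x
    by (rule D.alternating_contract[OF extD(1)[OF s that] dual_frame_in_dual[OF F subsetD[OF V(2) that]]])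
  show "(\<lambda>ys. s x (dual_frame M e i x # ys)) = (\<lambda>_. 0)" if "x \<notin> V" for x
    unfolding extD(2)[OF s that] by (rule refl)
  fix W' e' "is" assume F': "(W', e') \<in> frames M" and "is": "is \<in> lists {..<r}"
  note o = frame_Int_open[OF V(1) F']
  let ?f = "\<lambda>x. \<Sum>k<r. dual_frame M e i x (e' k x) * s x (map (\<lambda>i. dual_frame M e' i x) (k # is))"
  have h: "holo_fun (dm M) (charts M) (V \<inter> W') ?f"
  proof (rule holo_fun_sum[OF o])
    fix k assume k: "k < r"
    have "holo_fun (dm M) (charts M) (V \<inter> W') (\<lambda>x. dual_frame M e i x (e' k x))"
      by (rule holo_fun_subset[OF dual_frame_change_holo[OF F F' k i] o]) (use V(2) in blast)
    moreover have "k # is \<in> lists {..<r}" using k "is" by simp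
    ultimately show "holo_fun (dm M) (charts M) (V \<inter> W') (\<lambda>x. dual_frame M e i x (e' k x) * s x (map (\<lambda>i. dual_frame M e' i x) (k # is)))"
      by (intro holo_fun_mult extD(3)[OF s F'])
  qed
  have "holo_fun (dm M) (charts M) (V \<inter> W') (\<lambda>x. s x (dual_frame M e i x # map (\<lambda>i. dual_frame M e' i x) is)) \<longleftrightarrow>
      holo_fun (dm M) (charts M) (V \<inter> W') ?f"
  proof (rule holo_fun_cong)
    fix x assume x: "x \<in> V \<inter> W'"
    then have xW: "x \<in> W" "x \<in> W'" "x \<in> V" using V(2) by auto
    have xs: "map (\<lambda>i. dual_frame M e' i x) is \<in> lists (dual_fib M x)" using dual_frame_in_dual[OF F' xW(2)] by auto
    have "s x (dual_frame M e i x # map (\<lambda>i. dual_frame M e' i x) is) =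
        s x ((\<lambda>v. \<Sum>k<r. dual_frame M e i x (e' k x) * dual_frame M e' k x v) # map (\<lambda>i. dual_frame M e' i x) is)"
      using covector_coordinates[OF F' xW(2) dual_frame_in_dual[OF F xW(1)], of i] by simp
    also have "\<dots> = (\<Sum>k<r. dual_frame M e i x (e' k x) * s x (dual_frame M e' k x # map (\<lambda>i. dual_frame M e' i x) is))"
      by (rule conjunct2[OF D.alternating_sum[where c = "\<lambda>k. dual_frame M e i x (e' k x)" and \<theta> = "\<lambda>k. dual_frame M e' k x",
            OF extD(1)[OF s xW(3)] xs]]) (rule dual_frame_in_dual[OF F' xW(2)])
    finally show "s x (dual_frame M e i x # map (\<lambda>i. dual_frame M e' i x) is) = ?f x" by simp
  qed
  then show "holo_fun (dm M) (charts M) (V \<inter> W') (\<lambda>x. s x (dual_frame M e i x # map (\<lambda>i. dual_frame M e' i x) is))"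
    using h by simp
qed

definition vanish :: "nat \<Rightarrow> ('a, 'v) msection \<Rightarrow> bool" where
  "vanish k s \<longleftrightarrow> (\<forall>x xs. length xs < k \<longrightarrow> s x xs = 0)"

lemma J_ideal_iff: "s \<in> J_ideal M k U \<longleftrightarrow> s \<in> ext U \<and> vanish k s"
  by (simp add: J_ideal_def vanish_def)

text \<open>Euler's formula, applied to \<open>u\<close> with its component of degree \<open>k\<close> divided by \<open>k\<close>; the component
  of degree 0 vanishes by hypothesis.\<close>

lemma frame_decomposition:
  assumes F: "(W, e) \<in> frames M" and V: "opn V" "V \<subseteq> W" and u: "u \<in> ext V" and m: "vanish (Suc m) u"
  obtains v where "\<And>i. i < r \<Longrightarrow> v i \<in> ext V" "\<And>i. vanish m (v i)"
    "u = (\<lambda>x xs. \<Sum>i<r. sec_wedge (frame_section e i V) (v i) x xs)"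
proof -
  define u' :: "('a, 'v) msection" where "u' = (\<lambda>x xs. inverse (of_nat (length xs)) * u x xs)"
  have u': "u' \<in> ext V" unfolding u'_def by (rule ext_weight[OF V(1) u])
  define v :: "nat \<Rightarrow> ('a, 'v) msection" where "v i = (\<lambda>x ys. u' x (dual_frame M e i x # ys))" for i
  show thesis
  proof (rule that[of v])
    show "v i \<in> ext V" if i: "i < r" for i unfolding v_def by (rule ext_contract[OF F V i u'])
    show "vanish m (v i)" for i using m by (simp add: vanish_def v_def u'_def)
    show "u = (\<lambda>x xs. \<Sum>i<r. sec_wedge (frame_section e i V) (v i) x xs)"
    proof (intro HOL.ext)
      fix x xs
      show "u x xs = (\<Sum>i<r. sec_wedge (frame_section e i V) (v i) x xs)"
      proof (cases "x \<in> V")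
        case False
        then have "sec_wedge (frame_section e i V) (v i) x xs = 0" for i
          by (simp add: sec_wedge_def frame_section_def wedge_zero_left)
        then show ?thesis using extD(2)[OF u False] by simp
      next
        case True
        then have xW: "x \<in> W" using V(2) by blast
        have fs: "frame_section e i V x = evaluation (dual_fib M x) (e i x)" for i
          using True by (simp add: frame_section_def)
        show ?thesis
        proof (cases "xs \<in> lists (dual_fib M x)")
          case lists: True
          have "(\<Sum>i<r. sec_wedge (frame_section e i V) (v i) x xs) = of_nat (length xs) * u' x xs"
            unfolding sec_wedge_def fs v_def
            by (rule D.euler_formula[where \<theta> = "\<lambda>i. dual_frame M e i x" and e = "\<lambda>i. e i x", OF dual_frame_in_dual[OF F xW]
                  covector_coordinates[OF F xW] extD(1)[OF u' True] lists])
          also have "\<dots> = u x xs" using m by (cases xs) (simp_all add: u'_def vanish_def del: of_nat_Suc)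
          finally show ?thesis by simp
        next
          case False
          have "sec_wedge (frame_section e i V) (v i) x xs = 0" if "i < r" for i
            unfolding sec_wedge_def fs v_def
            by (rule D.wedge_outside[OF D.alternating_evaluation
                  D.alternating_contract[OF extD(1)[OF u' True] dual_frame_in_dual[OF F xW]] False])
          then show ?thesis using D.alternating_outside[OF extD(1)[OF u True] False] by simp
        qed
      qed
    qed
  qed
qed

end

section \<open>The automorphism sheaves\<close>

context bundle_model
begin

abbreviation opens where "opens U \<equiv> opens_in (base M) U"

lemma opensD: "V \<in> opens U \<Longrightarrow> opn V" "V \<in> opens U \<Longrightarrow> V \<subseteq> U"
  by (simp_all add: opens_in_def)

lemma opens_mono: "V \<in> opens U \<Longrightarrow> opens V \<subseteq> opens U"
  by (auto simp: opens_in_def)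

lemma opens_trans: "V \<in> opens U \<Longrightarrow> W \<in> opens V \<Longrightarrow> W \<in> opens U"
  using opens_mono by blast

lemma vanish_mono: "vanish k s \<Longrightarrow> l \<le> k \<Longrightarrow> vanish l s"
  by (auto simp: vanish_def)

lemma vanish_add: "vanish k s \<Longrightarrow> vanish k t \<Longrightarrow> vanish k (sec_add s t)"
  by (auto simp: vanish_def sec_add_def)

lemma vanish_diff: "vanish k s \<Longrightarrow> vanish k t \<Longrightarrow> vanish k (sec_diff s t)"
  by (auto simp: vanish_def sec_diff_def)

lemma vanish_wedge: "vanish k s \<Longrightarrow> vanish l t \<Longrightarrow> vanish (k + l) (sec_wedge s t)"
  unfolding vanish_def sec_wedge_def by (intro allI impI wedge_order[of k _ l]) auto

lemma vanish_0: "vanish 0 s"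
  by (simp add: vanish_def)

lemma vanish_image: "vanish k (sec_diff t s) \<Longrightarrow> vanish k s \<Longrightarrow> vanish k t"
  by (force simp: vanish_def sec_diff_def)

lemma sec_add_diff: "sec_add s (sec_diff t s) = t"
  by (simp add: sec_add_def sec_diff_def)

lemma aut_props:
  assumes "\<alpha> \<in> ext_automorphisms M U" "V \<in> opens U"
  shows "\<alpha> V \<in> extensional (ext V) \<and>
        bij_betw (\<alpha> V) (ext V) (ext V) \<and>
        \<alpha> V (sec_one V) = sec_one V \<and>
        (\<forall>s\<in>ext V. \<forall>t\<in>ext V.
           \<alpha> V (sec_add s t) = sec_add (\<alpha> V s) (\<alpha> V t) \<and>
           \<alpha> V (sec_wedge s t) = sec_wedge (\<alpha> V s) (\<alpha> V t)) \<and>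
        (\<forall>s\<in>ext V.
           (\<forall>c. \<alpha> V (sec_scale c s) = sec_scale c (\<alpha> V s)) \<and>
           (sec_even s \<longrightarrow> sec_even (\<alpha> V s)) \<and> (sec_odd s \<longrightarrow> sec_odd (\<alpha> V s)) \<and>
           (\<forall>W\<in>opens V. \<alpha> W (sec_restrict W s) = sec_restrict W (\<alpha> V s)))"
  by (rule bspec[OF conjunct2[OF assms(1)[unfolded ext_automorphisms_def mem_Collect_eq]] assms(2)])

lemma aut_fam_extensional: "\<alpha> \<in> ext_automorphisms M U \<Longrightarrow> \<alpha> \<in> extensional (opens U)"
  by (simp add: ext_automorphisms_def)

context
  fixes \<alpha> U V assumes a: "\<alpha> \<in> ext_automorphisms M U" and V: "V \<in> opens U"
begin

lemma aut_extensional: "\<alpha> V \<in> extensional (ext V)"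
  using aut_props[OF a V] by (elim conjE)

lemma aut_bij: "bij_betw (\<alpha> V) (ext V) (ext V)"
  using aut_props[OF a V] by (elim conjE)

lemma aut_one: "\<alpha> V (sec_one V) = sec_one V"
  using aut_props[OF a V] by (elim conjE)

lemma aut_closed: "s \<in> ext V \<Longrightarrow> \<alpha> V s \<in> ext V"
  by (rule bij_betwE[OF aut_bij, rule_format])

lemma aut_inj: "s \<in> ext V \<Longrightarrow> t \<in> ext V \<Longrightarrow> \<alpha> V s = \<alpha> V t \<Longrightarrow> s = t"
  using bij_betw_imp_inj_on[OF aut_bij] by (rule inj_onD)

lemma aut_add: "s \<in> ext V \<Longrightarrow> t \<in> ext V \<Longrightarrow> \<alpha> V (sec_add s t) = sec_add (\<alpha> V s) (\<alpha> V t)"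
  using aut_props[OF a V] by simp

lemma aut_wedge: "s \<in> ext V \<Longrightarrow> t \<in> ext V \<Longrightarrow> \<alpha> V (sec_wedge s t) = sec_wedge (\<alpha> V s) (\<alpha> V t)"
  using aut_props[OF a V] by simp

lemma aut_scale: "s \<in> ext V \<Longrightarrow> \<alpha> V (sec_scale c s) = sec_scale c (\<alpha> V s)"
  using aut_props[OF a V] by simp

lemma aut_even: "s \<in> ext V \<Longrightarrow> sec_even s \<Longrightarrow> sec_even (\<alpha> V s)"
  using aut_props[OF a V] by simp

lemma aut_odd: "s \<in> ext V \<Longrightarrow> sec_odd s \<Longrightarrow> sec_odd (\<alpha> V s)"
  using aut_props[OF a V] by simp

lemma aut_restrict: "s \<in> ext V \<Longrightarrow> W \<in> opens V \<Longrightarrow> \<alpha> W (sec_restrict W s) = sec_restrict W (\<alpha> V s)"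
  using aut_props[OF a V] by simp

end

lemma autI:
  assumes "\<alpha> \<in> extensional (opens U)"
    and "\<And>V. V \<in> opens U \<Longrightarrow> \<alpha> V \<in> extensional (ext V)"
    and "\<And>V. V \<in> opens U \<Longrightarrow> bij_betw (\<alpha> V) (ext V) (ext V)"
    and "\<And>V. V \<in> opens U \<Longrightarrow> \<alpha> V (sec_one V) = sec_one V"
    and "\<And>V s t. V \<in> opens U \<Longrightarrow> s \<in> ext V \<Longrightarrow> t \<in> ext V \<Longrightarrow> \<alpha> V (sec_add s t) = sec_add (\<alpha> V s) (\<alpha> V t)"
    and "\<And>V s t. V \<in> opens U \<Longrightarrow> s \<in> ext V \<Longrightarrow> t \<in> ext V \<Longrightarrow> \<alpha> V (sec_wedge s t) = sec_wedge (\<alpha> V s) (\<alpha> V t)"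
    and "\<And>V s c. V \<in> opens U \<Longrightarrow> s \<in> ext V \<Longrightarrow> \<alpha> V (sec_scale c s) = sec_scale c (\<alpha> V s)"
    and "\<And>V s. V \<in> opens U \<Longrightarrow> s \<in> ext V \<Longrightarrow> sec_even s \<Longrightarrow> sec_even (\<alpha> V s)"
    and "\<And>V s. V \<in> opens U \<Longrightarrow> s \<in> ext V \<Longrightarrow> sec_odd s \<Longrightarrow> sec_odd (\<alpha> V s)"
    and "\<And>V s W. V \<in> opens U \<Longrightarrow> s \<in> ext V \<Longrightarrow> W \<in> opens V \<Longrightarrow> \<alpha> W (sec_restrict W s) = sec_restrict W (\<alpha> V s)"
  shows "\<alpha> \<in> ext_automorphisms M U"
  unfolding ext_automorphisms_def mem_Collect_eq
  by (intro conjI ballI allI impI assms; assumption)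

lemma fam_eqI:
  assumes "\<alpha> \<in> extensional (opens U)" "\<beta> \<in> extensional (opens U)"
    and "\<And>V. V \<in> opens U \<Longrightarrow> \<alpha> V \<in> extensional (ext V)" "\<And>V. V \<in> opens U \<Longrightarrow> \<beta> V \<in> extensional (ext V)"
    and "\<And>V s. V \<in> opens U \<Longrightarrow> s \<in> ext V \<Longrightarrow> \<alpha> V s = \<beta> V s"
  shows "\<alpha> = \<beta>"
  by (rule extensionalityI[OF assms(1,2)], rule extensionalityI[OF assms(3,4)], assumption, assumption, rule assms(5))

lemma aut_eqI:
  assumes "\<alpha> \<in> ext_automorphisms M U" "\<beta> \<in> ext_automorphisms M U"
    and "\<And>V s. V \<in> opens U \<Longrightarrow> s \<in> ext V \<Longrightarrow> \<alpha> V s = \<beta> V s"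
  shows "\<alpha> = \<beta>"
  by (rule fam_eqI[OF aut_fam_extensional[OF assms(1)] aut_fam_extensional[OF assms(2)]
      aut_extensional[OF assms(1)] aut_extensional[OF assms(2)] assms(3)])

definition fam_comp :: "'a set \<Rightarrow> ('a, 'v) fam \<Rightarrow> ('a, 'v) fam \<Rightarrow> ('a, 'v) fam" where
  "fam_comp U \<alpha> \<beta> = (\<lambda>V\<in>opens U. compose (ext V) (\<alpha> V) (\<beta> V))"

definition fam_id :: "'a set \<Rightarrow> ('a, 'v) fam" where
  "fam_id U = (\<lambda>V\<in>opens U. \<lambda>s\<in>ext V. s)"

definition fam_inv :: "'a set \<Rightarrow> ('a, 'v) fam \<Rightarrow> ('a, 'v) fam" where
  "fam_inv U \<alpha> = (\<lambda>V\<in>opens U. \<lambda>t\<in>ext V. inv_into (ext V) (\<alpha> V) t)"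

lemma fam_comp_apply: "V \<in> opens U \<Longrightarrow> s \<in> ext V \<Longrightarrow> fam_comp U \<alpha> \<beta> V s = \<alpha> V (\<beta> V s)"
  by (simp add: fam_comp_def compose_def)

lemma fam_id_apply: "V \<in> opens U \<Longrightarrow> s \<in> ext V \<Longrightarrow> fam_id U V s = s"
  by (simp add: fam_id_def)

lemma aut_comp:
  assumes a: "\<alpha> \<in> ext_automorphisms M U" and b: "\<beta> \<in> ext_automorphisms M U"
  shows "fam_comp U \<alpha> \<beta> \<in> ext_automorphisms M U"
proof (rule autI)
  show "fam_comp U \<alpha> \<beta> \<in> extensional (opens U)" by (simp add: fam_comp_def)
  fix V assume V: "V \<in> opens U"
  note oV = opensD(1)[OF V]
  note ap = fam_comp_apply[OF V] and ac = aut_closed[OF a V] and bc = aut_closed[OF b V]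
  show "fam_comp U \<alpha> \<beta> V \<in> extensional (ext V)" using V by (simp add: fam_comp_def compose_def)
  have "bij_betw (compose (ext V) (\<alpha> V) (\<beta> V)) (ext V) (ext V)"
    by (rule bij_betw_compose[OF aut_bij[OF b V] aut_bij[OF a V]])
  then show "bij_betw (fam_comp U \<alpha> \<beta> V) (ext V) (ext V)" using V by (simp add: fam_comp_def)
  show "fam_comp U \<alpha> \<beta> V (sec_one V) = sec_one V"
    by (simp only: ap[OF ext_one[OF oV]] aut_one[OF a V] aut_one[OF b V])
  show "fam_comp U \<alpha> \<beta> V (sec_add s t) = sec_add (fam_comp U \<alpha> \<beta> V s) (fam_comp U \<alpha> \<beta> V t)"
    if s: "s \<in> ext V" and t: "t \<in> ext V" for s t
    by (simp only: ap[OF s] ap[OF t] ap[OF ext_add[OF s t]] aut_add[OF b V s t] aut_add[OF a V bc[OF s] bc[OF t]])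
  show "fam_comp U \<alpha> \<beta> V (sec_wedge s t) = sec_wedge (fam_comp U \<alpha> \<beta> V s) (fam_comp U \<alpha> \<beta> V t)"
    if s: "s \<in> ext V" and t: "t \<in> ext V" for s t
    by (simp only: ap[OF s] ap[OF t] ap[OF ext_wedge[OF oV s t]] aut_wedge[OF b V s t] aut_wedge[OF a V bc[OF s] bc[OF t]])
  fix s assume s: "s \<in> ext V"
  show "fam_comp U \<alpha> \<beta> V (sec_scale c s) = sec_scale c (fam_comp U \<alpha> \<beta> V s)" for c
    by (simp only: ap[OF s] ap[OF ext_scale[OF oV s]] aut_scale[OF b V s] aut_scale[OF a V bc[OF s]])
  show "sec_even (fam_comp U \<alpha> \<beta> V s)" if "sec_even s"
    unfolding ap[OF s] by (rule aut_even[OF a V bc[OF s] aut_even[OF b V s that]])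
  show "sec_odd (fam_comp U \<alpha> \<beta> V s)" if "sec_odd s"
    unfolding ap[OF s] by (rule aut_odd[OF a V bc[OF s] aut_odd[OF b V s that]])
  fix W assume W: "W \<in> opens V"
  note WU = opens_trans[OF V W]
  show "fam_comp U \<alpha> \<beta> W (sec_restrict W s) = sec_restrict W (fam_comp U \<alpha> \<beta> V s)"
    by (simp only: ap[OF s] fam_comp_apply[OF WU ext_restrict[OF s opensD[OF W]]]
        aut_restrict[OF b V s W] aut_restrict[OF a V bc[OF s] W])
qed

lemma aut_id: "fam_id U \<in> ext_automorphisms M U"
proof (rule autI)
  show "fam_id U \<in> extensional (opens U)" by (simp add: fam_id_def)
  fix V assume V: "V \<in> opens U"
  note oV = opensD(1)[OF V] and ap = fam_id_apply[OF V]
  show "fam_id U V \<in> extensional (ext V)" using V by (simp add: fam_id_def)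
  show "bij_betw (fam_id U V) (ext V) (ext V)"
    by (rule bij_betw_cong[THEN iffD1, OF _ bij_betw_id]) (simp add: ap)
  show "fam_id U V (sec_one V) = sec_one V" by (rule ap[OF ext_one[OF oV]])
  show "fam_id U V (sec_add s t) = sec_add (fam_id U V s) (fam_id U V t)" if "s \<in> ext V" "t \<in> ext V" for s t
    by (simp only: ap[OF that(1)] ap[OF that(2)] ap[OF ext_add[OF that]])
  show "fam_id U V (sec_wedge s t) = sec_wedge (fam_id U V s) (fam_id U V t)" if "s \<in> ext V" "t \<in> ext V" for s t
    by (simp only: ap[OF that(1)] ap[OF that(2)] ap[OF ext_wedge[OF oV that]])
  fix s assume s: "s \<in> ext V"
  show "fam_id U V (sec_scale c s) = sec_scale c (fam_id U V s)" for c
    by (simp only: ap[OF s] ap[OF ext_scale[OF oV s]])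
  show "sec_even s \<Longrightarrow> sec_even (fam_id U V s)" "sec_odd s \<Longrightarrow> sec_odd (fam_id U V s)" by (simp_all only: ap[OF s])
  fix W assume W: "W \<in> opens V"
  show "fam_id U W (sec_restrict W s) = sec_restrict W (fam_id U V s)"
    by (simp only: ap[OF s] fam_id_apply[OF opens_trans[OF V W] ext_restrict[OF s opensD[OF W]]])
qed

lemma fam_inv_apply:
  assumes a: "\<alpha> \<in> ext_automorphisms M U" and V: "V \<in> opens U" and t: "t \<in> ext V"
  shows "fam_inv U \<alpha> V t \<in> ext V" "\<alpha> V (fam_inv U \<alpha> V t) = t"
proof -
  have t': "t \<in> \<alpha> V ` ext V" using bij_betw_imp_surj_on[OF aut_bij[OF a V]] t by simp
  have e: "fam_inv U \<alpha> V t = inv_into (ext V) (\<alpha> V) t" using V t by (simp add: fam_inv_def)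
  show "fam_inv U \<alpha> V t \<in> ext V" "\<alpha> V (fam_inv U \<alpha> V t) = t"
    unfolding e by (rule inv_into_into[OF t'] f_inv_into_f[OF t'])+
qed

lemma sec_parity_split:
  assumes V: "opn V" and s: "s \<in> ext V"
  obtains s0 s1 where "s0 \<in> ext V" "s1 \<in> ext V" "sec_even s0" "sec_odd s1" "s = sec_add s0 s1"
proof
  let ?s0 = "\<lambda>x xs. (if even (length xs) then 1 else 0) * s x xs"
  let ?s1 = "\<lambda>x xs. (if odd (length xs) then 1 else 0) * s x xs"
  show "?s0 \<in> ext V" by (rule ext_weight[OF V s, where w = "\<lambda>n. if even n then 1 else 0"])
  show "?s1 \<in> ext V" by (rule ext_weight[OF V s, where w = "\<lambda>n. if odd n then 1 else 0"])
  show "sec_even ?s0" "sec_odd ?s1" by (simp_all add: sec_even_def sec_odd_def)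
  show "s = sec_add ?s0 ?s1" by (simp add: sec_add_def fun_eq_iff)
qed

lemma sec_even_odd_zero: "sec_even s \<Longrightarrow> sec_odd s \<Longrightarrow> s = (\<lambda>_ _. 0)"
  unfolding sec_even_def sec_odd_def by (intro HOL.ext) metis

lemma aut_zero:
  assumes a: "\<alpha> \<in> ext_automorphisms M U" and V: "V \<in> opens U" shows "\<alpha> V (\<lambda>_ _. 0) = (\<lambda>_ _. 0)"
  using aut_scale[OF a V ext_zero[OF opensD(1)[OF V]], of 0] by (simp add: sec_scale_def)

text \<open>An automorphism preserves the decomposition into even and odd parts and is injective. It
  follows that its inverse preserves the parity.\<close>

lemma aut_reflects_parity:
  assumes a: "\<alpha> \<in> ext_automorphisms M U" and V: "V \<in> opens U" and s: "s \<in> ext V"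
  shows "sec_even (\<alpha> V s) \<Longrightarrow> sec_even s" "sec_odd (\<alpha> V s) \<Longrightarrow> sec_odd s"
proof -
  obtain s0 s1 where p: "s0 \<in> ext V" "s1 \<in> ext V" "sec_even s0" "sec_odd s1" "s = sec_add s0 s1"
    by (rule sec_parity_split[OF opensD(1)[OF V] s])
  have e: "sec_even (\<alpha> V s0)" and o: "sec_odd (\<alpha> V s1)"
    by (rule aut_even[OF a V p(1,3)] aut_odd[OF a V p(2,4)])+
  have sum: "\<alpha> V s = sec_add (\<alpha> V s0) (\<alpha> V s1)" unfolding p(5) by (rule aut_add[OF a V p(1,2)])
  note z = ext_zero[OF opensD(1)[OF V]]
  show "sec_even s" if h: "sec_even (\<alpha> V s)"
  proof -
    have "sec_even (\<alpha> V s1)" using h e unfolding sum sec_even_def sec_add_def by simp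
    then have "\<alpha> V s1 = \<alpha> V (\<lambda>_ _. 0)" using sec_even_odd_zero o aut_zero[OF a V] by simp
    then have "s1 = (\<lambda>_ _. 0)" by (rule aut_inj[OF a V p(2) z])
    then have "s = s0" by (simp add: p(5) sec_add_def)
    then show ?thesis using p(3) by simp
  qed
  show "sec_odd s" if h: "sec_odd (\<alpha> V s)"
  proof -
    have "sec_odd (\<alpha> V s0)" using h o unfolding sum sec_odd_def sec_add_def by simp
    then have "\<alpha> V s0 = \<alpha> V (\<lambda>_ _. 0)" using sec_even_odd_zero e aut_zero[OF a V] by simp
    then have "s0 = (\<lambda>_ _. 0)" by (rule aut_inj[OF a V p(1) z])
    then have "s = s1" by (simp add: p(5) sec_add_def)
    then show ?thesis using p(4) by simp
  qed
qed

lemma aut_inv: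
  assumes a: "\<alpha> \<in> ext_automorphisms M U" shows "fam_inv U \<alpha> \<in> ext_automorphisms M U"
proof (rule autI)
  show "fam_inv U \<alpha> \<in> extensional (opens U)" by (simp add: fam_inv_def)
  fix V assume V: "V \<in> opens U"
  note oV = opensD(1)[OF V]
  note ic = fam_inv_apply(1)[OF a V] and ai = fam_inv_apply(2)[OF a V] and inj = aut_inj[OF a V]
  show "fam_inv U \<alpha> V \<in> extensional (ext V)" using V by (simp add: fam_inv_def)
  show "bij_betw (fam_inv U \<alpha> V) (ext V) (ext V)"
    by (rule bij_betw_cong[THEN iffD1, OF _ bij_betw_inv_into[OF aut_bij[OF a V]]]) (use V in \<open>simp add: fam_inv_def\<close>)
  show "fam_inv U \<alpha> V (sec_one V) = sec_one V"
    by (rule inj[OF ic[OF ext_one[OF oV]] ext_one[OF oV]]) (simp only: ai[OF ext_one[OF oV]] aut_one[OF a V])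
  show "fam_inv U \<alpha> V (sec_add s t) = sec_add (fam_inv U \<alpha> V s) (fam_inv U \<alpha> V t)" if s: "s \<in> ext V" and t: "t \<in> ext V" for s t
    by (rule inj[OF ic[OF ext_add[OF s t]] ext_add[OF ic[OF s] ic[OF t]]])
       (simp only: ai[OF ext_add[OF s t]] aut_add[OF a V ic[OF s] ic[OF t]] ai[OF s] ai[OF t])
  show "fam_inv U \<alpha> V (sec_wedge s t) = sec_wedge (fam_inv U \<alpha> V s) (fam_inv U \<alpha> V t)" if s: "s \<in> ext V" and t: "t \<in> ext V" for s t
    by (rule inj[OF ic[OF ext_wedge[OF oV s t]] ext_wedge[OF oV ic[OF s] ic[OF t]]])
       (simp only: ai[OF ext_wedge[OF oV s t]] aut_wedge[OF a V ic[OF s] ic[OF t]] ai[OF s] ai[OF t])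
  fix s assume s: "s \<in> ext V"
  show "fam_inv U \<alpha> V (sec_scale c s) = sec_scale c (fam_inv U \<alpha> V s)" for c
    by (rule inj[OF ic[OF ext_scale[OF oV s]] ext_scale[OF oV ic[OF s]]])
       (simp only: ai[OF ext_scale[OF oV s]] aut_scale[OF a V ic[OF s]] ai[OF s])
  show "sec_even (fam_inv U \<alpha> V s)" if "sec_even s"
    by (rule aut_reflects_parity(1)[OF a V ic[OF s]]) (simp only: ai[OF s] that)
  show "sec_odd (fam_inv U \<alpha> V s)" if "sec_odd s"
    by (rule aut_reflects_parity(2)[OF a V ic[OF s]]) (simp only: ai[OF s] that)
  fix W assume W: "W \<in> opens V"
  note WU = opens_trans[OF V W] and sW = ext_restrict[OF s opensD[OF W]]
  show "fam_inv U \<alpha> W (sec_restrict W s) = sec_restrict W (fam_inv U \<alpha> V s)"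
    by (rule aut_inj[OF a WU fam_inv_apply(1)[OF a WU sW] ext_restrict[OF ic[OF s] opensD[OF W]]])
       (simp only: fam_inv_apply(2)[OF a WU sW] aut_restrict[OF a V ic[OF s] W] ai[OF s])
qed

lemma aut_fam_restrict:
  assumes a: "\<alpha> \<in> ext_automorphisms M U" and V: "V \<in> opens U"
  shows "restrict \<alpha> (opens V) \<in> ext_automorphisms M V"
proof -
  note p = aut_props[OF a opens_trans[OF V]]
  show ?thesis
  proof (rule autI[OF restrict_extensional])
    fix W assume W: "W \<in> opens V"
    then have r: "restrict \<alpha> (opens V) W = \<alpha> W" by simp
    show "restrict \<alpha> (opens V) W \<in> extensional (ext W)" "bij_betw (restrict \<alpha> (opens V) W) (ext W) (ext W)"
      "restrict \<alpha> (opens V) W (sec_one W) = sec_one W"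
      unfolding r using p[OF W] by simp_all
    fix s assume s: "s \<in> ext W"
    show "restrict \<alpha> (opens V) W (sec_add s t) = sec_add (restrict \<alpha> (opens V) W s) (restrict \<alpha> (opens V) W t)"
      "restrict \<alpha> (opens V) W (sec_wedge s t) = sec_wedge (restrict \<alpha> (opens V) W s) (restrict \<alpha> (opens V) W t)"
      if "t \<in> ext W" for t
      unfolding r using p[OF W] s that by simp_all
    show "restrict \<alpha> (opens V) W (sec_scale c s) = sec_scale c (restrict \<alpha> (opens V) W s)" for c
      unfolding r using p[OF W] s by simp
    show "sec_even s \<Longrightarrow> sec_even (restrict \<alpha> (opens V) W s)" "sec_odd s \<Longrightarrow> sec_odd (restrict \<alpha> (opens V) W s)"
      unfolding r using p[OF W] s by simp_all
    show "restrict \<alpha> (opens V) W' (sec_restrict W' s) = sec_restrict W' (restrict \<alpha> (opens V) W s)"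
      if W': "W' \<in> opens W" for W'
      unfolding r using p[OF W] s W' opens_trans[OF W W'] by simp
  qed
qed

lemma carrier_G:
  "\<alpha> \<in> carrier (sec (Gsheaf M k) U) \<longleftrightarrow> \<alpha> \<in> ext_automorphisms M U \<and>
    (\<forall>V\<in>opens U. \<forall>s\<in>ext V. vanish k (sec_diff (\<alpha> V s) s))"
proof -
  have "\<alpha> \<in> ext_automorphisms M U \<Longrightarrow> V \<in> opens U \<Longrightarrow> s \<in> ext V \<Longrightarrow>
      sec_diff (\<alpha> V s) s \<in> J_ideal M k V \<longleftrightarrow> vanish k (sec_diff (\<alpha> V s) s)" for V s
    unfolding J_ideal_iff using ext_diff[OF opensD(1) aut_closed] by simp
  then show ?thesis by (simp add: Gsheaf_def cong: conj_cong ball_cong)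
qed

lemma G_aut: "\<alpha> \<in> carrier (sec (Gsheaf M k) U) \<Longrightarrow> \<alpha> \<in> ext_automorphisms M U"
  by (simp add: carrier_G)

lemma G_vanish: "\<alpha> \<in> carrier (sec (Gsheaf M k) U) \<Longrightarrow> V \<in> opens U \<Longrightarrow> s \<in> ext V \<Longrightarrow> vanish k (sec_diff (\<alpha> V s) s)"
  by (simp add: carrier_G)

lemma G_I: "\<alpha> \<in> ext_automorphisms M U \<Longrightarrow> (\<And>V s. V \<in> opens U \<Longrightarrow> s \<in> ext V \<Longrightarrow> vanish k (sec_diff (\<alpha> V s) s)) \<Longrightarrow>
  \<alpha> \<in> carrier (sec (Gsheaf M k) U)"
  by (simp add: carrier_G)

lemma mult_G: "\<alpha> \<otimes>\<^bsub>sec (Gsheaf M k) U\<^esub> \<beta> = fam_comp U \<alpha> \<beta>"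
  by (simp add: Gsheaf_def fam_comp_def)

lemma one_G: "\<one>\<^bsub>sec (Gsheaf M k) U\<^esub> = fam_id U"
  by (simp add: Gsheaf_def fam_id_def)

lemma res_G: "res (Gsheaf M k) U V \<alpha> = restrict \<alpha> (opens V)"
  by (simp add: Gsheaf_def)

lemma G_mult_closed:
  assumes a: "\<alpha> \<in> carrier (sec (Gsheaf M k) U)" and b: "\<beta> \<in> carrier (sec (Gsheaf M k) U)"
  shows "fam_comp U \<alpha> \<beta> \<in> carrier (sec (Gsheaf M k) U)"
proof (rule G_I[OF aut_comp[OF G_aut[OF a] G_aut[OF b]]])
  fix V s assume V: "V \<in> opens U" and s: "s \<in> ext V"
  have "sec_diff (\<alpha> V (\<beta> V s)) s = sec_add (sec_diff (\<alpha> V (\<beta> V s)) (\<beta> V s)) (sec_diff (\<beta> V s) s)"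
    by (simp add: sec_diff_def sec_add_def)
  then show "vanish k (sec_diff (fam_comp U \<alpha> \<beta> V s) s)"
    unfolding fam_comp_apply[OF V s]
    using vanish_add[OF G_vanish[OF a V aut_closed[OF G_aut[OF b] V s]] G_vanish[OF b V s]] by simp
qed

lemma G_inv_closed:
  assumes a: "\<alpha> \<in> carrier (sec (Gsheaf M k) U)"
  shows "fam_inv U \<alpha> \<in> carrier (sec (Gsheaf M k) U)"
proof (rule G_I[OF aut_inv[OF G_aut[OF a]]])
  fix V s assume V: "V \<in> opens U" and s: "s \<in> ext V"
  note i = fam_inv_apply[OF G_aut[OF a] V s]
  show "vanish k (sec_diff (fam_inv U \<alpha> V s) s)"
    using G_vanish[OF a V i(1)] unfolding i(2) by (simp add: vanish_def sec_diff_def)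
qed

lemma G_one_closed: "fam_id U \<in> carrier (sec (Gsheaf M k) U)"
  by (rule G_I[OF aut_id]) (simp add: fam_id_apply vanish_def sec_diff_def)

lemma G_group: "group (sec (Gsheaf M k) U)"
proof (rule groupI, unfold mult_G one_G)
  show "fam_comp U \<alpha> \<beta> \<in> carrier (sec (Gsheaf M k) U)"
    if "\<alpha> \<in> carrier (sec (Gsheaf M k) U)" "\<beta> \<in> carrier (sec (Gsheaf M k) U)" for \<alpha> \<beta>
    by (rule G_mult_closed[OF that])
  show "fam_id U \<in> carrier (sec (Gsheaf M k) U)" by (rule G_one_closed)
  show "fam_comp U (fam_comp U \<alpha> \<beta>) \<gamma> = fam_comp U \<alpha> (fam_comp U \<beta> \<gamma>)"
    if "\<alpha> \<in> carrier (sec (Gsheaf M k) U)" "\<beta> \<in> carrier (sec (Gsheaf M k) U)" "\<gamma> \<in> carrier (sec (Gsheaf M k) U)" for \<alpha> \<beta> \<gamma>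
  proof -
    note a = that[THEN G_aut]
    show ?thesis
    proof (rule aut_eqI[OF aut_comp[OF aut_comp[OF a(1,2)] a(3)] aut_comp[OF a(1) aut_comp[OF a(2,3)]]])
      fix V s assume V: "V \<in> opens U" and s: "s \<in> ext V"
      show "fam_comp U (fam_comp U \<alpha> \<beta>) \<gamma> V s = fam_comp U \<alpha> (fam_comp U \<beta> \<gamma>) V s"
        by (simp only: fam_comp_apply[OF V s] fam_comp_apply[OF V aut_closed[OF a(3) V s]])
    qed
  qed
  show "fam_comp U (fam_id U) \<alpha> = \<alpha>" if "\<alpha> \<in> carrier (sec (Gsheaf M k) U)" for \<alpha>
  proof -
    note a = G_aut[OF that]
    show ?thesis
      by (rule aut_eqI[OF aut_comp[OF aut_id a] a]) (simp only: fam_comp_apply fam_id_apply aut_closed[OF a])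
  qed
  show "\<exists>\<beta>\<in>carrier (sec (Gsheaf M k) U). fam_comp U \<beta> \<alpha> = fam_id U" if "\<alpha> \<in> carrier (sec (Gsheaf M k) U)" for \<alpha>
  proof (rule bexI[OF _ G_inv_closed[OF that]])
    note a = G_aut[OF that]
    show "fam_comp U (fam_inv U \<alpha>) \<alpha> = fam_id U"
    proof (rule aut_eqI[OF aut_comp[OF aut_inv[OF a] a] aut_id])
      fix V s assume V: "V \<in> opens U" and s: "s \<in> ext V"
      note c = aut_closed[OF a V s]
      have "fam_inv U \<alpha> V (\<alpha> V s) = s"
        by (rule aut_inj[OF a V fam_inv_apply(1)[OF a V c] s fam_inv_apply(2)[OF a V c]])
      then show "fam_comp U (fam_inv U \<alpha>) \<alpha> V s = fam_id U V s"
        by (simp only: fam_comp_apply[OF V s] fam_id_apply[OF V s])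
    qed
  qed
qed

lemma G_res_closed:
  assumes a: "\<alpha> \<in> carrier (sec (Gsheaf M k) U)" and V: "V \<in> opens U"
  shows "restrict \<alpha> (opens V) \<in> carrier (sec (Gsheaf M k) V)"
  by (rule G_I[OF aut_fam_restrict[OF G_aut[OF a] V]]) (simp add: G_vanish[OF a opens_trans[OF V]])

lemma G_group_presheaf: "group_presheaf (base M) (Gsheaf M k)"
proof (rule group_presheaf.intro)
  show "group (sec (Gsheaf M k) U)" for U by (rule G_group)
  show "res (Gsheaf M k) U V \<in> hom (sec (Gsheaf M k) U) (sec (Gsheaf M k) V)" if "opn V" "V \<subseteq> U" for U V
  proof (rule homI, unfold res_G mult_G)
    have V: "V \<in> opens U" using that by (simp add: opens_in_def)
    show "restrict \<alpha> (opens V) \<in> carrier (sec (Gsheaf M k) V)" if "\<alpha> \<in> carrier (sec (Gsheaf M k) U)" for \<alpha>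
      by (rule G_res_closed[OF that V])
    show "restrict (fam_comp U \<alpha> \<beta>) (opens V) = fam_comp V (restrict \<alpha> (opens V)) (restrict \<beta> (opens V))" for \<alpha> \<beta>
      unfolding fam_comp_def using opens_trans[OF V] by (auto simp: fun_eq_iff restrict_def)
  qed
  show "res (Gsheaf M k) V W (res (Gsheaf M k) U V \<alpha>) = res (Gsheaf M k) U W \<alpha>"
    if "opn W" "W \<subseteq> V" for U V W \<alpha>
    using opens_mono[of W V] that by (simp add: res_G Int_absorb1 opens_in_def)
  show "res (Gsheaf M k) U U \<alpha> = \<alpha>" if "\<alpha> \<in> carrier (sec (Gsheaf M k) U)" for U \<alpha>
    using aut_fam_extensional[OF G_aut[OF that]] by (simp add: res_G extensional_restrict)
qed

lemma G_mono: "k \<le> l \<Longrightarrow> carrier (sec (Gsheaf M l) U) \<subseteq> carrier (sec (Gsheaf M k) U)"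
  unfolding subset_iff carrier_G using vanish_mono by blast

text \<open>How much an automorphism moves \<open>J\<^sup>m\<^sup>+\<^sup>1\<close>, given how much it moves odd sections and \<open>J\<^sup>m\<close>: write a
  section of \<open>J\<^sup>m\<^sup>+\<^sup>1\<close> locally as \<open>\<Sum> \<xi>\<^sub>i v\<^sub>i\<close> and use
  \<open>\<alpha>(\<xi>v) - \<xi>v = (\<alpha>\<xi> - \<xi>) \<alpha>v + \<xi> (\<alpha>v - v)\<close>.\<close>

lemma aut_displacement_step:
  assumes a: "\<alpha> \<in> ext_automorphisms M U"
    and odd: "\<And>V \<xi>. V \<in> opens U \<Longrightarrow> \<xi> \<in> ext V \<Longrightarrow> sec_odd \<xi> \<Longrightarrow> vanish p (sec_diff (\<alpha> V \<xi>) \<xi>)"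
    and low: "\<And>V v. V \<in> opens U \<Longrightarrow> v \<in> ext V \<Longrightarrow> vanish m v \<Longrightarrow> vanish q (sec_diff (\<alpha> V v) v)"
    and img: "\<And>V v. V \<in> opens U \<Longrightarrow> v \<in> ext V \<Longrightarrow> vanish m v \<Longrightarrow> vanish l (\<alpha> V v)"
    and V: "V \<in> opens U" and u: "u \<in> ext V" "vanish (Suc m) u" and k: "k \<le> p + l" "k \<le> Suc q"
  shows "vanish k (sec_diff (\<alpha> V u) u)"
  unfolding vanish_def
proof (intro allI impI)
  fix x and xs :: "('v \<Rightarrow> complex) list"
  assume len: "length xs < k"
  show "sec_diff (\<alpha> V u) u x xs = 0"
  proof (cases "x \<in> V")
    case False
    then show ?thesis using extD(2)[OF u(1)] extD(2)[OF aut_closed[OF a V u(1)]] by (simp add: sec_diff_def)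
  next
    case True
    then have "x \<in> topspace (base M)" using openin_subset[OF opensD(1)[OF V]] by blast
    then obtain W e where F: "(W, e) \<in> frames M" and xW: "x \<in> W" by (rule frame_at)
    define Z where "Z = V \<inter> W"
    have Zo: "opn Z" unfolding Z_def by (rule frame_Int_open[OF opensD(1)[OF V] F])
    have ZV: "Z \<in> opens V" using Zo by (simp add: Z_def opens_in_def)
    note ZU = opens_trans[OF V ZV]
    have ZW: "Z \<subseteq> W" by (simp add: Z_def)
    let ?u = "sec_restrict Z u"
    have u': "?u \<in> ext Z" by (rule ext_restrict[OF u(1) opensD[OF ZV]])
    have um: "vanish (Suc m) ?u" using u(2) by (simp add: vanish_def sec_restrict_def)
    have "\<exists>v. (\<forall>i<r. v i \<in> ext Z) \<and> (\<forall>i. vanish m (v i)) \<and>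
        ?u = (\<lambda>x xs. \<Sum>i<r. sec_wedge (frame_section e i Z) (v i) x xs)"
    proof (rule frame_decomposition[OF F Zo ZW u' um])
      fix v assume 1: "\<And>i. i < r \<Longrightarrow> v i \<in> ext Z" and 2: "\<And>i. vanish m (v i)"
        and 3: "?u = (\<lambda>x xs. \<Sum>i<r. sec_wedge (frame_section e i Z) (v i) x xs)"
      show ?thesis by (intro exI[of _ v] conjI allI impI 1 2 3)
    qed
    then obtain v where v': "\<forall>i<r. v i \<in> ext Z" "\<forall>i. vanish m (v i)"
        "?u = (\<lambda>x xs. \<Sum>i<r. sec_wedge (frame_section e i Z) (v i) x xs)"
      by (elim exE conjE)
    note v = v'(1)[rule_format] v'(2)[rule_format] v'(3)
    have part: "(\<lambda>x xs. \<Sum>i<n. sec_wedge (frame_section e i Z) (v i) x xs) \<in> ext Z \<and>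
        vanish k (sec_diff (\<alpha> Z (\<lambda>x xs. \<Sum>i<n. sec_wedge (frame_section e i Z) (v i) x xs))
                           (\<lambda>x xs. \<Sum>i<n. sec_wedge (frame_section e i Z) (v i) x xs))" if "n \<le> r" for n
      using that
    proof (induction n)
      case 0
      show ?case using ext_zero[OF Zo] aut_zero[OF a ZU] by (simp add: vanish_def sec_diff_def)
    next
      case (Suc n)
      then have n: "n < r" by simp
      note IH = conjunct1[OF Suc.IH[OF less_imp_le[OF n]]] conjunct2[OF Suc.IH[OF less_imp_le[OF n]]]
      let ?t = "\<lambda>x xs. \<Sum>i<n. sec_wedge (frame_section e i Z) (v i) x xs"
      let ?x = "frame_section e n Z" and ?v = "v n"
      have x: "?x \<in> ext Z" by (rule ext_frame_section[OF F Zo ZW n])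
      note vn = v(1)[OF n] and w = ext_wedge[OF Zo x v(1)[OF n]]
      have xo: "sec_odd ?x" by (auto simp: sec_odd_def frame_section_def evaluation_def split: list.splits)
      have x1: "vanish 1 ?x" by (auto simp: vanish_def frame_section_def evaluation_def)
      have split: "sec_diff (sec_wedge (\<alpha> Z ?x) (\<alpha> Z ?v)) (sec_wedge ?x ?v) =
          sec_add (sec_wedge (sec_diff (\<alpha> Z ?x) ?x) (\<alpha> Z ?v)) (sec_wedge ?x (sec_diff (\<alpha> Z ?v) ?v))"
      proof (intro HOL.ext)
        fix y ys
        have 1: "wedge (\<lambda>zs. \<alpha> Z ?x y zs - ?x y zs) \<eta> ys = wedge (\<alpha> Z ?x y) \<eta> ys - wedge (?x y) \<eta> ys" for \<eta>
          using wedge_linear_left[of "-1" "?x y" "\<alpha> Z ?x y" \<eta> ys] by (simp add: add.commute)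
        have 2: "wedge (?x y) (\<lambda>zs. \<alpha> Z ?v y zs - ?v y zs) ys = wedge (?x y) (\<alpha> Z ?v y) ys - wedge (?x y) (?v y) ys"
          using wedge_linear_right[of "?x y" "-1" "?v y" "\<alpha> Z ?v y" ys] by (simp add: add.commute)
        show "sec_diff (sec_wedge (\<alpha> Z ?x) (\<alpha> Z ?v)) (sec_wedge ?x ?v) y ys =
          sec_add (sec_wedge (sec_diff (\<alpha> Z ?x) ?x) (\<alpha> Z ?v)) (sec_wedge ?x (sec_diff (\<alpha> Z ?v) ?v)) y ys"
          unfolding sec_diff_def sec_add_def sec_wedge_def 1 2 by simp
      qed
      have "vanish (p + l) (sec_wedge (sec_diff (\<alpha> Z ?x) ?x) (\<alpha> Z ?v))"
        by (rule vanish_wedge[OF odd[OF ZU x xo] img[OF ZU vn v(2)]])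
      moreover have "vanish (1 + q) (sec_wedge ?x (sec_diff (\<alpha> Z ?v) ?v))"
        by (rule vanish_wedge[OF x1 low[OF ZU vn v(2)]])
      ultimately have new: "vanish k (sec_diff (\<alpha> Z (sec_wedge ?x ?v)) (sec_wedge ?x ?v))"
        unfolding aut_wedge[OF a ZU x vn] split using k by (intro vanish_add) (auto elim: vanish_mono)
      have sum: "(\<lambda>x xs. \<Sum>i<Suc n. sec_wedge (frame_section e i Z) (v i) x xs) = sec_add ?t (sec_wedge ?x ?v)"
        by (simp add: sec_add_def)
      have "sec_diff (sec_add (\<alpha> Z ?t) (\<alpha> Z (sec_wedge ?x ?v))) (sec_add ?t (sec_wedge ?x ?v)) =
          sec_add (sec_diff (\<alpha> Z ?t) ?t) (sec_diff (\<alpha> Z (sec_wedge ?x ?v)) (sec_wedge ?x ?v))"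
        by (intro HOL.ext) (simp add: sec_diff_def sec_add_def)
      then show ?case unfolding sum aut_add[OF a ZU IH(1) w]
        using ext_add[OF IH(1) w] vanish_add[OF IH(2) new] by simp
    qed
    have "vanish k (sec_diff (\<alpha> Z ?u) ?u)" using conjunct2[OF part[OF order_refl]] unfolding v(3)[symmetric] .
    then have "sec_diff (\<alpha> Z ?u) ?u x xs = 0" using len unfolding vanish_def by blast
    then show ?thesis unfolding aut_restrict[OF a V u(1) ZV]
      using True xW by (simp add: sec_diff_def sec_restrict_def Z_def)
  qed
qed

text \<open>The automorphisms in \<open>G\<^sub>j\<close> move \<open>J\<^sup>j\<close> by two steps of the filtration more than they move
  functions. For \<open>j = 2\<close> this uses that the displacement of an odd section is odd, hence in \<open>J\<^sup>3\<close>.\<close>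

lemma G_displacement:
  assumes a: "\<alpha> \<in> carrier (sec (Gsheaf M j) U)" and j: "j \<ge> 2"
    and V: "V \<in> opens U" and u: "u \<in> ext V" "vanish j u"
  shows "vanish (j + 2) (sec_diff (\<alpha> V u) u)"
proof -
  note aut = G_aut[OF a]
  have img: "vanish m (\<alpha> W v)" if W: "W \<in> opens U" and v: "v \<in> ext W" "vanish m v" and m: "m \<le> j" for W v m
    by (rule vanish_image[OF vanish_mono[OF G_vanish[OF a W v(1)] m] v(2)])
  show ?thesis
  proof (cases "j = 2")
    case True
    have odd: "vanish 3 (sec_diff (\<alpha> W \<xi>) \<xi>)" if W: "W \<in> opens U" and x: "\<xi> \<in> ext W" "sec_odd \<xi>" for W \<xi>
      unfolding vanish_def
    proof (intro allI impI)
      fix x and xs :: "('v \<Rightarrow> complex) list" assume "length xs < 3"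
      then consider "length xs < j" | "even (length xs)" using True by (cases "length xs = 2") auto
      then show "sec_diff (\<alpha> W \<xi>) \<xi> x xs = 0"
      proof cases
        case 1
        then show ?thesis using G_vanish[OF a W x(1)] unfolding vanish_def by blast
      next
        case 2
        then show ?thesis using aut_odd[OF aut W x] x(2) by (simp add: sec_odd_def sec_diff_def)
      qed
    qed
    \<comment> \<open>Sections of \<open>J\<close> change by sections of \<open>J\<^sup>3\<close>, hence those of \<open>J\<^sup>2\<close> by sections of \<open>J\<^sup>4\<close>.\<close>
    have one: "vanish 3 (sec_diff (\<alpha> W v) v)" if W: "W \<in> opens U" and v: "v \<in> ext W" "vanish (Suc 0) v" for W v
      by (rule aut_displacement_step[where p = 3 and m = 0 and q = 2 and l = 0, OF aut odd _ vanish_0 W v])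
         (use G_vanish[OF a] True in simp_all)
    show ?thesis
      by (rule aut_displacement_step[where p = 3 and m = "Suc 0" and q = 3 and l = "Suc 0", OF aut odd one img V u(1)])
         (use u(2) True in \<open>simp_all add: numeral_2_eq_2\<close>)
  next
    case False
    then have j3: "j \<ge> 3" using j by simp
    note odd = G_vanish[OF a]
    \<comment> \<open>Sections of \<open>J\<^sup>2\<close>, so also of \<open>J\<^sup>j\<^sup>-\<^sup>1\<close>, change by sections of \<open>J\<^sup>j\<^sup>+\<^sup>1\<close>, hence those of \<open>J\<^sup>j\<close> by sections of \<open>J\<^sup>j\<^sup>+\<^sup>2\<close>.\<close>
    have two: "vanish (Suc j) (sec_diff (\<alpha> W v) v)" if W: "W \<in> opens U" and v: "v \<in> ext W" "vanish (Suc (Suc 0)) v" for W v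
      by (rule aut_displacement_step[where p = j and m = "Suc 0" and q = j and l = "Suc 0", OF aut odd _ img W v])
         (use G_vanish[OF a] j3 in simp_all)
    have low: "vanish (Suc j) (sec_diff (\<alpha> W v) v)" if W: "W \<in> opens U" and v: "v \<in> ext W" "vanish (j - 1) v" for W v
      by (rule two[OF W v(1) vanish_mono[OF v(2)]]) (use j3 in simp)
    show ?thesis
      by (rule aut_displacement_step[where p = j and m = "j - 1" and q = "Suc j" and l = "j - 1", OF aut odd low img V u(1)])
         (use u(2) j3 in simp_all)
  qed
qed

text \<open>With \<open>p = \<alpha> s - s\<close> and \<open>q = \<beta> s - s\<close> in \<open>J\<^sup>j\<close>, one has
  \<open>\<alpha> \<beta> s - \<beta> \<alpha> s = (\<alpha> q - q) - (\<beta> p - p)\<close>, and both differences lie in \<open>J\<^sup>j\<^sup>+\<^sup>2\<close>.\<close>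

lemma G_commutator:
  assumes a: "\<alpha> \<in> carrier (sec (Gsheaf M j) U)" and b: "\<beta> \<in> carrier (sec (Gsheaf M j) U)" and j: "j \<ge> 2"
  defines "G \<equiv> sec (Gsheaf M j) U"
  shows "inv\<^bsub>G\<^esub> \<alpha> \<otimes>\<^bsub>G\<^esub> inv\<^bsub>G\<^esub> \<beta> \<otimes>\<^bsub>G\<^esub> \<alpha> \<otimes>\<^bsub>G\<^esub> \<beta> \<in> carrier (sec (Gsheaf M (j + 2)) U)"
proof -
  interpret group G unfolding G_def by (rule G_group)
  note a' = a[folded G_def] and b' = b[folded G_def]
  let ?a = "inv\<^bsub>G\<^esub> \<alpha>" and ?b = "inv\<^bsub>G\<^esub> \<beta>"
  note ia = inv_closed[OF a'] and ib = inv_closed[OF b']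
  note A = G_aut[OF a] and B = G_aut[OF b] and IA = G_aut[OF ia[unfolded G_def], folded G_def]
    and IB = G_aut[OF ib[unfolded G_def], folded G_def]
  have mult: "\<mu> \<otimes>\<^bsub>G\<^esub> \<nu> = fam_comp U \<mu> \<nu>" for \<mu> \<nu> unfolding G_def by (rule mult_G)
  have oneG: "\<one>\<^bsub>G\<^esub> = fam_id U" unfolding G_def by (rule one_G)
  have ab: "?a \<otimes>\<^bsub>G\<^esub> ?b \<otimes>\<^bsub>G\<^esub> \<alpha> \<otimes>\<^bsub>G\<^esub> \<beta> \<in> carrier G"
    using a' b' by simp
  show ?thesis
  proof (rule G_I)
    show "?a \<otimes>\<^bsub>G\<^esub> ?b \<otimes>\<^bsub>G\<^esub> \<alpha> \<otimes>\<^bsub>G\<^esub> \<beta> \<in> ext_automorphisms M U" by (rule G_aut[OF ab[unfolded G_def], folded G_def])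
    fix V s assume V: "V \<in> opens U" and s: "s \<in> ext V"
    note oV = opensD(1)[OF V]
    have inv_a: "?a V (\<alpha> V t) = t" and inv_b: "?b V (\<beta> V t) = t" if t: "t \<in> ext V" for t
    proof -
      have "?a \<otimes>\<^bsub>G\<^esub> \<alpha> = fam_id U" "?b \<otimes>\<^bsub>G\<^esub> \<beta> = fam_id U" by (rule l_inv[OF a', unfolded oneG], rule l_inv[OF b', unfolded oneG])
      then have "fam_comp U ?a \<alpha> V t = fam_id U V t" "fam_comp U ?b \<beta> V t = fam_id U V t" by (simp_all only: mult)
      then show "?a V (\<alpha> V t) = t" "?b V (\<beta> V t) = t" by (simp_all only: fam_comp_apply[OF V t] fam_id_apply[OF V t])
    qed
    note cA = aut_closed[OF A V] and cB = aut_closed[OF B V] and cIA = aut_closed[OF IA V] and cIB = aut_closed[OF IB V]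
    let ?p = "sec_diff (\<alpha> V s) s" and ?q = "sec_diff (\<beta> V s) s"
    have p: "?p \<in> ext V" "vanish j ?p" and q: "?q \<in> ext V" "vanish j ?q"
      using ext_diff[OF oV cA[OF s] s] ext_diff[OF oV cB[OF s] s] G_vanish[OF a V s] G_vanish[OF b V s] by auto
    define d where "d = sec_diff (sec_diff (\<alpha> V ?q) ?q) (sec_diff (\<beta> V ?p) ?p)"
    have d: "d \<in> ext V" unfolding d_def by (intro ext_diff oV cA cB p(1) q(1))
    have dv: "vanish (j + 2) d" unfolding d_def
      by (rule vanish_diff[OF G_displacement[OF a j V q] G_displacement[OF b j V p]])
    have "\<alpha> V (\<beta> V s) = sec_add (\<alpha> V s) (\<alpha> V ?q)" "\<beta> V (\<alpha> V s) = sec_add (\<beta> V s) (\<beta> V ?p)"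
      using aut_add[OF A V s q(1)] aut_add[OF B V s p(1)] by (simp_all only: sec_add_diff)
    then have comm: "\<alpha> V (\<beta> V s) = sec_add (\<beta> V (\<alpha> V s)) d"
      by (simp add: d_def sec_add_def sec_diff_def fun_eq_iff)
    have "?b V (\<alpha> V (\<beta> V s)) = sec_add (\<alpha> V s) (?b V d)"
      unfolding comm aut_add[OF IB V cB[OF cA[OF s]] d] inv_b[OF cA[OF s]] ..
    then have "?a V (?b V (\<alpha> V (\<beta> V s))) = sec_add s (?a V (?b V d))"
      by (simp only: aut_add[OF IA V cA[OF s] cIB[OF d]] inv_a[OF s])
    moreover have "(?a \<otimes>\<^bsub>G\<^esub> ?b \<otimes>\<^bsub>G\<^esub> \<alpha> \<otimes>\<^bsub>G\<^esub> \<beta>) V s = ?a V (?b V (\<alpha> V (\<beta> V s)))"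
      unfolding mult by (simp only: fam_comp_apply[OF V s] fam_comp_apply[OF V cB[OF s]] fam_comp_apply[OF V cA[OF cB[OF s]]])
    ultimately have eq: "sec_diff ((?a \<otimes>\<^bsub>G\<^esub> ?b \<otimes>\<^bsub>G\<^esub> \<alpha> \<otimes>\<^bsub>G\<^esub> \<beta>) V s) s = ?a V (?b V d)"
      by (simp add: sec_diff_def sec_add_def)
    have dj: "vanish j d" by (rule vanish_mono[OF dv]) simp
    have bd: "vanish (j + 2) (?b V d)"
      by (rule vanish_image[OF G_displacement[OF ib[unfolded G_def] j V d dj, folded G_def] dv])
    have bdj: "vanish j (?b V d)" by (rule vanish_mono[OF bd]) simp
    show "vanish (j + 2) (sec_diff ((?a \<otimes>\<^bsub>G\<^esub> ?b \<otimes>\<^bsub>G\<^esub> \<alpha> \<otimes>\<^bsub>G\<^esub> \<beta>) V s) s)"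
      unfolding eq by (rule vanish_image[OF G_displacement[OF ia[unfolded G_def] j V cIB[OF d] bdj, folded G_def] bd])
  qed
qed

lemma G_abelian_quotient:
  assumes "2 \<le> j" "j \<le> k" "k \<le> j + 2"
  shows "abelian_quotient (base M) (Gsheaf M j) (Gsheaf M k)"
proof (intro abelian_quotient.intro abelian_quotient_axioms.intro G_group_presheaf)
  show "subgroup (carrier (sec (Gsheaf M k) U)) (sec (Gsheaf M j) U)" for U
  proof (rule group.group_incl_imp_subgroup[OF G_group G_mono[OF assms(2)]])
    have "(sec (Gsheaf M j) U)\<lparr>carrier := carrier (sec (Gsheaf M k) U)\<rparr> = sec (Gsheaf M k) U"
      by (simp add: Gsheaf_def)
    then show "group ((sec (Gsheaf M j) U)\<lparr>carrier := carrier (sec (Gsheaf M k) U)\<rparr>)" by (simp add: G_group)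
  qed
  show "res (Gsheaf M j) U V h \<in> carrier (sec (Gsheaf M k) V)"
    if "opn V" "V \<subseteq> U" "h \<in> carrier (sec (Gsheaf M k) U)" for U V h
    using G_res_closed[OF that(3)] that by (simp add: res_G opens_in_def)
  show "inv\<^bsub>sec (Gsheaf M j) U\<^esub> \<alpha> \<otimes>\<^bsub>sec (Gsheaf M j) U\<^esub> inv\<^bsub>sec (Gsheaf M j) U\<^esub> \<beta> \<otimes>\<^bsub>sec (Gsheaf M j) U\<^esub> \<alpha>
      \<otimes>\<^bsub>sec (Gsheaf M j) U\<^esub> \<beta> \<in> carrier (sec (Gsheaf M k) U)"
    if "\<alpha> \<in> carrier (sec (Gsheaf M j) U)" "\<beta> \<in> carrier (sec (Gsheaf M j) U)" for U \<alpha> \<beta>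
    by (rule subsetD[OF G_mono[OF assms(3)] G_commutator[OF that assms(1)]])
qed

lemma G_local:
  assumes a: "\<alpha> \<in> carrier (sec (Gsheaf M j) U)"
    and loc: "\<And>x. x \<in> U \<Longrightarrow> \<exists>N. opn N \<and> x \<in> N \<and> N \<subseteq> U \<and> restrict \<alpha> (opens N) \<in> carrier (sec (Gsheaf M k) N)"
  shows "\<alpha> \<in> carrier (sec (Gsheaf M k) U)"
proof (rule G_I[OF G_aut[OF a]])
  note aut = G_aut[OF a]
  fix V s assume V: "V \<in> opens U" and s: "s \<in> ext V"
  show "vanish k (sec_diff (\<alpha> V s) s)" unfolding vanish_def
  proof (intro allI impI)
    fix x and xs :: "('v \<Rightarrow> complex) list" assume len: "length xs < k"
    show "sec_diff (\<alpha> V s) s x xs = 0"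
    proof (cases "x \<in> V")
      case False
      then show ?thesis using extD(2)[OF s] extD(2)[OF aut_closed[OF aut V s]] by (simp add: sec_diff_def)
    next
      case True
      then have "x \<in> U" using opensD(2)[OF V] by blast
      from loc[OF this] obtain N where N: "opn N" "x \<in> N" "N \<subseteq> U" "restrict \<alpha> (opens N) \<in> carrier (sec (Gsheaf M k) N)"
        by (elim exE conjE)
      have o: "opn (N \<inter> V)" using N(1) opensD(1)[OF V] by blast
      then have Z: "N \<inter> V \<in> opens V" "N \<inter> V \<in> opens N" by (simp_all add: opens_in_def)
      have "vanish k (sec_diff (restrict \<alpha> (opens N) (N \<inter> V) (sec_restrict (N \<inter> V) s)) (sec_restrict (N \<inter> V) s))"
        by (rule G_vanish[OF N(4) Z(2) ext_restrict[OF s opensD[OF Z(1)]]])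
      then have "vanish k (sec_diff (sec_restrict (N \<inter> V) (\<alpha> V s)) (sec_restrict (N \<inter> V) s))"
        using Z(2) by (simp add: aut_restrict[OF aut V s Z(1)])
      from this[unfolded vanish_def, rule_format, OF len, of x]
      show ?thesis using True N(2) by (simp add: sec_diff_def sec_restrict_def)
    qed
  qed
qed

lemma G_quotient_sequence:
  assumes "2 \<le> j"
  shows "quotient_sequence (base M) (Gsheaf M j) (Gsheaf M (j + 1)) (Gsheaf M (j + 2))"
proof (intro quotient_sequence.intro quotient_sequence_axioms.intro)
  show "abelian_quotient (base M) (Gsheaf M j) (Gsheaf M (j + 2))"
    "abelian_quotient (base M) (Gsheaf M j) (Gsheaf M (j + 1))"
    "abelian_quotient (base M) (Gsheaf M (j + 1)) (Gsheaf M (j + 2))"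
    using assms by (auto intro!: G_abelian_quotient)
  show "sec (Gsheaf M (j + 1)) U = (sec (Gsheaf M j) U)\<lparr>carrier := carrier (sec (Gsheaf M (j + 1)) U)\<rparr>" for U
    by (simp add: Gsheaf_def)
  show "res (Gsheaf M (j + 1)) = res (Gsheaf M j)" by (simp add: Gsheaf_def)
  show "\<alpha> \<in> carrier (sec (Gsheaf M (j + 1)) U)"
    if "\<alpha> \<in> carrier (sec (Gsheaf M j) U)"
      "\<And>x. x \<in> U \<Longrightarrow> \<exists>N. opn N \<and> x \<in> N \<and> N \<subseteq> U \<and> res (Gsheaf M j) U N \<alpha> \<in> carrier (sec (Gsheaf M (j + 1)) N)" for U \<alpha>
    by (rule G_local[OF that(1)]) (use that(2) in \<open>simp only: res_G\<close>)
  show "regular_space (base M)" "Lindelof_space (base M)" by (rule complex_manifold_regular_Lindelof[OF manifold])+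
qed

end

section \<open>Direct sums of kernels\<close>

lemma trivial_sum_group_iff:
  assumes F: "\<And>j. group (F j)"
  shows "trivial_group (sum_group UNIV F) \<longleftrightarrow> (\<forall>j. carrier (F j) \<subseteq> {\<one>\<^bsub>F j\<^esub>})"
proof
  assume triv: "trivial_group (sum_group UNIV F)"
  show "\<forall>j. carrier (F j) \<subseteq> {\<one>\<^bsub>F j\<^esub>}"
  proof (intro allI subsetI)
    fix j x assume x: "x \<in> carrier (F j)"
    define s where "s = (\<lambda>i. if i = j then x else \<one>\<^bsub>F i\<^esub>)"
    have "{i \<in> UNIV. s i \<noteq> \<one>\<^bsub>F i\<^esub>} \<subseteq> {j}" by (auto simp: s_def)
    then have "s \<in> carrier (sum_group UNIV F)"
      using x F by (auto simp: carrier_sum_group s_def PiE_iff group.is_monoid intro: finite_subset)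
    then have "s = (\<lambda>i\<in>UNIV. \<one>\<^bsub>F i\<^esub>)" using triv by (auto simp: trivial_group_def)
    from fun_cong[OF this, of j] show "x \<in> {\<one>\<^bsub>F j\<^esub>}" by (simp add: s_def)
  qed
next
  assume "\<forall>j. carrier (F j) \<subseteq> {\<one>\<^bsub>F j\<^esub>}"
  then have "carrier (sum_group UNIV F) \<subseteq> {\<one>\<^bsub>sum_group UNIV F\<^esub>}"
    using F by (fastforce simp: carrier_sum_group PiE_iff)
  then show "trivial_group (sum_group UNIV F)"
    by (simp only: group.trivial_group_subset[OF sum_group[OF F]])
qed

text \<open>A homomorphism is injective if and only if its kernel is trivial. Families supported at a
  single index reduce the direct sum to its summands.\<close>

lemma trivial_sum_of_kernels_iff_inj:
  fixes H :: "'i \<Rightarrow> 'b monoid"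
  assumes H: "\<And>j. group (H j)" and K: "\<And>j. group (K j)" and d: "\<And>j. d j \<in> hom (H j) (K j)"
  shows "trivial_group (sum_group UNIV (\<lambda>j. (H j)\<lparr>carrier := kernel (H j) (K j) (d j)\<rparr> Mod {\<one>\<^bsub>H j\<^esub>})) \<longleftrightarrow>
    inj_on (\<lambda>h j. d j (h j)) (carrier (sum_group UNIV H))"
proof -
  define N where "N j = (H j)\<lparr>carrier := kernel (H j) (K j) (d j)\<rparr>" for j
  have gh: "group_hom (H j) (K j) (d j)" for j using H K d by (simp add: group_hom_def group_hom_axioms_def)
  have N: "group (N j)" for j
    unfolding N_def by (rule subgroup.subgroup_is_group[OF group_hom.subgroup_kernel[OF gh] H])
  have one: "\<one>\<^bsub>N j\<^esub> = \<one>\<^bsub>H j\<^esub>" for j by (simp add: N_def)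
  have normal: "{\<one>\<^bsub>H j\<^esub>} \<lhd> N j" for j using group.one_is_normal[OF N, of j] by (simp add: one)
  have coset: "{\<one>\<^bsub>H j\<^esub>} #>\<^bsub>N j\<^esub> x = {x}" if "x \<in> kernel (H j) (K j) (d j)" for j x
    using group.is_monoid[OF H, of j] that by (simp add: r_coset_def N_def kernel_def)
  have "trivial_group (sum_group UNIV (\<lambda>j. N j Mod {\<one>\<^bsub>H j\<^esub>})) \<longleftrightarrow>
      (\<forall>j. carrier (N j Mod {\<one>\<^bsub>H j\<^esub>}) \<subseteq> {{\<one>\<^bsub>H j\<^esub>}})"
    by (subst trivial_sum_group_iff[OF normal.factorgroup_is_group[OF normal]]) simp
  also have "\<dots> \<longleftrightarrow> (\<forall>j. kernel (H j) (K j) (d j) \<subseteq> {\<one>\<^bsub>H j\<^esub>})"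
  proof -
    have "carrier (N j Mod {\<one>\<^bsub>H j\<^esub>}) = (\<lambda>x. {x}) ` kernel (H j) (K j) (d j)" for j
      unfolding carrier_FactGroup by (rule image_cong, simp add: N_def, rule coset)
    moreover have "(\<lambda>x. {x}) ` S \<subseteq> {{a}} \<longleftrightarrow> S \<subseteq> {a}" for S and a :: 'b by auto
    ultimately show ?thesis by (simp only:)
  qed
  also have "\<dots> \<longleftrightarrow> inj_on (\<lambda>h j. d j (h j)) (carrier (sum_group UNIV H))"
  proof
    assume ker: "\<forall>j. kernel (H j) (K j) (d j) \<subseteq> {\<one>\<^bsub>H j\<^esub>}"
    show "inj_on (\<lambda>h j. d j (h j)) (carrier (sum_group UNIV H))"
    proof (rule inj_onI, rule ext)
      fix h h' j assume h: "h \<in> carrier (sum_group UNIV H)" "h' \<in> carrier (sum_group UNIV H)"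
        and eq: "(\<lambda>j. d j (h j)) = (\<lambda>j. d j (h' j))"
      have "inj_on (d j) (carrier (H j))"
        using ker group_hom.inj_iff_trivial_ker[OF gh] subgroup.one_closed[OF group_hom.subgroup_kernel[OF gh]] by blast
      then show "h j = h' j"
        using h H fun_cong[OF eq, of j] by (auto simp: carrier_sum_group PiE_iff inj_on_def)
    qed
  next
    assume inj: "inj_on (\<lambda>h j. d j (h j)) (carrier (sum_group UNIV H))"
    show "\<forall>j. kernel (H j) (K j) (d j) \<subseteq> {\<one>\<^bsub>H j\<^esub>}"
    proof (intro allI subsetI)
      fix j x assume x: "x \<in> kernel (H j) (K j) (d j)"
      define s where "s = (\<lambda>i. if i = j then x else \<one>\<^bsub>H i\<^esub>)"
      have "{i \<in> UNIV. s i \<noteq> \<one>\<^bsub>H i\<^esub>} \<subseteq> {j}" by (auto simp: s_def)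
      then have s: "s \<in> carrier (sum_group UNIV H)"
        using x H by (auto simp: carrier_sum_group s_def PiE_iff group.is_monoid kernel_def intro: finite_subset)
      have o: "(\<lambda>i. \<one>\<^bsub>H i\<^esub>) \<in> carrier (sum_group UNIV H)"
        using H by (simp add: carrier_sum_group PiE_iff group.is_monoid)
      have "d i (s i) = d i \<one>\<^bsub>H i\<^esub>" for i
        using x hom_one[OF d H K] by (simp add: s_def kernel_def)
      then have "s = (\<lambda>i. \<one>\<^bsub>H i\<^esub>)" by (intro inj_onD[OF inj _ s o] HOL.ext)
      from fun_cong[OF this, of j] show "x \<in> {\<one>\<^bsub>H j\<^esub>}" by (simp add: s_def)
    qed
  qed
  finally show ?thesis unfolding N_def .
qed

section \<open>Non-abelian coboundaries\<close>

lemma (in group) conjugate_twist: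
  assumes "t \<in> carrier G" "t' \<in> carrier G" "k \<in> carrier G" "k' \<in> carrier G" "d \<in> carrier G"
  shows "t \<otimes> (k \<otimes> d \<otimes> inv k') \<otimes> inv t' = (t \<otimes> k) \<otimes> d \<otimes> inv (t' \<otimes> k')"
  using assms by (simp add: m_assoc inv_mult_group)

context group_presheaf
begin

abbreviation pull where "pull c \<rho> A B \<equiv> res G (\<rho> A \<inter> \<rho> B) (A \<inter> B) (c [\<rho> A, \<rho> B])"

text \<open>\<open>\<kappa>\<close> exhibits the pullbacks along \<open>\<rho>\<close> and \<open>\<sigma>\<close> of the 1-cochains \<open>c\<close> and \<open>d\<close> as cohomologous.\<close>

definition nab_equiv where
  "nab_equiv \<W> \<rho> \<sigma> \<kappa> c d \<longleftrightarrow> (\<forall>A\<in>\<W>. \<kappa> A \<in> carrier (sec G A)) \<and>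
     (\<forall>A\<in>\<W>. \<forall>B\<in>\<W>. pull c \<rho> A B =
        res G A (A \<inter> B) (\<kappa> A) \<otimes>\<^bsub>sec G (A \<inter> B)\<^esub> pull d \<sigma> A B
          \<otimes>\<^bsub>sec G (A \<inter> B)\<^esub> inv\<^bsub>sec G (A \<inter> B)\<^esub> res G B (A \<inter> B) (\<kappa> B))"

lemma cochain_0_closed: "h \<in> cochains G \<U> 0 \<Longrightarrow> A \<in> \<U> \<Longrightarrow> h [A] \<in> carrier (sec G A)"
  unfolding cochains_def by (drule PiE_mem[of _ _ _ "[A]"]) (auto simp: simplices_def)

lemma cochain_1_closed: "c \<in> cochains G \<U> 1 \<Longrightarrow> A \<in> \<U> \<Longrightarrow> B \<in> \<U> \<Longrightarrow> c [A, B] \<in> carrier (sec G (A \<inter> B))"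
  unfolding cochains_def by (drule PiE_mem[of _ _ _ "[A, B]"]) (auto simp: simplices_def)

lemma mem_nab_class_iff:
  "(\<V>, d) \<in> nab_class X G (\<U>, c) \<longleftrightarrow> (\<V>, d) \<in> nab_reps X G \<and>
     (\<exists>\<W> \<rho> \<sigma>. open_cover X \<W> \<and> refinement \<rho> \<W> \<U> \<and> refinement \<sigma> \<W> \<V> \<and> (\<exists>\<kappa>. nab_equiv \<W> \<rho> \<sigma> \<kappa> c d))"
proof -
  have simplex: "(\<forall>l\<in>simplices \<W> 1. P l) \<longleftrightarrow> (\<forall>A\<in>\<W>. \<forall>B\<in>\<W>. P [A, B])" for \<W> and P :: "'a set list \<Rightarrow> bool"
    by (auto simp: simplices_def length_Suc_conv)
  have eq: "(\<exists>h\<in>cochains G \<W> 0. \<forall>l\<in>simplices \<W> 1.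
          pullback G \<rho> \<W> 1 c l =
            face_res G h l 1 \<otimes>\<^bsub>sec G (\<Inter>(set l))\<^esub> pullback G \<sigma> \<W> 1 d l
              \<otimes>\<^bsub>sec G (\<Inter>(set l))\<^esub> inv\<^bsub>sec G (\<Inter>(set l))\<^esub> (face_res G h l 0)) \<longleftrightarrow>
      (\<exists>\<kappa>. nab_equiv \<W> \<rho> \<sigma> \<kappa> c d)" (is "?L \<longleftrightarrow> ?R") for \<W> \<rho> \<sigma>
  proof
    assume ?L
    then obtain h where h: "h \<in> cochains G \<W> 0" and *: "\<forall>A\<in>\<W>. \<forall>B\<in>\<W>.
          pullback G \<rho> \<W> 1 c [A, B] =
            face_res G h [A, B] 1 \<otimes>\<^bsub>sec G (\<Inter>(set [A, B]))\<^esub> pullback G \<sigma> \<W> 1 d [A, B]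
              \<otimes>\<^bsub>sec G (\<Inter>(set [A, B]))\<^esub> inv\<^bsub>sec G (\<Inter>(set [A, B]))\<^esub> (face_res G h [A, B] 0)"
      unfolding simplex by (elim bexE)
    then show ?R by (intro exI[of _ "\<lambda>A. h [A]"]) (simp add: nab_equiv_def cochain_0_closed pullback_def face_res_def simplices_def)
  next
    assume ?R
    then obtain \<kappa> where \<kappa>: "nab_equiv \<W> \<rho> \<sigma> \<kappa> c d" by (elim exE)
    show ?L unfolding simplex
    proof (rule bexI[of _ "\<lambda>l\<in>simplices \<W> 0. \<kappa> (hd l)"])
      show "(\<lambda>l\<in>simplices \<W> 0. \<kappa> (hd l)) \<in> cochains G \<W> 0"
        unfolding cochains_def using \<kappa>
        by (intro restrict_PiE_iff[THEN iffD2] ballI) (elim simplices_0_cases, simp add: nab_equiv_def)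
    qed (use \<kappa> in \<open>simp add: nab_equiv_def pullback_def face_res_def simplices_def\<close>)
  qed
  show ?thesis unfolding nab_class_def by (simp only: mem_Collect_eq case_prod_conv eq)
qed

lemma pull_closed:
  assumes U: "open_cover X \<U>" and W: "open_cover X \<W>" and r: "refinement \<rho> \<W> \<U>"
    and c: "c \<in> cochains G \<U> 1" and A: "A \<in> \<W>" "B \<in> \<W>" and S: "openin X S" "S \<subseteq> A" "S \<subseteq> B"
  shows "res G (\<rho> A \<inter> \<rho> B) S (c [\<rho> A, \<rho> B]) \<in> carrier (sec G S)"
    and "res G (A \<inter> B) S (pull c \<rho> A B) = res G (\<rho> A \<inter> \<rho> B) S (c [\<rho> A, \<rho> B])"
proof -
  have p: "\<rho> A \<in> \<U>" "\<rho> B \<in> \<U>" "A \<subseteq> \<rho> A" "B \<subseteq> \<rho> B" using r A by (auto simp: refinement_def)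
  have o: "openin X (\<rho> A \<inter> \<rho> B)" "openin X (A \<inter> B)" using U W A p by (auto simp: open_cover_def)
  have s: "S \<subseteq> A \<inter> B" "A \<inter> B \<subseteq> \<rho> A \<inter> \<rho> B" "S \<subseteq> \<rho> A \<inter> \<rho> B" using p S by auto
  note cc = cochain_1_closed[OF c p(1,2)]
  show "res G (\<rho> A \<inter> \<rho> B) S (c [\<rho> A, \<rho> B]) \<in> carrier (sec G S)" by (rule res_closed[OF o(1) S(1) s(3) cc])
  show "res G (A \<inter> B) S (pull c \<rho> A B) = res G (\<rho> A \<inter> \<rho> B) S (c [\<rho> A, \<rho> B])"
    by (rule res_res[OF o S(1) s(2,1) cc])
qed

text \<open>The relation is restricted from \<open>\<tau> A \<inter> \<tau> B\<close> to \<open>A \<inter> B\<close>.\<close>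

lemma nab_equiv_refine:
  assumes U: "open_cover X \<U>" "open_cover X \<V>" "open_cover X \<W>" "open_cover X \<Z>"
    and r: "refinement \<rho> \<W> \<U>" "refinement \<sigma> \<W> \<V>" "refinement \<tau> \<Z> \<W>"
    and c: "c \<in> cochains G \<U> 1" and d: "d \<in> cochains G \<V> 1"
    and eq: "nab_equiv \<W> \<rho> \<sigma> \<kappa> c d"
  shows "nab_equiv \<Z> (\<rho> \<circ> \<tau>) (\<sigma> \<circ> \<tau>) (\<lambda>A. res G (\<tau> A) A (\<kappa> (\<tau> A))) c d"
  unfolding nab_equiv_def
proof (intro conjI ballI)
  have o: "openin X A" if "A \<in> \<Z>" for A using U(4) that by (simp add: open_cover_def)
  have t: "\<tau> A \<in> \<W>" "A \<subseteq> \<tau> A" "openin X (\<tau> A)" if "A \<in> \<Z>" for A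
    using r(3) U(3) that by (auto simp: refinement_def open_cover_def)
  have k: "\<kappa> (\<tau> A) \<in> carrier (sec G (\<tau> A))" if "A \<in> \<Z>" for A using eq t(1)[OF that] by (simp add: nab_equiv_def)
  show "res G (\<tau> A) A (\<kappa> (\<tau> A)) \<in> carrier (sec G A)" if "A \<in> \<Z>" for A
    by (rule res_closed[OF t(3)[OF that] o[OF that] t(2)[OF that] k[OF that]])
  fix A B assume A: "A \<in> \<Z>" "B \<in> \<Z>"
  let ?S = "A \<inter> B" and ?T = "\<tau> A \<inter> \<tau> B"
  have S: "openin X ?S" "?S \<subseteq> \<tau> A" "?S \<subseteq> \<tau> B" "?S \<subseteq> ?T" and T: "openin X ?T" using o t A by blast+
  note pc = pull_closed[OF U(1,3) r(1) c t(1)[OF A(1)] t(1)[OF A(2)]]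
  note pd = pull_closed[OF U(2,3) r(2) d t(1)[OF A(1)] t(1)[OF A(2)]]
  note kA = res_closed[OF t(3)[OF A(1)] T Int_lower1 k[OF A(1)]] and kB = res_closed[OF t(3)[OF A(2)] T Int_lower2 k[OF A(2)]]
  have "res G ?T ?S (pull c \<rho> (\<tau> A) (\<tau> B)) = res G ?T ?S (res G (\<tau> A) ?T (\<kappa> (\<tau> A)) \<otimes>\<^bsub>sec G ?T\<^esub> pull d \<sigma> (\<tau> A) (\<tau> B)
          \<otimes>\<^bsub>sec G ?T\<^esub> inv\<^bsub>sec G ?T\<^esub> res G (\<tau> B) ?T (\<kappa> (\<tau> B)))"
    using eq t(1)[OF A(1)] t(1)[OF A(2)] by (simp add: nab_equiv_def)
  also have "\<dots> = res G ?T ?S (res G (\<tau> A) ?T (\<kappa> (\<tau> A))) \<otimes>\<^bsub>sec G ?S\<^esub> res G ?T ?S (pull d \<sigma> (\<tau> A) (\<tau> B))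
          \<otimes>\<^bsub>sec G ?S\<^esub> inv\<^bsub>sec G ?S\<^esub> res G ?T ?S (res G (\<tau> B) ?T (\<kappa> (\<tau> B)))"
    unfolding res_mult[OF T S(1,4) mult_closed[OF T kA pd(1)[OF T Int_lower1 Int_lower2]] inv_closed[OF T kB]]
      res_mult[OF T S(1,4) kA pd(1)[OF T Int_lower1 Int_lower2]] res_inv[OF T S(1,4) kB] ..
  finally have main: "res G (\<rho> (\<tau> A) \<inter> \<rho> (\<tau> B)) ?S (c [\<rho> (\<tau> A), \<rho> (\<tau> B)]) =
      res G (\<tau> A) ?S (\<kappa> (\<tau> A)) \<otimes>\<^bsub>sec G ?S\<^esub> res G (\<sigma> (\<tau> A) \<inter> \<sigma> (\<tau> B)) ?S (d [\<sigma> (\<tau> A), \<sigma> (\<tau> B)])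
        \<otimes>\<^bsub>sec G ?S\<^esub> inv\<^bsub>sec G ?S\<^esub> res G (\<tau> B) ?S (\<kappa> (\<tau> B))"
    unfolding pc(2)[OF S(1-3)] pd(2)[OF S(1-3)]
      res_res[OF t(3)[OF A(1)] T S(1) Int_lower1 S(4) k[OF A(1)]] res_res[OF t(3)[OF A(2)] T S(1) Int_lower2 S(4) k[OF A(2)]] .
  show "pull c (\<rho> \<circ> \<tau>) A B = res G A ?S (res G (\<tau> A) A (\<kappa> (\<tau> A))) \<otimes>\<^bsub>sec G ?S\<^esub> pull d (\<sigma> \<circ> \<tau>) A B
      \<otimes>\<^bsub>sec G ?S\<^esub> inv\<^bsub>sec G ?S\<^esub> res G B ?S (res G (\<tau> B) B (\<kappa> (\<tau> B)))"
    unfolding o_apply res_res[OF t(3)[OF A(1)] o[OF A(1)] S(1) t(2)[OF A(1)] Int_lower1 k[OF A(1)]]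
      res_res[OF t(3)[OF A(2)] o[OF A(2)] S(1) t(2)[OF A(2)] Int_lower2 k[OF A(2)]] by (rule main)
qed

text \<open>The 0-cochain \<open>t\<close> by which \<open>c\<close> is changed is absorbed into \<open>\<kappa>\<close>.\<close>

lemma nab_equiv_twist:
  assumes W: "open_cover X \<W>" and V: "open_cover X \<V>" "refinement \<sigma> \<W> \<V>" "d \<in> cochains G \<V> 1"
    and t: "\<And>A. A \<in> \<W> \<Longrightarrow> t A \<in> carrier (sec G A)"
    and tw: "\<And>A B. A \<in> \<W> \<Longrightarrow> B \<in> \<W> \<Longrightarrow> pull c' \<rho>' A B = res G A (A \<inter> B) (t A) \<otimes>\<^bsub>sec G (A \<inter> B)\<^esub> pull c \<rho> A B
          \<otimes>\<^bsub>sec G (A \<inter> B)\<^esub> inv\<^bsub>sec G (A \<inter> B)\<^esub> res G B (A \<inter> B) (t B)"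
    and eq: "nab_equiv \<W> \<rho> \<sigma> \<kappa> c d"
  shows "nab_equiv \<W> \<rho>' \<sigma> (\<lambda>A. t A \<otimes>\<^bsub>sec G A\<^esub> \<kappa> A) c' d"
  unfolding nab_equiv_def
proof (intro conjI ballI)
  have o: "openin X A" if "A \<in> \<W>" for A using W that by (simp add: open_cover_def)
  have k: "\<kappa> A \<in> carrier (sec G A)" if "A \<in> \<W>" for A using eq that by (simp add: nab_equiv_def)
  show "t A \<otimes>\<^bsub>sec G A\<^esub> \<kappa> A \<in> carrier (sec G A)" if "A \<in> \<W>" for A
    by (rule mult_closed[OF o[OF that] t[OF that] k[OF that]])
  fix A B assume A: "A \<in> \<W>" "B \<in> \<W>"
  let ?S = "A \<inter> B"
  have S: "openin X ?S" using o A by blast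
  interpret S: group "sec G ?S" by (rule sec_group[OF S])
  note rA = res_closed[OF o[OF A(1)] S Int_lower1] and rB = res_closed[OF o[OF A(2)] S Int_lower2]
  have "pull c \<rho> A B = res G A ?S (\<kappa> A) \<otimes>\<^bsub>sec G ?S\<^esub> pull d \<sigma> A B
          \<otimes>\<^bsub>sec G ?S\<^esub> inv\<^bsub>sec G ?S\<^esub> res G B ?S (\<kappa> B)"
    using eq A by (simp add: nab_equiv_def)
  then show "pull c' \<rho>' A B = res G A ?S (t A \<otimes>\<^bsub>sec G A\<^esub> \<kappa> A) \<otimes>\<^bsub>sec G ?S\<^esub> pull d \<sigma> A B
          \<otimes>\<^bsub>sec G ?S\<^esub> inv\<^bsub>sec G ?S\<^esub> res G B ?S (t B \<otimes>\<^bsub>sec G B\<^esub> \<kappa> B)"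
    unfolding tw[OF A] res_mult[OF o[OF A(1)] S Int_lower1 t[OF A(1)] k[OF A(1)]]
      res_mult[OF o[OF A(2)] S Int_lower2 t[OF A(2)] k[OF A(2)]]
    by (simp only: S.conjugate_twist[OF rA[OF t[OF A(1)]] rB[OF t[OF A(2)]] rA[OF k[OF A(1)]] rB[OF k[OF A(2)]]
      pull_closed(1)[OF V(1) W V(2,3) A S Int_lower1 Int_lower2]])
qed

text \<open>A non-abelian cocycle of the form \<open>h\<^sub>A h\<^sub>B\<^sup>-\<^sup>1\<close> represents the base-point: twisting by \<open>h\<close> or its
  inverse turns equivalences with the one into equivalences with the other.\<close>

lemma nab_class_coboundary:
  assumes u: "(\<U>, u) \<in> nab_reps X G" and h: "h \<in> cochains G \<U> 0"
    and uh: "\<And>A B. A \<in> \<U> \<Longrightarrow> B \<in> \<U> \<Longrightarrow>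
      u [A, B] = res G A (A \<inter> B) (h [A]) \<otimes>\<^bsub>sec G (A \<inter> B)\<^esub> inv\<^bsub>sec G (A \<inter> B)\<^esub> res G B (A \<inter> B) (h [B])"
  shows "nab_class X G (\<U>, u) = nab_basepoint X G"
proof -
  let ?T = "topspace X"
  let ?one = "cone G {?T} 1"
  have U: "open_cover X \<U>" and uc: "u \<in> cochains G \<U> 1" using u by (simp_all add: nab_reps_def)
  have oU: "openin X A" if "A \<in> \<U>" for A using U that by (simp add: open_cover_def)
  note hc = cochain_0_closed[OF h]
  have one_c: "?one \<in> cochains G {?T} 1" unfolding cochains_def cone_def
    by (intro restrict_PiE_iff[THEN iffD2] ballI one_closed openin_simplex[OF open_cover_topspace])
  have pull_one: "pull ?one \<rho> A B = \<one>\<^bsub>sec G (A \<inter> B)\<^esub>"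
    if W: "open_cover X \<W>" "refinement \<rho> \<W> {?T}" and A: "A \<in> \<W>" "B \<in> \<W>" for \<W> \<rho> A B
  proof -
    have "\<rho> A = ?T" "\<rho> B = ?T" "openin X (A \<inter> B)" using W A by (auto simp: refinement_def open_cover_def)
    then show ?thesis using res_one[OF openin_topspace, of "A \<inter> B"] openin_subset[of X "A \<inter> B"]
      by (simp add: cone_def simplices_def)
  qed
  {
    fix \<W> \<rho> A B assume W: "open_cover X \<W>" and r: "refinement \<rho> \<W> \<U>" and A: "A \<in> \<W>" "B \<in> \<W>"
    have p: "\<rho> A \<in> \<U>" "\<rho> B \<in> \<U>" "A \<subseteq> \<rho> A" "B \<subseteq> \<rho> B" using r A by (auto simp: refinement_def)
    have o: "openin X (\<rho> A \<inter> \<rho> B)" "openin X (A \<inter> B)" "A \<inter> B \<subseteq> \<rho> A \<inter> \<rho> B" "openin X A" "openin X B"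
      using W A p oU by (auto simp: open_cover_def)
    note c = res_closed[OF oU[OF p(1)] o(1) Int_lower1 hc[OF p(1)]] res_closed[OF oU[OF p(2)] o(1) Int_lower2 hc[OF p(2)]]
    have "pull u \<rho> A B = res G A (A \<inter> B) (res G (\<rho> A) A (h [\<rho> A])) \<otimes>\<^bsub>sec G (A \<inter> B)\<^esub>
        inv\<^bsub>sec G (A \<inter> B)\<^esub> res G B (A \<inter> B) (res G (\<rho> B) B (h [\<rho> B]))"
      unfolding uh[OF p(1,2)] res_mult[OF o(1-3) c(1) inv_closed[OF o(1) c(2)]] res_inv[OF o(1-3) c(2)]
        res_res[OF oU[OF p(1)] o(1,2) Int_lower1 o(3) hc[OF p(1)]]
        res_res[OF oU[OF p(2)] o(1,2) Int_lower2 o(3) hc[OF p(2)]]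
        res_res[OF oU[OF p(1)] o(4,2) p(3) Int_lower1 hc[OF p(1)]]
        res_res[OF oU[OF p(2)] o(5,2) p(4) Int_lower2 hc[OF p(2)]] ..
    note this res_closed[OF oU[OF p(1)] o(4) p(3) hc[OF p(1)]]
  } note pull_u = this(1) and hr = this(2)
  have "(\<V>, d) \<in> nab_class X G (\<U>, u) \<longleftrightarrow> (\<V>, d) \<in> nab_class X G ({?T}, ?one)" for \<V> d
    unfolding mem_nab_class_iff
  proof (rule conj_cong[OF refl], rule iffI; elim exE conjE)
    assume "(\<V>, d) \<in> nab_reps X G"
    then have V: "open_cover X \<V>" "d \<in> cochains G \<V> 1" by (simp_all add: nab_reps_def)
    {
      fix \<W> \<rho> \<sigma> \<kappa>
      assume W: "open_cover X \<W>" and r: "refinement \<rho> \<W> \<U>" and s: "refinement \<sigma> \<W> \<V>" and eq: "nab_equiv \<W> \<rho> \<sigma> \<kappa> u d"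
      have o: "openin X A" if "A \<in> \<W>" for A using W that by (simp add: open_cover_def)
      let ?h = "\<lambda>A. res G (\<rho> A) A (h [\<rho> A])"
      have E: "nab_equiv \<W> (\<lambda>_. ?T) \<sigma> (\<lambda>A. inv\<^bsub>sec G A\<^esub> ?h A \<otimes>\<^bsub>sec G A\<^esub> \<kappa> A) ?one d"
      proof (rule nab_equiv_twist[OF W V(1) s V(2) _ _ eq])
        show "inv\<^bsub>sec G A\<^esub> ?h A \<in> carrier (sec G A)" if "A \<in> \<W>" for A
          by (rule inv_closed[OF o[OF that] hr[OF W r that that]])
        fix A B assume A: "A \<in> \<W>" "B \<in> \<W>"
        let ?S = "A \<inter> B"
        have S: "openin X ?S" using o A by blast
        interpret S: group "sec G ?S" by (rule sec_group[OF S])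
        note a = hr[OF W r A(1) A(1)] and b = hr[OF W r A(2) A(2)]
        note ra = res_closed[OF o[OF A(1)] S Int_lower1 a] and rb = res_closed[OF o[OF A(2)] S Int_lower2 b]
        show "pull ?one (\<lambda>_. ?T) A B = res G A ?S (inv\<^bsub>sec G A\<^esub> ?h A) \<otimes>\<^bsub>sec G ?S\<^esub> pull u \<rho> A B
            \<otimes>\<^bsub>sec G ?S\<^esub> inv\<^bsub>sec G ?S\<^esub> res G B ?S (inv\<^bsub>sec G B\<^esub> ?h B)"
          unfolding pull_one[OF W refinement_topspace[OF W] A] pull_u[OF W r A]
            res_inv[OF o[OF A(1)] S Int_lower1 a] res_inv[OF o[OF A(2)] S Int_lower2 b] S.inv_inv[OF rb]
          using ra rb by (simp add: S.m_assoc S.cancel_inv_left)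
      qed
      show "\<exists>\<W> \<rho> \<sigma>. open_cover X \<W> \<and> refinement \<rho> \<W> {?T} \<and> refinement \<sigma> \<W> \<V> \<and>
          (\<exists>\<kappa>. nab_equiv \<W> \<rho> \<sigma> \<kappa> ?one d)"
        by (rule exI[of _ \<W>], rule exI[of _ "\<lambda>_. ?T"], rule exI[of _ \<sigma>], intro conjI W refinement_topspace s, rule exI, rule E)
    next
      fix \<W> \<rho> \<sigma> \<kappa>
      assume W: "open_cover X \<W>" and r: "refinement \<rho> \<W> {?T}" and s: "refinement \<sigma> \<W> \<V>" and eq: "nab_equiv \<W> \<rho> \<sigma> \<kappa> ?one d"
      obtain \<Z> \<tau> \<mu> where Z: "open_cover X \<Z>" "refinement \<tau> \<Z> \<W>" "refinement \<mu> \<Z> \<U>" by (rule common_refinement[OF W U])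
      note eq' = nab_equiv_refine[OF open_cover_topspace V(1) W Z(1) r s Z(2) one_c V(2) eq]
      note r' = refinement_comp[OF Z(2) r] and s' = refinement_comp[OF Z(2) s]
      have o: "openin X A" if "A \<in> \<Z>" for A using Z(1) that by (simp add: open_cover_def)
      let ?h = "\<lambda>A. res G (\<mu> A) A (h [\<mu> A])"
      have E: "nab_equiv \<Z> \<mu> (\<sigma> \<circ> \<tau>) (\<lambda>A. ?h A \<otimes>\<^bsub>sec G A\<^esub> res G (\<tau> A) A (\<kappa> (\<tau> A))) u d"
      proof (rule nab_equiv_twist[OF Z(1) V(1) s' V(2) _ _ eq'])
        show "?h A \<in> carrier (sec G A)" if "A \<in> \<Z>" for A by (rule hr[OF Z(1,3) that that])
        fix A B assume A: "A \<in> \<Z>" "B \<in> \<Z>"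
        let ?S = "A \<inter> B"
        have S: "openin X ?S" using o A by blast
        interpret S: group "sec G ?S" by (rule sec_group[OF S])
        show "pull u \<mu> A B = res G A ?S (?h A) \<otimes>\<^bsub>sec G ?S\<^esub> pull ?one (\<rho> \<circ> \<tau>) A B
            \<otimes>\<^bsub>sec G ?S\<^esub> inv\<^bsub>sec G ?S\<^esub> res G B ?S (?h B)"
          unfolding pull_one[OF Z(1) r' A] pull_u[OF Z(1,3) A]
          using res_closed[OF o[OF A(1)] S Int_lower1 hr[OF Z(1,3) A(1) A(1)]] by simp
      qed
      show "\<exists>\<W> \<rho> \<sigma>. open_cover X \<W> \<and> refinement \<rho> \<W> \<U> \<and> refinement \<sigma> \<W> \<V> \<and>
          (\<exists>\<kappa>. nab_equiv \<W> \<rho> \<sigma> \<kappa> u d)"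
        by (rule exI[of _ \<Z>], rule exI[of _ \<mu>], rule exI[of _ "\<sigma> \<circ> \<tau>"], intro conjI Z(1,3) s', rule exI, rule E)
    }
  qed
  then show ?thesis unfolding nab_basepoint_def by auto
qed

end

section \<open>The obstruction complex of a good model\<close>

lemma zero_sheaf_ab_presheaf: "ab_presheaf X zero_sheaf"
proof (rule ab_presheaf.intro)
  show "comm_group (sec zero_sheaf U)" for U
    unfolding zero_sheaf_def by (rule comm_groupI) (auto simp: singleton_group_def)
qed (auto simp: zero_sheaf_def singleton_group_def hom_def)

context bundle_model
begin

lemma obstr_sheaf_nat: "2 \<le> i \<Longrightarrow> obstr_sheaf M (int i) = quot_sheaf (base M) (Gsheaf M i) (Gsheaf M (i + 1))"
  by (simp add: obstr_sheaf_def Gquot_def)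

lemma obstr_sheaf_Suc:
  assumes "2 \<le> i"
  shows "obstr_sheaf M (int i + 1) = quot_sheaf (base M) (Gsheaf M (i + 1)) (Gsheaf M (i + 2))"
  using obstr_sheaf_nat[of "i + 1"] assms by (simp add: add.commute)

lemma obstr_diff_at_nat:
  assumes "2 \<le> i"
  shows "obstr_diff_at M n (int i) = connecting (base M)
    (quot_sheaf (base M) (Gsheaf M (i + 1)) (Gsheaf M (i + 2)))
    (quot_sheaf (base M) (Gsheaf M i) (Gsheaf M (i + 2)))
    (quot_sheaf (base M) (Gsheaf M i) (Gsheaf M (i + 1)))
    (qmap (base M) (Gsheaf M i) (Gsheaf M (i + 2))) (qmap (base M) (Gsheaf M i) (Gsheaf M (i + 1))) n"
  unfolding obstr_diff_at_def obstr_sheaf_nat[OF assms] obstr_sheaf_Suc[OF assms] Gquot_def nat_int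
  using assms by (intro HOL.ext) simp

lemma obstr_sheaf_ab_presheaf: "ab_presheaf (base M) (obstr_sheaf M j)"
proof (cases "2 \<le> j")
  case True
  then have j: "j = int (nat j)" "2 \<le> nat j" by simp_all
  show ?thesis
    by (subst j(1), unfold obstr_sheaf_nat[OF j(2)], rule abelian_quotient.quot_ab_presheaf[OF G_abelian_quotient])
       (use j(2) in simp_all)
next
  case False
  then show ?thesis by (simp add: obstr_sheaf_def zero_sheaf_ab_presheaf)
qed

lemma obstr_cohom_group:
  "group (cohom (base M) (obstr_sheaf M j) 0)"
  "group (cohom (base M) (obstr_sheaf M j) 1)"
  "group (cohom (base M) (obstr_sheaf M j) 2)"
  by (intro comm_group.axioms(2) cech_degree.cohom_comm_group cech_degree.intro cech_degree_axioms.intro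
      obstr_sheaf_ab_presheaf ab_presheaf.refinement_independent_0 ab_presheaf.refinement_independent_1
      ab_presheaf.refinement_independent_2)+

lemma obstr_diff_1_hom:
  "obstr_diff_at M 1 j \<in> hom (cohom (base M) (obstr_sheaf M j) 1) (cohom (base M) (obstr_sheaf M (j + 1)) 2)"
proof (cases "2 \<le> j")
  case True
  define i where "i = nat j"
  have i: "2 \<le> i" "j = int i" using True by (simp_all add: i_def)
  interpret quotient_sequence "base M" "Gsheaf M i" "Gsheaf M (i + 1)" "Gsheaf M (i + 2)"
    by (rule G_quotient_sequence[OF i(1)])
  have "obstr_diff_at M (Suc 0) (int i) \<in>
      hom (cohom (base M) (obstr_sheaf M (int i)) (Suc 0)) (cohom (base M) (obstr_sheaf M (int i + 1)) (Suc (Suc 0)))"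
    unfolding obstr_diff_at_nat[OF i(1)] obstr_sheaf_nat[OF i(1)] obstr_sheaf_Suc[OF i(1)]
    by (rule connecting_1_hom)
  then show ?thesis by (simp only: i(2) One_nat_def numeral_2_eq_2)
next
  case False
  interpret H: group "cohom (base M) (obstr_sheaf M (j + 1)) 2" by (rule obstr_cohom_group)
  have "obstr_diff_at M 1 j = (\<lambda>_. \<one>\<^bsub>cohom (base M) (obstr_sheaf M (j + 1)) 2\<^esub>)"
    using False by (intro HOL.ext) (simp add: obstr_diff_at_def numeral_2_eq_2)
  then show ?thesis by (simp add: hom_def)
qed

text \<open>If the cocycle of a supermanifold atlas is \<open>h\<^sub>A h\<^sub>B\<^sup>-\<^sup>1\<close> for sections \<open>h\<^sub>A\<close> of some \<open>G\<^sub>i\<close>, it is so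
  in \<open>G\<^sub>2\<close>, where strong splitting is decided.\<close>

lemma coboundary_strongly_split:
  assumes ik: "2 \<le> i" "2 \<le> k"
    and u: "(\<W>, u) \<in> nab_reps (base M) (Gsheaf M k)" and h: "h \<in> cochains (Gsheaf M i) \<W> 0"
    and uh: "\<And>A B. A \<in> \<W> \<Longrightarrow> B \<in> \<W> \<Longrightarrow> u [A, B] = res (Gsheaf M i) A (A \<inter> B) (h [A]) \<otimes>\<^bsub>sec (Gsheaf M i) (A \<inter> B)\<^esub>
         inv\<^bsub>sec (Gsheaf M i) (A \<inter> B)\<^esub> res (Gsheaf M i) B (A \<inter> B) (h [B])"
  shows "strongly_split M (\<W>, u)"
proof -
  interpret G2: group_presheaf "base M" "Gsheaf M 2" by (rule G_group_presheaf)
  interpret Gi: group_presheaf "base M" "Gsheaf M i" by (rule G_group_presheaf)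
  have W: "open_cover (base M) \<W>" using u by (simp add: nab_reps_def)
  have oW: "opn A" if "A \<in> \<W>" for A using W that by (simp add: open_cover_def)
  have mono: "cochains (Gsheaf M l) \<W> n \<subseteq> cochains (Gsheaf M 2) \<W> n" if "2 \<le> l" for l n
    unfolding cochains_def by (rule PiE_mono) (rule G_mono[OF that])
  have fr: "face_res (Gsheaf M k) = face_res (Gsheaf M 2)"
    by (intro HOL.ext) (simp add: face_res_def res_G)
  have "(\<W>, u) \<in> nab_reps (base M) (Gsheaf M 2)"
    using u subsetD[OF mono[OF ik(2)]] by (simp add: nab_reps_def fr mult_G)
  moreover have "h \<in> cochains (Gsheaf M 2) \<W> 0" by (rule subsetD[OF mono[OF ik(1)] h])
  moreover have "u [A, B] = res (Gsheaf M 2) A (A \<inter> B) (h [A]) \<otimes>\<^bsub>sec (Gsheaf M 2) (A \<inter> B)\<^esub>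
         inv\<^bsub>sec (Gsheaf M 2) (A \<inter> B)\<^esub> res (Gsheaf M 2) B (A \<inter> B) (h [B])" if A: "A \<in> \<W>" "B \<in> \<W>" for A B
  proof -
    let ?S = "A \<inter> B" and ?x = "res (Gsheaf M i) B (A \<inter> B) (h [B])"
    interpret S: group "sec (Gsheaf M i) ?S" by (rule G_group)
    have S: "opn ?S" using oW A by blast
    have x: "?x \<in> carrier (sec (Gsheaf M i) ?S)"
      by (rule Gi.res_closed[OF oW[OF A(2)] S Int_lower2 Gi.cochain_0_closed[OF h A(2)]])
    have "inv\<^bsub>sec (Gsheaf M 2) ?S\<^esub> ?x = inv\<^bsub>sec (Gsheaf M i) ?S\<^esub> ?x"
      by (rule group.inv_equality[OF G_group _ subsetD[OF G_mono[OF ik(1)] x] subsetD[OF G_mono[OF ik(1)] S.inv_closed[OF x]]])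
         (use S.l_inv[OF x] in \<open>simp only: mult_G one_G\<close>)
    then show ?thesis unfolding uh[OF A] by (simp only: mult_G res_G)
  qed
  ultimately show ?thesis unfolding strongly_split_def by (rule G2.nab_class_coboundary)
qed

text \<open>Goodness makes the obstruction complex degenerate from degree 0 to degree 1: lifting a section of
  \<open>\<A>\<^sub>j\<close> locally to \<open>G\<^sub>j\<close> and taking the coboundary there produces an atlas of order \<open>j + 1\<close> that is
  strongly split, and the connecting map returns its obstruction.\<close>

lemma obstr_diff_0_trivial:
  assumes good: "good_model M" and K: "K \<in> carrier (cohom (base M) (obstr_sheaf M j) 0)"
  shows "obstr_diff_at M 0 j K = \<one>\<^bsub>cohom (base M) (obstr_sheaf M (j + 1)) 1\<^esub>"
proof (cases "2 \<le> j")
  case True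
  define i where "i = nat j"
  have i: "2 \<le> i" "j = int i" using True by (simp_all add: i_def)
  interpret quotient_sequence "base M" "Gsheaf M i" "Gsheaf M (i + 1)" "Gsheaf M (i + 2)"
    by (rule G_quotient_sequence[OF i(1)])
  have triv: "cech_class (base M) G1H.Q 1 (\<W>, cmap (qproj (base M) (Gsheaf M (i + 1)) (Gsheaf M (i + 2))) \<W> 1 u)
      = \<one>\<^bsub>cohom (base M) G1H.Q 1\<^esub>"
    if u: "(\<W>, u) \<in> nab_reps (base M) (Gsheaf M (i + 1))" and h: "h \<in> cochains (Gsheaf M i) \<W> 0"
      and uh: "\<And>A B. A \<in> \<W> \<Longrightarrow> B \<in> \<W> \<Longrightarrow> u [A, B] = res (Gsheaf M i) A (A \<inter> B) (h [A])
        \<otimes>\<^bsub>sec (Gsheaf M i) (A \<inter> B)\<^esub> inv\<^bsub>sec (Gsheaf M i) (A \<inter> B)\<^esub> res (Gsheaf M i) B (A \<inter> B) (h [B])" for \<W> u h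
  proof -
    have "strongly_split M (\<W>, u)" by (rule coboundary_strongly_split[OF i(1) _ u h uh]) (use i(1) in simp)
    moreover have "\<not> exotic M (i + 1) (\<W>, u)"
      using good u i(1) unfolding good_model_def smf_atlases_def by simp
    ultimately have "obstruction M (i + 1) (\<W>, u) = \<one>\<^bsub>cohom (base M) (obstr_sheaf M (int (i + 1))) 1\<^esub>"
      unfolding exotic_def by blast
    moreover have "obstr_sheaf M (int (i + 1)) = G1H.Q" using obstr_sheaf_nat[of "i + 1"] i(1) by simp
    ultimately show ?thesis unfolding obstruction_def case_prod_conv by (simp only: add.assoc one_add_one)
  qed
  have K': "K \<in> carrier (cohom (base M) GG1.Q 0)" using K unfolding i(2) obstr_sheaf_nat[OF i(1)] .
  have "connecting (base M) G1H.Q GH.Q GG1.Q incl proj 0 K = \<one>\<^bsub>cohom (base M) G1H.Q (Suc 0)\<^esub>"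
    by (rule connecting_0_trivial[OF connecting_0_obstruction[OF triv] K'])
  then show ?thesis unfolding i(2) obstr_diff_at_nat[OF i(1)] obstr_sheaf_Suc[OF i(1)] One_nat_def .
next
  case False
  then show ?thesis by (simp add: obstr_diff_at_def)
qed

end

theorem theorem5p20:
  fixes M :: "('a, 'v::ab_group_add) model"
  assumes "is_model M" and "good_model M"
  shows "trivial_group (obstr_cohom1 M) \<longleftrightarrow>
    inj_on (obstr_diff M 1) (carrier (gr_cohom (base M) (obstr_sheaf M) 1))"
proof -
  interpret bundle_model M by (rule bundle_model.intro[OF assms(1)])
  have "obstr_diff_at M 0 (j - 1) ` carrier (cohom (base M) (obstr_sheaf M (j - 1)) 0) =
      {\<one>\<^bsub>cohom (base M) (obstr_sheaf M j) 1\<^esub>}" for j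
  proof -
    have "carrier (cohom (base M) (obstr_sheaf M (j - 1)) 0) \<noteq> {}"
      using monoid.one_closed[OF group.is_monoid[OF obstr_cohom_group(1)]] by (rule ex_in_conv[THEN iffD1, OF exI])
    moreover have "obstr_diff_at M 0 (j - 1) K = \<one>\<^bsub>cohom (base M) (obstr_sheaf M j) 1\<^esub>"
      if "K \<in> carrier (cohom (base M) (obstr_sheaf M (j - 1)) 0)" for K
      using obstr_diff_0_trivial[OF assms(2) that] by simp
    ultimately show ?thesis by (simp only: image_constant_conv cong: image_cong) simp
  qed
  moreover have "obstr_diff M 1 = (\<lambda>h j. obstr_diff_at M 1 j (h j))" by (intro HOL.ext) (simp add: obstr_diff_def)
  ultimately show ?thesis
    unfolding obstr_cohom1_def gr_cohom_def
    by (simp only: trivial_sum_of_kernels_iff_inj[OF obstr_cohom_group(2,3) obstr_diff_1_hom])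
qed

end
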